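(* Let $(M,\xi)$ be a prequantization space of a closed symplectic manifold $(X,\omega)$. Then for any $H,G\in\mathcal H_+(X)$, $$d_\gamma([\psi_H],[\psi_G])\le d_{\rm T,p}(H,G).$$
   Context: Prequantization: there is a principal $S^1$-bundle $p:M\to X$ and an $S^1$-invariant contact form $\alpha\in\Omega^1(M)$ with $\xi=\ker\alpha$ and $d\alpha=p^*\omega$. Contact isotopies: ${\rm PCont}_0(M,\xi)$ is the set of paths $\psi=\{\psi^t\}_{t\in[0,1]}$ of contactomorphisms of $(M,\xi)$ (co-oriented) starting at ${\rm id}_M$. Each such $\psi$ is generated by a unique contact Hamiltonian $h_\alpha(\psi)=\alpha(X_\psi):[0,1]\times M\to\mathbb R$, where $\frac{d\psi}{dt}=X_\psi\circ\psi$. $\psi$ is positive if $h_\alpha(\psi)>0$ pointwise; ${\rm PCont}_+(M,\xi)$ is the set of positive contact isotopies. ${\rm G}=\widetilde{\rm Cont}_0(M,\xi)$ is the group of homotopy classes (with fixed endpoints) $[\psi]$ of $\psi\in{\rm PCont}_0(M,\xi)$, i.e. the universal cover of ${\rm Cont}_0(M,\xi)$, and ${\rm G}_+=\{[\psi]\in{\rm G}\mid\psi\in{\rm PCont}_+(M,\xi)\}$. For $[\varphi],[\psi]\in{\rm G}$ write $[\varphi]\succeq[\psi]$ iff $h_\alpha(\varphi)\ge h_\alpha(\psi)$ pointwise for some representatives. An element $a\in{\rm G}\setminus\{1\}$ is a dominant if for every $b\in {\rm G}$ there is $k\in\mathbb N$ with $a^k\succeq b$; the elements of ${\rm G}_+$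 are dominants. For $a,b\in{\rm G}_+$ put $$\rho^+_\succeq(a,b)=\lim_{l\to\infty}\frac{\inf\{k\in\mathbb Z\mid a^k\succeq b^l\}}{l},\qquad \rho^-_\succeq(a,b)=\rho^+_\succeq(b,a),$$ $$\gamma_\succeq(a,b)=\max\{|\rho^+_\succeq(a,b)|,|\rho^-_\succeq(a,b)|\},\qquad d_\gamma(a,b)=\ln\gamma_\succeq(a,b).$$ In this setting $d_\gamma$ is regarded as a well-defined pseudo-metric ${\rm G}_+\times{\rm G}_+\to[0,\infty)$. $\mathcal H_+(X)$ is the set of smooth strictly positive functions $H:X\to\mathbb R_+$. For $H\in\mathcal H_+(X)$, $\psi_H\in{\rm PCont}_+(M,\xi)$ is the contact isotopy generated by the contact Hamiltonian $p^*H$ (with respect to $\alpha$), and $[\psi_H]\in{\rm G}_+$ its class. Finally $$d_{\rm T,p}(H,G)=\inf\{\ln C>0\mid\exists\,\varphi\in{\rm Ham}(X,\omega)\text{ with }\tfrac1C H\le G\circ\varphi\le CH\},$$ where ${\rm Ham}(X,\omega)$ is the group of Hamiltonian diffeomorphisms. *)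

theory Defs
  imports "HOL-Analysis.Analysis" "HOL-Algebra.Group"
begin

section \<open>Smooth manifolds\<close>

text \<open>
  Derivatives are taken within the set \<open>S\<close>.  Below, \<open>S\<close> is always relatively open in
  \<open>T \<times> UNIV\<close> with \<open>T\<close> a convex set with nonempty interior (\<open>UNIV\<close>, an interval or a square),
  or is itself open, so that these derivatives are unique; on \<open>T\<close> this is smoothness up to the
  boundary, with one-sided derivatives there.
\<close>

primrec Ck_on :: "nat \<Rightarrow> 'a::euclidean_space set \<Rightarrow> ('a \<Rightarrow> 'b::real_normed_vector) \<Rightarrow> bool" where
  "Ck_on 0 S f \<longleftrightarrow> continuous_on S f"
| "Ck_on (Suc k) S f \<longleftrightarrow>
     f differentiable_on S \<and> (\<forall>v. Ck_on k S (\<lambda>x. frechet_derivative f (at x within S) v))"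

definition smooth_on :: "'a::euclidean_space set \<Rightarrow> ('a \<Rightarrow> 'b::real_normed_vector) \<Rightarrow> bool" where
  "smooth_on S f \<longleftrightarrow> (\<forall>k. Ck_on k S f)"

text \<open>
  A manifold is a Hausdorff second countable type together with a smooth atlas, modelled on a
  Euclidean space whose dimension is the dimension of the manifold.
\<close>

type_synonym ('m, 'e) chart = "'m set \<times> ('m \<Rightarrow> 'e)"

abbreviation cdom :: "('m, 'e) chart \<Rightarrow> 'm set" where
  "cdom \<equiv> fst"

abbreviation coord :: "('m, 'e) chart \<Rightarrow> 'm \<Rightarrow> 'e" where
  "coord \<equiv> snd"

definition param :: "('m, 'e) chart \<Rightarrow> 'e \<Rightarrow> 'm" where
  "param \<kappa> = inv_into (cdom \<kappa>) (coord \<kappa>)"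

definition smooth_atlas ::
    "('m::{t2_space, second_countable_topology}, 'e::euclidean_space) chart set \<Rightarrow> bool" where
  "smooth_atlas A \<longleftrightarrow>
     (\<Union>\<kappa>\<in>A. cdom \<kappa>) = UNIV \<and>
     (\<forall>\<kappa>\<in>A. open (cdom \<kappa>) \<and> open (coord \<kappa> ` cdom \<kappa>) \<and>
        homeomorphism (cdom \<kappa>) (coord \<kappa> ` cdom \<kappa>) (coord \<kappa>) (param \<kappa>)) \<and>
     (\<forall>\<kappa>\<in>A. \<forall>\<mu>\<in>A. smooth_on (coord \<kappa> ` (cdom \<kappa> \<inter> cdom \<mu>)) (\<lambda>y. coord \<mu> (param \<kappa> y)))"

definition chart_at :: "('m, 'e) chart set \<Rightarrow> 'm \<Rightarrow> ('m, 'e) chart" where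
  "chart_at A x = (SOME \<kappa>. \<kappa> \<in> A \<and> x \<in> cdom \<kappa>)"

definition std_atlas :: "('e, 'e) chart set" where
  "std_atlas = {(UNIV, \<lambda>x. x)}"

definition smooth_map ::
    "'m set \<Rightarrow> ('m::topological_space, 'e::euclidean_space) chart set \<Rightarrow>
     ('n::topological_space, 'f::euclidean_space) chart set \<Rightarrow> ('m \<Rightarrow> 'n) \<Rightarrow> bool" where
  "smooth_map S A B F \<longleftrightarrow>
     continuous_on S F \<and>
     (\<forall>\<kappa>\<in>A. \<forall>\<mu>\<in>B. smooth_on {coord \<kappa> x | x. x \<in> cdom \<kappa> \<inter> S \<and> F x \<in> cdom \<mu>}
        (\<lambda>y. coord \<mu> (F (param \<kappa> y))))"

text \<open>
  \<open>smooth_family T S A B F\<close>: the map \<open>(t, x) \<mapsto> F t x\<close> is smooth on \<open>T \<times> S\<close>, jointly in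
  the parameter and in the point.
\<close>

definition smooth_family ::
    "'p::euclidean_space set \<Rightarrow> 'm set \<Rightarrow> ('m::topological_space, 'e::euclidean_space) chart set \<Rightarrow>
     ('n::topological_space, 'f::euclidean_space) chart set \<Rightarrow> ('p \<Rightarrow> 'm \<Rightarrow> 'n) \<Rightarrow> bool" where
  "smooth_family T S A B F \<longleftrightarrow>
     continuous_on (T \<times> S) (\<lambda>(t, x). F t x) \<and>
     (\<forall>\<kappa>\<in>A. \<forall>\<mu>\<in>B.
        smooth_on {(t, coord \<kappa> x) | t x. t \<in> T \<and> x \<in> cdom \<kappa> \<inter> S \<and> F t x \<in> cdom \<mu>}
          (\<lambda>(t, y). coord \<mu> (F t (param \<kappa> y))))"

definition diffeo :: "('m::topological_space, 'e::euclidean_space) chart set \<Rightarrow> ('m \<Rightarrow> 'm) \<Rightarrow> bool" where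
  "diffeo A f \<longleftrightarrow> bij f \<and> smooth_map UNIV A A f \<and> smooth_map UNIV A A (inv_into UNIV f)"

definition tangent_map ::
    "('m, 'e::euclidean_space) chart \<Rightarrow> ('n, 'f::euclidean_space) chart \<Rightarrow> ('m \<Rightarrow> 'n) \<Rightarrow> 'm \<Rightarrow> 'e \<Rightarrow> 'f" where
  "tangent_map \<kappa> \<mu> F x = frechet_derivative (\<lambda>y. coord \<mu> (F (param \<kappa> y))) (at (coord \<kappa> x))"

text \<open>
  \<open>velocity \<mu> \<psi> t x\<close> is the time derivative at \<open>t\<close> of the curve \<open>s \<mapsto> \<psi> s x\<close>, a tangent vector
  at \<open>\<psi> t x\<close>, expressed in the chart \<open>\<mu>\<close>.
\<close>

definition velocity ::
    "('m, 'e::euclidean_space) chart \<Rightarrow> (real \<Rightarrow> 'm \<Rightarrow> 'm) \<Rightarrow> real \<Rightarrow> 'm \<Rightarrow> 'e" where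
  "velocity \<mu> \<psi> t x = vector_derivative (\<lambda>s. coord \<mu> (\<psi> s x)) (at t within {0..1})"


section \<open>Differential forms\<close>

text \<open>
  A form assigns to a chart \<open>\<kappa>\<close> and a point \<open>x\<close> of its domain a multilinear form in the
  coordinate components of tangent vectors at \<open>x\<close>; the representatives in different charts
  are related by the derivative of the change of coordinates.  Values for other \<open>\<kappa>\<close> and \<open>x\<close>
  are irrelevant.
\<close>

type_synonym ('m, 'e) form1 = "('m, 'e) chart \<Rightarrow> 'm \<Rightarrow> 'e \<Rightarrow> real"
type_synonym ('m, 'e) form2 = "('m, 'e) chart \<Rightarrow> 'm \<Rightarrow> 'e \<Rightarrow> 'e \<Rightarrow> real"

definition one_form ::
    "('m::topological_space, 'e::euclidean_space) chart set \<Rightarrow> ('m, 'e) form1 \<Rightarrow> bool" where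
  "one_form A \<beta> \<longleftrightarrow>
     (\<forall>\<kappa>\<in>A. \<forall>x\<in>cdom \<kappa>. linear (\<beta> \<kappa> x)) \<and>
     (\<forall>\<kappa>\<in>A. \<forall>\<mu>\<in>A. \<forall>x\<in>cdom \<kappa> \<inter> cdom \<mu>. \<forall>v.
        \<beta> \<kappa> x v = \<beta> \<mu> x (tangent_map \<kappa> \<mu> (\<lambda>x. x) x v)) \<and>
     (\<forall>\<kappa>\<in>A. \<forall>v. smooth_on (coord \<kappa> ` cdom \<kappa>) (\<lambda>y. \<beta> \<kappa> (param \<kappa> y) v))"

definition two_form ::
    "('m::topological_space, 'e::euclidean_space) chart set \<Rightarrow> ('m, 'e) form2 \<Rightarrow> bool" where
  "two_form A \<eta> \<longleftrightarrow>
     (\<forall>\<kappa>\<in>A. \<forall>x\<in>cdom \<kappa>. bilinear (\<eta> \<kappa> x) \<and> (\<forall>v. \<eta> \<kappa> x v v = 0)) \<and>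
     (\<forall>\<kappa>\<in>A. \<forall>\<mu>\<in>A. \<forall>x\<in>cdom \<kappa> \<inter> cdom \<mu>. \<forall>v w.
        \<eta> \<kappa> x v w =
          \<eta> \<mu> x (tangent_map \<kappa> \<mu> (\<lambda>x. x) x v) (tangent_map \<kappa> \<mu> (\<lambda>x. x) x w)) \<and>
     (\<forall>\<kappa>\<in>A. \<forall>v w. smooth_on (coord \<kappa> ` cdom \<kappa>) (\<lambda>y. \<eta> \<kappa> (param \<kappa> y) v w))"

definition ext_deriv1 :: "('m, 'e::euclidean_space) form1 \<Rightarrow> ('m, 'e) form2" where
  "ext_deriv1 \<beta> \<kappa> x v w =
     frechet_derivative (\<lambda>y. \<beta> \<kappa> (param \<kappa> y) w) (at (coord \<kappa> x)) v -
     frechet_derivative (\<lambda>y. \<beta> \<kappa> (param \<kappa> y) v) (at (coord \<kappa> x)) w"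

definition ext_deriv2 ::
    "('m, 'e::euclidean_space) form2 \<Rightarrow> ('m, 'e) chart \<Rightarrow> 'm \<Rightarrow> 'e \<Rightarrow> 'e \<Rightarrow> 'e \<Rightarrow> real" where
  "ext_deriv2 \<eta> \<kappa> x u v w =
     frechet_derivative (\<lambda>y. \<eta> \<kappa> (param \<kappa> y) v w) (at (coord \<kappa> x)) u +
     frechet_derivative (\<lambda>y. \<eta> \<kappa> (param \<kappa> y) w u) (at (coord \<kappa> x)) v +
     frechet_derivative (\<lambda>y. \<eta> \<kappa> (param \<kappa> y) u v) (at (coord \<kappa> x)) w"

definition pullback1 ::
    "('n, 'f::euclidean_space) chart set \<Rightarrow> ('m \<Rightarrow> 'n) \<Rightarrow> ('n, 'f) form1 \<Rightarrow>
     ('m, 'e::euclidean_space) form1" where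
  "pullback1 B F \<beta> \<kappa> x v =
     (let \<mu> = chart_at B (F x) in \<beta> \<mu> (F x) (tangent_map \<kappa> \<mu> F x v))"

definition pullback2 ::
    "('n, 'f::euclidean_space) chart set \<Rightarrow> ('m \<Rightarrow> 'n) \<Rightarrow> ('n, 'f) form2 \<Rightarrow>
     ('m, 'e::euclidean_space) form2" where
  "pullback2 B F \<eta> \<kappa> x v w =
     (let \<mu> = chart_at B (F x)
      in \<eta> \<mu> (F x) (tangent_map \<kappa> \<mu> F x v) (tangent_map \<kappa> \<mu> F x w))"

definition symplectic_form ::
    "('m::topological_space, 'e::euclidean_space) chart set \<Rightarrow> ('m, 'e) form2 \<Rightarrow> bool" where
  "symplectic_form A \<omega> \<longleftrightarrow>
     two_form A \<omega> \<and>
     (\<forall>\<kappa>\<in>A. \<forall>x\<in>cdom \<kappa>. \<forall>u v w. ext_deriv2 \<omega> \<kappa> x u v w = 0) \<and>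
     (\<forall>\<kappa>\<in>A. \<forall>x\<in>cdom \<kappa>. \<forall>v. v \<noteq> 0 \<longrightarrow> (\<exists>w. \<omega> \<kappa> x v w \<noteq> 0))"

text \<open>
  The kernel of \<open>\<alpha>\<close> is a hyperplane field on which the exterior derivative of \<open>\<alpha>\<close> is
  nondegenerate.
\<close>

definition contact_form ::
    "('m::topological_space, 'e::euclidean_space) chart set \<Rightarrow> ('m, 'e) form1 \<Rightarrow> bool" where
  "contact_form A \<alpha> \<longleftrightarrow>
     one_form A \<alpha> \<and>
     (\<forall>\<kappa>\<in>A. \<forall>x\<in>cdom \<kappa>. (\<exists>v. \<alpha> \<kappa> x v \<noteq> 0) \<and>
        (\<forall>v. \<alpha> \<kappa> x v = 0 \<longrightarrow> v \<noteq> 0 \<longrightarrow> (\<exists>w. \<alpha> \<kappa> x w = 0 \<and> ext_deriv1 \<alpha> \<kappa> x v w \<noteq> 0)))"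


section \<open>Prequantization spaces\<close>

text \<open>
  The circle is \<open>\<real> / 2\<pi>\<int>\<close>, acting on the total space by \<open>R\<close>.  In a local trivialization over \<open>U\<close>,
  the map \<open>m \<mapsto> (p m, \<tau> m)\<close> is an equivariant diffeomorphism from the preimage of \<open>U\<close> onto
  \<open>U \<times> sphere 0 1\<close>, with smooth inverse \<open>(x, cis \<theta>) \<mapsto> \<sigma> \<theta> x\<close>.
\<close>

definition principal_circle_bundle ::
    "('m::topological_space, 'f::euclidean_space) chart set \<Rightarrow>
     ('x::topological_space, 'e::euclidean_space) chart set \<Rightarrow>
     (real \<Rightarrow> 'm \<Rightarrow> 'm) \<Rightarrow> ('m \<Rightarrow> 'x) \<Rightarrow> bool" where
  "principal_circle_bundle AM AX R p \<longleftrightarrow>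
     smooth_family UNIV UNIV AM AM R \<and>
     (\<forall>m. R 0 m = m) \<and> (\<forall>s t m. R (s + t) m = R s (R t m)) \<and> (\<forall>m. R (2 * pi) m = m) \<and>
     smooth_map UNIV AM AX p \<and> (\<forall>\<theta> m. p (R \<theta> m) = p m) \<and>
     (\<forall>x. \<exists>U (\<tau> :: 'm \<Rightarrow> complex) \<sigma>. open U \<and> x \<in> U \<and>
        smooth_map (p -` U) AM std_atlas \<tau> \<and> smooth_family UNIV U AX AM \<sigma> \<and>
        (\<forall>m\<in>p -` U. cmod (\<tau> m) = 1 \<and> (\<forall>\<theta>. \<tau> (R \<theta> m) = cis \<theta> * \<tau> m)) \<and>
        (\<forall>y\<in>U. \<forall>\<theta>. p (\<sigma> \<theta> y) = y \<and> \<tau> (\<sigma> \<theta> y) = cis \<theta>) \<and>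
        (\<forall>m\<in>p -` U. \<forall>\<theta>. \<tau> m = cis \<theta> \<longrightarrow> \<sigma> \<theta> (p m) = m))"

definition prequantization ::
    "('x::{t2_space, second_countable_topology}, 'e::euclidean_space) chart set \<Rightarrow> ('x, 'e) form2 \<Rightarrow>
     ('m::{t2_space, second_countable_topology}, 'f::euclidean_space) chart set \<Rightarrow> ('m, 'f) form1 \<Rightarrow>
     (real \<Rightarrow> 'm \<Rightarrow> 'm) \<Rightarrow> ('m \<Rightarrow> 'x) \<Rightarrow> bool" where
  "prequantization AX \<omega> AM \<alpha> R p \<longleftrightarrow>
     smooth_atlas AX \<and> compact (UNIV :: 'x set) \<and> symplectic_form AX \<omega> \<and>
     smooth_atlas AM \<and> principal_circle_bundle AM AX R p \<and>
     contact_form AM \<alpha> \<and>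
     (\<forall>\<theta>. \<forall>\<kappa>\<in>AM. \<forall>m\<in>cdom \<kappa>. \<forall>v. pullback1 AM (R \<theta>) \<alpha> \<kappa> m v = \<alpha> \<kappa> m v) \<and>
     (\<forall>\<kappa>\<in>AM. \<forall>m\<in>cdom \<kappa>. \<forall>v w. ext_deriv1 \<alpha> \<kappa> m v w = pullback2 AX p \<omega> \<kappa> m v w)"


section \<open>Contact isotopies and the universal cover\<close>

text \<open>
  A diffeomorphism preserves the co-oriented hyperplane field \<open>ker \<alpha>\<close> iff it pulls \<open>\<alpha>\<close> back
  to a positive multiple of itself.
\<close>

definition contactomorphism ::
    "('m::topological_space, 'f::euclidean_space) chart set \<Rightarrow> ('m, 'f) form1 \<Rightarrow> ('m \<Rightarrow> 'm) \<Rightarrow> bool" where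
  "contactomorphism A \<alpha> f \<longleftrightarrow>
     diffeo A f \<and>
     (\<exists>c. (\<forall>x. c x > 0) \<and>
        (\<forall>\<kappa>\<in>A. \<forall>x\<in>cdom \<kappa>. \<forall>v. pullback1 A f \<alpha> \<kappa> x v = c x * \<alpha> \<kappa> x v))"

text \<open>
  Isotopies are parametrized by \<open>{0..1}\<close>; values at other times are irrelevant, and isotopies
  that agree on \<open>{0..1}\<close> are identified by \<open>isotopy_rel\<close> below.
\<close>

definition PCont0 ::
    "('m::topological_space, 'f::euclidean_space) chart set \<Rightarrow> ('m, 'f) form1 \<Rightarrow> (real \<Rightarrow> 'm \<Rightarrow> 'm) set" where
  "PCont0 A \<alpha> =
     {\<psi>. smooth_family {0..1} UNIV A A \<psi> \<and> (\<forall>t\<in>{0..1}. contactomorphism A \<alpha> (\<psi> t)) \<and>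
         (\<forall>x. \<psi> 0 x = x)}"

text \<open>
  The generating vector field at time \<open>t\<close> has at \<open>y\<close> the velocity of the curve
  \<open>s \<mapsto> \<psi> s x\<close> at \<open>s = t\<close>, where \<open>\<psi> t x = y\<close>.
\<close>

definition contact_ham ::
    "('m, 'f::euclidean_space) chart set \<Rightarrow> ('m, 'f) form1 \<Rightarrow> (real \<Rightarrow> 'm \<Rightarrow> 'm) \<Rightarrow>
     real \<Rightarrow> 'm \<Rightarrow> real" where
  "contact_ham A \<alpha> \<psi> t y =
     (let \<mu> = chart_at A y in \<alpha> \<mu> y (velocity \<mu> \<psi> t (inv_into UNIV (\<psi> t) y)))"

definition PCont_plus ::
    "('m::topological_space, 'f::euclidean_space) chart set \<Rightarrow> ('m, 'f) form1 \<Rightarrow> (real \<Rightarrow> 'm \<Rightarrow> 'm) set" where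
  "PCont_plus A \<alpha> = {\<psi> \<in> PCont0 A \<alpha>. \<forall>t\<in>{0..1}. \<forall>y. contact_ham A \<alpha> \<psi> t y > 0}"

definition isotopy_rel ::
    "('m::topological_space, 'f::euclidean_space) chart set \<Rightarrow> ('m, 'f) form1 \<Rightarrow>
     ((real \<Rightarrow> 'm \<Rightarrow> 'm) \<times> (real \<Rightarrow> 'm \<Rightarrow> 'm)) set" where
  "isotopy_rel A \<alpha> =
     {(\<phi>, \<psi>). \<phi> \<in> PCont0 A \<alpha> \<and> \<psi> \<in> PCont0 A \<alpha> \<and>
        (\<exists>K :: real \<times> real \<Rightarrow> 'm \<Rightarrow> 'm.
           smooth_family ({0..1} \<times> {0..1}) UNIV A A K \<and>
           (\<forall>s\<in>{0..1}. (\<lambda>t. K (s, t)) \<in> PCont0 A \<alpha> \<and> K (s, 1) = \<phi> 1 \<and> K (s, 1) = \<psi> 1) \<and>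
           (\<forall>t\<in>{0..1}. K (0, t) = \<phi> t \<and> K (1, t) = \<psi> t))}"

definition isotopy_class ::
    "('m::topological_space, 'f::euclidean_space) chart set \<Rightarrow> ('m, 'f) form1 \<Rightarrow>
     (real \<Rightarrow> 'm \<Rightarrow> 'm) \<Rightarrow> (real \<Rightarrow> 'm \<Rightarrow> 'm) set" where
  "isotopy_class A \<alpha> \<psi> = isotopy_rel A \<alpha> `` {\<psi>}"

text \<open>The group structure is induced by the pointwise composition of isotopies.\<close>

definition UCont ::
    "('m::topological_space, 'f::euclidean_space) chart set \<Rightarrow> ('m, 'f) form1 \<Rightarrow>
     (real \<Rightarrow> 'm \<Rightarrow> 'm) set monoid" where
  "UCont A \<alpha> =
     \<lparr>carrier = PCont0 A \<alpha> // isotopy_rel A \<alpha>,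
      mult = (\<lambda>a b. \<Union>\<phi>\<in>a. \<Union>\<psi>\<in>b. isotopy_class A \<alpha> (\<lambda>t. \<phi> t \<circ> \<psi> t)),
      one = isotopy_class A \<alpha> (\<lambda>t. id)\<rparr>"

definition UCont_plus ::
    "('m::topological_space, 'f::euclidean_space) chart set \<Rightarrow> ('m, 'f) form1 \<Rightarrow>
     (real \<Rightarrow> 'm \<Rightarrow> 'm) set set" where
  "UCont_plus A \<alpha> = isotopy_class A \<alpha> ` PCont_plus A \<alpha>"


section \<open>Relative growth rates\<close>

definition dominates ::
    "('m::topological_space, 'f::euclidean_space) chart set \<Rightarrow> ('m, 'f) form1 \<Rightarrow>
     (real \<Rightarrow> 'm \<Rightarrow> 'm) set \<Rightarrow> (real \<Rightarrow> 'm \<Rightarrow> 'm) set \<Rightarrow> bool" where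
  "dominates A \<alpha> a b \<longleftrightarrow>
     (\<exists>\<phi>\<in>a. \<exists>\<psi>\<in>b. \<forall>t\<in>{0..1}. \<forall>y. contact_ham A \<alpha> \<phi> t y \<ge> contact_ham A \<alpha> \<psi> t y)"

definition growth_set ::
    "('m::topological_space, 'f::euclidean_space) chart set \<Rightarrow> ('m, 'f) form1 \<Rightarrow>
     (real \<Rightarrow> 'm \<Rightarrow> 'm) set \<Rightarrow> (real \<Rightarrow> 'm \<Rightarrow> 'm) set \<Rightarrow> nat \<Rightarrow> int set" where
  "growth_set A \<alpha> a b l =
     {k :: int. dominates A \<alpha> (a [^]\<^bsub>UCont A \<alpha>\<^esub> k) (b [^]\<^bsub>UCont A \<alpha>\<^esub> l)}"

definition rho_plus ::
    "('m::topological_space, 'f::euclidean_space) chart set \<Rightarrow> ('m, 'f) form1 \<Rightarrow>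
     (real \<Rightarrow> 'm \<Rightarrow> 'm) set \<Rightarrow> (real \<Rightarrow> 'm \<Rightarrow> 'm) set \<Rightarrow> real" where
  "rho_plus A \<alpha> a b = lim (\<lambda>l. of_int (Inf (growth_set A \<alpha> a b l)) / real l)"

definition rho_minus ::
    "('m::topological_space, 'f::euclidean_space) chart set \<Rightarrow> ('m, 'f) form1 \<Rightarrow>
     (real \<Rightarrow> 'm \<Rightarrow> 'm) set \<Rightarrow> (real \<Rightarrow> 'm \<Rightarrow> 'm) set \<Rightarrow> real" where
  "rho_minus A \<alpha> a b = rho_plus A \<alpha> b a"

definition gamma_dist ::
    "('m::topological_space, 'f::euclidean_space) chart set \<Rightarrow> ('m, 'f) form1 \<Rightarrow>
     (real \<Rightarrow> 'm \<Rightarrow> 'm) set \<Rightarrow> (real \<Rightarrow> 'm \<Rightarrow> 'm) set \<Rightarrow> real" where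
  "gamma_dist A \<alpha> a b = max \<bar>rho_plus A \<alpha> a b\<bar> \<bar>rho_minus A \<alpha> a b\<bar>"

definition d_gamma ::
    "('m::topological_space, 'f::euclidean_space) chart set \<Rightarrow> ('m, 'f) form1 \<Rightarrow>
     (real \<Rightarrow> 'm \<Rightarrow> 'm) set \<Rightarrow> (real \<Rightarrow> 'm \<Rightarrow> 'm) set \<Rightarrow> real" where
  "d_gamma A \<alpha> a b = ln (gamma_dist A \<alpha> a b)"

text \<open>
  The infima in the definition of \<open>rho_plus\<close> are integers, rather than \<open>\<plusminus>\<infinity>\<close>, and the limit exists.
  This is not automatic: if some positive contact isotopy is homotopic to the constant one, so
  that \<open>dominates\<close> is not antisymmetric, then the infima are \<open>-\<infinity>\<close>.
\<close>

definition growth_rates_well_defined ::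
    "('m::topological_space, 'f::euclidean_space) chart set \<Rightarrow> ('m, 'f) form1 \<Rightarrow> bool" where
  "growth_rates_well_defined A \<alpha> \<longleftrightarrow>
     (\<forall>a\<in>UCont_plus A \<alpha>. \<forall>b\<in>UCont_plus A \<alpha>.
        (\<forall>l\<ge>1. growth_set A \<alpha> a b l \<noteq> {} \<and> bdd_below (growth_set A \<alpha> a b l)) \<and>
        convergent (\<lambda>l. of_int (Inf (growth_set A \<alpha> a b l)) / real l :: real))"


section \<open>Functions on the base\<close>

definition positive_functions ::
    "('x::topological_space, 'e::euclidean_space) chart set \<Rightarrow> ('x \<Rightarrow> real) set" where
  "positive_functions A = {H. smooth_map UNIV A std_atlas H \<and> (\<forall>x. H x > 0)}"

text \<open>The sign convention for Hamiltonian vector fields does not affect this group.\<close>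

definition Ham ::
    "('x::topological_space, 'e::euclidean_space) chart set \<Rightarrow> ('x, 'e) form2 \<Rightarrow> ('x \<Rightarrow> 'x) set" where
  "Ham A \<omega> =
     {\<phi> 1 | \<phi> :: real \<Rightarrow> 'x \<Rightarrow> 'x.
        smooth_family {0..1} UNIV A A \<phi> \<and> (\<forall>t\<in>{0..1}. diffeo A (\<phi> t)) \<and> (\<forall>x. \<phi> 0 x = x) \<and>
        (\<exists>F :: real \<Rightarrow> 'x \<Rightarrow> real. smooth_family {0..1} UNIV A std_atlas F \<and>
           (\<forall>t\<in>{0..1}. \<forall>x. \<forall>\<mu>\<in>A. \<phi> t x \<in> cdom \<mu> \<longrightarrow>
              (\<forall>w. \<omega> \<mu> (\<phi> t x) (velocity \<mu> \<phi> t x) w =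
                frechet_derivative (\<lambda>y. F t (param \<mu> y)) (at (coord \<mu> (\<phi> t x))) w)))}"

definition d_T ::
    "('x::topological_space, 'e::euclidean_space) chart set \<Rightarrow> ('x, 'e) form2 \<Rightarrow>
     ('x \<Rightarrow> real) \<Rightarrow> ('x \<Rightarrow> real) \<Rightarrow> real" where
  "d_T A \<omega> H G =
     Inf {ln C | C. C > 0 \<and> ln C > 0 \<and>
            (\<exists>\<phi>\<in>Ham A \<omega>. \<forall>x. 1 / C * H x \<le> G (\<phi> x) \<and> G (\<phi> x) \<le> C * H x)}"

definition generated_by ::
    "('m::topological_space, 'f::euclidean_space) chart set \<Rightarrow> ('m, 'f) form1 \<Rightarrow>
     (real \<Rightarrow> 'm \<Rightarrow> 'm) \<Rightarrow> ('m \<Rightarrow> real) \<Rightarrow> bool" where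
  "generated_by A \<alpha> \<psi> h \<longleftrightarrow>
     \<psi> \<in> PCont0 A \<alpha> \<and> (\<forall>t\<in>{0..1}. \<forall>y. contact_ham A \<alpha> \<psi> t y = h y)"

end

theory Submission
  imports Defs
begin

text \<open>
  Let \<open>\<phi>\<close> be a Hamiltonian diffeomorphism with \<open>G \<circ> \<phi> \<le> C H\<close>.  Its isotopy lifts, through the circle
  bundle, to a contact isotopy \<open>\<Phi>\<close> preserving \<open>\<alpha>\<close>, and conjugating \<open>\<psi>G\<close> by the time-one map of \<open>\<Phi>\<close>
  turns the contact Hamiltonian \<open>G \<circ> p\<close> into \<open>G \<circ> \<phi> \<circ> p\<close>.  Isotopies generated by pullbacks of
  functions on the base preserve \<open>\<alpha>\<close> and their Hamiltonian, so the \<open>k\<close>-th power of \<open>\<psi>H\<close> has Hamiltonian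
  \<open>k H \<circ> p\<close>; hence the \<open>k\<close>-th power of \<open>[\<psi>H]\<close> dominates the conjugate of the \<open>l\<close>-th power of \<open>[\<psi>G]\<close>
  as soon as \<open>k \<ge> C l\<close>.  Since \<open>[\<psi>H]\<^sup>N\<close> dominates \<open>[\<Phi>]\<close> and its inverse for some \<open>N\<close> and the order is
  bi-invariant, removing the conjugation costs the bounded amount \<open>2 N\<close>, which disappears in the limit
  defining \<open>rho_plus\<close>.  The other growth rate is bounded in the same way, using the inverse of \<open>\<phi>\<close>.

  The order is bi-invariant because \<open>a\<close> dominates \<open>b\<close> iff \<open>b\<^sup>-\<^sup>1 a\<close> has a representative with nonnegative
  Hamiltonian, and these classes form a submonoid that is stable under conjugation.

  The lift is built for short time intervals, on which every point stays in one trivialization: there,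
  the condition that \<open>\<Phi>\<close> covers the given isotopy and has contact Hamiltonian \<open>- F\<close> determines the motion
  in the fibre by an integral over time, and Cartan's formula shows that \<open>\<alpha>\<close> is preserved.  A Hamiltonian
  isotopy is a composition of such short pieces.
\<close>

section \<open>Calculus of smooth functions\<close>

text \<open>Isotopies are smooth up to the ends of a closed time interval, and this shapes the first
  half: all calculus is done for derivatives within a set. No inverse function theorem and no
  existence theorem for flows is invoked. Inverses of families come from compactness, and the lifted
  flow is given by an explicit integral.

  Smooth paths cannot simply be concatenated either, because derivatives need not match at the
  joint. Homotopies, as well as the short pieces of a Hamiltonian isotopy, are therefore joined by
  pointwise composition, and of the base isotopy only the time-one map is remembered.

  Since \<open>gamma_dist\<close> takes absolute values, the growth rates need a lower bound too. It
  comes from \<open>growth_rates_well_defined\<close>: a negative exponent in one growth set would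
  make another growth set unbounded below.\<close>

definition thick :: "'a::euclidean_space set \<Rightarrow> bool" where
  "thick S \<longleftrightarrow> (\<forall>x\<in>S. \<forall>i\<in>Basis. \<forall>e>0. \<exists>d. 0 < \<bar>d\<bar> \<and> \<bar>d\<bar> < e \<and> x + d *\<^sub>R i \<in> S)"

text \<open>The points of a thick set accumulate at each of its members along every coordinate axis,
  which is what uniqueness of the derivative within the set asks for. The property passes to
  products and, unlike convexity, to relatively open subsets.\<close>

lemma thick_frechet_unique:
  assumes "thick S" "x \<in> S" "(f has_derivative f') (at x within S)"
  shows "frechet_derivative f (at x within S) = f'"
proof -
  have "(f has_derivative frechet_derivative f (at x within S)) (at x within S)"
    using assms(3) differentiableI frechet_derivative_works by blast
  then show ?thesis
    using frechet_derivative_unique_within[OF _ assms(3)] assms(1,2) unfolding thick_def by blast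
qed

lemma thick_Int_open:
  assumes "thick S" "open W"
  shows "thick (S \<inter> W)"
  unfolding thick_def
proof (intro ballI allI impI)
  fix x i :: 'a and e :: real assume x: "x \<in> S \<inter> W" and i: "i \<in> Basis" and e: "e > 0"
  from x assms(2) obtain r where r: "r > 0" "ball x r \<subseteq> W" by (meson IntD2 open_contains_ball)
  from assms(1) x i e r obtain d where d: "0 < \<bar>d\<bar>" "\<bar>d\<bar> < min e r" "x + d *\<^sub>R i \<in> S"
    unfolding thick_def by (metis IntD1 min_less_iff_conj)
  then have "x + d *\<^sub>R i \<in> ball x r" using i by (simp add: dist_norm)
  with d r show "\<exists>d. 0 < \<bar>d\<bar> \<and> \<bar>d\<bar> < e \<and> x + d *\<^sub>R i \<in> S \<inter> W" by auto
qed

lemma thick_UNIV [simp]: "thick UNIV"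
  unfolding thick_def by (metis UNIV_I abs_of_pos field_lbound_gt_zero)

lemma thick_open: "open S \<Longrightarrow> thick S"
  using thick_Int_open[OF thick_UNIV] by simp

lemma thick_unit_interval [simp]: "thick {0..1::real}"
  unfolding thick_def
proof (intro ballI allI impI)
  fix x i e :: real assume x: "x \<in> {0..1}" and i: "i \<in> Basis" and e: "e > 0"
  \<comment> \<open>The step points away from the nearer endpoint; capping it at 1/2 keeps it inside
    the interval.\<close>
  define d where "d = (if x \<le> 1/2 then min (e/2) (1/2) else - min (e/2) (1/2))"
  have "0 < \<bar>d\<bar> \<and> \<bar>d\<bar> < e \<and> x + d *\<^sub>R i \<in> {0..1}"
    using x i e by (auto simp: d_def min_def)
  then show "\<exists>d. 0 < \<bar>d\<bar> \<and> \<bar>d\<bar> < e \<and> x + d *\<^sub>R i \<in> {0..1}" by blast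
qed

lemma thick_Times:
  assumes "thick S" "thick T"
  shows "thick (S \<times> T)"
  unfolding thick_def
proof (intro ballI allI impI)
  fix x i :: "'a \<times> 'b" and e :: real
  assume x: "x \<in> S \<times> T" and i: "i \<in> Basis" and e: "e > 0"
  from i consider j where "j \<in> Basis" "i = (j, 0)" | j where "j \<in> Basis" "i = (0, j)"
    by (auto simp: Basis_prod_def)
  then show "\<exists>d. 0 < \<bar>d\<bar> \<and> \<bar>d\<bar> < e \<and> x + d *\<^sub>R i \<in> S \<times> T"
  proof cases
    case 1
    obtain a b where ab: "x = (a, b)" "a \<in> S" "b \<in> T" using x by auto
    with assms(1) 1 e obtain d where "0 < \<bar>d\<bar>" "\<bar>d\<bar> < e" "a + d *\<^sub>R j \<in> S" unfolding thick_def by metis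
    with ab 1 show ?thesis by (intro exI[of _ d]) simp
  next
    case 2
    obtain a b where ab: "x = (a, b)" "a \<in> S" "b \<in> T" using x by auto
    with assms(2) 2 e obtain d where "0 < \<bar>d\<bar>" "\<bar>d\<bar> < e" "b + d *\<^sub>R j \<in> T" unfolding thick_def by metis
    with ab 2 show ?thesis by (intro exI[of _ d]) simp
  qed
qed

section \<open>Locality and algebra of functions of class C^k within a set\<close>

lemma at_within_Int_open:
  fixes x :: "'a::topological_space"
  shows "x \<in> W \<Longrightarrow> open W \<Longrightarrow> at x within (S \<inter> W) = at x within S"
  by (rule at_within_nhd[of x W]) auto

lemma has_derivative_cong_on:
  assumes "x \<in> S" "\<And>y. y \<in> S \<Longrightarrow> f y = g y"
  shows "(f has_derivative D) (at x within S) \<longleftrightarrow> (g has_derivative D) (at x within S)"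
  using assms has_derivative_transform[of x S f g D] has_derivative_transform[of x S g f D] by auto

lemma frechet_derivative_cong_on:
  assumes "x \<in> S" "\<And>y. y \<in> S \<Longrightarrow> f y = g y"
  shows "frechet_derivative f (at x within S) = frechet_derivative g (at x within S)"
  unfolding frechet_derivative_def using has_derivative_cong_on[OF assms] by simp

lemma differentiable_on_cong:
  assumes "\<And>y. y \<in> S \<Longrightarrow> f y = g y"
  shows "f differentiable_on S \<longleftrightarrow> g differentiable_on S"
  unfolding differentiable_on_def differentiable_def
  by (intro ball_cong ex_cong1 refl has_derivative_cong_on assms)

lemma Ck_on_cong:
  assumes "\<And>x. x \<in> S \<Longrightarrow> f x = g x"
  shows "Ck_on k S f \<longleftrightarrow> Ck_on k S g"
  using assms
proof (induction k arbitrary: f g)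
  case 0
  then show ?case by (simp cong: continuous_on_cong)
next
  case (Suc k)
  have "Ck_on k S (\<lambda>x. frechet_derivative f (at x within S) v) \<longleftrightarrow>
        Ck_on k S (\<lambda>x. frechet_derivative g (at x within S) v)" for v
    by (rule Suc.IH) (simp add: frechet_derivative_cong_on[OF _ Suc.prems])
  then show ?case using differentiable_on_cong[of S f g] Suc.prems by simp
qed

lemma Ck_on_Int_open:
  assumes "Ck_on k S f" "open W"
  shows "Ck_on k (S \<inter> W) f"
  using assms(1)
proof (induction k arbitrary: f)
  case 0
  then show ?case by (auto intro: continuous_on_subset)
next
  case (Suc k)
  have "Ck_on k (S \<inter> W) (\<lambda>x. frechet_derivative f (at x within (S \<inter> W)) v)" for v
  proof -
    have "Ck_on k (S \<inter> W) (\<lambda>x. frechet_derivative f (at x within S) v)"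
      using Suc by simp
    then show ?thesis
      by (rule Ck_on_cong[THEN iffD1, rotated]) (simp add: at_within_Int_open assms(2))
  qed
  moreover have "f differentiable_on (S \<inter> W)"
    using Suc.prems by (auto intro: differentiable_on_subset)
  ultimately show ?case by simp
qed

text \<open>The derivative within \<open>S\<close> at a point sees only the part of \<open>S\<close>
  near that point, so the order can be checked on a relatively open cover. Charts give smoothness
  only in this local form.\<close>

lemma Ck_on_local:
  assumes "\<And>x. x \<in> S \<Longrightarrow> \<exists>W. open W \<and> x \<in> W \<and> Ck_on k (S \<inter> W) f"
  shows "Ck_on k S f"
  using assms
proof (induction k arbitrary: f)
  case 0
  have "continuous (at x within S) f" if "x \<in> S" for x
  proof -
    from 0[OF that] obtain W where W: "open W" "x \<in> W" "continuous_on (S \<inter> W) f" by auto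
    then have "continuous (at x within (S \<inter> W)) f"
      using that by (simp add: continuous_on_eq_continuous_within)
    then show ?thesis using W by (simp add: at_within_Int_open)
  qed
  then show ?case by (simp add: continuous_on_eq_continuous_within)
next
  case (Suc k)
  have "f differentiable (at x within S)" if "x \<in> S" for x
  proof -
    from Suc.prems[OF that] obtain W where W: "open W" "x \<in> W" "f differentiable_on (S \<inter> W)" by auto
    then have "f differentiable (at x within (S \<inter> W))"
      using that by (simp add: differentiable_on_def)
    then show ?thesis using W by (simp add: at_within_Int_open)
  qed
  moreover have "Ck_on k S (\<lambda>x. frechet_derivative f (at x within S) v)" for v
  proof (rule Suc.IH)
    fix x assume "x \<in> S"
    from Suc.prems[OF this] obtain W where W: "open W" "x \<in> W"
      "Ck_on k (S \<inter> W) (\<lambda>x. frechet_derivative f (at x within (S \<inter> W)) v)" by auto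
    then have "Ck_on k (S \<inter> W) (\<lambda>x. frechet_derivative f (at x within S) v)"
      by (subst Ck_on_cong) (auto simp: at_within_Int_open)
    with W show "\<exists>W. open W \<and> x \<in> W \<and> Ck_on k (S \<inter> W) (\<lambda>x. frechet_derivative f (at x within S) v)"
      by blast
  qed
  ultimately show ?case by (simp add: differentiable_on_def)
qed

text \<open>\<open>Ck_on\<close> speaks of the chosen \<open>frechet_derivative\<close>; on a thick
  set any derivative exhibited by hand equals it, so calculations need not mention the
  choice.\<close>

lemma Ck_on_SucI:
  assumes "thick S" "\<And>x. x \<in> S \<Longrightarrow> (f has_derivative f' x) (at x within S)"
    and "\<And>v. Ck_on k S (\<lambda>x. f' x v)"
  shows "Ck_on (Suc k) S f"
proof -
  have "Ck_on k S (\<lambda>x. frechet_derivative f (at x within S) v)" for v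
    by (rule Ck_on_cong[THEN iffD1, OF _ assms(3)[of v]])
       (simp add: thick_frechet_unique[OF assms(1) _ assms(2)])
  moreover have "f differentiable_on S"
    using assms(2) by (auto simp: differentiable_on_def intro: differentiableI)
  ultimately show ?thesis by simp
qed

lemma Ck_on_SucD:
  assumes "Ck_on (Suc k) S f"
  shows "x \<in> S \<Longrightarrow> (f has_derivative frechet_derivative f (at x within S)) (at x within S)"
    and "Ck_on k S (\<lambda>x. frechet_derivative f (at x within S) v)"
  using assms by (auto simp: differentiable_on_def frechet_derivative_works)

lemma Ck_on_Suc_imp: "Ck_on (Suc k) S f \<Longrightarrow> Ck_on k S f"
proof (induction k arbitrary: f)
  case 0
  then show ?case by (simp add: differentiable_imp_continuous_on)
next
  case (Suc k)
  then show ?case by (metis Ck_on.simps(2))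
qed

lemma Ck_on_imp_continuous: "Ck_on k S f \<Longrightarrow> continuous_on S f"
  by (induction k) (auto dest: Ck_on_Suc_imp simp del: Ck_on.simps(2))

lemma Ck_on_const: "thick S \<Longrightarrow> Ck_on k S (\<lambda>x. c)"
proof (induction k arbitrary: c)
  case (Suc k)
  show ?case by (rule Ck_on_SucI[where f' = "\<lambda>x v. 0"]) (use Suc in auto)
qed simp

lemma Ck_on_linear:
  assumes "bounded_linear L" "thick S" "Ck_on k S f"
  shows "Ck_on k S (\<lambda>x. L (f x))"
  using assms(3)
proof (induction k arbitrary: f)
  case 0
  then show ?case using assms(1) by (simp add: bounded_linear.continuous_on)
next
  case (Suc k)
  show ?case
    by (rule Ck_on_SucI[where f' = "\<lambda>x v. L (frechet_derivative f (at x within S) v)"])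
       (use Suc assms Ck_on_SucD[OF Suc.prems] in \<open>auto intro: bounded_linear.has_derivative\<close>)
qed

lemma Ck_on_id: "thick S \<Longrightarrow> Ck_on k S (\<lambda>x. x)"
proof (cases k)
  case (Suc k')
  assume "thick S"
  then show ?thesis unfolding Suc
    by (intro Ck_on_SucI[where f' = "\<lambda>x v. v"]) (auto intro: Ck_on_const)
qed simp

lemma Ck_on_add:
  assumes "thick S" "Ck_on k S f" "Ck_on k S g"
  shows "Ck_on k S (\<lambda>x. f x + g x)"
  using assms(2,3)
proof (induction k arbitrary: f g)
  case 0
  then show ?case by (simp add: continuous_on_add)
next
  case (Suc k)
  show ?case
    by (rule Ck_on_SucI[where f' = "\<lambda>x v. frechet_derivative f (at x within S) v + frechet_derivative g (at x within S) v"])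
       (use Suc assms Ck_on_SucD[OF Suc.prems(1)] Ck_on_SucD[OF Suc.prems(2)] in \<open>auto intro: has_derivative_add\<close>)
qed

lemma Ck_on_sum:
  assumes "thick S" "\<And>i. i \<in> I \<Longrightarrow> Ck_on k S (f i)"
  shows "Ck_on k S (\<lambda>x. \<Sum>i\<in>I. f i x)"
  using assms by (induction I rule: infinite_finite_induct) (auto intro: Ck_on_const Ck_on_add)

lemma Ck_on_bilinear:
  assumes "bounded_bilinear prd" "thick S" "Ck_on k S f" "Ck_on k S g"
  shows "Ck_on k S (\<lambda>x. prd (f x) (g x))"
  using assms(3,4)
proof (induction k arbitrary: f g)
  case 0
  then show ?case using assms(1) by (simp add: bounded_bilinear.continuous_on)
next
  case (Suc k)
  show ?case
  proof (rule Ck_on_SucI[OF assms(2)])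
    show "((\<lambda>x. prd (f x) (g x)) has_derivative (\<lambda>v. prd (f x) (frechet_derivative g (at x within S) v) +
          prd (frechet_derivative f (at x within S) v) (g x))) (at x within S)" if "x \<in> S" for x
      by (intro bounded_bilinear.FDERIV assms(1) Ck_on_SucD(1)[OF Suc.prems(1) that] Ck_on_SucD(1)[OF Suc.prems(2) that])
    show "Ck_on k S (\<lambda>x. prd (f x) (frechet_derivative g (at x within S) v) +
          prd (frechet_derivative f (at x within S) v) (g x))" for v
      by (rule Ck_on_add[OF assms(2) Suc.IH[OF Ck_on_Suc_imp[OF Suc.prems(1)] Ck_on_SucD(2)[OF Suc.prems(2)]]
            Suc.IH[OF Ck_on_SucD(2)[OF Suc.prems(1)] Ck_on_Suc_imp[OF Suc.prems(2)]]])
  qed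
qed

lemmas Ck_on_scaleR = Ck_on_bilinear[OF bounded_bilinear_scaleR]

lemma Ck_on_inner_left: "thick S \<Longrightarrow> Ck_on k S f \<Longrightarrow> Ck_on k S (\<lambda>x. f x \<bullet> c)"
  by (rule Ck_on_linear[OF bounded_linear_inner_left])

lemma linear_sum_Basis:
  fixes L :: "'a::euclidean_space \<Rightarrow> 'b::real_vector"
  shows "linear L \<Longrightarrow> L v = (\<Sum>i\<in>Basis. (v \<bullet> i) *\<^sub>R L i)"
  by (subst euclidean_representation[of v, symmetric]) (simp add: linear_sum linear_scale)

lemma Ck_on_compose:
  fixes f :: "'a::euclidean_space \<Rightarrow> 'b::euclidean_space"
  assumes "thick S" "f ` S \<subseteq> T" "Ck_on k T g" "Ck_on k S f"
  shows "Ck_on k S (\<lambda>x. g (f x))"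
  using assms(3,4)
proof (induction k arbitrary: g)
  case 0
  then show ?case using assms(2) by (auto intro: continuous_on_compose2)
next
  case (Suc k)
  define f' where "f' x = frechet_derivative f (at x within S)" for x
  define g' where "g' x = frechet_derivative g (at x within T)" for x
  have f': "(f has_derivative f' x) (at x within S)" if "x \<in> S" for x
    using Ck_on_SucD(1)[OF Suc.prems(2) that] unfolding f'_def .
  have g': "(g has_derivative g' x) (at x within T)" if "x \<in> T" for x
    using Ck_on_SucD(1)[OF Suc.prems(1) that] unfolding g'_def .
  have D: "((\<lambda>x. g (f x)) has_derivative (\<lambda>v. g' (f x) (f' x v))) (at x within S)" if "x \<in> S" for x
    using has_derivative_in_compose2[OF g' assms(2) that f'[OF that]] that assms(2) by auto
  have lin: "linear (g' (f x))" if "x \<in> S" for x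
    using g'[of "f x"] that assms(2) has_derivative_linear by blast
  show ?case
  proof (rule Ck_on_SucI[OF assms(1) D])
    fix v
    \<comment> \<open>In \<open>g' (f x) (f' x v)\<close> both the map and its argument depend on x.
      Expanding the argument in the basis leaves products of scalars with \<open>g' (f x) i\<close>,
      and these have a fixed direction, so the induction hypothesis covers them.\<close>
    have "Ck_on k S (\<lambda>x. \<Sum>i\<in>Basis. (f' x v \<bullet> i) *\<^sub>R g' (f x) i)"
    proof (intro Ck_on_sum Ck_on_scaleR Ck_on_inner_left assms(1))
      show "Ck_on k S (\<lambda>x. f' x v)" unfolding f'_def by (rule Ck_on_SucD[OF Suc.prems(2)])
      show "Ck_on k S (\<lambda>x. g' (f x) i)" for i
        unfolding g'_def by (rule Suc.IH[OF Ck_on_SucD(2)[OF Suc.prems(1)] Ck_on_Suc_imp[OF Suc.prems(2)]])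
    qed
    then show "Ck_on k S (\<lambda>x. g' (f x) (f' x v))"
      by (rule Ck_on_cong[THEN iffD1, rotated]) (simp add: linear_sum_Basis[OF lin, symmetric])
  qed
qed

text \<open>The derivative is a polynomial in the inverse itself and the derivative of
  \<open>f\<close>, so each order yields the next.\<close>

lemma Ck_on_inverse:
  fixes f :: "'a::euclidean_space \<Rightarrow> real"
  assumes "thick S" "\<And>x. x \<in> S \<Longrightarrow> f x \<noteq> 0" "Ck_on k S f"
  shows "Ck_on k S (\<lambda>x. inverse (f x))"
  using assms(3)
proof (induction k)
  case 0
  then show ?case using assms(2) by (simp add: continuous_on_inverse)
next
  case (Suc k)
  have IH: "Ck_on k S (\<lambda>x. inverse (f x))" by (rule Suc.IH[OF Ck_on_Suc_imp[OF Suc.prems]])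
  show ?case
  proof (rule Ck_on_SucI[OF assms(1)])
    show "((\<lambda>x. inverse (f x)) has_derivative
       (\<lambda>v. (-1) *\<^sub>R (inverse (f x) * (frechet_derivative f (at x within S) v * inverse (f x))))) (at x within S)"
      if "x \<in> S" for x
      using Deriv.has_derivative_inverse[OF assms(2)[OF that] Ck_on_SucD(1)[OF Suc.prems that]]
      by (simp add: mult.assoc)
    show "Ck_on k S (\<lambda>x. (-1) *\<^sub>R (inverse (f x) * (frechet_derivative f (at x within S) v * inverse (f x))))" for v
      by (intro Ck_on_linear[OF bounded_linear_scaleR_right] Ck_on_bilinear[OF bounded_bilinear_mult] IH
            Ck_on_SucD(2)[OF Suc.prems] assms(1))
  qed
qed

section \<open>Smoothness of inverses\<close>

lemma has_derivative_scaleR_vanishing: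
  fixes f :: "'a::real_normed_vector \<Rightarrow> real" and g :: "'a \<Rightarrow> 'b::real_normed_vector"
  assumes f: "continuous (at x within S) f" and g: "(g has_derivative g') (at x within S)" and g0: "g x = 0"
  shows "((\<lambda>y. f y *\<^sub>R g y) has_derivative (\<lambda>h. f x *\<^sub>R g' h)) (at x within S)"
proof (rule has_derivativeI_sandwich[where H = "\<lambda>y. \<bar>f y\<bar> * norm ((g y - g x - g' (y - x)) /\<^sub>R norm (y - x)) +
      \<bar>f y - f x\<bar> * onorm g'" and e = 1])
  interpret g': bounded_linear g' using g by (rule has_derivative_bounded_linear)
  show "bounded_linear (\<lambda>h. f x *\<^sub>R g' h)"
    by (rule bounded_linear_compose[OF bounded_linear_scaleR_right g'.bounded_linear_axioms])
  have f': "(f \<longlongrightarrow> f x) (at x within S)" using f by (simp add: continuous_within)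
  have "((\<lambda>y. (g y - g x - g' (y - x)) /\<^sub>R norm (y - x)) \<longlongrightarrow> 0) (at x within S)"
    using g unfolding has_derivative_at_within by blast
  then have "((\<lambda>y. \<bar>f y\<bar> * norm ((g y - g x - g' (y - x)) /\<^sub>R norm (y - x)) + \<bar>f y - f x\<bar> * onorm g')
      \<longlongrightarrow> \<bar>f x\<bar> * norm (0::'b) + \<bar>f x - f x\<bar> * onorm g') (at x within S)"
    by (intro tendsto_intros f')
  then show "((\<lambda>y. \<bar>f y\<bar> * norm ((g y - g x - g' (y - x)) /\<^sub>R norm (y - x)) + \<bar>f y - f x\<bar> * onorm g')
      \<longlongrightarrow> 0) (at x within S)" by simp
  fix y assume "y \<noteq> x"
  then have n: "norm (y - x) > 0" by simp
  \<comment> \<open>Since \<open>g x = 0\<close>, no difference quotient of \<open>f\<close> enters: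
    the factor f y - f x multiplies \<open>g' (y - x)\<close>, which is already of first
    order.\<close>
  have "f y *\<^sub>R g y - f x *\<^sub>R g x - f x *\<^sub>R g' (y - x) =
      f y *\<^sub>R (g y - g x - g' (y - x)) + (f y - f x) *\<^sub>R g' (y - x)"
    by (simp add: g0 algebra_simps)
  then have "norm (f y *\<^sub>R g y - f x *\<^sub>R g x - f x *\<^sub>R g' (y - x)) \<le>
      \<bar>f y\<bar> * norm (g y - g x - g' (y - x)) + \<bar>f y - f x\<bar> * norm (g' (y - x))"
    by (metis norm_scaleR norm_triangle_ineq)
  also have "\<dots> \<le> \<bar>f y\<bar> * norm (g y - g x - g' (y - x)) + \<bar>f y - f x\<bar> * (onorm g' * norm (y - x))"
    using onorm[OF g'.bounded_linear_axioms, of "y - x"] by (intro add_mono mult_left_mono) auto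
  finally have "norm (f y *\<^sub>R g y - f x *\<^sub>R g x - f x *\<^sub>R g' (y - x)) / norm (y - x) \<le>
      (\<bar>f y\<bar> * norm (g y - g x - g' (y - x)) + \<bar>f y - f x\<bar> * (onorm g' * norm (y - x))) / norm (y - x)"
    using n by (intro divide_right_mono) auto
  also have "\<dots> = \<bar>f y\<bar> * norm ((g y - g x - g' (y - x)) /\<^sub>R norm (y - x)) + \<bar>f y - f x\<bar> * onorm g'"
  proof -
    have "(a * E + b * (c * n)) / n = a * (inverse n * E) + b * c" if "n > 0" for a b c E n :: real
      using that by (simp add: field_simps)
    then show ?thesis using n unfolding norm_scaleR abs_inverse abs_norm_cancel by blast
  qed
  finally show "norm (f y *\<^sub>R g y - f x *\<^sub>R g x - f x *\<^sub>R g' (y - x)) / norm (y - x) \<le>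
      \<bar>f y\<bar> * norm ((g y - g x - g' (y - x)) /\<^sub>R norm (y - x)) + \<bar>f y - f x\<bar> * onorm g'" .
qed simp

text \<open>Everything follows from
  \<open>B w v = B w0 v - B w0 (A w (B w v) - A w0 (B w v))\<close>. It gives continuity of
  \<open>B\<close> by absorption, and then the derivative - B A' B, which is built from
  \<open>B\<close> and the derivative of \<open>A\<close> and so has the order needed for the
  induction.\<close>

lemma Ck_on_inverse_linear:
  fixes A B :: "'a::euclidean_space \<Rightarrow> 'b::euclidean_space \<Rightarrow> 'b"
  assumes S: "thick S" and linA: "\<And>w. w \<in> S \<Longrightarrow> linear (A w)" and linB: "\<And>w. w \<in> S \<Longrightarrow> linear (B w)"
    and AB: "\<And>w v. w \<in> S \<Longrightarrow> A w (B w v) = v" and BA: "\<And>w v. w \<in> S \<Longrightarrow> B w (A w v) = v"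
    and A: "\<And>v. Ck_on k S (\<lambda>w. A w v)"
  shows "Ck_on k S (\<lambda>w. B w v)"
  using A
proof (induction k arbitrary: v)
  case 0
  have "((\<lambda>w. B w v) \<longlongrightarrow> B w0 v) (at w0 within S)" if w0: "w0 \<in> S" for w0
  proof -
    obtain C where C: "C > 0" "\<And>x. norm (B w0 x) \<le> C * norm x"
      using linear_bounded_pos[OF linB[OF w0]] by auto
    \<comment> \<open>\<open>N w\<close> bounds the operator norm of A w - A w0; being a finite sum
      over the basis, it tends to 0 by continuity on each basis vector.\<close>
    define N where "N w = (\<Sum>i\<in>Basis. norm (A w i - A w0 i))" for w
    have contA: "((\<lambda>w. A w i) \<longlongrightarrow> A w0 i) (at w0 within S)" for i
      using 0[of i] w0 by (simp add: continuous_on_def)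
    have N: "(N \<longlongrightarrow> 0) (at w0 within S)"
      unfolding N_def using tendsto_sum[of Basis "\<lambda>i w. norm (A w i - A w0 i)" "\<lambda>i. 0" "at w0 within S"]
        tendsto_norm_zero[OF LIM_zero[OF contA]] by simp
    have est: "norm (B w v - B w0 v) \<le> 2 * C * N w * norm (B w0 v)" if w: "w \<in> S" and small: "C * N w < 1/2" for w
    proof -
      define u u0 where "u = B w v" and "u0 = B w0 v"
      interpret A: linear "\<lambda>x. A w x - A w0 x"
        using linA[OF w] linA[OF w0] by (rule linear_compose_sub)
      have "norm (A w u - A w0 u) \<le> (\<Sum>i\<in>Basis. norm ((u \<bullet> i) *\<^sub>R (A w i - A w0 i)))"
        by (subst linear_sum_Basis[OF A.linear_axioms]) (rule norm_sum)
      also have "\<dots> \<le> (\<Sum>i\<in>Basis. norm u * norm (A w i - A w0 i))"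
        by (intro sum_mono) (auto intro!: mult_right_mono simp: Basis_le_norm)
      finally have 1: "norm (A w u - A w0 u) \<le> N w * norm u" by (simp add: N_def sum_distrib_left mult.commute)
      have "u - u0 = - B w0 (A w u - A w0 u)"
        using linB[OF w0] BA[OF w0] AB[OF w] by (simp add: linear_diff u_def u0_def)
      then have "norm (u - u0) \<le> C * norm (A w u - A w0 u)" using C(2) by simp
      also have "\<dots> \<le> C * (N w * norm u)" using C(1) 1 by (intro mult_left_mono) auto
      also have "\<dots> \<le> C * N w * (norm (u - u0) + norm u0)"
      proof -
        have "N w \<ge> 0" by (simp add: N_def sum_nonneg)
        moreover have "norm u \<le> norm (u - u0) + norm u0" using norm_triangle_ineq[of "u - u0" u0] by simp
        ultimately show ?thesis using C(1) by (simp add: mult.assoc mult_left_mono)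
      qed
      \<comment> \<open>With C * N w below 1/2, half of norm (u - u0) can be absorbed into the
        left-hand side; this is the origin of the factor 2 in the estimate.\<close>
      also have "\<dots> \<le> 1/2 * norm (u - u0) + C * N w * norm u0"
        using small mult_right_mono[of "C * N w" "1/2" "norm (u - u0)"] by (simp add: distrib_left)
      finally show ?thesis by (simp add: u_def u0_def)
    qed
    have ev: "eventually (\<lambda>w. C * N w < 1/2) (at w0 within S)"
    proof -
      have "((\<lambda>w. C * N w) \<longlongrightarrow> C * 0) (at w0 within S)" by (intro tendsto_intros N)
      then show ?thesis using order_tendstoD(2)[of _ "C * 0" _ "1/2"] by simp
    qed
    have "((\<lambda>w. B w v - B w0 v) \<longlongrightarrow> 0) (at w0 within S)"
    proof (rule Lim_null_comparison)
      show "eventually (\<lambda>w. norm (B w v - B w0 v) \<le> 2 * C * N w * norm (B w0 v)) (at w0 within S)"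
        using ev by (auto simp: eventually_at_filter est elim!: eventually_mono)
      show "((\<lambda>w. 2 * C * N w * norm (B w0 v)) \<longlongrightarrow> 0) (at w0 within S)"
        using tendsto_mult[OF tendsto_mult[OF tendsto_const N, of "2*C"] tendsto_const, of "norm (B w0 v)"] by simp
    qed
    then show ?thesis by (simp add: Lim_null[symmetric])
  qed
  then show ?case by (simp add: continuous_on_def)
next
  case (Suc k)
  define A' where "A' w u h = frechet_derivative (\<lambda>w. A w u) (at w within S) h" for w u h
  have IH: "Ck_on k S (\<lambda>w. B w v)" for v by (rule Suc.IH[OF Ck_on_Suc_imp[OF Suc.prems]])
  have IH0: "continuous_on S (\<lambda>w. B w v)" for v
    using IH by (rule Ck_on_imp_continuous)
  have A': "((\<lambda>w. A w u) has_derivative A' w u) (at w within S)" if "w \<in> S" for w u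
    unfolding A'_def using Ck_on_SucD(1)[OF Suc.prems that] .
  show ?case
  proof (rule Ck_on_SucI[OF S])
    fix w0 assume w0: "w0 \<in> S"
    \<comment> \<open>Only continuity of \<open>B\<close> is known here. The factor A w i - A w0 i
      vanishes at \<open>w0\<close>, so the product is differentiable there nevertheless.\<close>
    have "((\<lambda>w. (B w v \<bullet> i) *\<^sub>R (A w i - A w0 i)) has_derivative (\<lambda>h. (B w0 v \<bullet> i) *\<^sub>R A' w0 i h)) (at w0 within S)" for i
    proof (rule has_derivative_scaleR_vanishing)
      have "continuous (at w0 within S) (\<lambda>w. B w v)"
        using IH0 w0 by (simp add: continuous_on_eq_continuous_within)
      then show "continuous (at w0 within S) (\<lambda>w. B w v \<bullet> i)" by (intro continuous_intros)
      show "((\<lambda>w. A w i - A w0 i) has_derivative A' w0 i) (at w0 within S)"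
        using has_derivative_diff[OF A'[OF w0] has_derivative_const] by simp
    qed simp
    then have "((\<lambda>w. \<Sum>i\<in>Basis. (B w v \<bullet> i) *\<^sub>R (A w i - A w0 i)) has_derivative
        (\<lambda>h. \<Sum>i\<in>Basis. (B w0 v \<bullet> i) *\<^sub>R A' w0 i h)) (at w0 within S)"
      by (intro has_derivative_sum)
    then have D: "((\<lambda>w. B w0 v - B w0 (\<Sum>i\<in>Basis. (B w v \<bullet> i) *\<^sub>R (A w i - A w0 i))) has_derivative
        (\<lambda>h. 0 - B w0 (\<Sum>i\<in>Basis. (B w0 v \<bullet> i) *\<^sub>R A' w0 i h))) (at w0 within S)"
      by (intro has_derivative_diff has_derivative_const bounded_linear.has_derivative[where f = "B w0"])
         (use linB[OF w0] linear_conv_bounded_linear in blast)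
    have "B w v = B w0 v - B w0 (\<Sum>i\<in>Basis. (B w v \<bullet> i) *\<^sub>R (A w i - A w0 i))" if "w \<in> S" for w
    proof -
      have "(\<Sum>i\<in>Basis. (B w v \<bullet> i) *\<^sub>R (A w i - A w0 i)) = A w (B w v) - A w0 (B w v)"
        by (rule linear_sum_Basis[OF linear_compose_sub[OF linA[OF that] linA[OF w0]], symmetric])
      then show ?thesis using linB[OF w0] BA[OF w0] AB[OF that] by (simp add: linear_diff)
    qed
    from has_derivative_transform[OF w0 this D]
    have "((\<lambda>w. B w v) has_derivative
        (\<lambda>h. 0 - B w0 (\<Sum>i\<in>Basis. (B w0 v \<bullet> i) *\<^sub>R A' w0 i h))) (at w0 within S)" .
    moreover have "0 - B w0 (\<Sum>i\<in>Basis. (B w0 v \<bullet> i) *\<^sub>R A' w0 i h) =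
       (\<Sum>j\<in>Basis. (- (\<Sum>i\<in>Basis. (B w0 v \<bullet> i) *\<^sub>R A' w0 i h) \<bullet> j) *\<^sub>R B w0 j)" for h
      by (subst linear_sum_Basis[OF linB[OF w0], symmetric]) (simp only: linear_neg[OF linB[OF w0]] diff_0)
    ultimately show "((\<lambda>w. B w v) has_derivative
        (\<lambda>h. \<Sum>j\<in>Basis. (- (\<Sum>i\<in>Basis. (B w0 v \<bullet> i) *\<^sub>R A' w0 i h) \<bullet> j) *\<^sub>R B w0 j)) (at w0 within S)"
      by simp
  next
    fix h
    show "Ck_on k S (\<lambda>w. \<Sum>j\<in>Basis. (- (\<Sum>i\<in>Basis. (B w v \<bullet> i) *\<^sub>R A' w i h) \<bullet> j) *\<^sub>R B w j)"
      unfolding A'_def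
      by (intro Ck_on_sum Ck_on_scaleR Ck_on_inner_left Ck_on_linear[OF bounded_linear_minus[OF bounded_linear_ident]]
          S IH Ck_on_SucD(2)[OF Suc.prems])
  qed
qed

text \<open>The domains carry a closed time interval, so continuity of \<open>G\<close> is a
  hypothesis rather than the conclusion of an inverse function theorem. The derivative of
  \<open>G\<close> at w is the inverse of that of \<open>F\<close> at G w, so each order of
  smoothness of \<open>G\<close> yields the next.\<close>

lemma smooth_on_inverse_function:
  fixes F G :: "'a::euclidean_space \<Rightarrow> 'a"
  assumes D: "thick D1" "thick D2" and F: "smooth_on D1 F" and G: "continuous_on D2 G"
    and FD: "F ` D1 = D2" and GF: "\<And>z. z \<in> D1 \<Longrightarrow> G (F z) = z"
    and inj: "\<And>z v. z \<in> D1 \<Longrightarrow> frechet_derivative F (at z within D1) v = 0 \<Longrightarrow> v = 0"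
  shows "smooth_on D2 G"
proof -
  have GD: "G w \<in> D1" and FG: "F (G w) = w" if "w \<in> D2" for w
    using that FD GF by auto
  define A where "A w = frechet_derivative F (at (G w) within D1)" for w
  define B where "B w = inv_into UNIV (A w)" for w
  have Fd: "(F has_derivative A w) (at (G w) within D1)" if "w \<in> D2" for w
    using F GD[OF that] Ck_on_SucD(1)[of 0] unfolding smooth_on_def A_def by blast
  have linA: "linear (A w)" if "w \<in> D2" for w using Fd[OF that] by (rule has_derivative_linear)
  have injA: "inj (A w)" if "w \<in> D2" for w
    using linear_injective_0[OF linA[OF that]] inj[OF GD[OF that]] unfolding A_def by blast
  have surjA: "surj (A w)" if "w \<in> D2" for w
    by (rule linear_inj_imp_surj[OF linA[OF that] injA[OF that]])
  have linB: "linear (B w)" if "w \<in> D2" for w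
    unfolding B_def using linA injA surjA that by (metis bij_betw_def inj_linear_imp_inv_linear)
  have AB: "A w (B w v) = v" if "w \<in> D2" for w v
    unfolding B_def using surjA[OF that] by (simp add: surj_f_inv_f)
  have BA: "B w (A w v) = v" if "w \<in> D2" for w v
    unfolding B_def using injA[OF that] by simp
  have Gd: "(G has_derivative B w) (at w within D2)" if "w \<in> D2" for w
  proof -
    have "(G has_derivative B w) (at (F (G w)) within F ` D1)"
    proof (rule has_derivative_inverse_within[OF Fd[OF that]])
      show "continuous (at (F (G w)) within F ` D1) G"
        using G that by (simp add: FD FG continuous_on_eq_continuous_within)
      show "B w \<circ> A w = id" using BA[OF that] by auto
    qed (use GD GF linB that in auto)
    then show ?thesis by (simp add: FG[OF that] FD)
  qed
  have "Ck_on k D2 G" for k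
  proof (induction k)
    case 0
    then show ?case using G by simp
  next
    case (Suc k)
    have "Ck_on k D1 (\<lambda>z. frechet_derivative F (at z within D1) v)" for v
      using F unfolding smooth_on_def by (intro Ck_on_SucD(2)) blast
    from Ck_on_compose[OF D(2) _ this Suc]
    have A: "Ck_on k D2 (\<lambda>w. A w v)" for v
      unfolding A_def
      using GD by blast
    have "Ck_on k D2 (\<lambda>w. B w v)" for v
      by (rule Ck_on_inverse_linear[of D2 A B k v]) (fact D linA linB AB BA A)+
    then show ?case by (intro Ck_on_SucI[OF D(2) Gd])
  qed
  then show ?thesis by (simp add: smooth_on_def)
qed

section \<open>Closure properties of smooth functions\<close>

lemma smooth_on_cong: "(\<And>x. x \<in> S \<Longrightarrow> f x = g x) \<Longrightarrow> smooth_on S f \<longleftrightarrow> smooth_on S g"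
  unfolding smooth_on_def using Ck_on_cong[of S f g] by simp

lemma smooth_on_Int_open: "smooth_on S f \<Longrightarrow> open W \<Longrightarrow> smooth_on (S \<inter> W) f"
  unfolding smooth_on_def by (blast intro: Ck_on_Int_open)

lemma smooth_on_local:
  assumes "\<And>x. x \<in> S \<Longrightarrow> \<exists>W. open W \<and> x \<in> W \<and> smooth_on (S \<inter> W) f"
  shows "smooth_on S f"
  unfolding smooth_on_def
proof
  fix k show "Ck_on k S f" by (rule Ck_on_local) (use assms in \<open>unfold smooth_on_def, blast\<close>)
qed

lemma smooth_on_const: "thick S \<Longrightarrow> smooth_on S (\<lambda>x. c)"
  by (simp add: smooth_on_def Ck_on_const)

lemma smooth_on_id: "thick S \<Longrightarrow> smooth_on S (\<lambda>x. x)"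
  by (simp add: smooth_on_def Ck_on_id)

lemma smooth_on_linear: "bounded_linear L \<Longrightarrow> thick S \<Longrightarrow> smooth_on S f \<Longrightarrow> smooth_on S (\<lambda>x. L (f x))"
  by (simp add: smooth_on_def Ck_on_linear)

lemma smooth_on_add: "thick S \<Longrightarrow> smooth_on S f \<Longrightarrow> smooth_on S g \<Longrightarrow> smooth_on S (\<lambda>x. f x + g x)"
  by (simp add: smooth_on_def Ck_on_add)

lemma smooth_on_sum:
  "thick S \<Longrightarrow> (\<And>i. i \<in> I \<Longrightarrow> smooth_on S (f i)) \<Longrightarrow> smooth_on S (\<lambda>x. \<Sum>i\<in>I. f i x)"
  by (simp add: smooth_on_def Ck_on_sum)

lemma smooth_on_mult:
  fixes f g :: "'a::euclidean_space \<Rightarrow> 'b::real_normed_algebra"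
  shows "thick S \<Longrightarrow> smooth_on S f \<Longrightarrow> smooth_on S g \<Longrightarrow> smooth_on S (\<lambda>x. f x * g x)"
  by (simp add: smooth_on_def Ck_on_bilinear[OF bounded_bilinear_mult])

lemma smooth_on_minus: "thick S \<Longrightarrow> smooth_on S f \<Longrightarrow> smooth_on S (\<lambda>x. - f x)"
  by (rule smooth_on_linear[OF bounded_linear_minus[OF bounded_linear_ident]])

lemma smooth_on_diff: "thick S \<Longrightarrow> smooth_on S f \<Longrightarrow> smooth_on S g \<Longrightarrow> smooth_on S (\<lambda>x. f x - g x)"
  using smooth_on_add[of S f "\<lambda>x. - g x"] smooth_on_minus[of S g] by simp

lemma smooth_on_inner_left: "thick S \<Longrightarrow> smooth_on S f \<Longrightarrow> smooth_on S (\<lambda>x. f x \<bullet> c)"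
  by (rule smooth_on_linear[OF bounded_linear_inner_left])

lemma smooth_on_inverse:
  fixes f :: "'a::euclidean_space \<Rightarrow> real"
  shows "thick S \<Longrightarrow> smooth_on S f \<Longrightarrow> (\<And>x. x \<in> S \<Longrightarrow> f x \<noteq> 0) \<Longrightarrow> smooth_on S (\<lambda>x. inverse (f x))"
  by (simp add: smooth_on_def Ck_on_inverse)

lemma smooth_on_compose:
  fixes f :: "'a::euclidean_space \<Rightarrow> 'b::euclidean_space"
  assumes "thick S" "smooth_on T g" "smooth_on S f" "\<And>x. x \<in> S \<Longrightarrow> f x \<in> T"
  shows "smooth_on S (\<lambda>x. g (f x))"
  using assms Ck_on_compose[of S f T _ g] unfolding smooth_on_def by blast

lemma smooth_on_fst: "thick S \<Longrightarrow> smooth_on S f \<Longrightarrow> smooth_on S (\<lambda>x. fst (f x))"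
  by (rule smooth_on_linear[OF bounded_linear_fst])

lemma smooth_on_snd: "thick S \<Longrightarrow> smooth_on S f \<Longrightarrow> smooth_on S (\<lambda>x. snd (f x))"
  by (rule smooth_on_linear[OF bounded_linear_snd])

lemma smooth_on_Pair:
  assumes "thick S" "smooth_on S f" "smooth_on S g"
  shows "smooth_on S (\<lambda>x. (f x, g x))"
proof -
  have "bounded_linear (\<lambda>a::'b. (a, 0::'c))" "bounded_linear (\<lambda>a::'c. (0::'b, a))"
    by (auto intro!: bounded_linear_Pair bounded_linear_ident bounded_linear_zero)
  from smooth_on_add[OF assms(1) smooth_on_linear[OF this(1) assms(1,2)] smooth_on_linear[OF this(2) assms(1,3)]]
  show ?thesis by simp
qed

lemma smooth_on_has_derivative:
  assumes "smooth_on S f" "x \<in> S"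
  shows "(f has_derivative frechet_derivative f (at x within S)) (at x within S)"
  using Ck_on_SucD(1)[of 0 S f x] assms unfolding smooth_on_def by blast

lemma smooth_on_derivative:
  assumes "smooth_on S f"
  shows "smooth_on S (\<lambda>x. frechet_derivative f (at x within S) v)"
  using assms Ck_on_SucD(2)[of _ S f v] unfolding smooth_on_def by blast

lemma smooth_on_imp_continuous: "smooth_on S f \<Longrightarrow> continuous_on S f"
  unfolding smooth_on_def using Ck_on.simps(1) by blast

lemmas smooth_on_intros = smooth_on_const smooth_on_id smooth_on_add smooth_on_diff smooth_on_minus
  smooth_on_mult smooth_on_fst smooth_on_snd smooth_on_Pair

section \<open>Symmetry of second derivatives\<close>

lemma has_derivative_line:
  fixes f :: "'a::real_normed_vector \<Rightarrow> real"
  assumes "(f has_derivative f') (at (z + s *\<^sub>R v))"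
  shows "((\<lambda>s. f (z + s *\<^sub>R v)) has_real_derivative f' v) (at s)"
proof -
  have "((\<lambda>s. z + s *\<^sub>R v) has_derivative (\<lambda>h. h *\<^sub>R v)) (at s)"
    by (auto intro!: derivative_eq_intros)
  from has_derivative_compose[OF this assms]
  have "((\<lambda>s. f (z + s *\<^sub>R v)) has_derivative (\<lambda>h. f' (h *\<^sub>R v))) (at s)" .
  moreover have "(\<lambda>h. f' (h *\<^sub>R v)) = (*) (f' v)"
    using has_derivative_linear[OF assms] by (auto simp: linear_scale mult.commute)
  ultimately show ?thesis by (simp add: has_field_derivative_def)
qed

text \<open>The mean value theorem, once along v and once along w. The second difference itself is
  symmetric in v and w, which makes the two mixed derivatives comparable.\<close>

lemma second_difference:
  fixes f :: "'a::real_normed_vector \<Rightarrow> real"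
  assumes h: "h > 0"
    and W: "\<And>s t. 0 \<le> s \<Longrightarrow> s \<le> h \<Longrightarrow> 0 \<le> t \<Longrightarrow> t \<le> h \<Longrightarrow> z + s *\<^sub>R v + t *\<^sub>R w \<in> W"
    and f: "\<And>x. x \<in> W \<Longrightarrow> (f has_derivative f' x) (at x)"
    and A: "\<And>x. x \<in> W \<Longrightarrow> ((\<lambda>x. f' x v) has_derivative A x) (at x)"
  shows "\<exists>s t. 0 \<le> s \<and> s \<le> h \<and> 0 \<le> t \<and> t \<le> h \<and>
     f (z + h *\<^sub>R v + h *\<^sub>R w) - f (z + h *\<^sub>R v) - f (z + h *\<^sub>R w) + f z = h * h * A (z + s *\<^sub>R v + t *\<^sub>R w) w"
proof -
  define \<phi> where "\<phi> s = f (z + h *\<^sub>R w + s *\<^sub>R v) - f (z + s *\<^sub>R v)" for s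
  have "(\<phi> has_real_derivative f' (z + h *\<^sub>R w + s *\<^sub>R v) v - f' (z + s *\<^sub>R v) v) (at s)" if "0 \<le> s" "s \<le> h" for s
  proof -
    have "z + h *\<^sub>R w + s *\<^sub>R v \<in> W" "z + s *\<^sub>R v \<in> W"
      using W[of s h] W[of s 0] that h by (simp_all add: add_ac)
    then show ?thesis unfolding \<phi>_def by (intro DERIV_diff has_derivative_line f)
  qed
  from MVT2[OF h this] obtain s where s: "0 < s" "s < h"
    "\<phi> h - \<phi> 0 = h * (f' (z + h *\<^sub>R w + s *\<^sub>R v) v - f' (z + s *\<^sub>R v) v)" by auto
  have "((\<lambda>t. f' (z + s *\<^sub>R v + t *\<^sub>R w) v) has_real_derivative A (z + s *\<^sub>R v + t *\<^sub>R w) w) (at t)"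
    if "0 \<le> t" "t \<le> h" for t
    by (rule has_derivative_line[of "\<lambda>x. f' x v"], rule A, rule W) (use s that in auto)
  from MVT2[OF h this] obtain t where t: "0 < t" "t < h"
    "f' (z + s *\<^sub>R v + h *\<^sub>R w) v - f' (z + s *\<^sub>R v + 0 *\<^sub>R w) v = h * A (z + s *\<^sub>R v + t *\<^sub>R w) w" by auto
  have "\<phi> h - \<phi> 0 = h * (h * A (z + s *\<^sub>R v + t *\<^sub>R w) w)"
    unfolding s(3) t(3)[symmetric] by (simp add: add_ac)
  moreover have "\<phi> h - \<phi> 0 = f (z + h *\<^sub>R v + h *\<^sub>R w) - f (z + h *\<^sub>R v) - f (z + h *\<^sub>R w) + f z"
    by (simp add: \<phi>_def algebra_simps)
  ultimately show ?thesis
    using s(1,2) t(1,2) by (metis less_eq_real_def mult.assoc)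
qed

lemma symmetric_second_derivative_real:
  fixes f :: "'a::real_normed_vector \<Rightarrow> real"
  assumes W: "open W" "z \<in> W"
    and f: "\<And>x. x \<in> W \<Longrightarrow> (f has_derivative f' x) (at x)"
    and A: "\<And>x. x \<in> W \<Longrightarrow> ((\<lambda>x. f' x v) has_derivative A x) (at x)"
    and B: "\<And>x. x \<in> W \<Longrightarrow> ((\<lambda>x. f' x w) has_derivative B x) (at x)"
    and contA: "continuous_on W (\<lambda>x. A x w)" and contB: "continuous_on W (\<lambda>x. B x v)"
  shows "A z w = B z v"
proof (rule ccontr)
  assume ne: "A z w \<noteq> B z v"
  define e where "e = \<bar>A z w - B z v\<bar> / 2"
  have e: "e > 0" using ne by (simp add: e_def)
  obtain r0 where r0: "r0 > 0" "ball z r0 \<subseteq> W" using W open_contains_ball by blast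
  have "isCont (\<lambda>x. A x w) z" "isCont (\<lambda>x. B x v) z"
    using contA contB W by (auto simp: continuous_on_eq_continuous_at)
  then obtain r1 r2 where r1: "r1 > 0" "\<And>x. dist x z < r1 \<Longrightarrow> dist (A x w) (A z w) < e"
    and r2: "r2 > 0" "\<And>x. dist x z < r2 \<Longrightarrow> dist (B x v) (B z v) < e"
    unfolding continuous_at_eps_delta using e by metis
  define r where "r = min r0 (min r1 r2)"
  have r: "r > 0" using r0 r1 r2 by (simp add: r_def)
  \<comment> \<open>These constants keep the whole parallelogram spanned by h v and h w within
    distance r / 2 of z; the summand 1 avoids a division by zero for v = w = 0.\<close>
  define N where "N = norm v + norm w + 1"
  define h where "h = r / (2 * N)"
  have n: "N > 0" unfolding N_def by (smt (verit) norm_ge_zero)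
  have h: "h > 0" using r n by (simp add: h_def)
  have near: "dist (z + s *\<^sub>R v + t *\<^sub>R w) z < r" if "0 \<le> s" "s \<le> h" "0 \<le> t" "t \<le> h" for s t
  proof -
    have "dist (z + s *\<^sub>R v + t *\<^sub>R w) z = norm (s *\<^sub>R v + t *\<^sub>R w)" by (simp add: dist_norm)
    also have "\<dots> \<le> s * norm v + t * norm w" using that norm_triangle_ineq[of "s *\<^sub>R v" "t *\<^sub>R w"] by simp
    also have "\<dots> \<le> h * norm v + h * norm w" using that by (intro add_mono mult_right_mono) auto
    also have "\<dots> \<le> h * N" using h by (simp add: N_def distrib_left)
    also have "\<dots> = r / 2" using n by (simp add: h_def)
    finally show ?thesis using r by simp
  qed
  have inW: "z + s *\<^sub>R v + t *\<^sub>R w \<in> W" if "0 \<le> s" "s \<le> h" "0 \<le> t" "t \<le> h" for s t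
    using near[OF that] r0 by (auto simp: r_def dist_commute)
  have inW': "z + s *\<^sub>R w + t *\<^sub>R v \<in> W" if "0 \<le> s" "s \<le> h" "0 \<le> t" "t \<le> h" for s t
    using inW[of t s] that by (simp add: add_ac)
  obtain s t where 1: "0 \<le> s" "s \<le> h" "0 \<le> t" "t \<le> h"
     "f (z + h *\<^sub>R v + h *\<^sub>R w) - f (z + h *\<^sub>R v) - f (z + h *\<^sub>R w) + f z = h * h * A (z + s *\<^sub>R v + t *\<^sub>R w) w"
    using second_difference[OF h inW f A] by blast
  obtain s' t' where 2: "0 \<le> s'" "s' \<le> h" "0 \<le> t'" "t' \<le> h"
     "f (z + h *\<^sub>R w + h *\<^sub>R v) - f (z + h *\<^sub>R w) - f (z + h *\<^sub>R v) + f z = h * h * B (z + s' *\<^sub>R w + t' *\<^sub>R v) v"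
    using second_difference[OF h inW' f B] by blast
  have "h * h * A (z + s *\<^sub>R v + t *\<^sub>R w) w = h * h * B (z + s' *\<^sub>R w + t' *\<^sub>R v) v"
    unfolding 1(5)[symmetric] 2(5)[symmetric] by (simp add: add_ac)
  then have "A (z + s *\<^sub>R v + t *\<^sub>R w) w = B (z + s' *\<^sub>R w + t' *\<^sub>R v) v" using h by simp
  moreover have "dist (A (z + s *\<^sub>R v + t *\<^sub>R w) w) (A z w) < e"
    using near[OF 1(1-4)] by (intro r1) (simp add: r_def)
  moreover have "dist (B (z + s' *\<^sub>R w + t' *\<^sub>R v) v) (B z v) < e"
    using near[OF 2(3,4,1,2)] by (intro r2) (simp add: r_def add_ac)
  ultimately show False by (auto simp: e_def dist_real_def abs_if split: if_splits)
qed

lemma smooth_on_open_has_derivative: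
  assumes "smooth_on W f" "open W" "x \<in> W"
  shows "(f has_derivative frechet_derivative f (at x)) (at x)"
  using smooth_on_has_derivative[OF assms(1,3)] unfolding at_within_open[OF assms(3,2)] .

lemma smooth_on_open_derivative:
  assumes "smooth_on W f" "open W"
  shows "smooth_on W (\<lambda>x. frechet_derivative f (at x) v)"
proof -
  have "smooth_on W (\<lambda>x. frechet_derivative f (at x within W) v) \<longleftrightarrow> smooth_on W (\<lambda>x. frechet_derivative f (at x) v)"
    by (rule smooth_on_cong) (simp add: at_within_open[OF _ assms(2)])
  then show ?thesis using smooth_on_derivative[OF assms(1)] by blast
qed

lemma symmetric_second_derivative:
  fixes f :: "'a::euclidean_space \<Rightarrow> 'b::euclidean_space"
  assumes W: "open W" "z \<in> W" and f: "smooth_on W f"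
  shows "frechet_derivative (\<lambda>x. frechet_derivative f (at x) v) (at z) w =
         frechet_derivative (\<lambda>x. frechet_derivative f (at x) w) (at z) v"
proof (rule euclidean_eqI)
  fix i :: 'b assume "i \<in> Basis"
  let ?D = "\<lambda>v x. frechet_derivative f (at x) v"
  note D = smooth_on_open_has_derivative[OF _ W(1)] smooth_on_open_derivative[OF _ W(1)]
  show "frechet_derivative (?D v) (at z) w \<bullet> i = frechet_derivative (?D w) (at z) v \<bullet> i"
  proof (rule symmetric_second_derivative_real[OF W, of "\<lambda>x. f x \<bullet> i" "\<lambda>x v. ?D v x \<bullet> i" v
        "\<lambda>x w. frechet_derivative (?D v) (at x) w \<bullet> i" w "\<lambda>x v. frechet_derivative (?D w) (at x) v \<bullet> i"])
    show "continuous_on W (\<lambda>x. frechet_derivative (?D v) (at x) w \<bullet> i)"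
      by (intro continuous_intros smooth_on_imp_continuous D f)
    show "continuous_on W (\<lambda>x. frechet_derivative (?D w) (at x) v \<bullet> i)"
      by (intro continuous_intros smooth_on_imp_continuous D f)
  qed (intro has_derivative_inner_left D f; assumption)+
qed

lemma frechet_derivative_cong_open:
  assumes "open S" "x \<in> S" "\<And>y. y \<in> S \<Longrightarrow> f y = g y"
  shows "frechet_derivative f (at x) = frechet_derivative g (at x)"
  using frechet_derivative_cong_on[of x S f g] assms(2,3) unfolding at_within_open[OF assms(2,1)] by blast

section \<open>Angles on the unit circle and integrals with parameters\<close>

lemma unit_complex_cis:
  assumes "cmod z = 1" obtains \<theta> where "0 \<le> \<theta>" "\<theta> \<le> 2 * pi" "z = cis \<theta>"
proof (rule that)
  show "0 \<le> Arg2pi z" "Arg2pi z \<le> 2 * pi" using Arg2pi[of z] by auto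
  have "z = complex_of_real (cmod z) * exp (\<i> * complex_of_real (Arg2pi z))" by (rule Arg2pi_eq)
  then show "z = cis (Arg2pi z)" unfolding assms by (simp add: cis_conv_exp)
qed

text \<open>The derivative is the rational function 1 / (1 + x^2), which is already known to be
  smooth.\<close>

lemma smooth_on_arctan: "smooth_on UNIV arctan"
  unfolding smooth_on_def
proof
  fix k show "Ck_on k UNIV arctan"
  proof (cases k)
    case 0
    then show ?thesis by (simp add: continuous_on_arctan[OF continuous_on_id])
  next
    case (Suc j)
    have sm: "smooth_on UNIV (\<lambda>x::real. inverse (1 + x * x))"
      by (rule smooth_on_inverse[OF thick_UNIV]) (auto intro!: smooth_on_intros simp: add_nonneg_eq_0_iff)
    show ?thesis unfolding Suc
    proof (rule Ck_on_SucI[OF thick_UNIV])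
      show "(arctan has_derivative (\<lambda>v. inverse (1 + x * x) * v)) (at x within UNIV)" for x
        using DERIV_arctan[of x] by (simp add: has_field_derivative_def power2_eq_square)
      show "Ck_on j UNIV (\<lambda>x. inverse (1 + x * x) * v)" for v :: real
        using smooth_on_mult[OF thick_UNIV sm smooth_on_const[OF thick_UNIV]] unfolding smooth_on_def by blast
    qed
  qed
qed

text \<open>The argument has no global smooth choice. On the half-plane around \<open>w0\<close> it
  is an angle of \<open>w0\<close> plus the arctangent of the slope of w / w0.\<close>

lemma local_angle:
  assumes w0: "cmod w0 = 1"
  obtains a where "smooth_on {w. Re (w * cnj w0) > 0} a"
    "\<And>w. cmod w = 1 \<Longrightarrow> Re (w * cnj w0) > 0 \<Longrightarrow> cis (a w) = w"
proof -
  obtain \<theta> where \<theta>: "w0 = cis \<theta>" using unit_complex_cis[OF w0] by blast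
  define S where "S = {w. Re (w * cnj w0) > 0}"
  have oS: "open S" unfolding S_def by (intro open_Collect_less continuous_intros)
  define a where "a w = \<theta> + arctan (Im (w * cnj w0) * inverse (Re (w * cnj w0)))" for w
  have lin: "smooth_on S (\<lambda>w. w * cnj w0)"
    using smooth_on_mult[OF thick_open[OF oS] smooth_on_id smooth_on_const] thick_open[OF oS] by blast
  have "smooth_on S (\<lambda>w. Im (w * cnj w0) * inverse (Re (w * cnj w0)))"
    by (intro smooth_on_mult smooth_on_inverse smooth_on_linear[OF bounded_linear_Re] smooth_on_linear[OF bounded_linear_Im] lin thick_open[OF oS])
       (simp add: S_def)
  from smooth_on_compose[OF thick_open[OF oS] smooth_on_arctan this]
  have "smooth_on S a" unfolding a_def[abs_def]
    by (intro smooth_on_add smooth_on_const thick_open[OF oS]) simp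
  moreover have "cis (a w) = w" if w: "cmod w = 1" "Re (w * cnj w0) > 0" for w
  proof -
    define g where "g = w * cnj w0"
    define x where "x = Re g"
    define y where "y = Im g"
    have x: "x > 0" using w by (simp add: x_def g_def)
    have "cmod g = 1" using w w0 by (simp add: g_def norm_mult)
    then have xy: "x\<^sup>2 + y\<^sup>2 = 1" by (simp add: x_def y_def cmod_power2[symmetric])
    have "1 + (y * inverse x)\<^sup>2 = (1 / x)\<^sup>2" using x xy by (simp add: field_simps)
    then have sq: "sqrt (1 + (y * inverse x)\<^sup>2) = 1 / x" using x by (simp add: real_sqrt_divide)
    have "cos (arctan (y * inverse x)) = x" "sin (arctan (y * inverse x)) = y"
      using x by (simp_all add: cos_arctan sin_arctan sq)
    then have "cis (arctan (y * inverse x)) = g" by (simp add: complex_eq_iff x_def y_def)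
    moreover have "g * w0 = w" using complex_norm_square[of w0] w0 by (simp add: g_def mult.assoc mult.commute[of w0])
    ultimately show ?thesis
      by (simp add: a_def \<theta>[symmetric] cis_mult[symmetric] g_def[symmetric] x_def[symmetric] y_def[symmetric] mult.commute)
  qed
  ultimately show ?thesis using that[of a] by (simp add: S_def)
qed

text \<open>Differentiating under the integral sign in direction \<open>v\<close> yields an integral
  of the same kind, with the derivative of \<open>f\<close> along \<open>(0, v)\<close>, so the
  induction closes. Convexity of \<open>S\<close> is what \<open>leibniz_rule\<close> asks
  for.\<close>

lemma Ck_on_integral:
  fixes f :: "real \<times> 'a::euclidean_space \<Rightarrow> real"
  assumes S: "convex S" "thick S" and f: "Ck_on k ({0..1} \<times> S) f"
  shows "Ck_on k S (\<lambda>u. integral {0..1} (\<lambda>s. f (s, u)))"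
  using f
proof (induction k arbitrary: f)
  case 0
  have "continuous_on (S \<times> {0..1}) (\<lambda>z. f (snd z, fst z))"
    by (rule continuous_on_compose2[of "{0..1} \<times> S" f]) (use 0 in \<open>auto intro!: continuous_intros\<close>)
  then show ?case
    using integral_continuous_on_param[of S 0 1 "\<lambda>u s. f (s, u)"] by (simp add: case_prod_unfold)
next
  case (Suc k)
  let ?E = "{0..1} \<times> S"
  define f' where "f' z = frechet_derivative f (at z within ?E)" for z
  have f': "(f has_derivative f' z) (at z within ?E)" if "z \<in> ?E" for z
    unfolding f'_def by (rule Ck_on_SucD(1)[OF Suc.prems that])
  have Cf': "Ck_on k ?E (\<lambda>z. f' z v)" for v unfolding f'_def by (rule Ck_on_SucD(2)[OF Suc.prems])
  \<comment> \<open>\<open>leibniz_rule\<close> integrates the derivative as a bounded linear map,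
    so the partial derivative is repackaged as one; its continuity is then checked on single
    vectors.\<close>
  define g where "g u s = Blinfun (\<lambda>v. f' (s, u) (0, v))" for u s
  have bl: "bounded_linear (\<lambda>v. f' (s, u) (0, v))" if "u \<in> S" "s \<in> {0..1}" for u s
    using bounded_linear_compose[OF has_derivative_bounded_linear[OF f'] bounded_linear_Pair[OF bounded_linear_zero bounded_linear_ident]] that
    by auto
  have g: "blinfun_apply (g u s) v = f' (s, u) (0, v)" if "u \<in> S" "s \<in> {0..1}" for u s v
    unfolding g_def using bounded_linear_Blinfun_apply[OF bl[OF that]] by simp
  have contg: "continuous_on (S \<times> {0..1}) (\<lambda>(u, s). g u s)"
  proof (rule continuous_on_blinfun_componentwise)
    fix i :: 'a
    have "continuous_on (S \<times> {0..1}) (\<lambda>z. f' (snd z, fst z) (0, i))"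
      by (rule continuous_on_compose2[OF Ck_on_imp_continuous[OF Cf'[of "(0, i)"]]]) (auto intro!: continuous_intros)
    then show "continuous_on (S \<times> {0..1}) (\<lambda>z. blinfun_apply (case z of (u, s) \<Rightarrow> g u s) i)"
      by (rule continuous_on_cong[THEN iffD1, rotated 2]) (auto simp: g)
  qed
  have contf: "continuous_on {0..1} (\<lambda>s. f (s, u))" if "u \<in> S" for u
    by (rule continuous_on_compose2[OF Ck_on_imp_continuous[OF Suc.prems]]) (use that in \<open>auto intro!: continuous_intros\<close>)
  have D: "((\<lambda>u. integral (cbox 0 1) (\<lambda>s. f (s, u))) has_derivative blinfun_apply (integral (cbox 0 1) (g u))) (at u within S)"
    if u: "u \<in> S" for u
  proof (rule leibniz_rule[OF _ _ _ u S(1)])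
    fix u' and s :: real assume us: "u' \<in> S" "s \<in> cbox 0 1"
    have i: "(\<lambda>u. (s, u)) ` S \<subseteq> ?E" using us by auto
    have *: "((\<lambda>u. f (s, u)) has_derivative (\<lambda>v. f' (s, u') (0, v))) (at u' within S)"
      by (rule has_derivative_in_compose[of "\<lambda>u. (s, u)" "\<lambda>v. (0, v)"])
         (use us f'[of "(s, u')"] has_derivative_subset[OF _ i] in \<open>auto intro!: derivative_eq_intros\<close>)
    show "((\<lambda>u. f (s, u)) has_derivative blinfun_apply (g u' s)) (at u' within S)"
    proof -
      have "blinfun_apply (g u' s) = (\<lambda>v. f' (s, u') (0, v))" using g[OF us(1)] us by (simp add: fun_eq_iff)
      with * show ?thesis by simp
    qed
  next
    show "(\<lambda>s. f (s, u')) integrable_on cbox 0 1" if "u' \<in> S" for u'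
      using integrable_continuous_real[OF contf[OF that]] by simp
    show "continuous_on (S \<times> cbox 0 1) (\<lambda>(u, s). g u s)" using contg by simp
  qed
  show ?case
  proof (rule Ck_on_SucI[OF S(2)])
    show "((\<lambda>u. integral {0..1} (\<lambda>s. f (s, u))) has_derivative blinfun_apply (integral {0..1} (g u))) (at u within S)"
      if "u \<in> S" for u using D[OF that] by simp
    fix v
    have "Ck_on k S (\<lambda>u. integral {0..1} (\<lambda>s. f' (s, u) (0, v)))" by (rule Suc.IH[OF Cf'])
    moreover have "integral {0..1} (\<lambda>s. f' (s, u) (0, v)) = blinfun_apply (integral {0..1} (g u)) v" if u: "u \<in> S" for u
    proof -
      have "continuous_on {0..1} (g u)"
      proof -
        have "continuous_on {0..1} (\<lambda>s. (u, s))" "(\<lambda>s. (u, s)) ` {0..1} \<subseteq> S \<times> {0..1}"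
          using u by (auto intro!: continuous_intros)
        from continuous_on_compose2[OF contg this] show ?thesis by simp
      qed
      then have "blinfun_apply (integral {0..1} (g u)) v = integral {0..1} (\<lambda>s. blinfun_apply (g u s) v)"
        by (intro blinfun_apply_integral integrable_continuous_real)
      also have "\<dots> = integral {0..1} (\<lambda>s. f' (s, u) (0, v))" by (rule integral_cong) (simp add: g u)
      finally show ?thesis by simp
    qed
    ultimately show "Ck_on k S (\<lambda>u. blinfun_apply (integral {0..1} (g u)) v)"
      by (rule Ck_on_cong[THEN iffD1, rotated])
  qed
qed

text \<open>The primitive \<open>\<integral>\<^sub>0\<^sup>t r\<close> is written as an integral over a fixed interval in order to differentiate under the integral.\<close>

definition primitive :: "(real \<Rightarrow> real) \<Rightarrow> real \<Rightarrow> real" where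
  "primitive r t = integral {0..1} (\<lambda>s. t * r (s * t))"

lemma primitive_zero [simp]: "primitive r 0 = 0"
  by (simp add: primitive_def)

lemma primitive_deriv:
  assumes r: "continuous_on {0..1} r" and t: "t \<in> {0..1}"
  shows "(primitive r has_real_derivative r t) (at t within {0..1})"
proof -
  have eq: "primitive r t = integral {0..t} r" if t: "t \<in> {0..1}" for t
  proof -
    \<comment> \<open>Substitution by the fundamental theorem of calculus along s \<mapsto> s t; in
      this form t = 0 is no special case.\<close>
    have "((\<lambda>s. t * r (s * t)) has_integral (integral {0..1 * t} r - integral {0..0 * t} r)) {0..1}"
    proof (rule fundamental_theorem_of_calculus)
      fix s :: real assume s: "s \<in> {0..1}"
      have st: "s * t \<in> {0..1}" using s t by (auto intro: mult_le_one)
      have im: "(\<lambda>s. s * t) ` {0..1} \<subseteq> {0..1}" using t by (auto intro: mult_le_one)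
      have "((\<lambda>u. integral {0..u} r) has_vector_derivative r (s * t)) (at (s * t) within (\<lambda>s. s * t) ` {0..1})"
        using integral_has_vector_derivative[OF r st] im by (rule has_vector_derivative_within_subset)
      moreover have "((\<lambda>s. s * t) has_vector_derivative t) (at s within {0..1})"
        by (auto intro!: derivative_eq_intros simp: has_vector_derivative_def)
      ultimately show "((\<lambda>s. integral {0..s * t} r) has_vector_derivative t * r (s * t)) (at s within {0..1})"
        using vector_diff_chain_within[of "\<lambda>s. s * t" t s "{0..1}" "\<lambda>u. integral {0..u} r" "r (s * t)"] by (simp add: o_def)
    qed simp
    from integral_unique[OF this] show ?thesis unfolding primitive_def by simp
  qed
  have "((\<lambda>t. integral {0..t} r) has_real_derivative r t) (at t within {0..1})"
    using integral_has_vector_derivative[OF r t] by (simp add: has_real_derivative_iff_has_vector_derivative)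
  from has_derivative_transform[OF t eq this[unfolded has_field_derivative_def]]
  show ?thesis by (simp add: has_field_derivative_def)
qed

section \<open>Smooth plots\<close>

text \<open>Smoothness of maps between manifolds is tested on maps from subsets of Euclidean spaces.\<close>

definition plot :: "('m::topological_space, 'e::euclidean_space) chart set \<Rightarrow> 'a::euclidean_space set \<Rightarrow> ('a \<Rightarrow> 'm) \<Rightarrow> bool" where
  "plot A D u \<longleftrightarrow> continuous_on D u \<and> (\<forall>\<kappa>\<in>A. smooth_on {z\<in>D. u z \<in> cdom \<kappa>} (\<lambda>z. coord \<kappa> (u z)))"

context
  fixes A :: "('m::{t2_space, second_countable_topology}, 'e::euclidean_space) chart set"
  assumes A: "smooth_atlas A"
begin

lemma open_cdom: "\<kappa> \<in> A \<Longrightarrow> open (cdom \<kappa>)"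
  using A unfolding smooth_atlas_def by blast

lemma chart_homeomorphism:
  "\<kappa> \<in> A \<Longrightarrow> homeomorphism (cdom \<kappa>) (coord \<kappa> ` cdom \<kappa>) (coord \<kappa>) (param \<kappa>)"
  using A unfolding smooth_atlas_def by blast

lemma continuous_on_coord: "\<kappa> \<in> A \<Longrightarrow> continuous_on (cdom \<kappa>) (coord \<kappa>)"
  using chart_homeomorphism unfolding homeomorphism_def by blast

lemma continuous_on_param: "\<kappa> \<in> A \<Longrightarrow> continuous_on (coord \<kappa> ` cdom \<kappa>) (param \<kappa>)"
  using chart_homeomorphism unfolding homeomorphism_def by blast

lemma param_coord [simp]: "\<kappa> \<in> A \<Longrightarrow> x \<in> cdom \<kappa> \<Longrightarrow> param \<kappa> (coord \<kappa> x) = x"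
  using chart_homeomorphism unfolding homeomorphism_def by blast

lemma coord_param [simp]: "\<kappa> \<in> A \<Longrightarrow> y \<in> coord \<kappa> ` cdom \<kappa> \<Longrightarrow> coord \<kappa> (param \<kappa> y) = y"
  using chart_homeomorphism unfolding homeomorphism_def by blast

lemma param_in_cdom: "\<kappa> \<in> A \<Longrightarrow> y \<in> coord \<kappa> ` cdom \<kappa> \<Longrightarrow> param \<kappa> y \<in> cdom \<kappa>"
  using chart_homeomorphism unfolding homeomorphism_def by blast

lemma chart_at: "chart_at A x \<in> A" "x \<in> cdom (chart_at A x)"
proof -
  have "\<exists>\<kappa>. \<kappa> \<in> A \<and> x \<in> cdom \<kappa>" using A unfolding smooth_atlas_def by blast
  from someI_ex[OF this] show "chart_at A x \<in> A" "x \<in> cdom (chart_at A x)"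
    unfolding chart_at_def by auto
qed

lemma smooth_transition:
  "\<kappa> \<in> A \<Longrightarrow> \<mu> \<in> A \<Longrightarrow> smooth_on (coord \<kappa> ` (cdom \<kappa> \<inter> cdom \<mu>)) (\<lambda>y. coord \<mu> (param \<kappa> y))"
  using A unfolding smooth_atlas_def by blast

lemma open_chart_image:
  assumes "\<kappa> \<in> A" "open S"
  shows "open (coord \<kappa> ` (cdom \<kappa> \<inter> S))"
proof -
  have "coord \<kappa> ` (cdom \<kappa> \<inter> S) = coord \<kappa> ` cdom \<kappa> \<inter> param \<kappa> -` S"
    using assms(1) by (force simp: image_iff)
  moreover have "open (coord \<kappa> ` cdom \<kappa>)" using A assms unfolding smooth_atlas_def by blast
  ultimately show ?thesis using continuous_on_param[OF assms(1)] assms(2)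
    by (metis continuous_on_open_vimage Int_commute)
qed

lemma plot_chart_domain:
  assumes "continuous_on D u" "\<kappa> \<in> A"
  obtains W where "open W" "{z\<in>D. u z \<in> cdom \<kappa>} = D \<inter> W"
proof -
  from assms(1) open_cdom[OF assms(2)] obtain W where "open W" "W \<inter> D = u -` cdom \<kappa> \<inter> D"
    unfolding continuous_on_open_invariant by blast
  then show ?thesis by (intro that[of W]) auto
qed

lemma plotD:
  assumes "plot A D u" "\<kappa> \<in> A"
  obtains W where "open W" "{z\<in>D. u z \<in> cdom \<kappa>} = D \<inter> W" "smooth_on (D \<inter> W) (\<lambda>z. coord \<kappa> (u z))"
proof -
  obtain W where "open W" "{z\<in>D. u z \<in> cdom \<kappa>} = D \<inter> W"
    using plot_chart_domain assms unfolding plot_def by blast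
  then show ?thesis using that[of W] assms unfolding plot_def by auto
qed

lemma plotD_at:
  assumes "plot A D u" "z \<in> D"
  obtains \<kappa> W where "\<kappa> \<in> A" "open W" "z \<in> W" "u ` (D \<inter> W) \<subseteq> cdom \<kappa>" "smooth_on (D \<inter> W) (\<lambda>z. coord \<kappa> (u z))"
proof -
  from plotD[OF assms(1) chart_at(1)[of "u z"]] obtain W where W: "open W"
    "{y\<in>D. u y \<in> cdom (chart_at A (u z))} = D \<inter> W" "smooth_on (D \<inter> W) (\<lambda>y. coord (chart_at A (u z)) (u y))" .
  moreover have "z \<in> W" using W(2) assms(2) chart_at(2)[of "u z"] by blast
  ultimately show ?thesis using that[OF chart_at(1)] by blast
qed

lemma plot_imp_continuous: "plot A D u \<Longrightarrow> continuous_on D u"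
  by (simp add: plot_def)

text \<open>One chart around each point suffices: smooth transitions carry the property to all other
  charts, and continuity follows from continuity of the inverse chart.\<close>

lemma plotI:
  assumes D: "thick D"
    and loc: "\<And>z. z \<in> D \<Longrightarrow> \<exists>\<kappa>\<in>A. \<exists>W. open W \<and> z \<in> W \<and> u ` (D \<inter> W) \<subseteq> cdom \<kappa> \<and> smooth_on (D \<inter> W) (\<lambda>z. coord \<kappa> (u z))"
  shows "plot A D u"
proof -
  have cont: "continuous_on D u"
    unfolding continuous_on_eq_continuous_within
  proof
    fix z assume z: "z \<in> D"
    from loc[OF this] obtain \<kappa> W where W: "\<kappa> \<in> A" "open W" "z \<in> W" "u ` (D \<inter> W) \<subseteq> cdom \<kappa>"
      "smooth_on (D \<inter> W) (\<lambda>z. coord \<kappa> (u z))" by blast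
    have "continuous_on (D \<inter> W) (\<lambda>z. param \<kappa> (coord \<kappa> (u z)))"
      by (rule continuous_on_compose2[OF continuous_on_param[OF W(1)] smooth_on_imp_continuous[OF W(5)]])
         (use W(4) in auto)
    then have "continuous_on (D \<inter> W) u"
      by (rule continuous_on_cong[THEN iffD1, rotated 2]) (use W in auto)
    then show "continuous (at z within D) u"
      using z W(2,3) by (simp add: continuous_on_eq_continuous_within) (metis IntI at_within_Int_open)
  qed
  moreover have "smooth_on {z\<in>D. u z \<in> cdom \<mu>} (\<lambda>z. coord \<mu> (u z))" if \<mu>: "\<mu> \<in> A" for \<mu>
  proof -
    obtain W' where W': "open W'" "{z\<in>D. u z \<in> cdom \<mu>} = D \<inter> W'"
      using plot_chart_domain[OF cont \<mu>] .
    show ?thesis unfolding W'(2)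
    proof (rule smooth_on_local)
      fix z assume z: "z \<in> D \<inter> W'"
      from loc[of z] z obtain \<kappa> W where W: "\<kappa> \<in> A" "open W" "z \<in> W" "u ` (D \<inter> W) \<subseteq> cdom \<kappa>"
        "smooth_on (D \<inter> W) (\<lambda>z. coord \<kappa> (u z))" by blast
      have sm: "smooth_on (D \<inter> W' \<inter> W) (\<lambda>z. coord \<kappa> (u z))"
        using smooth_on_Int_open[OF W(5) W'(1)] by (simp add: Int_ac)
      have "smooth_on (D \<inter> W' \<inter> W) (\<lambda>z. coord \<mu> (param \<kappa> (coord \<kappa> (u z))))"
        by (rule smooth_on_compose[OF _ smooth_transition[OF W(1) \<mu>] sm])
           (use W W' D in \<open>auto intro!: thick_Int_open\<close>)
      then have "smooth_on (D \<inter> W' \<inter> W) (\<lambda>z. coord \<mu> (u z))"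
        by (rule smooth_on_cong[THEN iffD1, rotated]) (use W in auto)
      then show "\<exists>W. open W \<and> z \<in> W \<and> smooth_on (D \<inter> W' \<inter> W) (\<lambda>z. coord \<mu> (u z))"
        using W by blast
    qed
  qed
  ultimately show ?thesis unfolding plot_def by blast
qed

lemma plot_cong:
  assumes "plot A D u" "\<And>z. z \<in> D \<Longrightarrow> u z = w z"
  shows "plot A D w"
proof -
  have "continuous_on D w" using assms continuous_on_cong[of D D u w] unfolding plot_def by auto
  moreover have "smooth_on {z\<in>D. w z \<in> cdom \<kappa>} (\<lambda>z. coord \<kappa> (w z))" if "\<kappa> \<in> A" for \<kappa>
  proof -
    have "{z\<in>D. w z \<in> cdom \<kappa>} = {z\<in>D. u z \<in> cdom \<kappa>}" using assms(2) by auto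
    moreover have "smooth_on {z\<in>D. u z \<in> cdom \<kappa>} (\<lambda>z. coord \<kappa> (w z))"
      by (rule smooth_on_cong[THEN iffD1, of _ "\<lambda>z. coord \<kappa> (u z)"]) (use assms that in \<open>auto simp: plot_def\<close>)
    ultimately show ?thesis by simp
  qed
  ultimately show ?thesis unfolding plot_def by blast
qed

lemma plot_compose:
  fixes f :: "'a::euclidean_space \<Rightarrow> 'b::euclidean_space"
  assumes "plot A D u" "thick D'" "smooth_on D' f" "\<And>z. z \<in> D' \<Longrightarrow> f z \<in> D"
  shows "plot A D' (\<lambda>z. u (f z))"
proof -
  have cont: "continuous_on D' (\<lambda>z. u (f z))"
    using continuous_on_compose2[OF plot_imp_continuous[OF assms(1)] smooth_on_imp_continuous[OF assms(3)]] assms(4)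
    by blast
  moreover have "smooth_on {z\<in>D'. u (f z) \<in> cdom \<kappa>} (\<lambda>z. coord \<kappa> (u (f z)))" if \<kappa>: "\<kappa> \<in> A" for \<kappa>
  proof -
    obtain W where W: "open W" "{z\<in>D'. u (f z) \<in> cdom \<kappa>} = D' \<inter> W" using plot_chart_domain[OF cont \<kappa>] .
    have "smooth_on {z\<in>D. u z \<in> cdom \<kappa>} (\<lambda>z. coord \<kappa> (u z))" using assms(1) \<kappa> by (simp add: plot_def)
    from smooth_on_compose[OF thick_Int_open[OF assms(2) W(1)] this smooth_on_Int_open[OF assms(3) W(1)]]
    show ?thesis unfolding W(2) using W(2) assms(4) by auto
  qed
  ultimately show ?thesis unfolding plot_def by blast
qed

lemma plot_subset: "plot A D u \<Longrightarrow> thick D' \<Longrightarrow> D' \<subseteq> D \<Longrightarrow> plot A D' u"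
  using plot_compose[of D u D' "\<lambda>z. z"] smooth_on_id[of D'] by auto

lemma plot_param:
  assumes "\<kappa> \<in> A" "thick D" "smooth_on D f" "\<And>z. z \<in> D \<Longrightarrow> f z \<in> coord \<kappa> ` cdom \<kappa>"
  shows "plot A D (\<lambda>z. param \<kappa> (f z))"
proof (rule plotI[OF assms(2)])
  fix z assume "z \<in> D"
  have "smooth_on D (\<lambda>z. coord \<kappa> (param \<kappa> (f z)))"
    by (rule smooth_on_cong[THEN iffD2, OF _ assms(3)]) (use assms in auto)
  then show "\<exists>\<kappa>'\<in>A. \<exists>W. open W \<and> z \<in> W \<and> (\<lambda>z. param \<kappa> (f z)) ` (D \<inter> W) \<subseteq> cdom \<kappa>' \<and>
      smooth_on (D \<inter> W) (\<lambda>z. coord \<kappa>' (param \<kappa> (f z)))"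
    using param_in_cdom[OF assms(1) assms(4)] by (intro bexI[OF _ assms(1)] exI[of _ UNIV]) (simp add: image_subset_iff)
qed

end

lemma plot_local:
  assumes A: "smooth_atlas A" and D: "thick D"
    and loc: "\<And>z. z \<in> D \<Longrightarrow> \<exists>W. open W \<and> z \<in> W \<and> plot A (D \<inter> W) u"
  shows "plot A D u"
proof (rule plotI[OF A D])
  fix z assume z: "z \<in> D"
  from loc[OF z] obtain W where W: "open W" "z \<in> W" "plot A (D \<inter> W) u" by blast
  from plotD_at[OF A W(3), of z] z W(2) obtain \<kappa> W' where W': "\<kappa> \<in> A" "open W'" "z \<in> W'"
    "u ` (D \<inter> W \<inter> W') \<subseteq> cdom \<kappa>" "smooth_on (D \<inter> W \<inter> W') (\<lambda>z. coord \<kappa> (u z))" by blast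
  show "\<exists>\<kappa>\<in>A. \<exists>W. open W \<and> z \<in> W \<and> u ` (D \<inter> W) \<subseteq> cdom \<kappa> \<and> smooth_on (D \<inter> W) (\<lambda>z. coord \<kappa> (u z))"
    using W W' by (intro bexI[OF _ W'(1)] exI[of _ "W \<inter> W'"]) (simp add: Int_assoc open_Int)
qed

lemma smooth_atlas_std [simp]: "smooth_atlas (std_atlas :: ('e::euclidean_space, 'e) chart set)"
proof -
  have "inv_into UNIV (\<lambda>x::'e. x) = (\<lambda>x. x)" by (simp add: fun_eq_iff inv_into_f_eq)
  then show ?thesis
    unfolding smooth_atlas_def std_atlas_def param_def
    by (auto simp: homeomorphism_def intro!: smooth_on_id)
qed

lemma plot_std: "plot std_atlas D u \<longleftrightarrow> smooth_on D u"
  by (auto simp: plot_def std_atlas_def intro: smooth_on_imp_continuous)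

context
  fixes A :: "('m::{t2_space, second_countable_topology}, 'e::euclidean_space) chart set"
    and B :: "('n::{t2_space, second_countable_topology}, 'f::euclidean_space) chart set"
  assumes A: "smooth_atlas A" and B: "smooth_atlas B"
begin

lemma plot_family:
  fixes \<tau> :: "'a::euclidean_space \<Rightarrow> 'p::euclidean_space"
  assumes F: "smooth_family T S A B F" and u: "plot A D u" and D: "thick D"
    and \<tau>: "smooth_on D \<tau>" and TS: "\<And>z. z \<in> D \<Longrightarrow> \<tau> z \<in> T" "\<And>z. z \<in> D \<Longrightarrow> u z \<in> S"
  shows "plot B D (\<lambda>z. F (\<tau> z) (u z))"
proof -
  have contF: "continuous_on (T \<times> S) (\<lambda>(t, x). F t x)" using F by (simp add: smooth_family_def)
  have cont: "continuous_on D (\<lambda>z. F (\<tau> z) (u z))"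
  proof -
    have "continuous_on D (\<lambda>z. (\<tau> z, u z))"
      by (intro continuous_intros smooth_on_imp_continuous[OF \<tau>] plot_imp_continuous[OF A u])
    from continuous_on_compose2[OF contF this] show ?thesis using TS by auto
  qed
  moreover have "smooth_on {z\<in>D. F (\<tau> z) (u z) \<in> cdom \<mu>} (\<lambda>z. coord \<mu> (F (\<tau> z) (u z)))" if \<mu>: "\<mu> \<in> B" for \<mu>
  proof -
    obtain W' where W': "open W'" "{z\<in>D. F (\<tau> z) (u z) \<in> cdom \<mu>} = D \<inter> W'"
      using plot_chart_domain[OF B cont \<mu>] .
    show ?thesis unfolding W'(2)
    proof (rule smooth_on_local)
      fix z assume z: "z \<in> D \<inter> W'"
      from plotD_at[OF A u] z obtain \<kappa> W where W: "\<kappa> \<in> A" "open W" "z \<in> W" "u ` (D \<inter> W) \<subseteq> cdom \<kappa>"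
        "smooth_on (D \<inter> W) (\<lambda>z. coord \<kappa> (u z))" by blast
      have D'': "thick (D \<inter> W' \<inter> W)" by (intro thick_Int_open D W W')
      have sm: "smooth_on (D \<inter> W' \<inter> W) (\<lambda>z. coord \<kappa> (u z))"
        using smooth_on_Int_open[OF W(5) W'(1)] by (simp add: Int_ac)
      have "smooth_on (D \<inter> W' \<inter> W) (\<lambda>z. (\<tau> z, coord \<kappa> (u z)))"
        by (intro smooth_on_Pair D'' sm smooth_on_Int_open \<tau> W W')
      moreover have "smooth_on {(t, coord \<kappa> x) | t x. t \<in> T \<and> x \<in> cdom \<kappa> \<inter> S \<and> F t x \<in> cdom \<mu>}
          (\<lambda>(t, y). coord \<mu> (F t (param \<kappa> y)))"
        using F W(1) \<mu> by (simp add: smooth_family_def)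
      moreover have "(\<tau> y, coord \<kappa> (u y)) \<in> {(t, coord \<kappa> x) | t x. t \<in> T \<and> x \<in> cdom \<kappa> \<inter> S \<and> F t x \<in> cdom \<mu>}"
        if "y \<in> D \<inter> W' \<inter> W" for y
      proof -
        have "y \<in> D" "F (\<tau> y) (u y) \<in> cdom \<mu>" "u y \<in> cdom \<kappa>" using that W'(2) W(4) by auto
        then show ?thesis using TS[of y] by blast
      qed
      ultimately have "smooth_on (D \<inter> W' \<inter> W) (\<lambda>y. (\<lambda>(t, y). coord \<mu> (F t (param \<kappa> y))) (\<tau> y, coord \<kappa> (u y)))"
        using smooth_on_compose[OF D''] by blast
      then have "smooth_on (D \<inter> W' \<inter> W) (\<lambda>z. coord \<mu> (F (\<tau> z) (u z)))"
        by (rule smooth_on_cong[THEN iffD1, rotated]) (use W A in auto)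
      then show "\<exists>W. open W \<and> z \<in> W \<and> smooth_on (D \<inter> W' \<inter> W) (\<lambda>z. coord \<mu> (F (\<tau> z) (u z)))"
        using W by blast
    qed
  qed
  ultimately show ?thesis unfolding plot_def by blast
qed

text \<open>The converse of \<open>plot_family\<close>, with inverse charts times the parameter set
  as test plots. Smoothness of composites, inverses and lifts is reduced to plots through this
  pair.\<close>

lemma smooth_familyI:
  assumes S: "open S"
    and pl: "\<And>\<kappa>. \<kappa> \<in> A \<Longrightarrow> plot B (T \<times> coord \<kappa> ` (cdom \<kappa> \<inter> S)) (\<lambda>z. F (fst z) (param \<kappa> (snd z)))"
  shows "smooth_family T S A B F"
  unfolding smooth_family_def
proof (intro conjI ballI)
  show "continuous_on (T \<times> S) (\<lambda>(t, x). F t x)"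
    unfolding continuous_on_eq_continuous_within
  proof
    fix z assume z: "z \<in> T \<times> S"
    define \<kappa> where "\<kappa> = chart_at A (snd z)"
    have \<kappa>: "\<kappa> \<in> A" "snd z \<in> cdom \<kappa>" using chart_at[OF A] by (auto simp: \<kappa>_def)
    let ?W = "UNIV \<times> cdom \<kappa>"
    have W: "open ?W" "z \<in> ?W" using open_cdom[OF A \<kappa>(1)] \<kappa>(2) by (auto simp: open_Times mem_Times_iff)
    have "continuous_on ((T \<times> S) \<inter> ?W) (\<lambda>z. F (fst z) (param \<kappa> (coord \<kappa> (snd z))))"
    proof -
      have "continuous_on ((T \<times> S) \<inter> ?W) (\<lambda>z. (fst z, coord \<kappa> (snd z)))"
        by (intro continuous_intros continuous_on_compose2[OF continuous_on_coord[OF A \<kappa>(1)]]) auto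
      moreover have "(\<lambda>z. (fst z, coord \<kappa> (snd z))) ` (T \<times> S \<inter> ?W) \<subseteq> T \<times> coord \<kappa> ` (cdom \<kappa> \<inter> S)"
        by auto
      ultimately show ?thesis using continuous_on_compose2[OF plot_imp_continuous[OF B pl[OF \<kappa>(1)]]] by fastforce
    qed
    then have "continuous_on ((T \<times> S) \<inter> ?W) (\<lambda>(t, x). F t x)"
      by (rule continuous_on_cong[THEN iffD1, rotated 2]) (use A \<kappa> in auto)
    then show "continuous (at z within T \<times> S) (\<lambda>(t, x). F t x)"
      using z W unfolding continuous_on_eq_continuous_within by (metis IntI at_within_Int_open)
  qed
next
  fix \<kappa> \<mu> assume \<kappa>: "\<kappa> \<in> A" and \<mu>: "\<mu> \<in> B"
  have "{(t, coord \<kappa> x) | t x. t \<in> T \<and> x \<in> cdom \<kappa> \<inter> S \<and> F t x \<in> cdom \<mu>} =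
      {z \<in> T \<times> coord \<kappa> ` (cdom \<kappa> \<inter> S). F (fst z) (param \<kappa> (snd z)) \<in> cdom \<mu>}"
    using \<kappa> A by (auto simp: image_iff)
  with pl[OF \<kappa>] \<mu> show "smooth_on {(t, coord \<kappa> x) | t x. t \<in> T \<and> x \<in> cdom \<kappa> \<inter> S \<and> F t x \<in> cdom \<mu>}
      (\<lambda>(t, y). coord \<mu> (F t (param \<kappa> y)))"
    by (simp add: plot_def case_prod_unfold)
qed

lemma plot_map:
  assumes F: "smooth_map S A B F" and u: "plot A D u" and D: "thick D" and S: "open S" "\<And>z. z \<in> D \<Longrightarrow> u z \<in> S"
  shows "plot B D (\<lambda>z. F (u z))"
proof -
  have contF: "continuous_on S F" using F by (simp add: smooth_map_def)
  \<comment> \<open>A dummy real parameter makes \<open>F\<close> a constant family, so that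
    \<open>plot_family\<close> applies to a single map.\<close>
  have "plot B (UNIV \<times> coord \<kappa> ` (cdom \<kappa> \<inter> S) :: (real \<times> 'e) set) (\<lambda>z. F (param \<kappa> (snd z)))" if \<kappa>: "\<kappa> \<in> A" for \<kappa>
  proof -
    define E where "E = (UNIV \<times> coord \<kappa> ` (cdom \<kappa> \<inter> S) :: (real \<times> 'e) set)"
    have oE: "open E" unfolding E_def by (intro open_Times open_UNIV open_chart_image[OF A \<kappa> S(1)])
    have cont: "continuous_on E (\<lambda>z. F (param \<kappa> (snd z)))"
    proof -
      have "continuous_on E (\<lambda>z. param \<kappa> (snd z))"
        by (rule continuous_on_compose2[OF continuous_on_param[OF A \<kappa>] continuous_on_snd[OF continuous_on_id]])
           (auto simp: E_def)
      moreover have "(\<lambda>z. param \<kappa> (snd z)) ` E \<subseteq> S" using \<kappa> A by (auto simp: E_def)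
      ultimately show ?thesis using continuous_on_compose2[OF contF] by fastforce
    qed
    have "smooth_on {z\<in>E. F (param \<kappa> (snd z)) \<in> cdom \<mu>} (\<lambda>z. coord \<mu> (F (param \<kappa> (snd z))))" if \<mu>: "\<mu> \<in> B" for \<mu>
    proof -
      obtain W where W: "open W" "{z\<in>E. F (param \<kappa> (snd z)) \<in> cdom \<mu>} = E \<inter> W"
        using plot_chart_domain[OF B cont \<mu>] .
      have *: "smooth_on {coord \<kappa> x | x. x \<in> cdom \<kappa> \<inter> S \<and> F x \<in> cdom \<mu>} (\<lambda>y. coord \<mu> (F (param \<kappa> y)))"
        using F \<kappa> \<mu> by (simp add: smooth_map_def)
      show ?thesis unfolding W(2)
      proof (rule smooth_on_compose[OF _ *])
        show "thick (E \<inter> W)" using oE W by (intro thick_open) auto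
        then show "smooth_on (E \<inter> W) snd" using smooth_on_snd[OF _ smooth_on_id] by auto
        fix z assume "z \<in> E \<inter> W"
        with W(2) have "z \<in> E" "F (param \<kappa> (snd z)) \<in> cdom \<mu>" by blast+
        then show "snd z \<in> {coord \<kappa> x | x. x \<in> cdom \<kappa> \<inter> S \<and> F x \<in> cdom \<mu>}"
          using A \<kappa> by (auto simp: E_def)
      qed
    qed
    with cont show ?thesis unfolding E_def plot_def by blast
  qed
  then have "smooth_family (UNIV :: real set) S A B (\<lambda>_. F)" by (intro smooth_familyI S) simp
  from plot_family[OF this u D smooth_on_const[OF D]] show ?thesis using S by simp
qed

lemma smooth_mapI:
  assumes S: "open S"
    and pl: "\<And>\<kappa>. \<kappa> \<in> A \<Longrightarrow> plot B (coord \<kappa> ` (cdom \<kappa> \<inter> S)) (\<lambda>y. F (param \<kappa> y))"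
  shows "smooth_map S A B F"
  unfolding smooth_map_def
proof (intro conjI ballI)
  show "continuous_on S F"
    unfolding continuous_on_eq_continuous_within
  proof
    fix z assume z: "z \<in> S"
    define \<kappa> where "\<kappa> = chart_at A z"
    have \<kappa>: "\<kappa> \<in> A" "z \<in> cdom \<kappa>" using chart_at[OF A] by (auto simp: \<kappa>_def)
    have "continuous_on (S \<inter> cdom \<kappa>) (coord \<kappa>)"
      by (rule continuous_on_subset[OF continuous_on_coord[OF A \<kappa>(1)]]) auto
    from continuous_on_compose2[OF plot_imp_continuous[OF B pl[OF \<kappa>(1)]] this]
    have "continuous_on (S \<inter> cdom \<kappa>) (\<lambda>x. F (param \<kappa> (coord \<kappa> x)))" by auto
    then have "continuous_on (S \<inter> cdom \<kappa>) F"
      by (rule continuous_on_cong[THEN iffD1, rotated 2]) (use A \<kappa> in auto)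
    then show "continuous (at z within S) F"
      using z \<kappa> open_cdom[OF A \<kappa>(1)] unfolding continuous_on_eq_continuous_within
      by (metis IntI at_within_Int_open)
  qed
next
  fix \<kappa> \<mu> assume \<kappa>: "\<kappa> \<in> A" and \<mu>: "\<mu> \<in> B"
  have "{coord \<kappa> x | x. x \<in> cdom \<kappa> \<inter> S \<and> F x \<in> cdom \<mu>} =
      {z \<in> coord \<kappa> ` (cdom \<kappa> \<inter> S). F (param \<kappa> z) \<in> cdom \<mu>}"
    using \<kappa> A by (auto simp: image_iff)
  with pl[OF \<kappa>] \<mu> show "smooth_on {coord \<kappa> x | x. x \<in> cdom \<kappa> \<inter> S \<and> F x \<in> cdom \<mu>} (\<lambda>y. coord \<mu> (F (param \<kappa> y)))"
    by (simp add: plot_def)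
qed

end

section \<open>Derivatives of plots\<close>

definition dplot :: "('m, 'e::real_normed_vector) chart \<Rightarrow> 'a::euclidean_space set \<Rightarrow> ('a \<Rightarrow> 'm) \<Rightarrow> 'a \<Rightarrow> 'a \<Rightarrow> 'e" where
  "dplot \<kappa> D u z = frechet_derivative (\<lambda>z. coord \<kappa> (u z)) (at z within D)"

lemma dplot_eqI:
  assumes "thick D" "z \<in> D" "((\<lambda>z. coord \<kappa> (u z)) has_derivative L) (at z within D)"
  shows "dplot \<kappa> D u z = L"
  unfolding dplot_def by (rule thick_frechet_unique[OF assms])

lemma dplot_Int_open: "z \<in> W \<Longrightarrow> open W \<Longrightarrow> dplot \<kappa> (D \<inter> W) u z = dplot \<kappa> D u z"
  unfolding dplot_def by (simp add: at_within_Int_open)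

lemma dplot_cong:
  assumes "z \<in> D" "\<And>z. z \<in> D \<Longrightarrow> u z = w z"
  shows "dplot \<kappa> D u z = dplot \<kappa> D w z"
  unfolding dplot_def by (rule frechet_derivative_cong_on[OF assms(1)]) (simp add: assms(2))

context
  fixes A :: "('m::{t2_space, second_countable_topology}, 'e::euclidean_space) chart set"
  assumes A: "smooth_atlas A"
begin

lemma chart_times_thick:
  assumes "thick T" "\<kappa> \<in> A" "open S"
  shows "thick (T \<times> coord \<kappa> ` (cdom \<kappa> \<inter> S))"
  by (intro thick_Times assms(1) thick_open open_chart_image[OF A assms(2,3)])

lemma plot_chart_times:
  assumes "thick T" "\<kappa> \<in> A" "open S"
  shows "plot A (T \<times> coord \<kappa> ` (cdom \<kappa> \<inter> S)) (\<lambda>z. param \<kappa> (snd z))"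
  by (rule plot_param[OF A assms(2) chart_times_thick[OF assms]])
     (auto intro!: smooth_on_snd smooth_on_id chart_times_thick assms)

lemma plot_chart: "\<kappa> \<in> A \<Longrightarrow> open S \<Longrightarrow> plot A (coord \<kappa> ` (cdom \<kappa> \<inter> S)) (param \<kappa>)"
  using plot_param[OF A, of \<kappa> "coord \<kappa> ` (cdom \<kappa> \<inter> S)" "\<lambda>y. y"]
  by (auto intro!: smooth_on_id thick_open open_chart_image[OF A])

context
  fixes B :: "('n::{t2_space, second_countable_topology}, 'f::euclidean_space) chart set"
  assumes B: "smooth_atlas B"
begin

lemma smooth_family_reparam:
  fixes \<tau> :: "'q::euclidean_space \<Rightarrow> 'p::euclidean_space"
  assumes F: "smooth_family T S A B F" and T': "thick T'" and S: "open S"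
    and \<tau>: "smooth_on T' \<tau>" "\<And>t. t \<in> T' \<Longrightarrow> \<tau> t \<in> T"
  shows "smooth_family T' S A B (\<lambda>t. F (\<tau> t))"
proof (rule smooth_familyI[OF A B S])
  fix \<kappa> assume \<kappa>: "\<kappa> \<in> A"
  note D = chart_times_thick[OF T' \<kappa> S]
  show "plot B (T' \<times> coord \<kappa> ` (cdom \<kappa> \<inter> S)) (\<lambda>z. F (\<tau> (fst z)) (param \<kappa> (snd z)))"
    by (rule plot_family[OF A B F plot_chart_times[OF T' \<kappa> S] D smooth_on_compose[OF D \<tau>(1)]])
       (use \<kappa> A \<tau> D in \<open>auto intro: smooth_on_intros\<close>)
qed

lemma smooth_family_of_map:
  assumes F: "smooth_map S A B F" and T: "thick T" and S: "open S"
  shows "smooth_family T S A B (\<lambda>t. F)"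
proof (rule smooth_familyI[OF A B S])
  fix \<kappa> assume \<kappa>: "\<kappa> \<in> A"
  show "plot B (T \<times> coord \<kappa> ` (cdom \<kappa> \<inter> S)) (\<lambda>z. F (param \<kappa> (snd z)))"
    by (rule plot_map[OF A B F plot_chart_times[OF T \<kappa> S] chart_times_thick[OF T \<kappa> S] S])
       (use \<kappa> A in auto)
qed

lemma smooth_map_of_family:
  assumes F: "smooth_family T S A B F" and t: "t \<in> T" and S: "open S"
  shows "smooth_map S A B (F t)"
proof (rule smooth_mapI[OF A B S])
  fix \<kappa> assume \<kappa>: "\<kappa> \<in> A"
  have D: "thick (coord \<kappa> ` (cdom \<kappa> \<inter> S))" by (intro thick_open open_chart_image[OF A \<kappa> S])
  show "plot B (coord \<kappa> ` (cdom \<kappa> \<inter> S)) (\<lambda>y. F t (param \<kappa> y))"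
    by (rule plot_family[OF A B F plot_chart[OF \<kappa> S] D smooth_on_const[OF D]]) (use \<kappa> A t in auto)
qed

context
  fixes C :: "('o::{t2_space, second_countable_topology}, 'g::euclidean_space) chart set"
  assumes C: "smooth_atlas C"
begin

lemma smooth_family_compose:
  assumes F: "smooth_family T UNIV B C F" and G: "smooth_family T S A B G" and T: "thick T" and S: "open S"
  shows "smooth_family T S A C (\<lambda>t x. F t (G t x))"
proof (rule smooth_familyI[OF A C S])
  fix \<kappa> assume \<kappa>: "\<kappa> \<in> A"
  note D = chart_times_thick[OF T \<kappa> S]
  have sm: "smooth_on (T \<times> coord \<kappa> ` (cdom \<kappa> \<inter> S)) fst" by (rule smooth_on_fst[OF D smooth_on_id[OF D]])
  have "plot B (T \<times> coord \<kappa> ` (cdom \<kappa> \<inter> S)) (\<lambda>z. G (fst z) (param \<kappa> (snd z)))"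
    by (rule plot_family[OF A B G plot_chart_times[OF T \<kappa> S] D sm]) (use \<kappa> A in auto)
  from plot_family[OF B C F this D sm]
  show "plot C (T \<times> coord \<kappa> ` (cdom \<kappa> \<inter> S)) (\<lambda>z. F (fst z) (G (fst z) (param \<kappa> (snd z))))" by auto
qed

lemma smooth_map_compose:
  assumes F: "smooth_map UNIV B C F" and G: "smooth_map S A B G" and S: "open S"
  shows "smooth_map S A C (\<lambda>x. F (G x))"
proof (rule smooth_mapI[OF A C S])
  fix \<kappa> assume \<kappa>: "\<kappa> \<in> A"
  have D: "thick (coord \<kappa> ` (cdom \<kappa> \<inter> S))" by (intro thick_open open_chart_image[OF A \<kappa> S])
  have "plot B (coord \<kappa> ` (cdom \<kappa> \<inter> S)) (\<lambda>y. G (param \<kappa> y))"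
    by (rule plot_map[OF A B G plot_chart[OF \<kappa> S] D S]) (use \<kappa> A in auto)
  from plot_map[OF B C F this D open_UNIV] show "plot C (coord \<kappa> ` (cdom \<kappa> \<inter> S)) (\<lambda>y. F (G (param \<kappa> y)))" by simp
qed

end

end

lemma smooth_map_id: "smooth_map UNIV A A (\<lambda>x. x)"
  by (rule smooth_mapI[OF A A open_UNIV]) (rule plot_chart[OF _ open_UNIV])

lemma plot_differentiable:
  assumes u: "plot A D u" and z: "z \<in> D" and \<kappa>: "\<kappa> \<in> A" "u z \<in> cdom \<kappa>"
  shows "((\<lambda>z. coord \<kappa> (u z)) has_derivative dplot \<kappa> D u z) (at z within D)"
proof -
  obtain W where W: "open W" "{z\<in>D. u z \<in> cdom \<kappa>} = D \<inter> W" "smooth_on (D \<inter> W) (\<lambda>z. coord \<kappa> (u z))"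
    using plotD[OF A u \<kappa>(1)] .
  have zW: "z \<in> D \<inter> W" using W(2) z \<kappa>(2) by blast
  from smooth_on_has_derivative[OF W(3) zW] show ?thesis
    using at_within_Int_open[of z W D] W(1) zW unfolding dplot_def by simp
qed

lemma dplot_compose:
  fixes f :: "'a::euclidean_space \<Rightarrow> 'b::euclidean_space"
  assumes u: "plot A D u" and D': "thick D'" and f: "smooth_on D' f" "\<And>z. z \<in> D' \<Longrightarrow> f z \<in> D"
    and z: "z \<in> D'" and \<kappa>: "\<kappa> \<in> A" "u (f z) \<in> cdom \<kappa>"
  shows "dplot \<kappa> D' (\<lambda>z. u (f z)) z v = dplot \<kappa> D u (f z) (frechet_derivative f (at z within D') v)"
proof -
  have "((\<lambda>z. coord \<kappa> (u (f z))) has_derivative (\<lambda>v. dplot \<kappa> D u (f z) (frechet_derivative f (at z within D') v))) (at z within D')"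
  proof -
    have "f ` D' \<subseteq> D" using f(2) by auto
    from has_derivative_subset[OF plot_differentiable[OF u f(2)[OF z] \<kappa>] this]
    have "((\<lambda>z. coord \<kappa> (u z)) has_derivative dplot \<kappa> D u (f z)) (at (f z) within f ` D')" .
    from has_derivative_in_compose[OF smooth_on_has_derivative[OF f(1) z] this] show ?thesis .
  qed
  from dplot_eqI[OF D' z this] show ?thesis by simp
qed

lemma dplot_linear:
  assumes "plot A D u" "z \<in> D" "\<kappa> \<in> A" "u z \<in> cdom \<kappa>"
  shows "linear (dplot \<kappa> D u z)"
  using plot_differentiable[OF assms] has_derivative_linear by blast

lemma tangent_map_dplot:
  assumes "\<kappa> \<in> A" "open S" "x \<in> cdom \<kappa>" "x \<in> S"
  shows "tangent_map \<kappa> \<mu> F x = frechet_derivative (\<lambda>y. coord \<mu> (F (param \<kappa> y)))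
     (at (coord \<kappa> x) within coord \<kappa> ` (cdom \<kappa> \<inter> S))"
  unfolding tangent_map_def
  using at_within_open[OF _ open_chart_image[OF A assms(1,2)]] assms by simp

end

context
  fixes A :: "('m::{t2_space, second_countable_topology}, 'e::euclidean_space) chart set"
    and B :: "('n::{t2_space, second_countable_topology}, 'f::euclidean_space) chart set"
  assumes A: "smooth_atlas A" and B: "smooth_atlas B"
begin

lemma dplot_map:
  assumes F: "smooth_map S A B F" and u: "plot A D u" and D: "thick D"
    and S: "open S" "\<And>z. z \<in> D \<Longrightarrow> u z \<in> S"
    and z: "z \<in> D" and \<kappa>: "\<kappa> \<in> A" "u z \<in> cdom \<kappa>" and \<mu>: "\<mu> \<in> B" "F (u z) \<in> cdom \<mu>"
  shows "dplot \<mu> D (\<lambda>z. F (u z)) z v = tangent_map \<kappa> \<mu> F (u z) (dplot \<kappa> D u z v)"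
proof -
  obtain W where W: "open W" "{z\<in>D. u z \<in> cdom \<kappa>} = D \<inter> W" "smooth_on (D \<inter> W) (\<lambda>z. coord \<kappa> (u z))"
    using plotD[OF A u \<kappa>(1)] .
  have zW: "z \<in> D \<inter> W" using W(2) z \<kappa>(2) by blast
  have uW: "u y \<in> cdom \<kappa>" if "y \<in> D \<inter> W" for y using that W(2) by blast
  define E where "E = coord \<kappa> ` (cdom \<kappa> \<inter> S)"
  have DW: "thick (D \<inter> W)" by (rule thick_Int_open[OF D W(1)])
  have pl: "plot B E (\<lambda>y. F (param \<kappa> y))" unfolding E_def
    by (rule plot_map[OF A B F plot_chart[OF A \<kappa>(1) S(1)] thick_open[OF open_chart_image[OF A \<kappa>(1) S(1)]] S(1)])
       (use \<kappa> A in auto)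
  have pc: "param \<kappa> (coord \<kappa> (u y)) = u y" if "y \<in> D \<inter> W" for y
    using uW[OF that] \<kappa>(1) A by simp
  have "dplot \<mu> D (\<lambda>z. F (u z)) z v = dplot \<mu> (D \<inter> W) (\<lambda>z. F (u z)) z v"
    using zW by (simp add: dplot_Int_open W(1))
  also have "\<dots> = dplot \<mu> (D \<inter> W) (\<lambda>z. F (param \<kappa> (coord \<kappa> (u z)))) z v"
    by (rule fun_cong[OF dplot_cong[OF zW]]) (simp add: pc)
  also have "\<dots> = dplot \<mu> E (\<lambda>y. F (param \<kappa> y)) (coord \<kappa> (u z)) (dplot \<kappa> (D \<inter> W) u z v)"
    unfolding dplot_def[of \<kappa>]
    by (rule dplot_compose[OF B pl DW W(3) _ zW \<mu>(1)])
       (use uW S \<mu>(2) pc[OF zW] in \<open>auto simp: E_def\<close>)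
  also have "dplot \<mu> E (\<lambda>y. F (param \<kappa> y)) (coord \<kappa> (u z)) = tangent_map \<kappa> \<mu> F (u z)"
    unfolding E_def tangent_map_dplot[OF A \<kappa>(1) S(1) \<kappa>(2) S(2)[OF z]] dplot_def ..
  also have "dplot \<kappa> (D \<inter> W) u z v = dplot \<kappa> D u z v"
    using zW by (simp add: dplot_Int_open W(1))
  finally show ?thesis .
qed

end

section \<open>One-forms along plots\<close>

text \<open>The pullback of \<alpha> by the plot \<open>u\<close>, at z on v. The chart is a mere
  choice; for a one-form, \<open>lform_eq\<close> gives the same value in every chart.\<close>

definition lform :: "('m, 'e::euclidean_space) chart set \<Rightarrow> ('m, 'e) form1 \<Rightarrow> 'a::euclidean_space set \<Rightarrow> ('a \<Rightarrow> 'm) \<Rightarrow> 'a \<Rightarrow> 'a \<Rightarrow> real" where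
  "lform A \<alpha> D u z v = (let \<kappa> = chart_at A (u z) in \<alpha> \<kappa> (u z) (dplot \<kappa> D u z v))"

lemma lform_Int_open: "z \<in> W \<Longrightarrow> open W \<Longrightarrow> lform A \<alpha> (D \<inter> W) u z v = lform A \<alpha> D u z v"
  by (simp add: lform_def dplot_Int_open)

lemma lform_cong:
  fixes A :: "('m, 'e::euclidean_space) chart set"
  assumes "z \<in> D" "\<And>z. z \<in> D \<Longrightarrow> u z = w z"
  shows "lform A \<alpha> D u z v = lform A \<alpha> D w z v"
proof -
  have "dplot \<kappa> D u z = dplot \<kappa> D w z" for \<kappa> :: "('m, 'e) chart"
    by (rule dplot_cong[OF assms])
  then show ?thesis by (simp add: lform_def assms)
qed

context
  fixes A :: "('m::{t2_space, second_countable_topology}, 'e::euclidean_space) chart set" and \<alpha> :: "('m, 'e) form1"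
  assumes A: "smooth_atlas A"
begin

lemma lform_pullback:
  assumes F: "smooth_map UNIV A A F" and u: "plot A D u" and D: "thick D"
    and z: "z \<in> D" and \<kappa>: "\<kappa> \<in> A" "u z \<in> cdom \<kappa>"
  shows "lform A \<alpha> D (\<lambda>z. F (u z)) z v = pullback1 A F \<alpha> \<kappa> (u z) (dplot \<kappa> D u z v)"
  unfolding lform_def pullback1_def Let_def
  by (subst dplot_map[OF A A F u D open_UNIV _ z \<kappa>]) (use chart_at[OF A] in auto)

context
  assumes \<alpha>: "one_form A \<alpha>"
begin

lemma one_form_linear: "\<kappa> \<in> A \<Longrightarrow> x \<in> cdom \<kappa> \<Longrightarrow> linear (\<alpha> \<kappa> x)"
  using \<alpha> by (simp add: one_form_def)

lemma lform_eq:
  assumes u: "plot A D u" and D: "thick D" and z: "z \<in> D" and \<kappa>: "\<kappa> \<in> A" "u z \<in> cdom \<kappa>"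
  shows "lform A \<alpha> D u z v = \<alpha> \<kappa> (u z) (dplot \<kappa> D u z v)"
proof -
  \<comment> \<open>Compatibility of a one-form with changes of charts is its invariance under
    pullback by the identity.\<close>
  have "pullback1 A (\<lambda>x. x) \<alpha> \<kappa> (u z) (dplot \<kappa> D u z v) = \<alpha> \<kappa> (u z) (dplot \<kappa> D u z v)"
    using \<alpha> \<kappa> chart_at[OF A, of "u z"] unfolding one_form_def pullback1_def Let_def by (metis IntI)
  then show ?thesis using lform_pullback[OF smooth_map_id[OF A] u D z \<kappa>, of v] by simp
qed

lemma lform_linear:
  assumes u: "plot A D u" and D: "thick D" and z: "z \<in> D"
  shows "linear (lform A \<alpha> D u z)"
proof -
  note \<kappa> = chart_at[OF A, of "u z"]
  have "lform A \<alpha> D u z = (\<lambda>v. \<alpha> (chart_at A (u z)) (u z) (dplot (chart_at A (u z)) D u z v))"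
    by (simp add: lform_def Let_def fun_eq_iff)
  moreover have "linear \<dots>"
    using linear_compose[OF dplot_linear[OF A u z \<kappa>] one_form_linear[OF \<kappa>]] by (simp add: o_def)
  ultimately show ?thesis by simp
qed

lemma lform_compose:
  fixes f :: "'a::euclidean_space \<Rightarrow> 'b::euclidean_space"
  assumes u: "plot A D u" and D: "thick D" and D': "thick D'"
    and f: "smooth_on D' f" "\<And>z. z \<in> D' \<Longrightarrow> f z \<in> D" and z: "z \<in> D'"
  shows "lform A \<alpha> D' (\<lambda>z. u (f z)) z v = lform A \<alpha> D u (f z) (frechet_derivative f (at z within D') v)"
  unfolding lform_def Let_def
  using dplot_compose[OF A u D' f z chart_at[OF A], of v] by simp

text \<open>Locally the value is a finite sum of coefficients of \<alpha> along the plot times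
  components of the derivative of the plot.\<close>

lemma smooth_on_lform:
  assumes u: "plot A D u" and D: "thick D"
  shows "smooth_on D (\<lambda>z. lform A \<alpha> D u z v)"
proof (rule smooth_on_local)
  fix z assume "z \<in> D"
  from plotD_at[OF A u this] obtain \<kappa> W where W: "\<kappa> \<in> A" "open W" "z \<in> W" "u ` (D \<inter> W) \<subseteq> cdom \<kappa>"
    "smooth_on (D \<inter> W) (\<lambda>z. coord \<kappa> (u z))" by blast
  have DW: "thick (D \<inter> W)" by (rule thick_Int_open[OF D W(2)])
  have "smooth_on (D \<inter> W) (\<lambda>y. \<Sum>i\<in>Basis. (frechet_derivative (\<lambda>z. coord \<kappa> (u z)) (at y within (D \<inter> W)) v \<bullet> i) *
      \<alpha> \<kappa> (param \<kappa> (coord \<kappa> (u y))) i)"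
  proof (intro smooth_on_sum DW smooth_on_mult smooth_on_inner_left smooth_on_derivative W(5))
    fix i :: 'e
    have "smooth_on (coord \<kappa> ` cdom \<kappa>) (\<lambda>y. \<alpha> \<kappa> (param \<kappa> y) i)" using \<alpha> W(1) by (simp add: one_form_def)
    from smooth_on_compose[OF DW this W(5)] W(4)
    show "smooth_on (D \<inter> W) (\<lambda>y. \<alpha> \<kappa> (param \<kappa> (coord \<kappa> (u y))) i)" by auto
  qed
  moreover have "(\<Sum>i\<in>Basis. (frechet_derivative (\<lambda>z. coord \<kappa> (u z)) (at y within (D \<inter> W)) v \<bullet> i) *
      \<alpha> \<kappa> (param \<kappa> (coord \<kappa> (u y))) i) = lform A \<alpha> D u y v" if y: "y \<in> D \<inter> W" for y
  proof -
    have yk: "u y \<in> cdom \<kappa>" using y W(4) by auto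
    have "lform A \<alpha> D u y v = \<alpha> \<kappa> (u y) (dplot \<kappa> (D \<inter> W) u y v)"
      using lform_eq[OF u D _ W(1) yk, of v] y W(2) by (simp add: dplot_Int_open)
    also have "\<dots> = (\<Sum>i\<in>Basis. (dplot \<kappa> (D \<inter> W) u y v \<bullet> i) *\<^sub>R \<alpha> \<kappa> (u y) i)"
      by (rule linear_sum_Basis[OF one_form_linear[OF W(1) yk]])
    finally show ?thesis by (simp add: dplot_def param_coord[OF A W(1) yk])
  qed
  ultimately have "smooth_on (D \<inter> W) (\<lambda>y. lform A \<alpha> D u y v)"
    by (rule smooth_on_cong[THEN iffD1, rotated])
  then show "\<exists>W. open W \<and> z \<in> W \<and> smooth_on (D \<inter> W) (\<lambda>y. lform A \<alpha> D u y v)" using W by blast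
qed

text \<open>The second derivatives of the plot cancel by symmetry.\<close>

lemma ext_deriv1_plot:
  assumes u: "plot A D u" and D: "open D" and z: "z \<in> D" and \<kappa>: "\<kappa> \<in> A" "u z \<in> cdom \<kappa>"
  shows "frechet_derivative (\<lambda>z. lform A \<alpha> D u z w) (at z) v - frechet_derivative (\<lambda>z. lform A \<alpha> D u z v) (at z) w =
     ext_deriv1 \<alpha> \<kappa> (u z) (dplot \<kappa> D u z v) (dplot \<kappa> D u z w)"
proof -
  obtain W where W: "open W" "{z\<in>D. u z \<in> cdom \<kappa>} = D \<inter> W" "smooth_on (D \<inter> W) (\<lambda>z. coord \<kappa> (u z))"
    using plotD[OF A u \<kappa>(1)] .
  define E where "E = D \<inter> W"
  define f where "f = (\<lambda>z. coord \<kappa> (u z))"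
  define Y where "Y = coord \<kappa> ` cdom \<kappa>"
  define a where "a i y = \<alpha> \<kappa> (param \<kappa> y) i" for i y
  have E: "open E" "z \<in> E" using W z \<kappa> D unfolding E_def by blast+
  have uE: "u y \<in> cdom \<kappa>" "y \<in> D" if "y \<in> E" for y using that W(2) unfolding E_def by blast+
  have f: "smooth_on E f" using W(3) by (simp add: E_def f_def)
  have Y: "open Y" using open_chart_image[OF A \<kappa>(1) open_UNIV] by (simp add: Y_def)
  have fY: "f y \<in> Y" if "y \<in> E" for y using uE[OF that] by (simp add: f_def Y_def)
  have a: "smooth_on Y (a i)" for i using \<alpha> \<kappa>(1) unfolding one_form_def a_def Y_def by blast
  define f' where "f' v y = frechet_derivative f (at y) v" for v y
  have dp: "dplot \<kappa> D u y v = f' v y" if "y \<in> E" for y v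
    using uE(2)[OF that] at_within_open[OF _ D] unfolding dplot_def f'_def f_def by simp
  have f1: "(f has_derivative (\<lambda>v. f' v z)) (at z)"
    unfolding f'_def using smooth_on_open_has_derivative[OF f E] .
  have f2: "(f' v has_derivative frechet_derivative (f' v) (at z)) (at z)" for v
    using smooth_on_open_has_derivative[OF smooth_on_open_derivative[OF f E(1)] E] unfolding f'_def .
  have a1: "(a i has_derivative frechet_derivative (a i) (at (f z))) (at (f z))" for i
    by (rule smooth_on_open_has_derivative[OF a Y fY[OF E(2)]])
  have lf: "lform A \<alpha> D u y v = (\<Sum>i\<in>Basis. (f' v y \<bullet> i) * a i (f y))" if "y \<in> E" for y v
  proof -
    have "lform A \<alpha> D u y v = \<alpha> \<kappa> (u y) (f' v y)"
      using lform_eq[OF u thick_open[OF D] uE(2)[OF that] \<kappa>(1) uE(1)[OF that]] by (simp add: dp[OF that])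
    also have "\<dots> = (\<Sum>i\<in>Basis. (f' v y \<bullet> i) *\<^sub>R \<alpha> \<kappa> (u y) i)"
      by (rule linear_sum_Basis[OF one_form_linear[OF \<kappa>(1) uE(1)[OF that]]])
    finally show ?thesis using A \<kappa> uE(1)[OF that] by (simp add: a_def f_def)
  qed
  have D1: "frechet_derivative (\<lambda>z. lform A \<alpha> D u z v) (at z) w =
      (\<Sum>i\<in>Basis. (f' v z \<bullet> i) * frechet_derivative (a i) (at (f z)) (f' w z) +
        (frechet_derivative (f' v) (at z) w \<bullet> i) * a i (f z))" for v w
  proof -
    have "((\<lambda>y. \<Sum>i\<in>Basis. (f' v y \<bullet> i) * a i (f y)) has_derivative
       (\<lambda>w. \<Sum>i\<in>Basis. (f' v z \<bullet> i) * frechet_derivative (a i) (at (f z)) (f' w z) +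
        (frechet_derivative (f' v) (at z) w \<bullet> i) * a i (f z))) (at z)"
      by (intro has_derivative_sum has_derivative_mult has_derivative_inner_left f2 has_derivative_compose[OF f1 a1])
    then have "((\<lambda>z. lform A \<alpha> D u z v) has_derivative
       (\<lambda>w. \<Sum>i\<in>Basis. (f' v z \<bullet> i) * frechet_derivative (a i) (at (f z)) (f' w z) +
        (frechet_derivative (f' v) (at z) w \<bullet> i) * a i (f z))) (at z)"
      by (rule has_derivative_transform_within_open[OF _ E]) (simp add: lf)
    from fun_cong[OF frechet_derivative_at[OF this], of w] show ?thesis by simp
  qed
  \<comment> \<open>\<open>ext_deriv1\<close> freezes the vector arguments, so here only the
    coefficients of \<alpha> are differentiated.\<close>
  have ext: "frechet_derivative (\<lambda>y. \<alpha> \<kappa> (param \<kappa> y) V) (at (f z)) U =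
      (\<Sum>i\<in>Basis. (V \<bullet> i) * frechet_derivative (a i) (at (f z)) U)" for U V
  proof -
    have "((\<lambda>y. \<Sum>i\<in>Basis. (V \<bullet> i) * a i y) has_derivative
        (\<lambda>U. \<Sum>i\<in>Basis. (V \<bullet> i) * frechet_derivative (a i) (at (f z)) U)) (at (f z))"
      by (intro has_derivative_sum has_derivative_mult_right a1)
    moreover have "(\<Sum>i\<in>Basis. (V \<bullet> i) * a i y) = \<alpha> \<kappa> (param \<kappa> y) V" if "y \<in> Y" for y
      using linear_sum_Basis[OF one_form_linear[OF \<kappa>(1)], of "param \<kappa> y" V] param_in_cdom[OF A \<kappa>(1)] that
      by (simp add: a_def Y_def)
    ultimately have "((\<lambda>y. \<alpha> \<kappa> (param \<kappa> y) V) has_derivative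
        (\<lambda>U. \<Sum>i\<in>Basis. (V \<bullet> i) * frechet_derivative (a i) (at (f z)) U)) (at (f z))"
      by (rule has_derivative_transform_within_open[OF _ Y fY[OF E(2)]])
    from fun_cong[OF frechet_derivative_at[OF this], of U] show ?thesis by simp
  qed
  have sym: "frechet_derivative (f' v) (at z) w = frechet_derivative (f' w) (at z) v"
    unfolding f'_def by (rule symmetric_second_derivative[OF E f])
  show ?thesis
    unfolding ext_deriv1_def D1 dp[OF E(2)] sum.distrib sym
    unfolding f_def[symmetric] ext[unfolded f_def] by (simp add: ext f_def)
qed

end

end

section \<open>Smooth families of contactomorphisms\<close>

context
  fixes A :: "('m::{t2_space, second_countable_topology}, 'e::euclidean_space) chart set"
  assumes A: "smooth_atlas A"
begin

lemma plot_const: "thick D \<Longrightarrow> plot A D (\<lambda>_. x)"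
  by (rule plotI[OF A]) (use chart_at[OF A, of x] in \<open>auto intro!: bexI[of _ "chart_at A x"] exI[of _ UNIV] smooth_on_const\<close>)

lemma plot_curve:
  fixes T :: "'p::euclidean_space set"
  assumes \<psi>: "smooth_family T UNIV A A \<psi>" and T: "thick T"
  shows "plot A T (\<lambda>s. \<psi> s x)"
  by (rule plot_family[OF A A \<psi> plot_const[OF T] T smooth_on_id[OF T]]) auto

text \<open>\<open>velocity\<close> is stated with \<open>vector_derivative\<close>; as the
  derivative of a plot it becomes subject to the chain rules.\<close>

lemma velocity_eq:
  assumes c: "plot A {0..1} (\<lambda>s. \<psi> s x)" and t: "t \<in> {0..1}" and \<mu>: "\<mu> \<in> A" "\<psi> t x \<in> cdom \<mu>"
  shows "velocity \<mu> \<psi> t x = dplot \<mu> {0..1} (\<lambda>s. \<psi> s x) t 1"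
proof -
  have lin: "dplot \<mu> {0..1} (\<lambda>s. \<psi> s x) t = (\<lambda>r. r *\<^sub>R dplot \<mu> {0..1} (\<lambda>s. \<psi> s x) t 1)"
  proof
    show "dplot \<mu> {0..1} (\<lambda>s. \<psi> s x) t r = r *\<^sub>R dplot \<mu> {0..1} (\<lambda>s. \<psi> s x) t 1" for r
      using linear_scale[OF dplot_linear[OF A c t \<mu>], of r 1] by simp
  qed
  have "((\<lambda>s. coord \<mu> (\<psi> s x)) has_vector_derivative dplot \<mu> {0..1} (\<lambda>s. \<psi> s x) t 1) (at t within {0..1})"
    unfolding has_vector_derivative_def lin[symmetric] by (rule plot_differentiable[OF A c t \<mu>])
  then show ?thesis
    unfolding velocity_def using vector_derivative_within_cbox[of 0 1 t] t by simp
qed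

lemma dplot_param:
  assumes \<kappa>: "\<kappa> \<in> A" and z: "z \<in> coord \<kappa> ` cdom \<kappa>"
  shows "dplot \<kappa> (coord \<kappa> ` cdom \<kappa>) (param \<kappa>) z v = v"
proof -
  have D: "thick (coord \<kappa> ` cdom \<kappa>)" using open_chart_image[OF A \<kappa> open_UNIV] by (simp add: thick_open)
  have "((\<lambda>z. coord \<kappa> (param \<kappa> z)) has_derivative (\<lambda>v. v)) (at z within coord \<kappa> ` cdom \<kappa>)"
    by (rule has_derivative_transform[OF z _ has_derivative_ident]) (use A \<kappa> in auto)
  from dplot_eqI[OF D z this] show ?thesis by simp
qed

lemma dplot_map_param:
  assumes F: "smooth_map UNIV A A F" and \<kappa>: "\<kappa> \<in> A" and z: "z \<in> coord \<kappa> ` cdom \<kappa>"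
    and \<mu>: "\<mu> \<in> A" "F (param \<kappa> z) \<in> cdom \<mu>"
  shows "dplot \<mu> (coord \<kappa> ` cdom \<kappa>) (\<lambda>y. F (param \<kappa> y)) z v = tangent_map \<kappa> \<mu> F (param \<kappa> z) v"
proof -
  have D: "thick (coord \<kappa> ` cdom \<kappa>)" and u: "plot A (coord \<kappa> ` cdom \<kappa>) (param \<kappa>)"
    using open_chart_image[OF A \<kappa> open_UNIV] plot_chart[OF A \<kappa> open_UNIV] by (auto simp: thick_open)
  show ?thesis
    using dplot_map[OF A A F u D open_UNIV _ z \<kappa> _ \<mu>, of v] param_in_cdom[OF A \<kappa> z] dplot_param[OF \<kappa> z] by simp
qed

text \<open>By the chain rule for \<open>g \<circ> f = id\<close>, the tangent map of g recovers a
  vector from its image.\<close>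

lemma diffeo_tangent_inj:
  assumes f: "diffeo A f" and \<kappa>: "\<kappa> \<in> A" "x \<in> cdom \<kappa>" and \<mu>: "\<mu> \<in> A" "f x \<in> cdom \<mu>"
    and v: "tangent_map \<kappa> \<mu> f x v = 0"
  shows "v = 0"
proof -
  define D where "D = coord \<kappa> ` cdom \<kappa>"
  define z where "z = coord \<kappa> x"
  define g where "g = inv_into UNIV f"
  have z: "z \<in> D" "param \<kappa> z = x" using \<kappa> A by (auto simp: D_def z_def)
  have D: "thick D" and u: "plot A D (param \<kappa>)"
    using open_chart_image[OF A \<kappa>(1) open_UNIV] plot_chart[OF A \<kappa>(1) open_UNIV] by (auto simp: thick_open D_def)
  have f': "smooth_map UNIV A A f" "smooth_map UNIV A A g" and gf: "g (f y) = y" for y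
    using f by (auto simp: diffeo_def g_def bij_is_inj)
  have fu: "plot A D (\<lambda>y. f (param \<kappa> y))" by (rule plot_map[OF A A f'(1) u D open_UNIV]) simp
  have 1: "w = tangent_map \<mu> \<kappa> g (f x) (dplot \<mu> D (\<lambda>y. f (param \<kappa> y)) z w)" for w
  proof -
    have "dplot \<kappa> D (\<lambda>y. g (f (param \<kappa> y))) z w = tangent_map \<mu> \<kappa> g (f (param \<kappa> z)) (dplot \<mu> D (\<lambda>y. f (param \<kappa> y)) z w)"
      by (rule dplot_map[OF A A f'(2) fu D open_UNIV _ z(1) \<mu>(1) _ \<kappa>(1)]) (use z \<kappa> \<mu> gf in auto)
    then show ?thesis using dplot_param[OF \<kappa>(1), of z w] z by (simp add: gf D_def)
  qed
  have "dplot \<mu> D (\<lambda>y. f (param \<kappa> y)) z v = 0"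
    using dplot_map_param[OF f'(1) \<kappa>(1) _ \<mu>(1), of z v] z \<mu>(2) v by (simp add: D_def)
  moreover have "dplot \<mu> D (\<lambda>y. f (param \<kappa> y)) z 0 = 0"
    using dplot_linear[OF A fu z(1) \<mu>(1)] z \<mu>(2) by (simp add: linear_0)
  ultimately show ?thesis using 1[of v] 1[of 0] by simp
qed

text \<open>The inverses are jointly continuous by compactness; smoothness then follows in charts.\<close>

lemma smooth_family_inverse:
  fixes \<psi> :: "'p::euclidean_space \<Rightarrow> 'm \<Rightarrow> 'm"
  assumes M: "compact (UNIV :: 'm set)" and T: "compact T" "thick T"
    and \<psi>: "smooth_family T UNIV A A \<psi>" and bij: "\<And>t. t \<in> T \<Longrightarrow> bij (\<psi> t)"
    and inj: "\<And>t \<kappa> \<mu> x v. t \<in> T \<Longrightarrow> \<kappa> \<in> A \<Longrightarrow> x \<in> cdom \<kappa> \<Longrightarrow> \<mu> \<in> A \<Longrightarrow> \<psi> t x \<in> cdom \<mu> \<Longrightarrow>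
       tangent_map \<kappa> \<mu> (\<psi> t) x v = 0 \<Longrightarrow> v = 0"
  shows "smooth_family T UNIV A A (\<lambda>t. inv_into UNIV (\<psi> t))"
proof -
  define \<eta> where "\<eta> t = inv_into UNIV (\<psi> t)" for t
  have \<eta>\<psi> [simp]: "\<eta> t (\<psi> t x) = x" "\<psi> t (\<eta> t x) = x" if "t \<in> T" for t x
    using bij[OF that] by (simp_all add: \<eta>_def bij_is_inj bij_is_surj surj_f_inv_f)
  have cont: "continuous_on (T \<times> UNIV) (\<lambda>(t, x). \<eta> t x)"
  proof -
    let ?F = "\<lambda>z. (fst z, \<psi> (fst z) (snd z))" and ?G = "\<lambda>z. (fst z, \<eta> (fst z) (snd z))"
    have c: "continuous_on (T \<times> UNIV) (\<lambda>z. \<psi> (fst z) (snd z))"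
      using \<psi> by (simp add: smooth_family_def case_prod_unfold)
    \<comment> \<open>The map (t, x) \<mapsto> (t, \<psi> t x) is a continuous bijection from a
      compact space to a Hausdorff space, so its inverse is continuous in both variables
      together.\<close>
    have "continuous_on (?F ` (T \<times> UNIV)) ?G"
      by (rule continuous_on_inv) (auto intro!: compact_Times T M continuous_intros c)
    moreover have "?F ` (T \<times> UNIV) = T \<times> UNIV"
    proof -
      have "z \<in> ?F ` (T \<times> UNIV)" if "z \<in> T \<times> UNIV" for z
        by (rule image_eqI[of _ _ "?G z"]) (use that in auto)
      then show ?thesis by auto
    qed
    ultimately have "continuous_on (T \<times> UNIV) ?G" by simp
    from continuous_on_snd[OF this] show ?thesis by (simp add: case_prod_unfold)
  qed
  have "smooth_family T UNIV A A \<eta>"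
  proof (rule smooth_familyI[OF A A open_UNIV])
    fix \<kappa>' assume \<kappa>': "\<kappa>' \<in> A"
    define E where "E = T \<times> coord \<kappa>' ` cdom \<kappa>'"
    define u where "u z = \<eta> (fst z) (param \<kappa>' (snd z))" for z
    have E: "thick E" using chart_times_thick[OF A T(2) \<kappa>' open_UNIV] by (simp add: E_def)
    have contu: "continuous_on E u"
    proof -
      have "continuous_on E (\<lambda>z. (fst z, param \<kappa>' (snd z)))"
        by (intro continuous_intros continuous_on_compose2[OF continuous_on_param[OF A \<kappa>']]) (auto simp: E_def)
      moreover have "(\<lambda>z. (fst z, param \<kappa>' (snd z))) ` E \<subseteq> T \<times> UNIV" by (auto simp: E_def)
      ultimately have "continuous_on E (\<lambda>z. (\<lambda>(t, x). \<eta> t x) (fst z, param \<kappa>' (snd z)))"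
        by (rule continuous_on_compose2[OF cont])
      then show ?thesis by (simp add: u_def[abs_def])
    qed
    have "plot A E u"
    proof (rule plotI[OF A E])
      fix z0 assume z0: "z0 \<in> E"
      define \<kappa> where "\<kappa> = chart_at A (u z0)"
      have \<kappa>: "\<kappa> \<in> A" "u z0 \<in> cdom \<kappa>" using chart_at[OF A] by (auto simp: \<kappa>_def)
      obtain W where W: "open W" "{z\<in>E. u z \<in> cdom \<kappa>} = E \<inter> W" using plot_chart_domain[OF A contu \<kappa>(1)] .
      define E' where "E' = T \<times> coord \<kappa> ` cdom \<kappa>"
      define w where "w z = \<psi> (fst z) (param \<kappa> (snd z))" for z
      have E': "thick E'" using chart_times_thick[OF A T(2) \<kappa>(1) open_UNIV] by (simp add: E'_def)
      have w: "plot A E' w" unfolding w_def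
        by (rule plot_family[OF A A \<psi> _ E' smooth_on_fst[OF E' smooth_on_id[OF E']]])
           (use plot_chart_times[OF A T(2) \<kappa>(1) open_UNIV] in \<open>auto simp: E'_def\<close>)
      obtain W' where W': "open W'" "{z\<in>E'. w z \<in> cdom \<kappa>'} = E' \<inter> W'" "smooth_on (E' \<inter> W') (\<lambda>z. coord \<kappa>' (w z))"
        using plotD[OF A w \<kappa>'] .
      \<comment> \<open>\<open>F\<close> and \<open>G\<close> express (t, x) \<mapsto> (t, \<psi> t
        x) and its inverse in charts. Keeping the time coordinate gives maps within one Euclidean
        space, as \<open>smooth_on_inverse_function\<close> requires.\<close>
      define D1 where "D1 = E' \<inter> W'"
      define D2 where "D2 = E \<inter> W"
      define F where "F z = (fst z, coord \<kappa>' (w z))" for z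
      define G where "G z = (fst z, coord \<kappa> (u z))" for z
      have D1: "z \<in> D1 \<longleftrightarrow> z \<in> E' \<and> w z \<in> cdom \<kappa>'" for z unfolding D1_def using W'(2) by blast
      have D2: "z \<in> D2 \<longleftrightarrow> z \<in> E \<and> u z \<in> cdom \<kappa>" for z unfolding D2_def using W(2) by blast
      have thick: "thick D1" "thick D2" unfolding D1_def D2_def by (intro thick_Int_open E E' W W')+
      have FD: "F z \<in> D2" and GF: "G (F z) = z" if z: "z \<in> D1" for z
      proof -
        obtain t x where tx: "z = (t, coord \<kappa> x)" "t \<in> T" "x \<in> cdom \<kappa>" "\<psi> t x \<in> cdom \<kappa>'"
          using z \<kappa>(1) A unfolding D1 E'_def w_def by auto
        then have *: "F z = (t, coord \<kappa>' (\<psi> t x))" "u (F z) = x"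
          using \<kappa>(1) \<kappa>' A by (simp_all add: F_def w_def u_def)
        then show "F z \<in> D2" "G (F z) = z" using tx by (simp_all add: D2 E_def G_def)
      qed
      have GD: "G z \<in> D1" and FG: "F (G z) = z" if z: "z \<in> D2" for z
      proof -
        obtain t x where tx: "z = (t, coord \<kappa>' x)" "t \<in> T" "x \<in> cdom \<kappa>'" "\<eta> t x \<in> cdom \<kappa>"
          using z \<kappa>' A unfolding D2 E_def u_def by auto
        then have *: "G z = (t, coord \<kappa> (\<eta> t x))" "w (G z) = x"
          using \<kappa>(1) \<kappa>' A by (simp_all add: G_def w_def u_def)
        then show "G z \<in> D1" "F (G z) = z" using tx by (simp_all add: D1 E'_def F_def)
      qed
      have sF: "smooth_on D1 F" unfolding F_def D1_def
        by (intro smooth_on_Pair smooth_on_fst smooth_on_id W'(3)) (use thick in \<open>simp_all add: D1_def\<close>)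
      have sG: "smooth_on D2 G"
      proof (rule smooth_on_inverse_function[OF thick sF])
        show "continuous_on D2 G" unfolding G_def
        proof (intro continuous_intros continuous_on_compose2[OF continuous_on_coord[OF A \<kappa>(1)]])
          show "continuous_on D2 u" by (rule continuous_on_subset[OF contu]) (auto simp: D2)
        qed (auto simp: D2)
        show "F ` D1 = D2" using FD GD FG by (metis (no_types, lifting) image_eqI image_subset_iff subsetI subset_antisym)
        show "G (F z) = z" if "z \<in> D1" for z using GF[OF that] .
        fix z v assume z: "z \<in> D1" and v: "frechet_derivative F (at z within D1) v = 0"
        obtain t x where tx: "z = (t, coord \<kappa> x)" "t \<in> T" "x \<in> cdom \<kappa>" "\<psi> t x \<in> cdom \<kappa>'"
          using z \<kappa>(1) A unfolding D1 E'_def w_def by auto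
        have zE': "z \<in> E'" "w z \<in> cdom \<kappa>'" using z by (simp_all add: D1)
        have "((\<lambda>z. coord \<kappa>' (w z)) has_derivative dplot \<kappa>' E' w z) (at z within D1)"
          using plot_differentiable[OF A w zE'(1) \<kappa>' zE'(2)] by (rule has_derivative_subset) (auto simp: D1)
        then have "(F has_derivative (\<lambda>v. (fst v, dplot \<kappa>' E' w z v))) (at z within D1)"
          unfolding F_def by (intro has_derivative_Pair has_derivative_fst has_derivative_ident)
        from thick_frechet_unique[OF thick(1) z this] v
        \<comment> \<open>The first component of \<open>F\<close> is time, so a kernel vector has no
          time part; its space part lies in the kernel of the tangent map of
          \<open>\<psi> t\<close>.\<close>
        have v0: "fst v = 0" "dplot \<kappa>' E' w z v = 0" by (auto simp: zero_prod_def)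
        define C where "C = coord \<kappa> ` cdom \<kappa>"
        have C: "thick C" using open_chart_image[OF A \<kappa>(1) open_UNIV] by (simp add: C_def thick_open)
        have zC: "snd z \<in> C" using tx by (simp add: C_def)
        have d: "frechet_derivative (\<lambda>y. (t, y)) (at (snd z) within C) = (\<lambda>h. (0, h))"
          by (rule thick_frechet_unique[OF C zC]) (auto intro!: derivative_eq_intros)
        have "dplot \<kappa>' C (\<lambda>y. w (t, y)) (snd z) (snd v) =
            dplot \<kappa>' E' w (t, snd z) (frechet_derivative (\<lambda>y. (t, y)) (at (snd z) within C) (snd v))"
          by (rule dplot_compose[OF A w C _ _ zC \<kappa>'])
             (use tx zE' C in \<open>auto intro!: smooth_on_intros simp: C_def E'_def\<close>)
        also have "\<dots> = dplot \<kappa>' E' w (t, snd z) (0, snd v)" unfolding d ..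
        also have "\<dots> = 0" using v0 tx(1) by (metis fst_conv prod.collapse)
        finally have "dplot \<kappa>' C (\<lambda>y. \<psi> t (param \<kappa> y)) (snd z) (snd v) = 0" by (simp add: w_def)
        then have "tangent_map \<kappa> \<kappa>' (\<psi> t) x (snd v) = 0"
          using dplot_map_param[OF smooth_map_of_family[OF A A \<psi> tx(2) open_UNIV] \<kappa>(1) _ \<kappa>', of "snd z" "snd v"] tx \<kappa>(1) A
          by (simp add: C_def)
        then have "snd v = 0" by (rule inj[OF tx(2) \<kappa>(1) tx(3) \<kappa>' tx(4)])
        with v0 show "v = 0" by (simp add: prod_eq_iff)
      qed
      have "smooth_on D2 (\<lambda>z. coord \<kappa> (u z))" using smooth_on_snd[OF thick(2) sG] by (simp add: G_def)
      then show "\<exists>\<kappa>\<in>A. \<exists>W. open W \<and> z0 \<in> W \<and> u ` (E \<inter> W) \<subseteq> cdom \<kappa> \<and> smooth_on (E \<inter> W) (\<lambda>z. coord \<kappa> (u z))"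
        using \<kappa> W z0 unfolding D2_def by (intro bexI[OF _ \<kappa>(1)] exI[of _ W]) blast
    qed
    then show "plot A (T \<times> coord \<kappa>' ` (cdom \<kappa>' \<inter> UNIV)) (\<lambda>z. \<eta> (fst z) (param \<kappa>' (snd z)))"
      by (simp add: E_def u_def[abs_def])
  qed
  then show ?thesis by (simp add: \<eta>_def[abs_def])
qed

lemma diffeo_compose: "diffeo A f \<Longrightarrow> diffeo A g \<Longrightarrow> diffeo A (\<lambda>x. f (g x))"
proof -
  assume f: "diffeo A f" and g: "diffeo A g"
  then have bf: "bij f" "bij g" by (auto simp: diffeo_def)
  have "bij (\<lambda>x. f (g x))" using bij_comp[OF bf(2,1)] by (simp add: o_def)
  moreover have "inv_into UNIV (\<lambda>x. f (g x)) = (\<lambda>x. inv_into UNIV g (inv_into UNIV f x))"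
    using o_inv_distrib[OF bf] by (simp add: o_def)
  ultimately show "diffeo A (\<lambda>x. f (g x))"
    using f g smooth_map_compose[OF A A A _ _ open_UNIV] by (auto simp: diffeo_def)
qed

lemma diffeo_inverse: "diffeo A f \<Longrightarrow> diffeo A (inv_into UNIV f)"
  by (auto simp: diffeo_def bij_imp_bij_inv inv_inv_eq)

lemma diffeo_id: "diffeo A (\<lambda>x. x)"
proof -
  have "inv_into UNIV (\<lambda>x::'m. x) = (\<lambda>x. x)" by (simp add: fun_eq_iff inv_into_f_eq)
  then show ?thesis using smooth_map_id[OF A] bij_id by (simp add: diffeo_def id_def)
qed

end

section \<open>Contact Hamiltonians\<close>

text \<open>Exposes the conformal factor that \<open>contactomorphism\<close> hides behind an
  existential quantifier; with \<open>c\<close> constantly 1 it says that \<open>f\<close> preserves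
  \<alpha>.\<close>

definition conformal ::
    "('m, 'e::euclidean_space) chart set \<Rightarrow> ('m, 'e) form1 \<Rightarrow> ('m \<Rightarrow> 'm) \<Rightarrow> ('m \<Rightarrow> real) \<Rightarrow> bool" where
  "conformal A \<alpha> f c \<longleftrightarrow> (\<forall>x. c x > 0) \<and> (\<forall>\<kappa>\<in>A. \<forall>x\<in>cdom \<kappa>. \<forall>v. pullback1 A f \<alpha> \<kappa> x v = c x * \<alpha> \<kappa> x v)"

lemma contactomorphism_iff: "contactomorphism A \<alpha> f \<longleftrightarrow> diffeo A f \<and> (\<exists>c. conformal A \<alpha> f c)"
  by (simp add: contactomorphism_def conformal_def)

context
  fixes A :: "('m::{t2_space, second_countable_topology}, 'e::euclidean_space) chart set" and \<alpha> :: "('m, 'e) form1"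
  assumes A: "smooth_atlas A" and \<alpha>: "one_form A \<alpha>"
begin

lemma lform_param:
  assumes \<kappa>: "\<kappa> \<in> A" "z \<in> coord \<kappa> ` cdom \<kappa>"
  shows "lform A \<alpha> (coord \<kappa> ` cdom \<kappa>) (param \<kappa>) z v = \<alpha> \<kappa> (param \<kappa> z) v"
proof -
  have D: "thick (coord \<kappa> ` cdom \<kappa>)" and u: "plot A (coord \<kappa> ` cdom \<kappa>) (param \<kappa>)"
    using open_chart_image[OF A \<kappa>(1) open_UNIV] plot_chart[OF A \<kappa>(1) open_UNIV] by (auto simp: thick_open)
  show ?thesis
    using lform_eq[OF A \<alpha> u D \<kappa>(2) \<kappa>(1), of v] param_in_cdom[OF A \<kappa>] dplot_param[OF A \<kappa>, of v] by simp
qed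

lemma conformal_lform:
  assumes "conformal A \<alpha> f c" "smooth_map UNIV A A f" "plot A D u" "thick D" "z \<in> D"
  shows "lform A \<alpha> D (\<lambda>z. f (u z)) z v = c (u z) * lform A \<alpha> D u z v"
proof -
  note \<kappa> = chart_at[OF A, of "u z"]
  show ?thesis
    using lform_pullback[OF A assms(2-5) \<kappa>, of \<alpha> v] assms(1) \<kappa> lform_eq[OF A \<alpha> assms(3-5) \<kappa>, of v]
    by (simp add: conformal_def)
qed

text \<open>Inverse charts are plots whose derivative is the identity, so testing the pullback on
  them is enough.\<close>

lemma conformalI:
  assumes f: "smooth_map UNIV A A f" and c: "\<And>x. c x > 0"
    and eq: "\<And>\<kappa> z v. \<kappa> \<in> A \<Longrightarrow> z \<in> coord \<kappa> ` cdom \<kappa> \<Longrightarrow>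
      lform A \<alpha> (coord \<kappa> ` cdom \<kappa>) (\<lambda>y. f (param \<kappa> y)) z v = c (param \<kappa> z) * \<alpha> \<kappa> (param \<kappa> z) v"
  shows "conformal A \<alpha> f c"
  unfolding conformal_def
proof (intro conjI allI ballI c)
  fix \<kappa> x v assume \<kappa>: "\<kappa> \<in> A" "x \<in> cdom \<kappa>"
  define z where "z = coord \<kappa> x"
  have z: "z \<in> coord \<kappa> ` cdom \<kappa>" "param \<kappa> z = x" using \<kappa> A by (auto simp: z_def)
  have D: "thick (coord \<kappa> ` cdom \<kappa>)" and u: "plot A (coord \<kappa> ` cdom \<kappa>) (param \<kappa>)"
    using open_chart_image[OF A \<kappa>(1) open_UNIV] plot_chart[OF A \<kappa>(1) open_UNIV] by (auto simp: thick_open)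
  show "pullback1 A f \<alpha> \<kappa> x v = c x * \<alpha> \<kappa> x v"
    using lform_pullback[OF A f u D z(1) \<kappa>(1), of \<alpha> v] eq[OF \<kappa>(1) z(1), of v] z(2) \<kappa>(2) dplot_param[OF A \<kappa>(1) z(1), of v]
    by simp
qed

lemma conformal_compose:
  assumes f: "conformal A \<alpha> f c" "smooth_map UNIV A A f" and g: "conformal A \<alpha> g d" "smooth_map UNIV A A g"
  shows "conformal A \<alpha> (\<lambda>x. f (g x)) (\<lambda>x. c (g x) * d x)"
proof (rule conformalI)
  show "smooth_map UNIV A A (\<lambda>x. f (g x))" by (rule smooth_map_compose[OF A A A f(2) g(2) open_UNIV])
  show "c (g x) * d x > 0" for x using f g by (simp add: conformal_def)
  fix \<kappa> z v assume \<kappa>: "\<kappa> \<in> A" "z \<in> coord \<kappa> ` cdom \<kappa>"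
  have D: "thick (coord \<kappa> ` cdom \<kappa>)" and u: "plot A (coord \<kappa> ` cdom \<kappa>) (param \<kappa>)"
    using open_chart_image[OF A \<kappa>(1) open_UNIV] plot_chart[OF A \<kappa>(1) open_UNIV] by (auto simp: thick_open)
  have gu: "plot A (coord \<kappa> ` cdom \<kappa>) (\<lambda>y. g (param \<kappa> y))" by (rule plot_map[OF A A g(2) u D open_UNIV]) simp
  show "lform A \<alpha> (coord \<kappa> ` cdom \<kappa>) (\<lambda>y. f (g (param \<kappa> y))) z v = c (g (param \<kappa> z)) * d (param \<kappa> z) * \<alpha> \<kappa> (param \<kappa> z) v"
    using conformal_lform[OF f gu D \<kappa>(2), of v] conformal_lform[OF g u D \<kappa>(2), of v] lform_param[OF \<kappa>, of v] by simp
qed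

text \<open>The factor is read off from f \<circ> g = id, by applying the rule for \<open>f\<close>
  to the plot that follows an inverse chart by g.\<close>

lemma conformal_inverse:
  assumes f: "conformal A \<alpha> f c" and df: "diffeo A f"
  shows "conformal A \<alpha> (inv_into UNIV f) (\<lambda>x. inverse (c (inv_into UNIV f x)))"
proof (rule conformalI)
  define g where "g = inv_into UNIV f"
  have f': "smooth_map UNIV A A f" and g: "smooth_map UNIV A A g" using df by (simp_all add: diffeo_def g_def)
  have fg: "f (g x) = x" for x using df by (simp add: g_def diffeo_def bij_is_surj surj_f_inv_f)
  show "smooth_map UNIV A A (inv_into UNIV f)" using g by (simp add: g_def)
  show "inverse (c (inv_into UNIV f x)) > 0" for x using f by (simp add: conformal_def)
  fix \<kappa> z v assume \<kappa>: "\<kappa> \<in> A" "z \<in> coord \<kappa> ` cdom \<kappa>"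
  have D: "thick (coord \<kappa> ` cdom \<kappa>)" and u: "plot A (coord \<kappa> ` cdom \<kappa>) (param \<kappa>)"
    using open_chart_image[OF A \<kappa>(1) open_UNIV] plot_chart[OF A \<kappa>(1) open_UNIV] by (auto simp: thick_open)
  have gu: "plot A (coord \<kappa> ` cdom \<kappa>) (\<lambda>y. g (param \<kappa> y))" by (rule plot_map[OF A A g u D open_UNIV]) simp
  have "c (g (param \<kappa> z)) > 0" using f by (simp add: conformal_def)
  moreover have "\<alpha> \<kappa> (param \<kappa> z) v = c (g (param \<kappa> z)) * lform A \<alpha> (coord \<kappa> ` cdom \<kappa>) (\<lambda>y. g (param \<kappa> y)) z v"
    using conformal_lform[OF f f' gu D \<kappa>(2), of v] lform_param[OF \<kappa>, of v] by (simp add: fg)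
  ultimately show "lform A \<alpha> (coord \<kappa> ` cdom \<kappa>) (\<lambda>y. inv_into UNIV f (param \<kappa> y)) z v =
      inverse (c (inv_into UNIV f (param \<kappa> z))) * \<alpha> \<kappa> (param \<kappa> z) v"
    by (simp add: g_def[symmetric])
qed

lemma conformal_id: "conformal A \<alpha> (\<lambda>x. x) (\<lambda>x. 1)"
  by (rule conformalI) (simp_all add: smooth_map_id[OF A] lform_param)

lemma contactomorphism_compose:
  "contactomorphism A \<alpha> f \<Longrightarrow> contactomorphism A \<alpha> g \<Longrightarrow> contactomorphism A \<alpha> (\<lambda>x. f (g x))"
  unfolding contactomorphism_iff using diffeo_compose[OF A] conformal_compose unfolding diffeo_def by blast

lemma contactomorphism_inverse: "contactomorphism A \<alpha> f \<Longrightarrow> contactomorphism A \<alpha> (inv_into UNIV f)"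
  unfolding contactomorphism_iff using diffeo_inverse[OF A] conformal_inverse by metis

lemma contactomorphism_id: "contactomorphism A \<alpha> (\<lambda>x. x)"
  unfolding contactomorphism_iff using diffeo_id[OF A] conformal_id by metis

text \<open>At a point written as \<open>\<psi> t x\<close> the inverse in
  \<open>contact_ham\<close> disappears, and the Hamiltonian becomes a pullback of \<alpha> by a
  curve, to which the rules for \<open>lform\<close> apply.\<close>

lemma contact_ham_eq:
  assumes \<psi>: "smooth_family {0..1} UNIV A A \<psi>" and t: "t \<in> {0..1}" and inj: "inj (\<psi> t)"
  shows "contact_ham A \<alpha> \<psi> t (\<psi> t x) = lform A \<alpha> {0..1} (\<lambda>s. \<psi> s x) t 1"
proof -
  define \<mu> where "\<mu> = chart_at A (\<psi> t x)"
  have \<mu>: "\<mu> \<in> A" "\<psi> t x \<in> cdom \<mu>" using chart_at[OF A] by (auto simp: \<mu>_def)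
  have "velocity \<mu> \<psi> t x = dplot \<mu> {0..1} (\<lambda>s. \<psi> s x) t 1"
    by (rule velocity_eq[where \<psi> = \<psi> and x = x, OF A plot_curve[OF A \<psi> thick_unit_interval] t \<mu>])
  then show ?thesis
    by (simp add: contact_ham_def lform_def \<mu>_def[symmetric] inv_f_f[OF inj])
qed

lemma contact_ham_compose:
  assumes \<phi>: "smooth_family {0..1} UNIV A A \<phi>" "diffeo A (\<phi> t)" and c: "conformal A \<alpha> (\<phi> t) c"
    and \<psi>: "smooth_family {0..1} UNIV A A \<psi>" "diffeo A (\<psi> t)" and t: "t \<in> {0..1}"
  shows "contact_ham A \<alpha> (\<lambda>t x. \<phi> t (\<psi> t x)) t (\<phi> t (\<psi> t x)) =
    contact_ham A \<alpha> \<phi> t (\<phi> t (\<psi> t x)) + c (\<psi> t x) * contact_ham A \<alpha> \<psi> t (\<psi> t x)"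
proof -
  let ?I = "{0..1::real}"
  \<comment> \<open>The two factors run on separate clocks. Along the diagonal the velocity is the
    sum of the two partial velocities; the second one is pushed forward by \<open>\<phi> t\<close>,
    which contributes the factor \<open>c\<close>.\<close>
  define U where "U z = \<phi> (fst z) (\<psi> (snd z) x)" for z :: "real \<times> real"
  have I: "thick (?I \<times> ?I)" by (intro thick_Times thick_unit_interval)
  have \<psi>c: "plot A ?I (\<lambda>s. \<psi> s x)" by (rule plot_curve[OF A \<psi>(1) thick_unit_interval])
  have "plot A (?I \<times> ?I) (\<lambda>z. \<psi> (snd z) x)"
    by (rule plot_compose[OF A \<psi>c I]) (auto intro!: smooth_on_intros I)
  then have U: "plot A (?I \<times> ?I) U" unfolding U_def
    by (rule plot_family[OF A A \<phi>(1) _ I]) (auto intro!: smooth_on_intros I)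
  have inj: "inj (\<phi> t)" "inj (\<psi> t)" "inj (\<lambda>x. \<phi> t (\<psi> t x))"
    using \<phi>(2) \<psi>(2) diffeo_compose[OF A \<phi>(2) \<psi>(2)] by (auto simp: diffeo_def intro: bij_is_inj)
  note lc = lform_compose[OF A \<alpha> U I thick_unit_interval _ _ t]
  have "contact_ham A \<alpha> (\<lambda>t x. \<phi> t (\<psi> t x)) t (\<phi> t (\<psi> t x)) = lform A \<alpha> ?I (\<lambda>s. U (s, s)) t 1"
    using contact_ham_eq[OF smooth_family_compose[OF A A A \<phi>(1) \<psi>(1) thick_unit_interval open_UNIV] t inj(3), of x]
    by (simp add: U_def)
  also have "\<dots> = lform A \<alpha> (?I \<times> ?I) U (t, t) (1, 1)"
  proof -
    have "frechet_derivative (\<lambda>s. (s, s)) (at t within ?I) = (\<lambda>h. (h, h))"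
      by (rule thick_frechet_unique[OF thick_unit_interval t]) (auto intro!: derivative_eq_intros)
    then show ?thesis by (subst lc) (auto intro!: smooth_on_intros)
  qed
  also have "\<dots> = lform A \<alpha> (?I \<times> ?I) U (t, t) (1, 0) + lform A \<alpha> (?I \<times> ?I) U (t, t) (0, 1)"
    using linear_add[OF lform_linear[OF A \<alpha> U I, of "(t, t)"], of "(1, 0)" "(0, 1)"] t by simp
  also have "lform A \<alpha> (?I \<times> ?I) U (t, t) (1, 0) = lform A \<alpha> ?I (\<lambda>s. U (s, t)) t 1"
  proof -
    have "frechet_derivative (\<lambda>s. (s, t)) (at t within ?I) = (\<lambda>h. (h, 0))"
      by (rule thick_frechet_unique[OF thick_unit_interval t]) (auto intro!: derivative_eq_intros)
    then show ?thesis using t by (subst lc) (auto intro!: smooth_on_intros)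
  qed
  also have "\<dots> = contact_ham A \<alpha> \<phi> t (\<phi> t (\<psi> t x))"
    using contact_ham_eq[OF \<phi>(1) t inj(1)] by (simp add: U_def)
  also have "lform A \<alpha> (?I \<times> ?I) U (t, t) (0, 1) = lform A \<alpha> ?I (\<lambda>s. U (t, s)) t 1"
  proof -
    have "frechet_derivative (\<lambda>s. (t, s)) (at t within ?I) = (\<lambda>h. (0, h))"
      by (rule thick_frechet_unique[OF thick_unit_interval t]) (auto intro!: derivative_eq_intros)
    then show ?thesis using t by (subst lc) (auto intro!: smooth_on_intros)
  qed
  also have "\<dots> = c (\<psi> t x) * contact_ham A \<alpha> \<psi> t (\<psi> t x)"
    using conformal_lform[OF c _ \<psi>c thick_unit_interval t, of 1] \<phi>(2) contact_ham_eq[OF \<psi>(1) t inj(2), of x]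
    by (simp add: U_def diffeo_def)
  finally show ?thesis .
qed

lemma contact_ham_const:
  assumes f: "diffeo A f" and t: "t \<in> {0..1}"
  shows "contact_ham A \<alpha> (\<lambda>_. f) t x = 0"
proof -
  have fam: "smooth_family {0..1::real} UNIV A A (\<lambda>_. f)"
    by (intro smooth_family_of_map[OF A A _ thick_unit_interval open_UNIV]) (use f in \<open>simp add: diffeo_def\<close>)
  obtain y where y: "x = f y" using f by (auto simp: diffeo_def dest: bij_is_surj surjD)
  have "dplot \<kappa> {0..1} (\<lambda>_. f y) t = (\<lambda>_. 0)" for \<kappa> :: "('m, 'e) chart"
    by (rule dplot_eqI[OF thick_unit_interval t]) simp
  then have "lform A \<alpha> {0..1} (\<lambda>_. f y) t 1 = 0"
    using linear_0[OF one_form_linear[OF A \<alpha> chart_at[OF A]]] by (simp add: lform_def Let_def)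
  then show ?thesis using contact_ham_eq[OF fam t] f by (simp add: y diffeo_def bij_is_inj)
qed

end

section \<open>The universal cover as an ordered group\<close>

text \<open>The parameter set is left open so that isotopies, over the interval, and homotopies
  between them, over the square, obey the same closure rules.\<close>

definition contact_families where
  "contact_families T A \<alpha> = {\<psi>. smooth_family T UNIV A A \<psi> \<and> (\<forall>t\<in>T. contactomorphism A \<alpha> (\<psi> t))}"

lemma PCont0_iff: "\<psi> \<in> PCont0 A \<alpha> \<longleftrightarrow> \<psi> \<in> contact_families {0..1} A \<alpha> \<and> (\<forall>x. \<psi> 0 x = x)"
  by (auto simp: PCont0_def contact_families_def)

lemma contact_familiesD:
  assumes "\<psi> \<in> contact_families T A \<alpha>"
  shows "smooth_family T UNIV A A \<psi>" and "t \<in> T \<Longrightarrow> contactomorphism A \<alpha> (\<psi> t)"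
    and "t \<in> T \<Longrightarrow> diffeo A (\<psi> t)" and "t \<in> T \<Longrightarrow> bij (\<psi> t)"
  using assms by (auto simp: contact_families_def contactomorphism_def diffeo_def)

abbreviation (input) "unit_square \<equiv> {0..1::real} \<times> {0..1::real}"

lemma thick_unit_square [simp]: "thick unit_square"
  by (intro thick_Times thick_unit_interval)

lemma bij_inv_cancel:
  assumes "bij f"
  shows "inv_into UNIV f (f x) = x" "f (inv_into UNIV f x) = x"
  using assms by (simp_all add: bij_is_inj bij_is_surj surj_f_inv_f)

context group
begin

lemma inv_cancel_left:
  assumes "x \<in> carrier G" "y \<in> carrier G"
  shows "x \<otimes> (inv x \<otimes> y) = y" "inv x \<otimes> (x \<otimes> y) = y"
  using assms by (simp_all add: m_assoc[symmetric])

context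
  fixes P
  assumes P: "P \<subseteq> carrier G"
    and P_mult: "\<And>x y. x \<in> P \<Longrightarrow> y \<in> P \<Longrightarrow> x \<otimes> y \<in> P"
    and P_conj: "\<And>x c. x \<in> P \<Longrightarrow> c \<in> carrier G \<Longrightarrow> inv c \<otimes> (x \<otimes> c) \<in> P"
begin

text \<open>The quotient of the two products is itself a product of two elements of
  \<open>P\<close>: the conjugate of \<open>inv b \<otimes> a\<close> by b', and
  \<open>inv b' \<otimes> a'\<close>.\<close>

lemma cone_order_mult:
  assumes "a \<in> carrier G" "b \<in> carrier G" "a' \<in> carrier G" "b' \<in> carrier G"
    and "inv b \<otimes> a \<in> P" "inv b' \<otimes> a' \<in> P"
  shows "inv (b \<otimes> b') \<otimes> (a \<otimes> a') \<in> P"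
proof -
  have "inv (b \<otimes> b') \<otimes> (a \<otimes> a') = (inv b' \<otimes> ((inv b \<otimes> a) \<otimes> b')) \<otimes> (inv b' \<otimes> a')"
    using assms by (simp add: m_assoc inv_cancel_left inv_mult_group)
  then show ?thesis using P_mult P_conj assms by simp
qed

end

end

definition nonneg_isotopies where
  "nonneg_isotopies A \<alpha> = {\<phi> \<in> PCont0 A \<alpha>. \<forall>t\<in>{0..1}. \<forall>y. contact_ham A \<alpha> \<phi> t y \<ge> 0}"

context
  fixes A :: "('m::{t2_space, second_countable_topology}, 'e::euclidean_space) chart set" and \<alpha> :: "('m, 'e) form1"
  assumes A: "smooth_atlas A" and \<alpha>: "one_form A \<alpha>" and M: "compact (UNIV :: 'm set)"
begin

lemma contact_families_compose:
  fixes T :: "'p::euclidean_space set"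
  assumes "\<phi> \<in> contact_families T A \<alpha>" "\<psi> \<in> contact_families T A \<alpha>" "thick T"
  shows "(\<lambda>t x. \<phi> t (\<psi> t x)) \<in> contact_families T A \<alpha>"
  using smooth_family_compose[OF A A A _ _ assms(3) open_UNIV] contactomorphism_compose[OF A \<alpha>] assms(1,2)
  by (simp add: contact_families_def)

lemma contact_families_inverse:
  fixes T :: "'p::euclidean_space set"
  assumes \<psi>: "\<psi> \<in> contact_families T A \<alpha>" and T: "thick T" "compact T"
  shows "(\<lambda>t. inv_into UNIV (\<psi> t)) \<in> contact_families T A \<alpha>"
proof -
  note D = contact_familiesD[OF \<psi>]
  have "smooth_family T UNIV A A (\<lambda>t. inv_into UNIV (\<psi> t))"
    by (rule smooth_family_inverse[OF A M T(2,1) D(1) D(4)]) (auto dest: D(3) intro: diffeo_tangent_inj[OF A])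
  then show ?thesis using contactomorphism_inverse[OF A \<alpha> D(2)] by (simp add: contact_families_def)
qed

lemma contact_families_reparam:
  fixes T :: "'p::euclidean_space set" and T' :: "'q::euclidean_space set"
  assumes "\<psi> \<in> contact_families T A \<alpha>" "thick T'" "smooth_on T' \<tau>" "\<And>t. t \<in> T' \<Longrightarrow> \<tau> t \<in> T"
  shows "(\<lambda>t. \<psi> (\<tau> t)) \<in> contact_families T' A \<alpha>"
  using smooth_family_reparam[OF A A _ assms(2) open_UNIV assms(3,4)] assms(1,4)
  by (simp add: contact_families_def)

lemma contact_families_const:
  fixes T :: "'p::euclidean_space set"
  assumes "contactomorphism A \<alpha> f" "thick T"
  shows "(\<lambda>t. f) \<in> contact_families T A \<alpha>"
  using assms smooth_family_of_map[OF A A _ assms(2) open_UNIV, of f]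
  by (simp add: contact_families_def contactomorphism_def diffeo_def)

lemma PCont0_compose: "\<phi> \<in> PCont0 A \<alpha> \<Longrightarrow> \<psi> \<in> PCont0 A \<alpha> \<Longrightarrow> (\<lambda>t x. \<phi> t (\<psi> t x)) \<in> PCont0 A \<alpha>"
  unfolding PCont0_iff using contact_families_compose[OF _ _ thick_unit_interval] by simp

lemma PCont0_inverse: "\<psi> \<in> PCont0 A \<alpha> \<Longrightarrow> (\<lambda>t. inv_into UNIV (\<psi> t)) \<in> PCont0 A \<alpha>"
proof -
  assume \<psi>: "\<psi> \<in> PCont0 A \<alpha>"
  then have "inv_into UNIV (\<psi> 0) x = x" for x
    using bij_inv_cancel(1)[of "\<psi> 0" x] contact_familiesD(4)[of \<psi> "{0..1}" A \<alpha> 0] by (simp add: PCont0_iff)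
  with \<psi> show ?thesis
    unfolding PCont0_iff using contact_families_inverse[OF _ thick_unit_interval compact_Icc] by simp
qed

lemma PCont0_id: "(\<lambda>t x. x) \<in> PCont0 A \<alpha>"
  unfolding PCont0_iff using contact_families_const[OF contactomorphism_id[OF A \<alpha>] thick_unit_interval] by simp

lemma PCont0_bij: "\<psi> \<in> PCont0 A \<alpha> \<Longrightarrow> t \<in> {0..1} \<Longrightarrow> bij (\<psi> t)"
  unfolding PCont0_iff using contact_familiesD(4) by blast

lemma isotopy_relI:
  assumes "\<phi> \<in> PCont0 A \<alpha>" "\<psi> \<in> PCont0 A \<alpha>" and K: "K \<in> contact_families unit_square A \<alpha>"
    and "\<And>s x. s \<in> {0..1} \<Longrightarrow> K (s, 0) x = x"
    and "\<And>s x. s \<in> {0..1} \<Longrightarrow> K (s, 1) x = \<phi> 1 x" "\<And>x. \<phi> 1 x = \<psi> 1 x"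
    and "\<And>t x. t \<in> {0..1} \<Longrightarrow> K (0, t) x = \<phi> t x" "\<And>t x. t \<in> {0..1} \<Longrightarrow> K (1, t) x = \<psi> t x"
  shows "(\<phi>, \<psi>) \<in> isotopy_rel A \<alpha>"
proof -
  have "(\<lambda>t. K (s, t)) \<in> PCont0 A \<alpha>" if "s \<in> {0..1}" for s
    unfolding PCont0_iff
    using contact_families_reparam[OF K thick_unit_interval, of "\<lambda>t. (s, t)"] that assms(4)
    by (simp add: smooth_on_intros)
  then show ?thesis
    using assms contact_familiesD(1)[OF K] unfolding isotopy_rel_def
    by (auto intro!: exI[of _ K] simp: fun_eq_iff)
qed

lemma isotopy_relE:
  assumes "(\<phi>, \<psi>) \<in> isotopy_rel A \<alpha>"
  obtains K where "\<phi> \<in> PCont0 A \<alpha>" "\<psi> \<in> PCont0 A \<alpha>" "K \<in> contact_families unit_square A \<alpha>"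
    "\<And>s x. s \<in> {0..1} \<Longrightarrow> K (s, 0) x = x"
    "\<And>s x. s \<in> {0..1} \<Longrightarrow> K (s, 1) x = \<phi> 1 x" "\<And>x. \<phi> 1 x = \<psi> 1 x"
    "\<And>t x. t \<in> {0..1} \<Longrightarrow> K (0, t) x = \<phi> t x" "\<And>t x. t \<in> {0..1} \<Longrightarrow> K (1, t) x = \<psi> t x"
proof -
  from assms obtain K where *: "\<phi> \<in> PCont0 A \<alpha>" "\<psi> \<in> PCont0 A \<alpha>"
    "smooth_family unit_square UNIV A A K"
    "\<forall>s\<in>{0..1}. (\<lambda>t. K (s, t)) \<in> PCont0 A \<alpha> \<and> K (s, 1) = \<phi> 1 \<and> K (s, 1) = \<psi> 1"
    "\<forall>t\<in>{0..1}. K (0, t) = \<phi> t \<and> K (1, t) = \<psi> t"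
    unfolding isotopy_rel_def by auto
  have "K \<in> contact_families unit_square A \<alpha>"
    using *(3,4) by (auto simp: contact_families_def PCont0_def)
  moreover have "\<phi> 1 x = \<psi> 1 x" for x using *(4)[rule_format, of 0] by auto
  moreover have "K (s, 0) x = x" if "s \<in> {0..1}" for s x using *(4) that by (auto simp: PCont0_def)
  ultimately show ?thesis using * by (intro that[of K]) auto
qed

lemma isotopy_rel_refl: "\<phi> \<in> PCont0 A \<alpha> \<Longrightarrow> (\<phi>, \<phi>) \<in> isotopy_rel A \<alpha>"
  by (rule isotopy_relI[of _ _ "\<lambda>z. \<phi> (snd z)"])
     (auto simp: PCont0_iff intro!: contact_families_reparam[where T = "{0..1}" and T' = unit_square] smooth_on_intros thick_unit_square)

lemma isotopy_rel_sym:
  assumes "(\<phi>, \<psi>) \<in> isotopy_rel A \<alpha>"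
  shows "(\<psi>, \<phi>) \<in> isotopy_rel A \<alpha>"
proof (rule isotopy_relE[OF assms])
  fix K assume K: "\<phi> \<in> PCont0 A \<alpha>" "\<psi> \<in> PCont0 A \<alpha>" "K \<in> contact_families unit_square A \<alpha>"
    "\<And>s x. s \<in> {0..1} \<Longrightarrow> K (s, 0) x = x"
    "\<And>s x. s \<in> {0..1} \<Longrightarrow> K (s, 1) x = \<phi> 1 x" "\<And>x. \<phi> 1 x = \<psi> 1 x"
    "\<And>t x. t \<in> {0..1} \<Longrightarrow> K (0, t) x = \<phi> t x" "\<And>t x. t \<in> {0..1} \<Longrightarrow> K (1, t) x = \<psi> t x"
  show ?thesis
  proof (rule isotopy_relI[OF K(2,1), of "\<lambda>z. K (1 - fst z, snd z)"])
    show "(\<lambda>z. K (1 - fst z, snd z)) \<in> contact_families unit_square A \<alpha>"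
      by (rule contact_families_reparam[OF K(3)]) (auto intro!: smooth_on_intros thick_unit_square)
    show "K (1 - fst (s, 0::real), snd (s, 0)) x = x" "K (1 - fst (s, 1::real), snd (s, 1)) x = \<psi> 1 x"
      if "s \<in> {0..1}" for s x
      using K(4,5)[of "1 - s" x] K(6) that by simp_all
  qed (use K in auto)
qed

text \<open>No reparametrization in the homotopy parameter is needed for transitivity: homotopies are
  composed with respect to the group structure.\<close>

lemma isotopy_rel_trans:
  assumes "(\<phi>, \<psi>) \<in> isotopy_rel A \<alpha>" "(\<psi>, \<eta>) \<in> isotopy_rel A \<alpha>"
  shows "(\<phi>, \<eta>) \<in> isotopy_rel A \<alpha>"
proof (rule isotopy_relE[OF assms(1)], rule isotopy_relE[OF assms(2)])
  fix K L assume K: "\<phi> \<in> PCont0 A \<alpha>" "\<psi> \<in> PCont0 A \<alpha>" "K \<in> contact_families unit_square A \<alpha>"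
    "\<And>s x. s \<in> {0..1} \<Longrightarrow> K (s, 0) x = x"
    "\<And>s x. s \<in> {0..1} \<Longrightarrow> K (s, 1) x = \<phi> 1 x" "\<And>x. \<phi> 1 x = \<psi> 1 x"
    "\<And>t x. t \<in> {0..1} \<Longrightarrow> K (0, t) x = \<phi> t x" "\<And>t x. t \<in> {0..1} \<Longrightarrow> K (1, t) x = \<psi> t x"
  assume L: "\<eta> \<in> PCont0 A \<alpha>" "L \<in> contact_families unit_square A \<alpha>"
    "\<And>s x. s \<in> {0..1} \<Longrightarrow> L (s, 0) x = x"
    "\<And>s x. s \<in> {0..1} \<Longrightarrow> L (s, 1) x = \<psi> 1 x" "\<And>x. \<psi> 1 x = \<eta> 1 x"
    "\<And>t x. t \<in> {0..1} \<Longrightarrow> L (0, t) x = \<psi> t x" "\<And>t x. t \<in> {0..1} \<Longrightarrow> L (1, t) x = \<eta> t x"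
  define \<psi>' where "\<psi>' t = inv_into UNIV (\<psi> t)" for t
  have \<psi>': "\<psi>' \<in> PCont0 A \<alpha>" using PCont0_inverse[OF K(2)] by (simp add: \<psi>'_def[abs_def])
  have inv [simp]: "\<psi>' t (\<psi> t x) = x" "\<psi> t (\<psi>' t x) = x" if "t \<in> {0..1}" for t x
    using bij_inv_cancel[OF PCont0_bij[OF K(2) that]] by (simp_all add: \<psi>'_def)
  have inv1: "\<psi>' 1 (\<eta> 1 x) = x" for x using inv(1)[of 1 x] L(5)[of x] by simp
  have \<psi>'0: "\<psi>' 0 x = x" for x using \<psi>' by (simp add: PCont0_iff)
  have "(\<lambda>z. \<psi>' (snd z)) \<in> contact_families unit_square A \<alpha>"
    using contact_families_reparam[OF _ thick_unit_square, of \<psi>' "{0..1}" snd] \<psi>' smooth_on_snd[OF thick_unit_square smooth_on_id]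
    by (auto simp: PCont0_iff)
  \<comment> \<open>The homotopy is the product of K, \<psi>' and L: at s = 0 the factors \<phi>,
    \<psi>', \<psi> leave \<phi>, and at s = 1 the factors \<psi>, \<psi>', \<eta> leave
    \<eta>.\<close>
  from contact_families_compose[OF K(3) contact_families_compose[OF this L(2)]]
  have C: "(\<lambda>z x. K z (\<psi>' (snd z) (L z x))) \<in> contact_families unit_square A \<alpha>" by simp
  show ?thesis
    by (rule isotopy_relI[OF K(1) L(1) C]) (use K L inv1 in \<open>auto simp: \<psi>'0\<close>)
qed

lemma isotopy_rel_compose:
  assumes "(\<phi>, \<phi>') \<in> isotopy_rel A \<alpha>" "(\<psi>, \<psi>') \<in> isotopy_rel A \<alpha>"
  shows "((\<lambda>t x. \<phi> t (\<psi> t x)), (\<lambda>t x. \<phi>' t (\<psi>' t x))) \<in> isotopy_rel A \<alpha>"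
proof (rule isotopy_relE[OF assms(1)], rule isotopy_relE[OF assms(2)])
  fix K L assume K: "\<phi> \<in> PCont0 A \<alpha>" "\<phi>' \<in> PCont0 A \<alpha>" "K \<in> contact_families unit_square A \<alpha>"
    "\<And>s x. s \<in> {0..1} \<Longrightarrow> K (s, 0) x = x"
    "\<And>s x. s \<in> {0..1} \<Longrightarrow> K (s, 1) x = \<phi> 1 x" "\<And>x. \<phi> 1 x = \<phi>' 1 x"
    "\<And>t x. t \<in> {0..1} \<Longrightarrow> K (0, t) x = \<phi> t x" "\<And>t x. t \<in> {0..1} \<Longrightarrow> K (1, t) x = \<phi>' t x"
  assume L: "\<psi> \<in> PCont0 A \<alpha>" "\<psi>' \<in> PCont0 A \<alpha>" "L \<in> contact_families unit_square A \<alpha>"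
    "\<And>s x. s \<in> {0..1} \<Longrightarrow> L (s, 0) x = x"
    "\<And>s x. s \<in> {0..1} \<Longrightarrow> L (s, 1) x = \<psi> 1 x" "\<And>x. \<psi> 1 x = \<psi>' 1 x"
    "\<And>t x. t \<in> {0..1} \<Longrightarrow> L (0, t) x = \<psi> t x" "\<And>t x. t \<in> {0..1} \<Longrightarrow> L (1, t) x = \<psi>' t x"
  show ?thesis
    by (rule isotopy_relI[OF PCont0_compose[OF K(1) L(1)] PCont0_compose[OF K(2) L(2)]
          contact_families_compose[OF K(3) L(3) thick_unit_square]]) (use K L in auto)
qed

lemma isotopy_class_eq:
  assumes "(\<phi>, \<psi>) \<in> isotopy_rel A \<alpha>"
  shows "isotopy_class A \<alpha> \<phi> = isotopy_class A \<alpha> \<psi>"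
  unfolding isotopy_class_def using isotopy_rel_trans isotopy_rel_sym assms by blast

lemma isotopy_class_self: "\<phi> \<in> PCont0 A \<alpha> \<Longrightarrow> \<phi> \<in> isotopy_class A \<alpha> \<phi>"
  unfolding isotopy_class_def using isotopy_rel_refl by blast

lemma isotopy_class_mem: "\<phi> \<in> isotopy_class A \<alpha> \<psi> \<Longrightarrow> \<phi> \<in> PCont0 A \<alpha> \<and> isotopy_class A \<alpha> \<phi> = isotopy_class A \<alpha> \<psi>"
  using isotopy_class_eq[of \<psi> \<phi>] by (auto simp: isotopy_class_def isotopy_rel_def)

section \<open>Group structure on homotopy classes of contact isotopies\<close>

abbreviation (input) "UG \<equiv> UCont A \<alpha>"
abbreviation (input) "cl \<equiv> isotopy_class A \<alpha>"

lemma UCont_carrier: "carrier UG = cl ` PCont0 A \<alpha>"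
  by (auto simp: UCont_def quotient_def isotopy_class_def)

lemma UCont_carrierE:
  assumes "a \<in> carrier UG" obtains \<phi> where "\<phi> \<in> PCont0 A \<alpha>" "a = cl \<phi>"
  using assms unfolding UCont_carrier by blast

lemma UCont_mult:
  assumes "\<phi> \<in> PCont0 A \<alpha>" "\<psi> \<in> PCont0 A \<alpha>"
  shows "cl \<phi> \<otimes>\<^bsub>UG\<^esub> cl \<psi> = cl (\<lambda>t x. \<phi> t (\<psi> t x))"
proof -
  have "cl (\<lambda>t. \<phi>' t \<circ> \<psi>' t) = cl (\<lambda>t x. \<phi> t (\<psi> t x))" if "\<phi>' \<in> cl \<phi>" "\<psi>' \<in> cl \<psi>" for \<phi>' \<psi>'
    using isotopy_class_eq[OF isotopy_rel_compose[of \<phi> \<phi>' \<psi> \<psi>']] that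
    by (simp add: isotopy_class_def o_def)
  moreover have "\<phi> \<in> cl \<phi>" "\<psi> \<in> cl \<psi>" using assms isotopy_class_self by auto
  ultimately have "(\<Union>\<phi>'\<in>cl \<phi>. \<Union>\<psi>'\<in>cl \<psi>. cl (\<lambda>t. \<phi>' t \<circ> \<psi>' t)) = cl (\<lambda>t x. \<phi> t (\<psi> t x))" by blast
  then show ?thesis by (simp add: UCont_def)
qed

lemma UCont_one: "\<one>\<^bsub>UG\<^esub> = cl (\<lambda>t x. x)"
  by (simp add: UCont_def id_def)

lemma UCont_inv_mult:
  assumes "\<phi> \<in> PCont0 A \<alpha>"
  shows "cl (\<lambda>t. inv_into UNIV (\<phi> t)) \<otimes>\<^bsub>UG\<^esub> cl \<phi> = \<one>\<^bsub>UG\<^esub>"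
proof -
  have "((\<lambda>t x. inv_into UNIV (\<phi> t) (\<phi> t x)), (\<lambda>t x. x)) \<in> isotopy_rel A \<alpha>"
    by (rule isotopy_relI[of _ _ "\<lambda>z x. x"])
       (use bij_inv_cancel[OF PCont0_bij[OF assms]] PCont0_compose[OF PCont0_inverse assms] assms PCont0_id
          contact_families_const[OF contactomorphism_id[OF A \<alpha>] thick_unit_square] in auto)
  then show ?thesis
    using UCont_mult[OF PCont0_inverse[OF assms] assms] isotopy_class_eq UCont_one by simp
qed

lemma group_UCont: "group UG"
proof (rule groupI)
  show "\<one>\<^bsub>UG\<^esub> \<in> carrier UG" using PCont0_id by (auto simp: UCont_one UCont_carrier)
  fix a assume "a \<in> carrier UG"
  then obtain \<phi> where a: "\<phi> \<in> PCont0 A \<alpha>" "a = cl \<phi>" by (rule UCont_carrierE)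
  show "\<one>\<^bsub>UG\<^esub> \<otimes>\<^bsub>UG\<^esub> a = a" using UCont_mult[OF PCont0_id a(1)] by (simp add: UCont_one a)
  show "\<exists>b\<in>carrier UG. b \<otimes>\<^bsub>UG\<^esub> a = \<one>\<^bsub>UG\<^esub>"
    using UCont_inv_mult[OF a(1)] PCont0_inverse[OF a(1)] unfolding a(2) UCont_carrier by blast
  fix b assume "b \<in> carrier UG"
  then obtain \<psi> where b: "\<psi> \<in> PCont0 A \<alpha>" "b = cl \<psi>" by (rule UCont_carrierE)
  show "a \<otimes>\<^bsub>UG\<^esub> b \<in> carrier UG"
    using UCont_mult[OF a(1) b(1)] PCont0_compose[OF a(1) b(1)] by (simp add: a b UCont_carrier)
  fix c assume "c \<in> carrier UG"
  then obtain \<eta> where c: "\<eta> \<in> PCont0 A \<alpha>" "c = cl \<eta>" by (rule UCont_carrierE)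
  show "a \<otimes>\<^bsub>UG\<^esub> b \<otimes>\<^bsub>UG\<^esub> c = a \<otimes>\<^bsub>UG\<^esub> (b \<otimes>\<^bsub>UG\<^esub> c)"
    by (simp add: a b c UCont_mult PCont0_compose)
qed

lemma UCont_inv:
  assumes "\<phi> \<in> PCont0 A \<alpha>"
  shows "inv\<^bsub>UG\<^esub> (cl \<phi>) = cl (\<lambda>t. inv_into UNIV (\<phi> t))"
  using group.inv_equality[OF group_UCont UCont_inv_mult[OF assms]] assms PCont0_inverse[OF assms]
  by (auto simp: UCont_carrier)

lemma PCont0_funpow: "\<phi> \<in> PCont0 A \<alpha> \<Longrightarrow> (\<lambda>t. \<phi> t ^^ n) \<in> PCont0 A \<alpha>"
proof (induction n)
  case 0
  then show ?case using PCont0_id by (simp add: id_def)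
next
  case (Suc n)
  then show ?case using PCont0_compose[OF Suc.prems Suc.IH] by (simp add: o_def)
qed

lemma UCont_pow:
  assumes "\<phi> \<in> PCont0 A \<alpha>"
  shows "cl \<phi> [^]\<^bsub>UG\<^esub> (n::nat) = cl (\<lambda>t. \<phi> t ^^ n)"
proof (induction n)
  case 0
  then show ?case by (simp add: UCont_one id_def)
next
  case (Suc n)
  then show ?case
    using UCont_mult[OF PCont0_funpow[OF assms, of n] assms] by (simp add: funpow_Suc_right o_def del: funpow.simps)
qed

text \<open>The homotopy conjugates by \<open>\<phi>\<close> at time \<open>t + s (1 - t)\<close>, which moves \<open>\<phi> t\<close> to \<open>\<phi> 1\<close>.\<close>

lemma UCont_conj:
  assumes \<phi>: "\<phi> \<in> PCont0 A \<alpha>" and \<psi>: "\<psi> \<in> PCont0 A \<alpha>"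
  shows "(\<lambda>t x. inv_into UNIV (\<phi> 1) (\<psi> t (\<phi> 1 x))) \<in> PCont0 A \<alpha>"
    and "inv\<^bsub>UG\<^esub> (cl \<phi>) \<otimes>\<^bsub>UG\<^esub> (cl \<psi> \<otimes>\<^bsub>UG\<^esub> cl \<phi>) = cl (\<lambda>t x. inv_into UNIV (\<phi> 1) (\<psi> t (\<phi> 1 x)))"
proof -
  let ?Q = "{0..1::real} \<times> {0..1::real}"
  define \<phi>' where "\<phi>' t = inv_into UNIV (\<phi> t)" for t
  have \<phi>': "\<phi>' \<in> PCont0 A \<alpha>" using PCont0_inverse[OF \<phi>] by (simp add: \<phi>'_def[abs_def])
  have inv: "\<phi>' t (\<phi> t x) = x" if "t \<in> {0..1}" for t x
    using bij_inv_cancel[OF PCont0_bij[OF \<phi> that]] by (simp add: \<phi>'_def)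
  note CF = \<phi>[unfolded PCont0_iff] \<psi>[unfolded PCont0_iff] \<phi>'[unfolded PCont0_iff]
  have 1: "(1::real) \<in> {0..1}" by simp
  have "contactomorphism A \<alpha> (\<phi> 1)" "contactomorphism A \<alpha> (\<phi>' 1)"
    using CF 1 contact_familiesD(2) by blast+
  note const = this[THEN contact_families_const[OF _ thick_unit_interval]]
  have "(\<lambda>t x. \<psi> t (\<phi> 1 x)) \<in> contact_families {0..1} A \<alpha>"
    using contact_families_compose[OF _ const(1) thick_unit_interval, of \<psi>] CF by blast
  from contact_families_compose[OF const(2) this thick_unit_interval]
  have "(\<lambda>t x. \<phi>' 1 (\<psi> t (\<phi> 1 x))) \<in> contact_families {0..1} A \<alpha>" .
  then show P: "(\<lambda>t x. inv_into UNIV (\<phi> 1) (\<psi> t (\<phi> 1 x))) \<in> PCont0 A \<alpha>"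
    using CF inv[OF 1] unfolding PCont0_iff by (simp add: \<phi>'_def)
  define \<tau> where "\<tau> z = snd z + fst z * (1 - snd z)" for z :: "real \<times> real"
  have \<tau>: "smooth_on ?Q \<tau>" unfolding \<tau>_def by (intro smooth_on_intros thick_unit_square)
  have \<tau>1: "\<tau> z \<in> {0..1}" if "z \<in> ?Q" for z
  proof -
    have "fst z * (1 - snd z) \<le> 1 - snd z" "0 \<le> fst z * (1 - snd z)" using that
      by (auto intro!: mult_left_le_one_le mult_nonneg_nonneg)
    moreover have "0 \<le> snd z" using that by auto
    ultimately show ?thesis unfolding \<tau>_def by simp
  qed
  have K: "(\<lambda>z x. \<phi>' (\<tau> z) (\<psi> (snd z) (\<phi> (\<tau> z) x))) \<in> contact_families ?Q A \<alpha>"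
  proof -
    note re = contact_families_reparam[OF _ thick_unit_square, where T = "{0..1}"]
    have 1: "(\<lambda>z. \<phi> (\<tau> z)) \<in> contact_families ?Q A \<alpha>" "(\<lambda>z. \<phi>' (\<tau> z)) \<in> contact_families ?Q A \<alpha>"
      by (rule re[OF _ \<tau> \<tau>1]; use CF in blast)+
    have 2: "(\<lambda>z. \<psi> (snd z)) \<in> contact_families ?Q A \<alpha>"
      by (rule re[OF _ smooth_on_snd[OF thick_unit_square smooth_on_id[OF thick_unit_square]]]) (use CF in auto)
    from contact_families_compose[OF 1(2) contact_families_compose[OF 2 1(1) thick_unit_square] thick_unit_square]
    show ?thesis .
  qed
  have "((\<lambda>t x. \<phi>' t (\<psi> t (\<phi> t x))), (\<lambda>t x. inv_into UNIV (\<phi> 1) (\<psi> t (\<phi> 1 x)))) \<in> isotopy_rel A \<alpha>"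
    by (rule isotopy_relI[OF PCont0_compose[OF \<phi>' PCont0_compose[OF \<psi> \<phi>]] P K])
       (use CF inv in \<open>auto simp: \<tau>_def \<phi>'_def[symmetric]\<close>)
  then show "inv\<^bsub>UG\<^esub> (cl \<phi>) \<otimes>\<^bsub>UG\<^esub> (cl \<psi> \<otimes>\<^bsub>UG\<^esub> cl \<phi>) = cl (\<lambda>t x. inv_into UNIV (\<phi> 1) (\<psi> t (\<phi> 1 x)))"
    using isotopy_class_eq UCont_inv[OF \<phi>] UCont_mult[OF \<psi> \<phi>] UCont_mult[OF \<phi>' PCont0_compose[OF \<psi> \<phi>]]
    by (simp add: \<phi>'_def[abs_def])
qed

text \<open>The product of the inverse isotopy with \<phi> is constant and has Hamiltonian 0, so the
  composition formula can be solved for the inverse.\<close>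

lemma contact_ham_inverse:
  assumes \<phi>: "\<phi> \<in> PCont0 A \<alpha>" and t: "t \<in> {0..1}" and c: "conformal A \<alpha> (inv_into UNIV (\<phi> t)) c"
  shows "contact_ham A \<alpha> (\<lambda>t. inv_into UNIV (\<phi> t)) t x = - c (\<phi> t x) * contact_ham A \<alpha> \<phi> t (\<phi> t x)"
proof -
  let ?\<phi>' = "\<lambda>t. inv_into UNIV (\<phi> t)"
  note F = contact_familiesD[OF \<phi>[unfolded PCont0_iff, THEN conjunct1]]
  note F' = contact_familiesD[OF PCont0_inverse[OF \<phi>, unfolded PCont0_iff, THEN conjunct1]]
  note canc = bij_inv_cancel(1)[OF F(4)]
  have "contact_ham A \<alpha> (\<lambda>t x. ?\<phi>' t (\<phi> t x)) t (?\<phi>' t (\<phi> t x)) =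
      contact_ham A \<alpha> ?\<phi>' t (?\<phi>' t (\<phi> t x)) + c (\<phi> t x) * contact_ham A \<alpha> \<phi> t (\<phi> t x)"
    by (rule contact_ham_compose[OF A \<alpha> F'(1) F'(3)[OF t] c F(1) F(3)[OF t] t])
  \<comment> \<open>The product is the identity only for times in \<open>{0..1}\<close>; this
    suffices, since velocities are derivatives within that interval.\<close>
  moreover have "contact_ham A \<alpha> (\<lambda>t x. ?\<phi>' t (\<phi> t x)) t x = contact_ham A \<alpha> (\<lambda>t x. x) t x"
  proof -
    have fam: "smooth_family {0..1} UNIV A A (\<lambda>t x. ?\<phi>' t (\<phi> t x))" "smooth_family {0..1::real} UNIV A A (\<lambda>t x. x)"
      using smooth_family_compose[OF A A A F'(1) F(1) thick_unit_interval open_UNIV]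
        PCont0_id by (auto simp: PCont0_def)
    have "lform A \<alpha> {0..1} (\<lambda>s. ?\<phi>' s (\<phi> s x)) t 1 = lform A \<alpha> {0..1} (\<lambda>s. x) t 1"
      by (rule lform_cong[OF t]) (simp add: canc)
    then show ?thesis
      using contact_ham_eq[OF A \<alpha> fam(1) t, of x] contact_ham_eq[OF A \<alpha> fam(2) t, of x]
      by (simp add: canc[OF t] inj_def)
  qed
  ultimately show ?thesis using contact_ham_const[OF A \<alpha> diffeo_id[OF A] t, of x] by (simp add: canc[OF t])
qed

text \<open>Constant isotopies have Hamiltonian 0, so only the conformal factor of the outer map and
  the change of base point survive.\<close>

lemma contact_ham_conj:
  assumes f: "diffeo A f" and c: "conformal A \<alpha> f d" "conformal A \<alpha> (inv_into UNIV f) c" and \<psi>: "\<psi> \<in> PCont0 A \<alpha>" and t: "t \<in> {0..1}"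
  shows "contact_ham A \<alpha> (\<lambda>t x. inv_into UNIV f (\<psi> t (f x))) t y = c (f y) * contact_ham A \<alpha> \<psi> t (f y)"
proof -
  let ?g = "inv_into UNIV f"
  note F = contact_familiesD[OF \<psi>[unfolded PCont0_iff, THEN conjunct1]]
  have bij: "bij f" using f by (simp add: diffeo_def)
  note canc = bij_inv_cancel[OF bij] bij_inv_cancel[OF F(4)[OF t]]
  define x where "x = ?g (inv_into UNIV (\<psi> t) (f y))"
  have x: "\<psi> t (f x) = f y" "?g (f y) = y" by (simp_all add: x_def canc)
  have cst: "smooth_family {0..1} UNIV A A (\<lambda>t::real. f)" "smooth_family {0..1} UNIV A A (\<lambda>t::real. ?g)"
    using f smooth_family_of_map[OF A A _ thick_unit_interval open_UNIV] by (auto simp: diffeo_def)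
  obtain e where e: "conformal A \<alpha> (\<psi> t) e" using F(2)[OF t] by (auto simp: contactomorphism_iff)
  have 1: "contact_ham A \<alpha> (\<lambda>t x. \<psi> t (f x)) t (\<psi> t (f x)) = contact_ham A \<alpha> \<psi> t (\<psi> t (f x))"
    using contact_ham_compose[OF A \<alpha> F(1) F(3)[OF t] e cst(1) f t, of x] contact_ham_const[OF A \<alpha> f t] by simp
  have "contact_ham A \<alpha> (\<lambda>t x. ?g (\<psi> t (f x))) t (?g (\<psi> t (f x))) =
      contact_ham A \<alpha> (\<lambda>t. ?g) t (?g (\<psi> t (f x))) + c (\<psi> t (f x)) * contact_ham A \<alpha> (\<lambda>t x. \<psi> t (f x)) t (\<psi> t (f x))"
    by (rule contact_ham_compose[OF A \<alpha> cst(2) diffeo_inverse[OF A f] c(2)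
        smooth_family_compose[OF A A A F(1) cst(1) thick_unit_interval open_UNIV] diffeo_compose[OF A F(3)[OF t] f] t])
  then show ?thesis using 1 contact_ham_const[OF A \<alpha> diffeo_inverse[OF A f] t] by (simp add: x)
qed

section \<open>The cone of nonnegative isotopies and the bi-invariant order\<close>

abbreviation (input) "pos_cone \<equiv> cl ` nonneg_isotopies A \<alpha>"

lemma contact_ham_mult:
  assumes \<phi>: "\<phi> \<in> PCont0 A \<alpha>" and \<psi>: "\<psi> \<in> PCont0 A \<alpha>" and t: "t \<in> {0..1}" and c: "conformal A \<alpha> (\<phi> t) c"
  shows "contact_ham A \<alpha> (\<lambda>t x. \<phi> t (\<psi> t x)) t y =
    contact_ham A \<alpha> \<phi> t y + c (inv_into UNIV (\<phi> t) y) * contact_ham A \<alpha> \<psi> t (inv_into UNIV (\<phi> t) y)"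
proof -
  note F = contact_familiesD[OF \<phi>[unfolded PCont0_iff, THEN conjunct1]]
  note F' = contact_familiesD[OF \<psi>[unfolded PCont0_iff, THEN conjunct1]]
  define x where "x = inv_into UNIV (\<psi> t) (inv_into UNIV (\<phi> t) y)"
  have x: "\<psi> t x = inv_into UNIV (\<phi> t) y" "\<phi> t (\<psi> t x) = y"
    by (simp_all add: x_def bij_inv_cancel[OF F(4)[OF t]] bij_inv_cancel[OF F'(4)[OF t]])
  show ?thesis
    using contact_ham_compose[OF A \<alpha> F(1) F(3)[OF t] c F'(1) F'(3)[OF t] t, of x]
    by (simp only: x(2)) (simp only: x(1))
qed

lemma PCont0_conformal:
  assumes "\<phi> \<in> PCont0 A \<alpha>" "t \<in> {0..1}"
  obtains c where "conformal A \<alpha> (\<phi> t) c" "\<And>x. c x > 0"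
proof -
  have "contactomorphism A \<alpha> (\<phi> t)" using assms by (simp add: PCont0_def)
  then obtain c where "conformal A \<alpha> (\<phi> t) c" unfolding contactomorphism_iff by blast
  then show ?thesis using that[of c] by (simp add: conformal_def)
qed

text \<open>Multiplication on the right adds a positive multiple of the Hamiltonian of
  \<open>n\<close>, taken at a moved point.\<close>

lemma nonneg_mult_ham:
  assumes "\<psi> \<in> PCont0 A \<alpha>" "n \<in> nonneg_isotopies A \<alpha>" "t \<in> {0..1}"
  shows "contact_ham A \<alpha> (\<lambda>t x. \<psi> t (n t x)) t y \<ge> contact_ham A \<alpha> \<psi> t y"
proof -
  obtain c where c: "conformal A \<alpha> (\<psi> t) c" "\<And>x. c x > 0" using PCont0_conformal[OF assms(1,3)] by blast
  have n: "n \<in> PCont0 A \<alpha>" "\<And>y. contact_ham A \<alpha> n t y \<ge> 0" using assms by (auto simp: nonneg_isotopies_def)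
  show ?thesis using contact_ham_mult[OF assms(1) n(1) assms(3) c(1), of y] c(2) n(2) by (simp add: less_imp_le)
qed

lemma pos_cone_mult: "p \<in> pos_cone \<Longrightarrow> q \<in> pos_cone \<Longrightarrow> p \<otimes>\<^bsub>UG\<^esub> q \<in> pos_cone"
proof -
  assume "p \<in> pos_cone" "q \<in> pos_cone"
  then obtain \<phi> \<psi> where *: "\<phi> \<in> nonneg_isotopies A \<alpha>" "\<psi> \<in> nonneg_isotopies A \<alpha>" "p = cl \<phi>" "q = cl \<psi>" by blast
  then have P: "\<phi> \<in> PCont0 A \<alpha>" "\<psi> \<in> PCont0 A \<alpha>" by (auto simp: nonneg_isotopies_def)
  have "0 \<le> contact_ham A \<alpha> (\<lambda>t x. \<phi> t (\<psi> t x)) t y" if "t \<in> {0..1}" for t y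
  proof -
    have "0 \<le> contact_ham A \<alpha> \<phi> t y" using *(1) that by (simp add: nonneg_isotopies_def)
    also have "\<dots> \<le> contact_ham A \<alpha> (\<lambda>t x. \<phi> t (\<psi> t x)) t y" by (rule nonneg_mult_ham[OF P(1) *(2) that])
    finally show ?thesis .
  qed
  then have "(\<lambda>t x. \<phi> t (\<psi> t x)) \<in> nonneg_isotopies A \<alpha>"
    using PCont0_compose[OF P] by (simp add: nonneg_isotopies_def)
  then show ?thesis using UCont_mult[OF P] * by simp
qed

lemma pos_cone_carrier: "pos_cone \<subseteq> carrier UG"
  by (auto simp: UCont_carrier nonneg_isotopies_def)

lemma pos_cone_one: "\<one>\<^bsub>UG\<^esub> \<in> pos_cone"
  using contact_ham_const[OF A \<alpha> diffeo_id[OF A]] PCont0_id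
  by (auto simp: UCont_one nonneg_isotopies_def)

lemma pos_cone_conj:
  assumes "p \<in> pos_cone" "c \<in> carrier UG"
  shows "inv\<^bsub>UG\<^esub> c \<otimes>\<^bsub>UG\<^esub> (p \<otimes>\<^bsub>UG\<^esub> c) \<in> pos_cone"
proof -
  obtain n where n: "n \<in> nonneg_isotopies A \<alpha>" "p = cl n" using assms by blast
  have nP: "n \<in> PCont0 A \<alpha>" using n by (simp add: nonneg_isotopies_def)
  obtain \<phi> where \<phi>: "\<phi> \<in> PCont0 A \<alpha>" "c = cl \<phi>" using UCont_carrierE[OF assms(2)] .
  have 1: "(1::real) \<in> {0..1}" by simp
  have d: "diffeo A (\<phi> 1)" using \<phi>(1) 1 by (auto simp: PCont0_def contactomorphism_iff)
  obtain e where e: "conformal A \<alpha> (\<phi> 1) e" using PCont0_conformal[OF \<phi>(1) 1] by blast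
  obtain e' where e': "conformal A \<alpha> (inv_into UNIV (\<phi> 1)) e'" "\<And>x. e' x > 0"
    using PCont0_conformal[OF PCont0_inverse[OF \<phi>(1)] 1] by blast
  have "(\<lambda>t x. inv_into UNIV (\<phi> 1) (n t (\<phi> 1 x))) \<in> nonneg_isotopies A \<alpha>"
    using UCont_conj(1)[OF \<phi>(1) nP] contact_ham_conj[OF d e e'(1) nP] less_imp_le[OF e'(2)] n(1)
    by (auto simp: nonneg_isotopies_def intro!: mult_nonneg_nonneg)
  then show ?thesis using UCont_conj(2)[OF \<phi>(1) nP] n \<phi> by simp
qed

text \<open>The inverse of \<psi> composed with \<phi> has at y a positive multiple of the
  difference of the two Hamiltonians at \<open>\<psi> t y\<close>. Conversely, if n is a nonnegative
  representative of the quotient and \<psi> one of b, their product represents a and lies above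
  \<psi>.\<close>

lemma dominates_iff:
  assumes a: "a \<in> carrier UG" and b: "b \<in> carrier UG"
  shows "dominates A \<alpha> a b \<longleftrightarrow> inv\<^bsub>UG\<^esub> b \<otimes>\<^bsub>UG\<^esub> a \<in> pos_cone"
proof
  assume "dominates A \<alpha> a b"
  then obtain \<phi> \<psi> where *: "\<phi> \<in> a" "\<psi> \<in> b" "\<And>t y. t \<in> {0..1} \<Longrightarrow> contact_ham A \<alpha> \<phi> t y \<ge> contact_ham A \<alpha> \<psi> t y"
    unfolding dominates_def by blast
  have \<phi>: "\<phi> \<in> PCont0 A \<alpha>" "cl \<phi> = a" and \<psi>: "\<psi> \<in> PCont0 A \<alpha>" "cl \<psi> = b"
    using a b *(1,2) isotopy_class_mem by (auto elim!: UCont_carrierE)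
  let ?\<psi>' = "\<lambda>t. inv_into UNIV (\<psi> t)"
  have \<psi>': "?\<psi>' \<in> PCont0 A \<alpha>" by (rule PCont0_inverse[OF \<psi>(1)])
  have "contact_ham A \<alpha> (\<lambda>t x. ?\<psi>' t (\<phi> t x)) t y \<ge> 0" if t: "t \<in> {0..1}" for t y
  proof -
    obtain c where c: "conformal A \<alpha> (?\<psi>' t) c" "\<And>x. c x > 0" using PCont0_conformal[OF \<psi>' t] by blast
    have "inv_into UNIV (?\<psi>' t) y = \<psi> t y"
      using inv_inv_eq[OF PCont0_bij[OF \<psi>(1) t]] by simp
    then have "contact_ham A \<alpha> (\<lambda>t x. ?\<psi>' t (\<phi> t x)) t y =
       c (\<psi> t y) * (contact_ham A \<alpha> \<phi> t (\<psi> t y) - contact_ham A \<alpha> \<psi> t (\<psi> t y))"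
      using contact_ham_mult[OF \<psi>' \<phi>(1) t c(1), of y] contact_ham_inverse[OF \<psi>(1) t c(1), of y]
      by (simp add: algebra_simps)
    then show ?thesis using c(2)[of "\<psi> t y"] *(3)[OF t] by simp
  qed
  then have "(\<lambda>t x. ?\<psi>' t (\<phi> t x)) \<in> nonneg_isotopies A \<alpha>"
    using PCont0_compose[OF \<psi>' \<phi>(1)] by (simp add: nonneg_isotopies_def)
  then show "inv\<^bsub>UG\<^esub> b \<otimes>\<^bsub>UG\<^esub> a \<in> pos_cone"
    using UCont_mult[OF \<psi>' \<phi>(1)] UCont_inv[OF \<psi>(1)] \<phi> \<psi> by auto
next
  interpret group UG by (rule group_UCont)
  assume "inv\<^bsub>UG\<^esub> b \<otimes>\<^bsub>UG\<^esub> a \<in> pos_cone"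
  then obtain n where n: "n \<in> nonneg_isotopies A \<alpha>" "inv\<^bsub>UG\<^esub> b \<otimes>\<^bsub>UG\<^esub> a = cl n" by blast
  have nP: "n \<in> PCont0 A \<alpha>" using n by (simp add: nonneg_isotopies_def)
  obtain \<psi> where \<psi>: "\<psi> \<in> PCont0 A \<alpha>" "b = cl \<psi>" using UCont_carrierE[OF b] .
  have "a = b \<otimes>\<^bsub>UG\<^esub> (inv\<^bsub>UG\<^esub> b \<otimes>\<^bsub>UG\<^esub> a)" using a b by (simp add: inv_cancel_left)
  then have "a = cl (\<lambda>t x. \<psi> t (n t x))" using UCont_mult[OF \<psi>(1) nP] n \<psi> by simp
  then have "(\<lambda>t x. \<psi> t (n t x)) \<in> a" using isotopy_class_self[OF PCont0_compose[OF \<psi>(1) nP]] by simp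
  moreover have "\<psi> \<in> b" using isotopy_class_self[OF \<psi>(1)] \<psi> by simp
  ultimately show "dominates A \<alpha> a b"
    unfolding dominates_def using nonneg_mult_ham[OF \<psi>(1) n(1)] by blast
qed

lemma dominates_mult:
  assumes "a \<in> carrier UG" "b \<in> carrier UG" "a' \<in> carrier UG" "b' \<in> carrier UG"
    "dominates A \<alpha> a b" "dominates A \<alpha> a' b'"
  shows "dominates A \<alpha> (a \<otimes>\<^bsub>UG\<^esub> a') (b \<otimes>\<^bsub>UG\<^esub> b')"
proof -
  interpret group UG by (rule group_UCont)
  show ?thesis
    using cone_order_mult[OF pos_cone_carrier pos_cone_mult pos_cone_conj assms(1-4)] assms
    by (simp add: dominates_iff)
qed

lemma dominates_ham:
  assumes "\<phi> \<in> PCont0 A \<alpha>" "\<psi> \<in> PCont0 A \<alpha>" "\<And>t y. t \<in> {0..1} \<Longrightarrow> contact_ham A \<alpha> \<phi> t y \<ge> contact_ham A \<alpha> \<psi> t y"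
  shows "dominates A \<alpha> (cl \<phi>) (cl \<psi>)"
  unfolding dominates_def using assms isotopy_class_self by blast

text \<open>A negative k would put the k-th power of \<open>a\<close> itself into the cone, so that
  every power with exponent k m + 1 dominates \<open>a\<close>. This contradicts boundedness from
  below for the pair consisting of \<open>a\<close> twice, which well-definedness includes.\<close>

lemma growth_set_nonneg:
  assumes wd: "growth_rates_well_defined A \<alpha>" and a: "a \<in> UCont_plus A \<alpha>" and b: "b \<in> UCont_plus A \<alpha>"
    and k: "k \<in> growth_set A \<alpha> a b l"
  shows "k \<ge> 0"
proof (rule ccontr)
  assume "\<not> k \<ge> 0"
  then have k0: "k < 0" by simp
  interpret group UG by (rule group_UCont)
  have "x \<in> pos_cone" if x: "x \<in> UCont_plus A \<alpha>" for x
  proof -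
    obtain \<phi> where "\<phi> \<in> PCont_plus A \<alpha>" "x = cl \<phi>" using x by (auto simp: UCont_plus_def)
    then show ?thesis by (auto simp: PCont_plus_def nonneg_isotopies_def intro!: imageI less_imp_le)
  qed
  then have aP: "a \<in> pos_cone" and bP: "b \<in> pos_cone" using a b by auto
  then have ac: "a \<in> carrier UG" and bc: "b \<in> carrier UG" using pos_cone_carrier by auto
  have pw: "x [^]\<^bsub>UG\<^esub> n \<in> pos_cone" if "x \<in> pos_cone" for x and n :: nat
    using that by (induction n) (simp_all add: pos_cone_one pos_cone_mult)
  have "inv\<^bsub>UG\<^esub> (b [^]\<^bsub>UG\<^esub> l) \<otimes>\<^bsub>UG\<^esub> a [^]\<^bsub>UG\<^esub> k \<in> pos_cone"
    using k ac bc by (simp add: growth_set_def dominates_iff)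
  \<comment> \<open>The l-th power of \<open>b\<close> lies in the cone as well, so multiplying by
    it cancels its inverse.\<close>
  from pos_cone_mult[OF pw[OF bP, of l] this] have ak: "a [^]\<^bsub>UG\<^esub> k \<in> pos_cone"
    using ac bc by (simp add: inv_cancel_left)
  have "k * int m + 1 \<in> growth_set A \<alpha> a a 1" for m
  proof -
    have "a [^]\<^bsub>UG\<^esub> (k * int m + 1) = a \<otimes>\<^bsub>UG\<^esub> (a [^]\<^bsub>UG\<^esub> k) [^]\<^bsub>UG\<^esub> m"
      using ac int_pow_mult[of a 1 "k * int m"] by (simp add: int_pow_pow int_pow_int[symmetric] add.commute)
    then have "inv\<^bsub>UG\<^esub> a \<otimes>\<^bsub>UG\<^esub> a [^]\<^bsub>UG\<^esub> (k * int m + 1) = (a [^]\<^bsub>UG\<^esub> k) [^]\<^bsub>UG\<^esub> m"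
      using ac by (simp add: inv_cancel_left)
    then show ?thesis using pw[OF ak, of m] ac by (simp add: growth_set_def dominates_iff)
  qed
  moreover have "bdd_below (growth_set A \<alpha> a a 1)"
    using wd a unfolding growth_rates_well_defined_def by (metis order_refl)
  then obtain B where "\<And>x. x \<in> growth_set A \<alpha> a a 1 \<Longrightarrow> B \<le> x" unfolding bdd_below_def by blast
  ultimately have B: "B \<le> k * int m + 1" for m by blast
  \<comment> \<open>The exponent m = |B| + 2 gives k m + 1 \<le> - |B| - 1, which is below
    \<open>B\<close>.\<close>
  have "k * int (nat \<bar>B\<bar> + 2) \<le> (-1) * int (nat \<bar>B\<bar> + 2)" using k0 by (intro mult_right_mono) auto
  with B[of "nat \<bar>B\<bar> + 2"] show False by simp
qed

text \<open>\<open>rho_plus\<close> is a genuine limit by \<open>growth_rates_well_defined\<close>,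
  so bounds on the quotients pass to it; rounding up and the fixed excess \<open>N\<close> cost only
  O(1 / l).\<close>

lemma rho_plus_bounds:
  assumes wd: "growth_rates_well_defined A \<alpha>" and a: "a \<in> UCont_plus A \<alpha>" and b: "b \<in> UCont_plus A \<alpha>"
    and dom: "\<And>l. l \<ge> 1 \<Longrightarrow> \<lceil>C * real l\<rceil> + N \<in> growth_set A \<alpha> a b l"
  shows "0 \<le> rho_plus A \<alpha> a b" "rho_plus A \<alpha> a b \<le> C"
proof -
  define r where "r l = of_int (Inf (growth_set A \<alpha> a b l)) / real l" for l
  have g: "growth_set A \<alpha> a b l \<noteq> {}" "bdd_below (growth_set A \<alpha> a b l)" if "l \<ge> 1" for l
    using wd a b that by (simp_all add: growth_rates_well_defined_def)
  have "convergent r" using wd a b unfolding growth_rates_well_defined_def r_def[abs_def] by blast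
  then have lim: "r \<longlonglongrightarrow> rho_plus A \<alpha> a b"
    unfolding rho_plus_def r_def[abs_def] by (simp add: convergent_LIMSEQ_iff)
  have "0 \<le> r l" if "l \<ge> 1" for l
  proof -
    have "0 \<le> Inf (growth_set A \<alpha> a b l)"
      by (rule cInf_greatest[OF g(1)[OF that]]) (rule growth_set_nonneg[OF wd a b])
    then show ?thesis by (simp add: r_def)
  qed
  then show "0 \<le> rho_plus A \<alpha> a b" by (intro LIMSEQ_le_const[OF lim]) blast
  have "r l \<le> C + (of_int N + 1) / real l" if "l \<ge> 1" for l
  proof -
    have "Inf (growth_set A \<alpha> a b l) \<le> \<lceil>C * real l\<rceil> + N" by (rule cInf_lower[OF dom[OF that] g(2)[OF that]])
    then have "real_of_int (Inf (growth_set A \<alpha> a b l)) \<le> C * real l + 1 + of_int N" by linarith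
    then have "r l \<le> (C * real l + 1 + of_int N) / real l" unfolding r_def by (rule divide_right_mono) simp
    also have "\<dots> = C + (of_int N + 1) / real l" using that by (simp add: field_simps)
    finally show ?thesis .
  qed
  moreover have "(\<lambda>l. C + (of_int N + 1) / real l) \<longlonglongrightarrow> C + 0"
    by (intro tendsto_add tendsto_const lim_const_over_n)
  ultimately show "rho_plus A \<alpha> a b \<le> C"
    using LIMSEQ_le[OF lim, of "\<lambda>l. C + (of_int N + 1) / real l" C] by auto
qed

text \<open>With conformal factor 1 and \<open>h\<close> invariant under the isotopy, each further
  factor adds \<open>h y\<close> itself rather than a rescaled value at a moved point.\<close>

lemma contact_ham_funpow:
  assumes \<psi>: "\<psi> \<in> PCont0 A \<alpha>" and ham: "\<And>t y. t \<in> {0..1} \<Longrightarrow> contact_ham A \<alpha> \<psi> t y = h y"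
    and strict: "\<And>t. t \<in> {0..1} \<Longrightarrow> conformal A \<alpha> (\<psi> t) (\<lambda>_. 1)"
    and inv: "\<And>t y. t \<in> {0..1} \<Longrightarrow> h (\<psi> t y) = h y" and t: "t \<in> {0..1}"
  shows "contact_ham A \<alpha> (\<lambda>t. \<psi> t ^^ n) t y = real n * h y"
proof (induction n arbitrary: y)
  case 0
  then show ?case using contact_ham_const[OF A \<alpha> diffeo_id[OF A] t] by (simp add: id_def)
next
  case (Suc n)
  have "h y = h (inv_into UNIV (\<psi> t) y)"
    using inv[OF t, of "inv_into UNIV (\<psi> t) y"] bij_inv_cancel[OF PCont0_bij[OF \<psi> t]] by simp
  then show ?case
    using contact_ham_mult[OF \<psi> PCont0_funpow[OF \<psi>] t strict[OF t], of n y] Suc ham[OF t]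
    by (simp add: o_def algebra_simps)
qed

text \<open>The l-th power of b is the product of inv c, its conjugate, and c. One power
  \<open>a [^] N\<close> pays for each of the two outer factors.\<close>

lemma growth_set_conj:
  assumes a: "a \<in> carrier UG" and b: "b \<in> carrier UG" and c: "c \<in> carrier UG"
    and dom: "dominates A \<alpha> (a [^]\<^bsub>UG\<^esub> (k::nat)) (c \<otimes>\<^bsub>UG\<^esub> (b [^]\<^bsub>UG\<^esub> (l::nat) \<otimes>\<^bsub>UG\<^esub> inv\<^bsub>UG\<^esub> c))"
    and N: "dominates A \<alpha> (a [^]\<^bsub>UG\<^esub> (N::nat)) c" "dominates A \<alpha> (a [^]\<^bsub>UG\<^esub> N) (inv\<^bsub>UG\<^esub> c)"
  shows "int k + int (2 * N) \<in> growth_set A \<alpha> a b l"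
proof -
  interpret group UG by (rule group_UCont)
  let ?x = "c \<otimes>\<^bsub>UG\<^esub> (b [^]\<^bsub>UG\<^esub> l \<otimes>\<^bsub>UG\<^esub> inv\<^bsub>UG\<^esub> c)"
  have "dominates A \<alpha> (a [^]\<^bsub>UG\<^esub> N \<otimes>\<^bsub>UG\<^esub> (a [^]\<^bsub>UG\<^esub> k \<otimes>\<^bsub>UG\<^esub> a [^]\<^bsub>UG\<^esub> N))
      (inv\<^bsub>UG\<^esub> c \<otimes>\<^bsub>UG\<^esub> (?x \<otimes>\<^bsub>UG\<^esub> c))"
    using a b c by (intro dominates_mult dom N) simp_all
  moreover have "inv\<^bsub>UG\<^esub> c \<otimes>\<^bsub>UG\<^esub> (?x \<otimes>\<^bsub>UG\<^esub> c) = b [^]\<^bsub>UG\<^esub> l"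
    using b c by (simp add: m_assoc inv_cancel_left)
  moreover have "a [^]\<^bsub>UG\<^esub> N \<otimes>\<^bsub>UG\<^esub> (a [^]\<^bsub>UG\<^esub> k \<otimes>\<^bsub>UG\<^esub> a [^]\<^bsub>UG\<^esub> N) = a [^]\<^bsub>UG\<^esub> (N + (k + N))"
    using a by (simp add: nat_pow_mult)
  moreover have "a [^]\<^bsub>UG\<^esub> (int k + int (2 * N)) = a [^]\<^bsub>UG\<^esub> (N + (k + N))"
  proof -
    have "int k + int (2 * N) = int (N + (k + N))" by simp
    then show ?thesis by (simp only: int_pow_int)
  qed
  ultimately show ?thesis by (simp add: growth_set_def)
qed

end

section \<open>Deformation of the contact form along an isotopy\<close>

context
  fixes A :: "('m::{t2_space, second_countable_topology}, 'e::euclidean_space) chart set" and \<alpha> :: "('m, 'e) form1"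
  assumes A: "smooth_atlas A" and \<alpha>: "one_form A \<alpha>"
begin

text \<open>The smaller time set \<open>T'\<close> makes room for the open interval, over which the
  domain is open and exterior derivatives can be computed.\<close>

lemma plot_family_chart:
  fixes T :: "'p::euclidean_space set"
  assumes \<psi>: "smooth_family T UNIV A A \<psi>" and \<kappa>: "\<kappa> \<in> A" and T: "thick T" "thick T'" "T' \<subseteq> T"
  shows "plot A (T' \<times> coord \<kappa> ` cdom \<kappa>) (\<lambda>z. \<psi> (fst z) (param \<kappa> (snd z)))"
proof -
  have D: "thick (T' \<times> coord \<kappa> ` cdom \<kappa>)" using chart_times_thick[OF A T(2) \<kappa> open_UNIV] by simp
  show ?thesis
    by (rule plot_family[OF A A \<psi> _ D smooth_on_fst[OF D smooth_on_id[OF D]]])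
       (use plot_chart_times[OF A T(2) \<kappa> open_UNIV] T in auto)
qed

lemma lform_slice:
  fixes T :: "'p::euclidean_space set"
  assumes \<psi>: "smooth_family T UNIV A A \<psi>" and \<kappa>: "\<kappa> \<in> A" "y \<in> coord \<kappa> ` cdom \<kappa>"
    and T: "thick T" "thick T'" "T' \<subseteq> T" and t: "t \<in> T'"
  shows "lform A \<alpha> (T' \<times> coord \<kappa> ` cdom \<kappa>) (\<lambda>z. \<psi> (fst z) (param \<kappa> (snd z))) (t, y) (0, v) =
      lform A \<alpha> (coord \<kappa> ` cdom \<kappa>) (\<lambda>y. \<psi> t (param \<kappa> y)) y v"
    and "lform A \<alpha> (T' \<times> coord \<kappa> ` cdom \<kappa>) (\<lambda>z. \<psi> (fst z) (param \<kappa> (snd z))) (t, y) (r, 0) =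
      lform A \<alpha> T' (\<lambda>s. \<psi> s (param \<kappa> y)) t r"
proof -
  define C where "C = coord \<kappa> ` cdom \<kappa>"
  have C: "thick C" "y \<in> C" using open_chart_image[OF A \<kappa>(1) open_UNIV] \<kappa> by (simp_all add: C_def thick_open)
  have D: "thick (T' \<times> C)" by (intro thick_Times T C)
  have U: "plot A (T' \<times> C) (\<lambda>z. \<psi> (fst z) (param \<kappa> (snd z)))"
    using plot_family_chart[OF \<psi> \<kappa>(1) T] by (simp add: C_def)
  have fr: "frechet_derivative (\<lambda>y. (t, y)) (at y within C) = (\<lambda>h. (0, h))"
    by (rule thick_frechet_unique[OF C]) (auto intro!: derivative_eq_intros)
  have "lform A \<alpha> C (\<lambda>y. (\<lambda>z. \<psi> (fst z) (param \<kappa> (snd z))) (t, y)) y v =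
      lform A \<alpha> (T' \<times> C) (\<lambda>z. \<psi> (fst z) (param \<kappa> (snd z))) (t, y) (frechet_derivative (\<lambda>y. (t, y)) (at y within C) v)"
    by (rule lform_compose[OF A \<alpha> U D C(1) smooth_on_Pair[OF C(1) smooth_on_const[OF C(1)] smooth_on_id[OF C(1)]] _ C(2)])
       (use t in auto)
  then show "lform A \<alpha> (T' \<times> coord \<kappa> ` cdom \<kappa>) (\<lambda>z. \<psi> (fst z) (param \<kappa> (snd z))) (t, y) (0, v) =
      lform A \<alpha> (coord \<kappa> ` cdom \<kappa>) (\<lambda>y. \<psi> t (param \<kappa> y)) y v"
    unfolding fr by (simp add: C_def)
  have fr: "frechet_derivative (\<lambda>s. (s, y)) (at t within T') = (\<lambda>h. (h, 0))"
    by (rule thick_frechet_unique[OF T(2) t]) (auto intro!: derivative_eq_intros)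
  have "lform A \<alpha> T' (\<lambda>s. (\<lambda>z. \<psi> (fst z) (param \<kappa> (snd z))) (s, y)) t r =
      lform A \<alpha> (T' \<times> C) (\<lambda>z. \<psi> (fst z) (param \<kappa> (snd z))) (t, y) (frechet_derivative (\<lambda>s. (s, y)) (at t within T') r)"
    by (rule lform_compose[OF A \<alpha> U D T(2) smooth_on_Pair[OF T(2) smooth_on_id[OF T(2)] smooth_on_const[OF T(2)]] _ t])
       (use C in auto)
  then show "lform A \<alpha> (T' \<times> coord \<kappa> ` cdom \<kappa>) (\<lambda>z. \<psi> (fst z) (param \<kappa> (snd z))) (t, y) (r, 0) =
      lform A \<alpha> T' (\<lambda>s. \<psi> s (param \<kappa> y)) t r"
    unfolding fr by (simp add: C_def)
qed

text \<open>Cartan's formula is available at interior times only; continuity up to 0 and 1 lets a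
  vanishing derivative give constancy on the closed interval.\<close>

lemma continuous_on_pullback_family:
  fixes \<psi> :: "real \<Rightarrow> 'm \<Rightarrow> 'm"
  assumes \<psi>: "smooth_family {0..1} UNIV A A \<psi>" and \<kappa>: "\<kappa> \<in> A" "y \<in> coord \<kappa> ` cdom \<kappa>"
  shows "continuous_on {0..1} (\<lambda>s. lform A \<alpha> (coord \<kappa> ` cdom \<kappa>) (\<lambda>y. \<psi> s (param \<kappa> y)) y v)"
proof -
  let ?C = "coord \<kappa> ` cdom \<kappa>"
  have C: "thick ?C" using open_chart_image[OF A \<kappa>(1) open_UNIV] by (simp add: thick_open)
  have "continuous_on ({0..1} \<times> ?C) (\<lambda>z. lform A \<alpha> ({0..1} \<times> ?C) (\<lambda>z. \<psi> (fst z) (param \<kappa> (snd z))) z (0, v))"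
    by (intro smooth_on_imp_continuous smooth_on_lform[OF A \<alpha>] plot_family_chart[OF \<psi> \<kappa>(1)] thick_Times C
        thick_unit_interval subset_refl)
  moreover have "continuous_on {0..1} (\<lambda>s. (s, y))" "(\<lambda>s. (s, y)) ` {0..1} \<subseteq> {0..1} \<times> ?C"
    using \<kappa>(2) by (auto intro!: continuous_intros simp del: image_eqI)
  ultimately have "continuous_on {0..1} (\<lambda>s. lform A \<alpha> ({0..1} \<times> ?C) (\<lambda>z. \<psi> (fst z) (param \<kappa> (snd z))) (s, y) (0, v))"
    by (rule continuous_on_compose2)
  then show ?thesis
    by (rule continuous_on_cong[THEN iffD1, rotated 2])
       (auto intro: lform_slice(1)[OF \<psi> \<kappa> thick_unit_interval thick_unit_interval subset_refl])
qed

text \<open>The derivative of the pulled-back form is d(i_X \<alpha>) + i_X d\<alpha>. This is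
  \<open>ext_deriv1_plot\<close> for the plot (t, y) \<mapsto> \<psi> t (param \<kappa> y),
  evaluated on the time direction and on (0, v); on the time direction \<alpha> takes the value
  \<open>h\<close>.\<close>

lemma cartan_formula:
  fixes \<psi> :: "real \<Rightarrow> 'm \<Rightarrow> 'm" and \<kappa> :: "('m, 'e) chart"
  defines "D \<equiv> {0<..<1::real} \<times> coord \<kappa> ` cdom \<kappa>" and "U \<equiv> \<lambda>z. \<psi> (fst z) (param \<kappa> (snd z))"
  assumes \<psi>: "smooth_family {0..1} UNIV A A \<psi>" and \<kappa>: "\<kappa> \<in> A" "y \<in> coord \<kappa> ` cdom \<kappa>" and t: "t \<in> {0<..<1}"
    and \<mu>: "\<mu> \<in> A" "\<psi> t (param \<kappa> y) \<in> cdom \<mu>"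
    and h: "\<And>s y. s \<in> {0..1} \<Longrightarrow> y \<in> coord \<kappa> ` cdom \<kappa> \<Longrightarrow> lform A \<alpha> {0..1} (\<lambda>s. \<psi> s (param \<kappa> y)) s 1 = h (s, y)"
  shows "((\<lambda>s. lform A \<alpha> (coord \<kappa> ` cdom \<kappa>) (\<lambda>y. \<psi> s (param \<kappa> y)) y v) has_real_derivative
     frechet_derivative h (at (t, y)) (0, v) +
     ext_deriv1 \<alpha> \<mu> (\<psi> t (param \<kappa> y)) (dplot \<mu> D U (t, y) (1, 0)) (dplot \<mu> D U (t, y) (0, v))) (at t)"
proof -
  define C where "C = coord \<kappa> ` cdom \<kappa>"
  have C: "open C" using open_chart_image[OF A \<kappa>(1) open_UNIV] by (simp add: C_def)
  have oD: "open D" unfolding D_def by (intro open_Times) (use C in \<open>simp_all add: C_def\<close>)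
  have z: "(t, y) \<in> D" using t \<kappa> by (simp add: D_def)
  have T': "thick {0<..<1::real}" "{0<..<1::real} \<subseteq> {0..1}" by (auto intro: thick_open)
  have U: "plot A D U" unfolding D_def U_def by (rule plot_family_chart[OF \<psi> \<kappa>(1) thick_unit_interval T'])
  define g where "g z = lform A \<alpha> D U z (0, v)" for z
  have g: "smooth_on D g" unfolding g_def by (rule smooth_on_lform[OF A \<alpha> U thick_open[OF oD]])
  have h': "lform A \<alpha> D U z (1, 0) = h z" if zD: "z \<in> D" for z
  proof -
    obtain s y where zs: "z = (s, y)" "s \<in> {0<..<1}" "y \<in> C" using zD by (force simp: D_def C_def)
    \<comment> \<open>At an interior time the velocities within the open and the closed interval
      agree.\<close>
    have "lform A \<alpha> D U z (1, 0) = lform A \<alpha> ({0..1} \<inter> {0<..<1}) (\<lambda>s. \<psi> s (param \<kappa> y)) s 1"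
      using lform_slice(2)[OF \<psi> \<kappa>(1) _ thick_unit_interval T' zs(2), of y 1] zs
      by (simp add: D_def U_def C_def Int_absorb1[OF T'(2)] Int_commute[of "{0..1}"] Int_absorb2[OF T'(2)])
    also have "\<dots> = lform A \<alpha> {0..1} (\<lambda>s. \<psi> s (param \<kappa> y)) s 1"
      by (rule lform_Int_open[OF zs(2)]) simp
    finally show ?thesis using h[of s y] zs by (simp add: C_def)
  qed
  have "((\<lambda>s. g ((0, y) + s *\<^sub>R (1, 0))) has_real_derivative frechet_derivative g (at (t, y)) (1, 0)) (at t)"
    using smooth_on_open_has_derivative[OF g oD z] by (intro has_derivative_line) simp
  moreover have "g ((0, y) + s *\<^sub>R (1, 0)) = lform A \<alpha> C (\<lambda>y. \<psi> s (param \<kappa> y)) y v" if "s \<in> {0<..<1}" for s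
    unfolding g_def D_def U_def C_def using lform_slice(1)[OF \<psi> \<kappa> thick_unit_interval T' that] by simp
  ultimately have "((\<lambda>s. lform A \<alpha> C (\<lambda>y. \<psi> s (param \<kappa> y)) y v) has_real_derivative frechet_derivative g (at (t, y)) (1, 0)) (at t)"
    by (rule has_field_derivative_transform_within_open[OF _ open_greaterThanLessThan t])
  moreover have "frechet_derivative g (at (t, y)) (1, 0) = frechet_derivative h (at (t, y)) (0, v) +
     ext_deriv1 \<alpha> \<mu> (\<psi> t (param \<kappa> y)) (dplot \<mu> D U (t, y) (1, 0)) (dplot \<mu> D U (t, y) (0, v))"
    using ext_deriv1_plot[OF A \<alpha> U oD z \<mu>(1), of "(0, v)" "(1, 0)"] \<mu>(2)
      frechet_derivative_cong_open[OF oD z h'] by (simp add: U_def g_def[abs_def])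
  ultimately show ?thesis by (simp add: C_def)
qed

end

section \<open>Prequantization spaces\<close>

text \<open>The complement of \<open>U\<close> is compact, so finitely many of the open sets
  separating its points from x cover it. Intersecting their partners gives \<open>V\<close>, and the
  complement of the cover gives \<open>K\<close>.\<close>

lemma compact_neighbourhood:
  fixes U :: "'x::t2_space set"
  assumes X: "compact (UNIV :: 'x set)" and U: "open U" "x \<in> U"
  obtains V K where "open V" "x \<in> V" "V \<subseteq> K" "compact K" "K \<subseteq> U"
proof -
  have cU: "compact (- U)" using compact_Int_closed[OF X, of "- U"] U by (simp add: closed_Compl)
  have "\<forall>y\<in>-U. \<exists>V W. open V \<and> open W \<and> x \<in> V \<and> y \<in> W \<and> V \<inter> W = {}"
    using U by (metis ComplD hausdorff)
  then obtain V W where VW: "\<And>y. y \<in> -U \<Longrightarrow> open (V y) \<and> open (W y) \<and> x \<in> V y \<and> y \<in> W y \<and> V y \<inter> W y = {}"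
    by metis
  obtain F where F: "F \<subseteq> -U" "finite F" "-U \<subseteq> (\<Union>y\<in>F. W y)"
    using compactE_image[OF cU, of "-U" W] VW by blast
  define V' where "V' = (\<Inter>y\<in>F. V y)"
  define K where "K = - (\<Union>y\<in>F. W y)"
  show ?thesis
  proof
    show "open V'" unfolding V'_def using F VW by (intro open_INT) auto
    show "x \<in> V'" unfolding V'_def using F VW by auto
    show "V' \<subseteq> K" unfolding V'_def K_def using F VW by blast
    have "closed K" unfolding K_def using F VW by (intro closed_Compl open_UN) auto
    then show "compact K" using compact_Int_closed[OF X, of K] by simp
    show "K \<subseteq> U" using F(3) by (auto simp: K_def)
  qed
qed

section \<open>Trivializations and compactness of the total space\<close>

locale prequantization_space =
  fixes AX :: "('x::{t2_space, second_countable_topology}, 'e::euclidean_space) chart set"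
    and \<omega> :: "('x, 'e) form2"
    and AM :: "('m::{t2_space, second_countable_topology}, 'f::euclidean_space) chart set"
    and \<alpha> :: "('m, 'f) form1"
    and R :: "real \<Rightarrow> 'm \<Rightarrow> 'm"
    and p :: "'m \<Rightarrow> 'x"
  assumes preq: "prequantization AX \<omega> AM \<alpha> R p"
begin

lemma AX: "smooth_atlas AX" and AM: "smooth_atlas AM" and compact_X: "compact (UNIV :: 'x set)"
  and circle_bundle: "principal_circle_bundle AM AX R p" and contact: "contact_form AM \<alpha>" and \<alpha>: "one_form AM \<alpha>"
  and symplectic: "symplectic_form AX \<omega>"
  using preq by (auto simp: prequantization_def contact_form_def)

lemma R_family: "smooth_family UNIV UNIV AM AM R" and R_zero: "R 0 m = m" and R_add: "R (s + t) m = R s (R t m)"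
  and p_smooth: "smooth_map UNIV AM AX p" and p_R [simp]: "p (R s m) = p m"
  using circle_bundle by (auto simp: principal_circle_bundle_def)

lemma R_smooth: "smooth_map UNIV AM AM (R s)"
  by (rule smooth_map_of_family[OF AM AM R_family _ open_UNIV]) simp

lemma R_strict: "conformal AM \<alpha> (R s) (\<lambda>_. 1)"
  using preq by (simp add: prequantization_def conformal_def)

lemma p_continuous: "continuous_on UNIV p"
  using p_smooth by (simp add: smooth_map_def)

lemma open_p_vimage: "open U \<Longrightarrow> open (p -` U)"
  using p_continuous by (simp add: continuous_on_open_vimage)

definition trivialization :: "'x set \<Rightarrow> ('m \<Rightarrow> complex) \<Rightarrow> (real \<Rightarrow> 'x \<Rightarrow> 'm) \<Rightarrow> bool" where
  "trivialization U \<tau> \<sigma> \<longleftrightarrow> open U \<and>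
        smooth_map (p -` U) AM std_atlas \<tau> \<and> smooth_family UNIV U AX AM \<sigma> \<and>
        (\<forall>m\<in>p -` U. cmod (\<tau> m) = 1 \<and> (\<forall>\<theta>. \<tau> (R \<theta> m) = cis \<theta> * \<tau> m)) \<and>
        (\<forall>y\<in>U. \<forall>\<theta>. p (\<sigma> \<theta> y) = y \<and> \<tau> (\<sigma> \<theta> y) = cis \<theta>) \<and>
        (\<forall>m\<in>p -` U. \<forall>\<theta>. \<tau> m = cis \<theta> \<longrightarrow> \<sigma> \<theta> (p m) = m)"

lemma trivialization_ex:
  obtains U \<tau> \<sigma> where "x \<in> U" "trivialization U \<tau> \<sigma>"
proof -
  have "\<exists>U \<tau> \<sigma>. x \<in> U \<and> trivialization U \<tau> \<sigma>"
    using circle_bundle unfolding principal_circle_bundle_def trivialization_def by blast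
  then show ?thesis using that by blast
qed

lemma trivializationD:
  assumes "trivialization U \<tau> \<sigma>"
  shows "open U" "smooth_map (p -` U) AM std_atlas \<tau>" "smooth_family UNIV U AX AM \<sigma>"
    "p m \<in> U \<Longrightarrow> cmod (\<tau> m) = 1" "p m \<in> U \<Longrightarrow> \<tau> (R \<theta> m) = cis \<theta> * \<tau> m"
    "y \<in> U \<Longrightarrow> p (\<sigma> \<theta> y) = y" "y \<in> U \<Longrightarrow> \<tau> (\<sigma> \<theta> y) = cis \<theta>"
    "p m \<in> U \<Longrightarrow> \<tau> m = cis \<theta> \<Longrightarrow> \<sigma> \<theta> (p m) = m"
  using assms by (simp_all add: trivialization_def)

lemma trivialization_inj:
  assumes "trivialization U \<tau> \<sigma>" "p m \<in> U" "p m' = p m" "\<tau> m' = \<tau> m"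
  shows "m' = m"
proof -
  obtain \<theta> where \<theta>: "\<tau> m = cis \<theta>" using unit_complex_cis[OF trivializationD(4)[OF assms(1,2)]] by blast
  have "\<sigma> \<theta> (p m) = m" by (rule trivializationD(8)[OF assms(1,2) \<theta>])
  moreover have "\<sigma> \<theta> (p m') = m'" by (rule trivializationD(8)[OF assms(1)]) (use assms(2-4) \<theta> in auto)
  ultimately show ?thesis using assms(3) by simp
qed

text \<open>Over a compact subset K of a trivializing set, the preimage lies in the image of
  [0, 2 pi] times K under the inverse trivialization. Finitely many such images cover the total
  space.\<close>

lemma compact_M: "compact (UNIV :: 'm set)"
proof -
  have "\<exists>V. open V \<and> x \<in> V \<and> (\<exists>L. compact L \<and> p -` V \<subseteq> L)" for x
  proof -
    obtain U \<tau> \<sigma> where U: "x \<in> U" "trivialization U \<tau> \<sigma>" by (rule trivialization_ex)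
    then have oU: "open U" by (simp add: trivialization_def)
    obtain V K where V: "open V" "x \<in> V" "V \<subseteq> K" "compact K" "K \<subseteq> U"
      using compact_neighbourhood[OF compact_X oU U(1)] .
    define L where "L = (\<lambda>(t, y). \<sigma> t y) ` ({0..2 * pi} \<times> K)"
    have "continuous_on (UNIV \<times> U) (\<lambda>(t, y). \<sigma> t y)" using U(2) by (simp add: trivialization_def smooth_family_def)
    then have "continuous_on ({0..2 * pi} \<times> K) (\<lambda>(t, y). \<sigma> t y)" by (rule continuous_on_subset) (use V(5) in auto)
    then have "compact L" unfolding L_def by (rule compact_continuous_image) (rule compact_Times[OF compact_Icc V(4)])
    moreover have "p -` V \<subseteq> L"
    proof
      fix m assume "m \<in> p -` V"
      then have m: "p m \<in> K" "p m \<in> U" using V by auto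
      then have "cmod (\<tau> m) = 1" using U(2) by (auto simp: trivialization_def)
      then obtain \<theta> where \<theta>: "0 \<le> \<theta>" "\<theta> \<le> 2 * pi" "\<tau> m = cis \<theta>" by (rule unit_complex_cis)
      have "\<sigma> \<theta> (p m) = m" using U(2) m \<theta> by (auto simp: trivialization_def)
      then show "m \<in> L" unfolding L_def using \<theta> m by (intro image_eqI[of _ _ "(\<theta>, p m)"]) auto
    qed
    ultimately show ?thesis using V by blast
  qed
  then obtain V L where VL: "\<And>x. open (V x) \<and> x \<in> V x \<and> compact (L x) \<and> p -` V x \<subseteq> L x" by metis
  obtain F where F: "finite F" "UNIV \<subseteq> (\<Union>x\<in>F. V x)"
  proof (rule compactE_image[OF compact_X])
    show "open (V x)" for x using VL by blast
    show "UNIV \<subseteq> (\<Union>x. V x)" using VL by blast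
  qed blast
  have "UNIV \<subseteq> (\<Union>x\<in>F. L x)"
  proof
    fix m :: 'm
    obtain x where "x \<in> F" "p m \<in> V x" using F by blast
    then show "m \<in> (\<Union>x\<in>F. L x)" using VL[of x] by blast
  qed
  moreover have "compact (\<Union>x\<in>F. L x)" using F VL by (intro compact_UN) auto
  ultimately show ?thesis by (simp add: top.extremum_unique)
qed

section \<open>Vertical vectors and the generator of the circle action\<close>

lemma dalpha_eq:
  assumes "\<kappa> \<in> AM" "m \<in> cdom \<kappa>"
  shows "ext_deriv1 \<alpha> \<kappa> m v w = \<omega> (chart_at AX (p m)) (p m) (tangent_map \<kappa> (chart_at AX (p m)) p m v)
     (tangent_map \<kappa> (chart_at AX (p m)) p m w)"
  using preq assms by (simp add: prequantization_def pullback2_def Let_def)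

lemma omega_bilinear: "\<mu> \<in> AX \<Longrightarrow> x \<in> cdom \<mu> \<Longrightarrow> bilinear (\<omega> \<mu> x)"
  using symplectic by (auto simp: symplectic_form_def two_form_def)

lemma dalpha_self: "\<kappa> \<in> AM \<Longrightarrow> m \<in> cdom \<kappa> \<Longrightarrow> ext_deriv1 \<alpha> \<kappa> m v v = 0"
  by (simp add: ext_deriv1_def)

lemma dalpha_vertical:
  assumes \<kappa>: "\<kappa> \<in> AM" "m \<in> cdom \<kappa>" and v: "tangent_map \<kappa> (chart_at AX (p m)) p m v = 0"
  shows "ext_deriv1 \<alpha> \<kappa> m v w = 0" "ext_deriv1 \<alpha> \<kappa> m w v = 0"
  using bilinear_lzero[OF omega_bilinear[OF chart_at[OF AX]]] bilinear_rzero[OF omega_bilinear[OF chart_at[OF AX]]]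
  by (simp_all add: dalpha_eq[OF \<kappa>] v)

text \<open>A vertical vector is in the kernel of d\<alpha>. Were a nonzero one annihilated by
  \<alpha> too, it would contradict nondegeneracy of d\<alpha> on the contact hyperplane.\<close>

lemma alpha_vertical:
  assumes \<kappa>: "\<kappa> \<in> AM" "m \<in> cdom \<kappa>" and v: "tangent_map \<kappa> (chart_at AX (p m)) p m v = 0" "v \<noteq> 0"
  shows "\<alpha> \<kappa> m v \<noteq> 0"
  using contact \<kappa> dalpha_vertical(1)[OF \<kappa> v(1)] v(2) unfolding contact_form_def by blast

definition vert :: "('m, 'f) chart \<Rightarrow> 'm \<Rightarrow> 'f" where
  "vert \<kappa> m = dplot \<kappa> UNIV (\<lambda>s. R s m) 0 1"

lemma plot_orbit: "plot AM UNIV (\<lambda>s. R s m)"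
  by (rule plot_curve[OF AM R_family thick_UNIV])

lemma dplot_const:
  assumes "thick D" "z \<in> D" shows "dplot \<kappa> D (\<lambda>_. x) z v = 0"
  using dplot_eqI[OF assms, of \<kappa> "\<lambda>_. x" "\<lambda>_. 0"] by simp

lemma tangent_vert_invariant:
  assumes F: "smooth_map UNIV AM B F" and B: "smooth_atlas B" and inv: "\<And>s. F (R s m) = F m"
    and \<kappa>: "\<kappa> \<in> AM" "m \<in> cdom \<kappa>" and \<mu>: "\<mu> \<in> B" "F m \<in> cdom \<mu>"
  shows "tangent_map \<kappa> \<mu> F m (vert \<kappa> m) = 0"
  using dplot_map[OF AM B F plot_orbit thick_UNIV open_UNIV _ _ \<kappa>(1) _ \<mu>(1), of m 0 1] \<kappa> \<mu>
    dplot_const[OF thick_UNIV UNIV_I, of \<mu> "F m" "0::real" 1] by (simp add: inv R_zero vert_def)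

lemma p_vert:
  assumes \<kappa>: "\<kappa> \<in> AM" "m \<in> cdom \<kappa>" shows "tangent_map \<kappa> (chart_at AX (p m)) p m (vert \<kappa> m) = 0"
  by (rule tangent_vert_invariant[OF p_smooth AX p_R \<kappa> chart_at[OF AX]])

text \<open>Along an orbit the circle coordinate of a trivialization turns with velocity \<i> times
  \<open>\<tau> m\<close>, which is nonzero; a vanishing generator would not allow this.\<close>

lemma vert_nonzero:
  assumes \<kappa>: "\<kappa> \<in> AM" "m \<in> cdom \<kappa>"
  shows "vert \<kappa> m \<noteq> 0"
proof
  assume z: "vert \<kappa> m = 0"
  obtain U \<tau> \<sigma> where U: "p m \<in> U" "trivialization U \<tau> \<sigma>" by (rule trivialization_ex)
  let ?\<mu> = "(UNIV, \<lambda>x. x) :: (complex, complex) chart"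
  note \<tau> = trivializationD(2)[OF U(2)] open_p_vimage[OF trivializationD(1)[OF U(2)]] trivializationD(5)[OF U(2,1)]
  have \<tau>m: "\<tau> m \<noteq> 0" using trivializationD(4)[OF U(2,1)] by auto
  have eq: "dplot ?\<mu> UNIV (\<lambda>s. \<tau> (R s m)) 0 v = tangent_map \<kappa> ?\<mu> \<tau> m (dplot \<kappa> UNIV (\<lambda>s. R s m) 0 v)" for v
  proof -
    have "dplot ?\<mu> UNIV (\<lambda>s. \<tau> (R s m)) 0 v = tangent_map \<kappa> ?\<mu> \<tau> (R 0 m) (dplot \<kappa> UNIV (\<lambda>s. R s m) 0 v)"
      by (rule dplot_map[OF AM smooth_atlas_std \<tau>(1) plot_orbit thick_UNIV \<tau>(2) _ UNIV_I \<kappa>(1)])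
         (use \<kappa> U(1) in \<open>auto simp: R_zero std_atlas_def\<close>)
    then show ?thesis by (simp add: R_zero)
  qed
  have "dplot \<kappa> UNIV (\<lambda>s. R s m) 0 0 = 0"
    by (rule linear_0[OF dplot_linear[OF AM plot_orbit UNIV_I \<kappa>(1)]]) (simp add: R_zero \<kappa>(2))
  then have same: "dplot ?\<mu> UNIV (\<lambda>s. \<tau> (R s m)) 0 1 = dplot ?\<mu> UNIV (\<lambda>s. \<tau> (R s m)) 0 0"
    using eq[of 0] eq[of 1] z by (simp add: vert_def)
  have "((\<lambda>s. \<tau> (R s m)) has_derivative (\<lambda>h. h *\<^sub>R (\<i> * \<tau> m))) (at 0)"
  proof -
    have "((\<lambda>s. exp (\<i> * of_real s)) has_vector_derivative \<i> * exp (\<i> * of_real 0)) (at 0)"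
      by (rule has_vector_derivative_real_field) (auto intro!: derivative_eq_intros)
    from has_vector_derivative_mult_left[OF this, of "\<tau> m"]
    show ?thesis by (simp add: \<tau>(3) has_vector_derivative_def cis_conv_exp)
  qed
  then have "((\<lambda>s. coord ?\<mu> (\<tau> (R s m))) has_derivative (\<lambda>h. h *\<^sub>R (\<i> * \<tau> m))) (at 0 within UNIV)" by simp
  from dplot_eqI[OF thick_UNIV UNIV_I this] same \<tau>m show False by simp
qed

text \<open>The value of \<alpha> on the generator of the circle action.
  \<open>prequantization\<close> does not prescribe it, so the lifting argument divides by it
  instead of assuming the value 1.\<close>

definition zeta :: "'m \<Rightarrow> real" where
  "zeta m = lform AM \<alpha> UNIV (\<lambda>s. R s m) 0 1"

lemma zeta_eq:
  assumes \<kappa>: "\<kappa> \<in> AM" "m \<in> cdom \<kappa>"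
  shows "zeta m = \<alpha> \<kappa> m (vert \<kappa> m)"
  using lform_eq[OF AM \<alpha> plot_orbit[of m] thick_UNIV UNIV_I \<kappa>(1), where z = 0 and v = 1] \<kappa>(2) by (simp add: zeta_def vert_def R_zero)

lemma zeta_nonzero: "zeta m \<noteq> 0"
  using alpha_vertical[OF chart_at[OF AM] p_vert[OF chart_at[OF AM]] vert_nonzero[OF chart_at[OF AM]]]
    zeta_eq[OF chart_at[OF AM]] by simp

text \<open>Cartan's formula on the vertical vector shows that the conformal factor is constant in time;
  on the velocity it then gives conservation of the Hamiltonian.\<close>

lemma autonomous_isotopy:
  assumes \<psi>: "\<psi> \<in> PCont0 AM \<alpha>" and H: "smooth_map UNIV AX std_atlas H"
    and ham: "\<And>t y. t \<in> {0..1} \<Longrightarrow> contact_ham AM \<alpha> \<psi> t y = H (p y)" and t: "t \<in> {0..1}"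
  shows "conformal AM \<alpha> (\<psi> t) (\<lambda>_. 1)" and "H (p (\<psi> t x)) = H (p x)"
proof -
  note F = contact_familiesD[OF \<psi>[unfolded PCont0_iff, THEN conjunct1]]
  have \<psi>0: "\<psi> 0 = (\<lambda>x. x)" using \<psi> by (auto simp: PCont0_iff)
  let ?\<nu> = "(UNIV, \<lambda>x. x) :: (real, real) chart"
  have \<nu>: "?\<nu> \<in> std_atlas" by (simp add: std_atlas_def)
  have Hp: "smooth_map UNIV AM std_atlas (\<lambda>m. H (p m))"
    by (rule smooth_map_compose[OF AM AX smooth_atlas_std H p_smooth open_UNIV])
  have main: "lform AM \<alpha> (coord \<kappa> ` cdom \<kappa>) (\<lambda>y. \<psi> t (param \<kappa> y)) y v = \<alpha> \<kappa> (param \<kappa> y) v \<and>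
      H (p (\<psi> t (param \<kappa> y))) = H (p (param \<kappa> y))"
    if \<kappa>: "\<kappa> \<in> AM" and y: "y \<in> coord \<kappa> ` cdom \<kappa>" and t: "t \<in> {0..1}" for \<kappa> y t v
  proof -
    define C where "C = coord \<kappa> ` cdom \<kappa>"
    have C: "open C" "thick C" "y \<in> C" using open_chart_image[OF AM \<kappa> open_UNIV] y by (simp_all add: C_def thick_open)
    define D where "D = {0<..<1::real} \<times> C"
    define U where "U = (\<lambda>z. \<psi> (fst z) (param \<kappa> (snd z)))"
    have oD: "open D" unfolding D_def by (intro open_Times) (use C in simp_all)
    have T': "thick {0<..<1::real}" "{0<..<1::real} \<subseteq> {0..1}" by (auto intro: thick_open)
    have U: "plot AM D U" unfolding D_def U_def C_def
      by (rule plot_family_chart[OF AM \<alpha> F(1) \<kappa> thick_unit_interval T'])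
    define h where "h z = H (p (U z))" for z
    have h: "lform AM \<alpha> {0..1} (\<lambda>s. \<psi> s (param \<kappa> y)) s 1 = h (s, y)" if s: "s \<in> {0..1}" for s y
      using contact_ham_eq[OF AM \<alpha> F(1) s bij_is_inj[OF F(4)[OF s]], of "param \<kappa> y"] ham[OF s]
      by (simp add: h_def U_def)
    define f where "f v s = lform AM \<alpha> C (\<lambda>y. \<psi> s (param \<kappa> y)) y v" for v s
    have fc: "\<exists>c>0. \<forall>v. f v s = c * \<alpha> \<kappa> (param \<kappa> y) v" if s: "s \<in> {0..1}" for s
    proof -
      obtain c where c: "conformal AM \<alpha> (\<psi> s) c" "\<And>x. c x > 0" using PCont0_conformal[OF AM \<alpha> compact_M \<psi> s] by blast
      have "smooth_map UNIV AM AM (\<psi> s)" using F(3)[OF s] by (simp add: diffeo_def)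
      from conformal_lform[OF AM \<alpha> c(1) this _ C(2,3)] plot_chart[OF AM \<kappa> open_UNIV] lform_param[OF AM \<alpha> \<kappa> y]
      have "f v s = c (param \<kappa> y) * \<alpha> \<kappa> (param \<kappa> y) v" for v unfolding f_def by (simp add: C_def)
      then show ?thesis using c(2) by blast
    qed
    have deriv: "(f v has_real_derivative 0) (at s) \<and> ((\<lambda>s. h (s, y)) has_real_derivative 0) (at s)"
      if s: "s \<in> {0<..<1}" for s v
    proof -
      define n where "n = \<psi> s (param \<kappa> y)"
      define \<mu> where "\<mu> = chart_at AM n"
      have \<mu>: "\<mu> \<in> AM" "n \<in> cdom \<mu>" using chart_at[OF AM] by (auto simp: \<mu>_def)
      have sI: "s \<in> {0..1}" using s by simp
      have z: "(s, y) \<in> D" "U (s, y) = n" using s C by (simp_all add: D_def U_def n_def)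
      define L where "L v = dplot \<mu> D U (s, y) (0, v)" for v
      define N where "N = dplot \<mu> D U (s, y) (1, 0)"
      define dh where "dh W = tangent_map \<mu> ?\<nu> (\<lambda>m. H (p m)) n W" for W
      have dh: "frechet_derivative h (at (s, y)) w = dh (dplot \<mu> D U (s, y) w)" for w
      proof -
        have "frechet_derivative h (at (s, y)) w = dplot ?\<nu> D (\<lambda>z. H (p (U z))) (s, y) w"
          unfolding dplot_def h_def[abs_def] using at_within_open[OF z(1) oD] by simp
        also have "\<dots> = tangent_map \<mu> ?\<nu> (\<lambda>m. H (p m)) (U (s, y)) (dplot \<mu> D U (s, y) w)"
          by (rule dplot_map[OF AM smooth_atlas_std Hp U thick_open[OF oD] open_UNIV _ z(1) \<mu>(1) _ \<nu>]) (use z \<mu> in auto)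
        finally show ?thesis by (simp add: dh_def z)
      qed
      \<comment> \<open>Cartan's formula: the Hamiltonian term is the differential of H \<circ> p,
        and both terms depend on v only through its image \<open>L v\<close>.\<close>
      have fd: "(f v has_real_derivative dh (L v) + ext_deriv1 \<alpha> \<mu> n N (L v)) (at s)" for v
        using cartan_formula[OF AM \<alpha> F(1) \<kappa> y s \<mu>(1), of h v] \<mu>(2) h dh[of "(0, v)"]
        by (simp add: f_def[abs_def] C_def[symmetric] D_def[symmetric] U_def[symmetric] n_def[symmetric] L_def N_def)
      have uC: "plot AM C (\<lambda>y. \<psi> s (param \<kappa> y))"
        using plot_map[OF AM AM _ plot_chart[OF AM \<kappa> open_UNIV] _ open_UNIV, of "\<psi> s"] F(3)[OF sI] C(2)
        by (simp add: diffeo_def C_def)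
      have Leq: "L v = dplot \<mu> C (\<lambda>y. \<psi> s (param \<kappa> y)) y v" for v
      proof -
        have fr: "frechet_derivative (\<lambda>y. (s, y)) (at y within C) = (\<lambda>h. (0, h))"
          by (rule thick_frechet_unique[OF C(2,3)]) (auto intro!: derivative_eq_intros)
        have "dplot \<mu> C (\<lambda>y. U (s, y)) y v = dplot \<mu> D U (s, y) (frechet_derivative (\<lambda>y. (s, y)) (at y within C) v)"
          by (rule dplot_compose[OF AM U C(2) smooth_on_Pair[OF C(2) smooth_on_const[OF C(2)] smooth_on_id[OF C(2)]] _ C(3) \<mu>(1)])
             (use s z \<mu> in \<open>auto simp: D_def\<close>)
        then show ?thesis unfolding fr by (simp add: L_def U_def)
      qed
      have Llin: "linear L"
        using dplot_linear[OF AM uC C(3) \<mu>(1)] \<mu>(2) unfolding Leq[abs_def] n_def by simp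
      have "v = 0" if "L v = 0" for v
      proof (rule diffeo_tangent_inj[OF AM F(3)[OF sI] \<kappa> param_in_cdom[OF AM \<kappa> y] \<mu>(1)])
        show "\<psi> s (param \<kappa> y) \<in> cdom \<mu>" using \<mu>(2) by (simp add: n_def)
        show "tangent_map \<kappa> \<mu> (\<psi> s) (param \<kappa> y) v = 0"
          using dplot_map_param[OF AM _ \<kappa> y \<mu>(1), of "\<psi> s" v] F(3)[OF sI] \<mu>(2) that Leq[of v]
          by (simp add: diffeo_def C_def n_def)
      qed
      then have "inj L" using linear_injective_0[OF Llin] by blast
      then have surj: "surj L" by (rule linear_inj_imp_surj[OF Llin])
      \<comment> \<open>A vector carried to the generator at this one time. Both terms of the
        formula vanish on it: H \<circ> p is constant along fibres, and d\<alpha> kills vertical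
        vectors.\<close>
      obtain vZ where vZ: "L vZ = vert \<mu> n" using surj by (metis surjD)
      have dhZ: "dh (vert \<mu> n) = 0" unfolding dh_def
        by (rule tangent_vert_invariant[OF Hp smooth_atlas_std _ \<mu> \<nu>]) simp_all
      have fZ: "(f vZ has_real_derivative 0) (at s)"
        using fd[of vZ] by (simp add: vZ dhZ dalpha_vertical(2)[OF \<mu> p_vert[OF \<mu>]])
      obtain c where c: "c > 0" "\<And>v. f v s = c * \<alpha> \<kappa> (param \<kappa> y) v" using fc[OF sI] by blast
      have "f vZ s = zeta n"
        using lform_eq[OF AM \<alpha> uC C(2,3) \<mu>(1), of vZ] \<mu>(2) Leq[of vZ] zeta_eq[OF \<mu>] by (simp add: f_def vZ n_def)
      then have aZ: "\<alpha> \<kappa> (param \<kappa> y) vZ \<noteq> 0" using c(2)[of vZ] zeta_nonzero[of n] by auto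
      \<comment> \<open>At each time \<open>f v\<close> is the conformal factor times a number
        depending on v alone, so the derivatives for different v are proportional. As that number is
        nonzero for \<open>vZ\<close>, one vanishing derivative settles all of them.\<close>
      have f0: "(f v has_real_derivative 0) (at s)" for v
      proof -
        have "((\<lambda>r. \<alpha> \<kappa> (param \<kappa> y) v / \<alpha> \<kappa> (param \<kappa> y) vZ * f vZ r) has_real_derivative
            \<alpha> \<kappa> (param \<kappa> y) v / \<alpha> \<kappa> (param \<kappa> y) vZ * 0) (at s)" by (rule DERIV_cmult[OF fZ])
        moreover have "\<alpha> \<kappa> (param \<kappa> y) v / \<alpha> \<kappa> (param \<kappa> y) vZ * f vZ r = f v r" if "r \<in> {0<..<1}" for r
        proof -
          from that have "r \<in> {0..1}" by simp
          from fc[OF this] obtain c where "\<And>v. f v r = c * \<alpha> \<kappa> (param \<kappa> y) v" by blast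
          then show ?thesis using aZ by simp
        qed
        ultimately have "(f v has_real_derivative \<alpha> \<kappa> (param \<kappa> y) v / \<alpha> \<kappa> (param \<kappa> y) vZ * 0) (at s)"
          by (rule has_field_derivative_transform_within_open[OF _ open_greaterThanLessThan s])
        then show ?thesis by simp
      qed
      \<comment> \<open>On the velocity itself the term d\<alpha>(N, N) drops out, and what remains
        is the time derivative of the Hamiltonian.\<close>
      obtain vN where vN: "L vN = N" using surj by (metis surjD)
      have "dh N = 0" using DERIV_unique[OF fd[of vN] f0[of vN]] by (simp add: vN dalpha_self[OF \<mu>])
      then have "frechet_derivative h (at (s, y)) (1, 0) = 0" using dh[of "(1, 0)"] by (simp add: N_def)
      moreover have "smooth_on D h"
        using plot_map[OF AM smooth_atlas_std Hp U thick_open[OF oD] open_UNIV] by (simp add: plot_std h_def[abs_def])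
      then have "(h has_derivative frechet_derivative h (at (s, y))) (at ((0, y) + s *\<^sub>R (1, 0)))"
        using smooth_on_open_has_derivative[OF _ oD z(1)] by simp
      ultimately have "((\<lambda>s. h ((0, y) + s *\<^sub>R (1, 0))) has_real_derivative 0) (at s)"
        using has_derivative_line[of h "frechet_derivative h (at (s, y))" "(0, y)" s "(1, 0)"] by simp
      then show ?thesis using f0 by simp
    qed
    have contf: "continuous_on {0..1} (f v)"
      unfolding f_def[abs_def] C_def by (rule continuous_on_pullback_family[OF AM \<alpha> F(1) \<kappa> y])
    have conth: "continuous_on {0..1} (\<lambda>s. h (s, y))"
    proof -
      have "plot AM {0..1} (\<lambda>s. \<psi> s (param \<kappa> y))" by (rule plot_curve[OF AM F(1) thick_unit_interval])
      from plot_map[OF AM smooth_atlas_std Hp this thick_unit_interval open_UNIV]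
      show ?thesis by (simp add: plot_std h_def U_def smooth_on_imp_continuous)
    qed
    have "f v t = f v 0" by (rule DERIV_isconst2[OF zero_less_one contf]) (use deriv t in auto)
    moreover have "h (t, y) = h (0, y)" by (rule DERIV_isconst2[OF zero_less_one conth]) (use deriv t in auto)
    ultimately show ?thesis
      using lform_param[OF AM \<alpha> \<kappa> y, of v] by (simp add: f_def h_def U_def \<psi>0 C_def)
  qed
  show "conformal AM \<alpha> (\<psi> t) (\<lambda>_. 1)"
    by (rule conformalI[OF AM \<alpha>]) (use main t F(3)[OF t] in \<open>auto simp: diffeo_def\<close>)
  show "H (p (\<psi> t x)) = H (p x)"
    using main[OF chart_at(1)[OF AM, of x] imageI[OF chart_at(2)[OF AM, of x]] t, of 0] chart_at[OF AM, of x] AM by simp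
qed

section \<open>Parallel transport\<close>

text \<open>Since the action preserves \<alpha>, a variable rotation changes the pullback only by
  the derivative of the angle times \<open>zeta\<close>. The condition on a lift thus becomes a
  condition on an angle.\<close>

lemma lform_R:
  fixes D :: "'a::euclidean_space set"
  assumes c: "plot AM D c" and D: "thick D" and \<theta>: "smooth_on D \<theta>" and z: "z \<in> D"
  shows "plot AM D (\<lambda>z. R (\<theta> z) (c z))"
    and "lform AM \<alpha> D (\<lambda>z. R (\<theta> z) (c z)) z v =
      frechet_derivative \<theta> (at z within D) v * zeta (c z) + lform AM \<alpha> D c z v"
proof -
  show pl: "plot AM D (\<lambda>z. R (\<theta> z) (c z))"
    by (rule plot_family[OF AM AM R_family c D \<theta>]) simp_all
  define E where "E = (UNIV :: real set) \<times> D"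
  have E: "thick E" unfolding E_def by (intro thick_Times thick_UNIV D)
  define U where "U = (\<lambda>w. R (fst w) (c (snd w)))"
  have "plot AM E (\<lambda>w. c (snd w))"
    by (rule plot_compose[OF AM c E]) (use E in \<open>auto intro!: smooth_on_snd smooth_on_id simp: E_def\<close>)
  then have U: "plot AM E U" unfolding U_def
    by (rule plot_family[OF AM AM R_family _ E]) (auto intro!: smooth_on_fst smooth_on_id E)
  define s where "s = \<theta> z"
  have sz: "(s, z) \<in> E" using z by (simp add: E_def)
  have "lform AM \<alpha> D (\<lambda>z. U (\<theta> z, z)) z v = lform AM \<alpha> E U (\<theta> z, z) (frechet_derivative (\<lambda>z. (\<theta> z, z)) (at z within D) v)"
    by (rule lform_compose[OF AM \<alpha> U E D smooth_on_Pair[OF D \<theta> smooth_on_id[OF D]] _ z]) (simp add: E_def)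
  also have "frechet_derivative (\<lambda>z. (\<theta> z, z)) (at z within D) = (\<lambda>v. (frechet_derivative \<theta> (at z within D) v, v))"
    by (rule thick_frechet_unique[OF D z]) (intro has_derivative_Pair smooth_on_has_derivative[OF \<theta> z] has_derivative_ident)
  also have "lform AM \<alpha> E U (\<theta> z, z) (frechet_derivative \<theta> (at z within D) v, v) =
      frechet_derivative \<theta> (at z within D) v * lform AM \<alpha> E U (s, z) (1, 0) + lform AM \<alpha> E U (s, z) (0, v)"
  proof -
    have lin: "linear (lform AM \<alpha> E U (s, z))" by (rule lform_linear[OF AM \<alpha> U E sz])
    have "(frechet_derivative \<theta> (at z within D) v, v) = frechet_derivative \<theta> (at z within D) v *\<^sub>R (1, 0) + (0, v)" by simp
    then show ?thesis by (simp only: s_def[symmetric] linear_add[OF lin] linear_scale[OF lin] real_scaleR_def)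
  qed
  also have "lform AM \<alpha> E U (s, z) (0, v) = lform AM \<alpha> D c z v"
  proof -
    have fr: "frechet_derivative (\<lambda>z. (s, z)) (at z within D) = (\<lambda>h. (0, h))"
      by (rule thick_frechet_unique[OF D z]) (auto intro!: derivative_eq_intros)
    have "lform AM \<alpha> D (\<lambda>z. U (s, z)) z v = lform AM \<alpha> E U (s, z) (frechet_derivative (\<lambda>z. (s, z)) (at z within D) v)"
      by (rule lform_compose[OF AM \<alpha> U E D smooth_on_Pair[OF D smooth_on_const[OF D] smooth_on_id[OF D]] _ z]) (simp add: E_def)
    then have "lform AM \<alpha> E U (s, z) (0, v) = lform AM \<alpha> D (\<lambda>z. R s (c z)) z v" unfolding fr by (simp add: U_def)
    also have "\<dots> = lform AM \<alpha> D c z v"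
      using conformal_lform[OF AM \<alpha> R_strict R_smooth c D z] by simp
    finally show ?thesis .
  qed
  also have "lform AM \<alpha> E U (s, z) (1, 0) = zeta (c z)"
  proof -
    have fr: "frechet_derivative (\<lambda>r. (s + r, z)) (at 0 within UNIV) = (\<lambda>h. (h, 0))"
      by (rule thick_frechet_unique[OF thick_UNIV UNIV_I]) (auto intro!: derivative_eq_intros)
    have "lform AM \<alpha> UNIV (\<lambda>r. U (s + r, z)) 0 1 = lform AM \<alpha> E U (s + 0, z) (frechet_derivative (\<lambda>r. (s + r, z)) (at 0 within UNIV) 1)"
      by (rule lform_compose[OF AM \<alpha> U E thick_UNIV _ _ UNIV_I])
         (use z in \<open>auto simp: E_def intro!: smooth_on_Pair smooth_on_add smooth_on_const smooth_on_id\<close>)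
    then have "lform AM \<alpha> E U (s, z) (1, 0) = lform AM \<alpha> UNIV (\<lambda>r. R s (R r (c z))) 0 1"
      unfolding fr by (simp add: U_def R_add)
    also have "\<dots> = zeta (c z)"
      using conformal_lform[OF AM \<alpha> R_strict R_smooth plot_orbit thick_UNIV UNIV_I] by (simp add: zeta_def)
    finally show ?thesis .
  qed
  finally show "lform AM \<alpha> D (\<lambda>z. R (\<theta> z) (c z)) z v =
      frechet_derivative \<theta> (at z within D) v * zeta (c z) + lform AM \<alpha> D c z v" by (simp add: U_def)
qed

text \<open>\<open>zeta (c z)\<close> is \<alpha> along the plot (z, r) \<mapsto> R r (c z) in the
  direction of r, hence a case of \<open>smooth_on_lform\<close>.\<close>

lemma smooth_on_zeta:
  fixes D :: "'a::euclidean_space set"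
  assumes c: "plot AM D c" and D: "thick D"
  shows "smooth_on D (\<lambda>z. zeta (c z))"
proof -
  define E where "E = D \<times> (UNIV :: real set)"
  have E: "thick E" unfolding E_def by (intro thick_Times thick_UNIV D)
  define U where "U = (\<lambda>w. R (snd w) (c (fst w)))"
  have "plot AM E (\<lambda>w. c (fst w))"
    by (rule plot_compose[OF AM c E]) (use E in \<open>auto intro!: smooth_on_fst smooth_on_id simp: E_def\<close>)
  then have U: "plot AM E U" unfolding U_def
    by (rule plot_family[OF AM AM R_family _ E]) (auto intro!: smooth_on_snd smooth_on_id E)
  have "smooth_on D (\<lambda>z. lform AM \<alpha> E U (z, 0) (0, 1))"
    by (rule smooth_on_compose[OF D smooth_on_lform[OF AM \<alpha> U E, of "(0, 1)"]
          smooth_on_Pair[OF D smooth_on_id[OF D] smooth_on_const[OF D]]]) (simp add: E_def)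
  moreover have "lform AM \<alpha> E U (z, 0) (0, 1) = zeta (c z)" if z: "z \<in> D" for z
  proof -
    have fr: "frechet_derivative (\<lambda>r. (z, r)) (at (0::real) within UNIV) = (\<lambda>h. (0, h))"
      by (rule thick_frechet_unique[OF thick_UNIV UNIV_I]) (auto intro!: derivative_eq_intros)
    have "lform AM \<alpha> UNIV (\<lambda>r. U (z, r)) 0 1 = lform AM \<alpha> E U (z, 0) (frechet_derivative (\<lambda>r. (z, r)) (at 0 within UNIV) 1)"
      by (rule lform_compose[OF AM \<alpha> U E thick_UNIV _ _ UNIV_I])
         (use z in \<open>auto simp: E_def intro!: smooth_on_Pair smooth_on_const smooth_on_id\<close>)
    then show ?thesis unfolding fr by (simp add: U_def zeta_def)
  qed
  ultimately show ?thesis by (rule smooth_on_cong[THEN iffD1, rotated])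
qed

text \<open>The last condition prescribes the value of \<alpha> on the velocity, the only freedom
  left by the projection. Its sign matches \<omega>(X, .) = dF in \<open>Ham\<close>, so that the
  two terms of Cartan's formula cancel.\<close>

definition lift_curve :: "(real \<Rightarrow> 'x \<Rightarrow> 'x) \<Rightarrow> (real \<Rightarrow> 'x \<Rightarrow> real) \<Rightarrow> 'm \<Rightarrow> (real \<Rightarrow> 'm) \<Rightarrow> bool" where
  "lift_curve \<theta> F m c \<longleftrightarrow> plot AM {0..1} c \<and> c 0 = m \<and>
     (\<forall>t\<in>{0..1}. p (c t) = \<theta> t (p m) \<and> lform AM \<alpha> {0..1} c t 1 = - F t (\<theta> t (p m)))"

text \<open>Two lifts over the same base curve differ by a rotation. Equal values of \<alpha> on the
  velocities force its angular velocity times \<open>zeta\<close> to vanish, so the rotation keeps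
  its initial value, the identity.\<close>

lemma lift_curve_unique:
  assumes U: "trivialization U \<tau> \<sigma>" and \<theta>: "\<And>t. t \<in> {0..1} \<Longrightarrow> \<theta> t (p m) \<in> U"
    and c: "lift_curve \<theta> F m c" and c': "lift_curve \<theta> F m c'" and t: "t \<in> {0..1}"
  shows "c t = c' t"
proof -
  let ?I = "{0..1::real}"
  note I = thick_unit_interval
  have pl: "plot AM ?I c" "plot AM ?I c'" using c c' by (simp_all add: lift_curve_def)
  have pc: "p (c s) = p (c' s)" "p (c s) \<in> U" "p (c' s) \<in> U" if "s \<in> ?I" for s
    using c c' \<theta>[OF that] that by (simp_all add: lift_curve_def)
  note \<tau> = trivializationD[OF U]
  have oU: "open (p -` U)" by (rule open_p_vimage[OF \<tau>(1)])
  \<comment> \<open>The rotation from c' to c, as a unit complex number: it is defined for all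
    times, whereas a smooth angle for it is available only locally.\<close>
  define r where "r s = \<tau> (c s) * cnj (\<tau> (c' s))" for s
  have sm: "smooth_on ?I (\<lambda>s. \<tau> (c s))" "smooth_on ?I (\<lambda>s. \<tau> (c' s))"
    using plot_map[OF AM smooth_atlas_std \<tau>(2) pl(1) I oU] plot_map[OF AM smooth_atlas_std \<tau>(2) pl(2) I oU] pc
    by (simp_all add: plot_std)
  have r: "smooth_on ?I r" unfolding r_def[abs_def]
    by (intro smooth_on_mult I sm smooth_on_linear[OF bounded_linear_cnj])
  have unit: "cmod (\<tau> (c s)) = 1" "cmod (\<tau> (c' s)) = 1" "cmod (r s) = 1" if "s \<in> ?I" for s
    using \<tau>(4)[OF pc(2)[OF that]] \<tau>(4)[OF pc(3)[OF that]] by (simp_all add: r_def norm_mult)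
  have rc: "r s * \<tau> (c' s) = \<tau> (c s)" if "s \<in> ?I" for s
    using unit(2)[OF that] complex_norm_square[of "\<tau> (c' s)"] by (simp add: r_def mult.assoc mult.commute[of "cnj _"])
  have "(r has_derivative (\<lambda>h. 0)) (at t within ?I)" if t: "t \<in> ?I" for t
  proof -
    obtain a where a: "smooth_on {w. Re (w * cnj (r t)) > 0} a"
      "\<And>w. cmod w = 1 \<Longrightarrow> Re (w * cnj (r t)) > 0 \<Longrightarrow> cis (a w) = w"
      using local_angle[OF unit(3)[OF t]] by blast
    let ?S = "{w. Re (w * cnj (r t)) > 0}"
    have oS: "open ?S" by (intro open_Collect_less continuous_intros)
    from smooth_on_imp_continuous[OF r] oS obtain W where W: "open W" "W \<inter> ?I = r -` ?S \<inter> ?I"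
      unfolding continuous_on_open_invariant by blast
    have W': "s \<in> ?I \<inter> W \<longleftrightarrow> s \<in> ?I \<and> r s \<in> ?S" for s using W(2) by blast
    have IW: "thick (?I \<inter> W)" by (rule thick_Int_open[OF I W(1)])
    have "Re (r t * cnj (r t)) = (cmod (r t))\<^sup>2" by (simp add: complex_mult_cnj cmod_power2)
    then have "Re (r t * cnj (r t)) > 0" unfolding unit(3)[OF t] by simp
    then have tW: "t \<in> ?I \<inter> W" using t W'[of t] by blast
    have ar: "smooth_on (?I \<inter> W) (\<lambda>s. a (r s))"
      by (rule smooth_on_compose[OF IW a(1) smooth_on_Int_open[OF r W(1)]]) (use W' in blast)
    have cis: "cis (a (r s)) = r s" if "s \<in> ?I \<inter> W" for s using a(2)[OF unit(3)] that W'[of s] by simp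
    have eq: "R (a (r s)) (c' s) = c s" if s: "s \<in> ?I \<inter> W" for s
    proof (rule trivialization_inj[OF U])
      have sI: "s \<in> ?I" using s by simp
      show "p (c s) \<in> U" "p (R (a (r s)) (c' s)) = p (c s)" using pc[OF sI] by simp_all
      show "\<tau> (R (a (r s)) (c' s)) = \<tau> (c s)"
        using \<tau>(5)[OF pc(3)[OF sI]] cis[OF s] rc[OF sI] by simp
    qed
    have lf: "lform AM \<alpha> (?I \<inter> W) c t 1 = lform AM \<alpha> (?I \<inter> W) c' t 1"
      using c c' t tW W(1) by (simp add: lform_Int_open lift_curve_def)
    have "lform AM \<alpha> (?I \<inter> W) c t 1 = lform AM \<alpha> (?I \<inter> W) (\<lambda>s. R (a (r s)) (c' s)) t 1"
      by (rule lform_cong[OF tW]) (simp add: eq)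
    also have "\<dots> = frechet_derivative (\<lambda>s. a (r s)) (at t within (?I \<inter> W)) 1 * zeta (c' t) + lform AM \<alpha> (?I \<inter> W) c' t 1"
      by (rule lform_R(2)[OF plot_subset[OF AM pl(2) IW] IW ar tW]) simp
    finally have d1: "frechet_derivative (\<lambda>s. a (r s)) (at t within (?I \<inter> W)) 1 = 0"
      using lf zeta_nonzero by simp
    note D = smooth_on_has_derivative[OF ar tW]
    have "frechet_derivative (\<lambda>s. a (r s)) (at t within (?I \<inter> W)) = (\<lambda>h. 0)"
    proof
      show "frechet_derivative (\<lambda>s. a (r s)) (at t within (?I \<inter> W)) h = 0" for h
        using linear_scale[OF has_derivative_linear[OF D], of h 1] d1 by simp
    qed
    with D have "((\<lambda>s. a (r s)) has_derivative (\<lambda>h. 0)) (at t within (?I \<inter> W))" by simp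
    from has_derivative_cis[OF this]
    have "((\<lambda>s. cis (a (r s))) has_derivative (\<lambda>h. 0)) (at t within (?I \<inter> W))" by simp
    then have "(r has_derivative (\<lambda>h. 0)) (at t within (?I \<inter> W))"
      by (rule has_derivative_transform[OF tW, rotated]) (simp add: cis)
    then show ?thesis using tW W(1) at_within_Int_open[of t W ?I] by simp
  qed
  from has_derivative_zero_constant[OF convex_real_interval(5) this]
  obtain k where k: "\<And>s. s \<in> ?I \<Longrightarrow> r s = k" by blast
  have "r 0 = 1"
    using c c' unit(1)[of 0] complex_norm_square[of "\<tau> m"] by (simp add: r_def lift_curve_def)
  then have "r t = 1" using k[OF t] k[of 0] by simp
  then have "\<tau> (c t) = \<tau> (c' t)" using rc[OF t] by simp
  then show ?thesis by (intro trivialization_inj[OF U pc(3)[OF t] pc(1)[OF t]])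
qed

text \<open>Lifts are sought as rotations of the reference curve that a local section assigns to the
  base motion; \<open>lform_R\<close> then determines the angular velocity.\<close>

lemma lift_curve_local:
  assumes \<theta>: "smooth_family {0..1} UNIV AX AX \<theta>" and \<theta>0: "\<And>x. \<theta> 0 x = x"
    and F: "smooth_family {0..1} UNIV AX std_atlas F"
    and U: "trivialization U \<tau> \<sigma>" and V: "open V" "\<And>t x. t \<in> {0..1} \<Longrightarrow> x \<in> V \<Longrightarrow> \<theta> t x \<in> U" and m0: "p m0 \<in> V"
  shows "\<exists>N L. open N \<and> m0 \<in> N \<and> smooth_family {0..1} N AM AM L \<and> (\<forall>m\<in>N. lift_curve \<theta> F m (\<lambda>t. L t m))"
proof -
  let ?I = "{0..1::real}"
  note I = thick_unit_interval
  note \<tau> = trivializationD[OF U]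
  have VU: "x \<in> U" if "x \<in> V" for x using V(2)[of 0 x] that \<theta>0 by simp
  define e where "e = \<sigma> 0"
  have e: "smooth_map U AX AM e" unfolding e_def by (rule smooth_map_of_family[OF AX AM \<tau>(3) UNIV_I \<tau>(1)])
  have pe: "p (e y) = y" "\<tau> (e y) = 1" if "y \<in> U" for y using \<tau>(6,7)[OF that] by (simp_all add: e_def)
  have plE: "plot AM D (\<lambda>z. e (\<theta> (s z) (u z)))" and plT: "plot AX D (\<lambda>z. \<theta> (s z) (u z))"
    if "plot AX D u" "thick D" "smooth_on D s" "\<And>z. z \<in> D \<Longrightarrow> u z \<in> V" "\<And>z. z \<in> D \<Longrightarrow> s z \<in> ?I"
    for D :: "'d::euclidean_space set" and u s
  proof -
    show T: "plot AX D (\<lambda>z. \<theta> (s z) (u z))" by (rule plot_family[OF AX AX \<theta> that(1-3)]) (use that in auto)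
    show "plot AM D (\<lambda>z. e (\<theta> (s z) (u z)))" by (rule plot_map[OF AX AM e T that(2) \<tau>(1)]) (use V(2) that in auto)
  qed
  \<comment> \<open>\<open>lam\<close> is the value of \<alpha> on the velocity of the reference
    curve, \<open>rho\<close> the angular velocity that corrects it to - F, and \<open>q\<close> the
    angle accumulated from time 0.\<close>
  define lam where "lam t x = lform AM \<alpha> ?I (\<lambda>s. e (\<theta> s x)) t 1" for t x
  define rho where "rho t x = (- F t (\<theta> t x) - lam t x) * inverse (zeta (e (\<theta> t x)))" for t x
  define q where "q t x = primitive (\<lambda>s. rho s x) t" for t x
  have rho: "smooth_on (?I \<times> coord \<kappa> ` (cdom \<kappa> \<inter> V)) (\<lambda>z. rho (fst z) (param \<kappa> (snd z)))" if \<kappa>: "\<kappa> \<in> AX" for \<kappa>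
  proof -
    define C where "C = coord \<kappa> ` (cdom \<kappa> \<inter> V)"
    have C: "thick C" using open_chart_image[OF AX \<kappa> V(1)] by (simp add: C_def thick_open)
    have D: "thick (?I \<times> C)" by (intro thick_Times I C)
    have pC: "param \<kappa> y \<in> V" if "y \<in> C" for y using that \<kappa> AX by (auto simp: C_def)
    have u: "plot AX (?I \<times> C) (\<lambda>z. param \<kappa> (snd z))"
      using plot_chart_times[OF AX I \<kappa> V(1)] by (simp add: C_def)
    have fst: "smooth_on (?I \<times> C) fst" by (rule smooth_on_fst[OF D smooth_on_id[OF D]])
    have E: "plot AM (?I \<times> C) (\<lambda>z. e (\<theta> (fst z) (param \<kappa> (snd z))))"
      and T: "plot AX (?I \<times> C) (\<lambda>z. \<theta> (fst z) (param \<kappa> (snd z)))"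
      by (rule plE[OF u D fst] plT[OF u D fst]; use pC in auto)+
    have sF: "smooth_on (?I \<times> C) (\<lambda>z. F (fst z) (\<theta> (fst z) (param \<kappa> (snd z))))"
      using plot_family[OF AX smooth_atlas_std F T D fst] by (simp add: plot_std mem_Times_iff)
    have "smooth_on (?I \<times> C) (\<lambda>z. lform AM \<alpha> (?I \<times> C) (\<lambda>z. e (\<theta> (fst z) (param \<kappa> (snd z)))) z (1, 0))"
      by (rule smooth_on_lform[OF AM \<alpha> E D])
    moreover have "lform AM \<alpha> (?I \<times> C) (\<lambda>z. e (\<theta> (fst z) (param \<kappa> (snd z)))) z (1, 0) = lam (fst z) (param \<kappa> (snd z))"
      if z: "z \<in> ?I \<times> C" for z
    proof -
      obtain t y where ty: "z = (t, y)" "t \<in> ?I" "y \<in> C" using z by blast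
      have fr: "frechet_derivative (\<lambda>s. (s, y)) (at t within ?I) = (\<lambda>h. (h, 0))"
        by (rule thick_frechet_unique[OF I ty(2)]) (auto intro!: derivative_eq_intros)
      have "lform AM \<alpha> ?I (\<lambda>s. (\<lambda>z. e (\<theta> (fst z) (param \<kappa> (snd z)))) (s, y)) t 1 =
          lform AM \<alpha> (?I \<times> C) (\<lambda>z. e (\<theta> (fst z) (param \<kappa> (snd z)))) (t, y) (frechet_derivative (\<lambda>s. (s, y)) (at t within ?I) 1)"
        by (rule lform_compose[OF AM \<alpha> E D I smooth_on_Pair[OF I smooth_on_id[OF I] smooth_on_const[OF I]] _ ty(2)])
           (use ty in auto)
      then show ?thesis unfolding fr by (simp add: lam_def ty(1))
    qed
    ultimately have slam: "smooth_on (?I \<times> C) (\<lambda>z. lam (fst z) (param \<kappa> (snd z)))"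
      by (rule smooth_on_cong[THEN iffD1, rotated])
    show ?thesis unfolding rho_def C_def[symmetric]
      by (intro smooth_on_mult smooth_on_diff smooth_on_minus smooth_on_inverse sF slam D smooth_on_zeta[OF E])
         (simp add: zeta_nonzero)
  qed
  have rho_cont: "continuous_on ?I (\<lambda>s. rho s x)" if x: "x \<in> V" for x
  proof -
    define \<kappa> where "\<kappa> = chart_at AX x"
    have \<kappa>: "\<kappa> \<in> AX" "x \<in> cdom \<kappa>" using chart_at[OF AX] by (auto simp: \<kappa>_def)
    have "continuous_on ?I (\<lambda>s. (s, coord \<kappa> x))" "(\<lambda>s. (s, coord \<kappa> x)) ` ?I \<subseteq> ?I \<times> coord \<kappa> ` (cdom \<kappa> \<inter> V)"
      using \<kappa> x by (auto intro!: continuous_intros)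
    from continuous_on_compose2[OF smooth_on_imp_continuous[OF rho[OF \<kappa>(1)]] this]
    show ?thesis using \<kappa> AX by simp
  qed
  have q: "smooth_family ?I V AX std_atlas q"
  proof (rule smooth_familyI[OF AX smooth_atlas_std V(1)])
    fix \<kappa> assume \<kappa>: "\<kappa> \<in> AX"
    define C where "C = coord \<kappa> ` (cdom \<kappa> \<inter> V)"
    have C: "open C" using open_chart_image[OF AX \<kappa> V(1)] by (simp add: C_def)
    have "smooth_on (?I \<times> C) (\<lambda>z. q (fst z) (param \<kappa> (snd z)))"
    proof (rule smooth_on_local)
      fix z assume z: "z \<in> ?I \<times> C"
      obtain d where d: "d > 0" "ball (snd z) d \<subseteq> C" using C z open_contains_ball by (metis mem_Times_iff)
      \<comment> \<open>\<open>Ck_on_integral\<close> asks for a convex parameter set; chart images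
        need not be convex, so smoothness is checked on small balls.\<close>
      define W where "W = (UNIV :: real set) \<times> ball (snd z) d"
      define S where "S = ?I \<times> ball (snd z) d"
      have W: "open W" "z \<in> W" using d by (auto simp: W_def open_Times mem_Times_iff)
      have SW: "(?I \<times> C) \<inter> W = S" using d by (auto simp: S_def W_def)
      have S: "convex S" "thick S" unfolding S_def
        by (intro convex_Times convex_real_interval convex_ball, intro thick_Times I thick_open open_ball)
      have IS: "thick (?I \<times> S)" by (intro thick_Times I S)
      have "smooth_on (?I \<times> S) (\<lambda>w. (fst w * fst (snd w), snd (snd w)))"
        by (intro smooth_on_Pair smooth_on_mult smooth_on_fst smooth_on_snd smooth_on_id IS)
      moreover have "(fst w * fst (snd w), snd (snd w)) \<in> ?I \<times> coord \<kappa> ` (cdom \<kappa> \<inter> V)" if "w \<in> ?I \<times> S" for w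
      proof -
        have "fst w * fst (snd w) \<in> ?I" "snd (snd w) \<in> C" using that d by (auto simp: S_def mult_le_one)
        then show ?thesis by (simp add: C_def)
      qed
      ultimately have "smooth_on (?I \<times> S) (\<lambda>w. rho (fst w * fst (snd w)) (param \<kappa> (snd (snd w))))"
        using smooth_on_compose[OF IS rho[OF \<kappa>], of "\<lambda>w. (fst w * fst (snd w), snd (snd w))"] by simp
      then have "smooth_on (?I \<times> S) (\<lambda>w. fst (snd w) * rho (fst w * fst (snd w)) (param \<kappa> (snd (snd w))))"
        by (intro smooth_on_mult smooth_on_fst smooth_on_snd smooth_on_id IS)
      then have "smooth_on S (\<lambda>u. integral ?I (\<lambda>s. fst u * rho (s * fst u) (param \<kappa> (snd u))))"
        using Ck_on_integral[OF S] unfolding smooth_on_def by fastforce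
      then have "smooth_on ((?I \<times> C) \<inter> W) (\<lambda>z. q (fst z) (param \<kappa> (snd z)))"
        by (simp add: SW q_def primitive_def)
      then show "\<exists>W. open W \<and> z \<in> W \<and> smooth_on ((?I \<times> C) \<inter> W) (\<lambda>z. q (fst z) (param \<kappa> (snd z)))"
        using W by blast
    qed
    then show "plot std_atlas (?I \<times> coord \<kappa> ` (cdom \<kappa> \<inter> V)) (\<lambda>z. q (fst z) (param \<kappa> (snd z)))"
      by (simp add: plot_std C_def)
  qed
  have unit: "cmod (\<tau> m0) = 1" by (rule \<tau>(4)[OF VU[OF m0]])
  obtain a where a: "smooth_on {w. Re (w * cnj (\<tau> m0)) > 0} a"
      "\<And>w. cmod w = 1 \<Longrightarrow> Re (w * cnj (\<tau> m0)) > 0 \<Longrightarrow> cis (a w) = w"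
    using local_angle[OF unit] by blast
  \<comment> \<open>The lift must start at m, which sits at angle \<open>a (\<tau> m)\<close> from
    the section; this angle is smooth only near \<open>\<tau> m0\<close>.\<close>
  define N where "N = p -` V \<inter> {m. Re (\<tau> m * cnj (\<tau> m0)) > 0}"
  have N: "open N"
  proof -
    have "continuous_on (p -` V) \<tau>"
      by (rule continuous_on_subset[of "p -` U"]) (use \<tau>(2) VU in \<open>auto simp: smooth_map_def\<close>)
    then have "open (p -` V \<inter> \<tau> -` {w. Re (w * cnj (\<tau> m0)) > 0})"
      by (rule continuous_open_preimage[OF _ open_p_vimage[OF V(1)]])
         (intro open_Collect_less continuous_intros)
    moreover have "N = p -` V \<inter> \<tau> -` {w. Re (w * cnj (\<tau> m0)) > 0}" by (auto simp: N_def)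
    ultimately show ?thesis by simp
  qed
  have "Re (\<tau> m0 * cnj (\<tau> m0)) = (cmod (\<tau> m0))\<^sup>2" by (simp add: complex_mult_cnj cmod_power2)
  then have mN: "m0 \<in> N" using m0 unit by (simp add: N_def)
  define L where "L t m = R (q t (p m) + a (\<tau> m)) (e (\<theta> t (p m)))" for t m
  have L: "smooth_family ?I N AM AM L"
  proof (rule smooth_familyI[OF AM AM N])
    fix \<kappa> assume \<kappa>: "\<kappa> \<in> AM"
    define D where "D = ?I \<times> coord \<kappa> ` (cdom \<kappa> \<inter> N)"
    have D: "thick D" unfolding D_def by (rule chart_times_thick[OF AM I \<kappa> N])
    have uN: "param \<kappa> (snd z) \<in> N" if "z \<in> D" for z using that \<kappa> AM by (auto simp: D_def)
    have u: "plot AM D (\<lambda>z. param \<kappa> (snd z))" unfolding D_def by (rule plot_chart_times[OF AM I \<kappa> N])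
    have pu: "plot AX D (\<lambda>z. p (param \<kappa> (snd z)))" by (rule plot_map[OF AM AX p_smooth u D open_UNIV]) simp
    have fst: "smooth_on D fst" by (rule smooth_on_fst[OF D smooth_on_id[OF D]])
    have fI: "fst z \<in> ?I" if "z \<in> D" for z using that by (auto simp: D_def)
    have puV: "p (param \<kappa> (snd z)) \<in> V" if "z \<in> D" for z using uN[OF that] by (simp add: N_def)
    have sq: "smooth_on D (\<lambda>z. q (fst z) (p (param \<kappa> (snd z))))"
      using plot_family[OF AX smooth_atlas_std q pu D fst fI puV] by (simp add: plot_std)
    have s\<tau>: "smooth_on D (\<lambda>z. \<tau> (param \<kappa> (snd z)))"
      using plot_map[OF AM smooth_atlas_std \<tau>(2) u D open_p_vimage[OF \<tau>(1)]] puV VU by (simp add: plot_std)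
    have "smooth_on D (\<lambda>z. a (\<tau> (param \<kappa> (snd z))))"
      by (rule smooth_on_compose[OF D a(1) s\<tau>]) (use uN in \<open>auto simp: N_def\<close>)
    from smooth_on_add[OF D sq this] plot_family[OF AM AM R_family plE[OF pu D fst puV fI] D]
    show "plot AM (?I \<times> coord \<kappa> ` (cdom \<kappa> \<inter> N)) (\<lambda>z. L (fst z) (param \<kappa> (snd z)))"
      unfolding L_def D_def[symmetric] by simp
  qed
  have "lift_curve \<theta> F m (\<lambda>t. L t m)" if m: "m \<in> N" for m
  proof -
    have mV: "p m \<in> V" using m by (simp add: N_def)
    have x: "plot AX ?I (\<lambda>_. p m)" by (rule plot_const[OF AX I])
    have c: "plot AM ?I (\<lambda>t. e (\<theta> t (p m)))" by (rule plE[OF x I smooth_on_id[OF I]]) (use mV in auto)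
    have sq: "smooth_on ?I (\<lambda>t. q t (p m) + a (\<tau> m))"
      using plot_family[OF AX smooth_atlas_std q x I smooth_on_id[OF I]] mV
      by (intro smooth_on_add smooth_on_const I) (simp add: plot_std)
    have d: "frechet_derivative (\<lambda>t. q t (p m) + a (\<tau> m)) (at t within ?I) 1 = rho t (p m)" if t: "t \<in> ?I" for t
    proof -
      have "((\<lambda>t. q t (p m) + a (\<tau> m)) has_derivative (*) (rho t (p m))) (at t within ?I)"
        using DERIV_add[OF primitive_deriv[OF rho_cont[OF mV] t] DERIV_const[of "a (\<tau> m)"]]
        by (simp add: q_def[abs_def] has_field_derivative_def)
      from thick_frechet_unique[OF I t this] show ?thesis by simp
    qed
    have "p (L t m) = \<theta> t (p m)" if "t \<in> ?I" for t using pe V(2)[OF that mV] by (simp add: L_def)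
    moreover have "lform AM \<alpha> ?I (\<lambda>t. L t m) t 1 = - F t (\<theta> t (p m))" if t: "t \<in> ?I" for t
      unfolding L_def lform_R(2)[OF c I sq t] d[OF t]
      by (simp add: rho_def lam_def mult.assoc zeta_nonzero)
    moreover have "L 0 m = m"
    proof (rule trivialization_inj[OF U VU[OF mV]])
      show "p (L 0 m) = p m" using pe VU[OF mV] by (simp add: L_def \<theta>0)
      have "cis (a (\<tau> m)) = \<tau> m" using a(2)[OF \<tau>(4)[OF VU[OF mV]]] m by (simp add: N_def)
      then show "\<tau> (L 0 m) = \<tau> m"
        using \<tau>(5)[of "e (p m)" "a (\<tau> m)"] pe VU[OF mV] by (simp add: L_def \<theta>0 q_def)
    qed
    ultimately show ?thesis using lform_R(1)[OF c I sq, of 0] I unfolding lift_curve_def L_def by auto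
  qed
  then show ?thesis using N mN L by blast
qed

section \<open>Lifting Hamiltonian isotopies\<close>

lemma fibre_nonempty: "\<exists>m. p m = x"
proof -
  obtain U \<tau> \<sigma> where U: "x \<in> U" "trivialization U \<tau> \<sigma>" by (rule trivialization_ex)
  then show ?thesis using trivializationD(6)[OF U(2,1)] by blast
qed

lemma fibre_transitive:
  assumes "p m' = p m" obtains s where "m' = R s m"
proof -
  obtain U \<tau> \<sigma> where U: "p m \<in> U" "trivialization U \<tau> \<sigma>" by (rule trivialization_ex)
  note \<tau> = trivializationD[OF U(2)]
  have unit: "cmod (\<tau> m) = 1" "cmod (\<tau> m') = 1" using \<tau>(4)[of m] \<tau>(4)[of m'] U(1) assms by auto
  then have "cmod (\<tau> m' * cnj (\<tau> m)) = 1" by (simp add: norm_mult)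
  then obtain s where s: "\<tau> m' * cnj (\<tau> m) = cis s" using unit_complex_cis by blast
  have "cis s * \<tau> m = \<tau> m'"
    using complex_norm_square[of "\<tau> m"] unit(1) by (simp add: s[symmetric] mult.assoc mult.commute[of "cnj _"])
  then have "\<tau> m' = \<tau> (R s m)" using \<tau>(5)[OF U(1)] by simp
  then have "m' = R s m" using trivialization_inj[OF U(2), of "R s m" m'] U(1) assms by simp
  then show ?thesis by (rule that)
qed

text \<open>The action is free up to its period: one fixed point forces \<open>cis s = 1\<close>,
  and such an s acts trivially on every fibre.\<close>

lemma R_fixed:
  assumes "R s n = n" shows "R s m = m"
proof -
  obtain U \<tau> \<sigma> where U: "p n \<in> U" "trivialization U \<tau> \<sigma>" by (rule trivialization_ex)
  have "\<tau> n = cis s * \<tau> n" using trivializationD(5)[OF U(2,1), of s] assms by simp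
  moreover have "\<tau> n \<noteq> 0" using trivializationD(4)[OF U(2,1)] by auto
  ultimately have cis: "cis s = 1" by simp
  obtain U' \<tau>' \<sigma>' where U': "p m \<in> U'" "trivialization U' \<tau>' \<sigma>'" by (rule trivialization_ex)
  show ?thesis
    using trivialization_inj[OF U'(2,1), of "R s m"] trivializationD(5)[OF U'(2,1), of s] cis by simp
qed

text \<open>Only the endpoint of the isotopy is tied to \<phi>, so composites are lifted by
  pointwise composition, with no smoothing at joints. The bound \<open>B\<close> is kept for
  comparing the lift with powers of a positive class.\<close>

definition liftable :: "('x \<Rightarrow> 'x) \<Rightarrow> bool" where
  "liftable \<phi> \<longleftrightarrow> (\<exists>\<Phi>\<in>PCont0 AM \<alpha>. (\<forall>t\<in>{0..1}. conformal AM \<alpha> (\<Phi> t) (\<lambda>_. 1)) \<and>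
     (\<exists>B. \<forall>t\<in>{0..1}. \<forall>y. \<bar>contact_ham AM \<alpha> \<Phi> t y\<bar> \<le> B) \<and> (\<forall>m. p (\<Phi> 1 m) = \<phi> (p m)))"

lemma liftableI:
  assumes "\<Phi> \<in> PCont0 AM \<alpha>" "\<And>t. t \<in> {0..1} \<Longrightarrow> conformal AM \<alpha> (\<Phi> t) (\<lambda>_. 1)"
    "\<And>t y. t \<in> {0..1} \<Longrightarrow> \<bar>contact_ham AM \<alpha> \<Phi> t y\<bar> \<le> B" "\<And>m. p (\<Phi> 1 m) = \<phi> (p m)"
  shows "liftable \<phi>"
  unfolding liftable_def by (intro bexI[OF _ assms(1)] conjI exI[of _ B] ballI allI assms)

lemma liftable_compose:
  assumes "liftable \<phi>" "liftable \<psi>"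
  shows "liftable (\<lambda>x. \<phi> (\<psi> x))"
proof -
  obtain \<Phi> B where \<Phi>: "\<Phi> \<in> PCont0 AM \<alpha>" "\<And>t. t \<in> {0..1} \<Longrightarrow> conformal AM \<alpha> (\<Phi> t) (\<lambda>_. 1)"
    "\<And>t y. t \<in> {0..1} \<Longrightarrow> \<bar>contact_ham AM \<alpha> \<Phi> t y\<bar> \<le> B" "\<And>m. p (\<Phi> 1 m) = \<phi> (p m)"
    using assms(1) unfolding liftable_def by blast
  obtain \<Psi> B' where \<Psi>: "\<Psi> \<in> PCont0 AM \<alpha>" "\<And>t. t \<in> {0..1} \<Longrightarrow> conformal AM \<alpha> (\<Psi> t) (\<lambda>_. 1)"
    "\<And>t y. t \<in> {0..1} \<Longrightarrow> \<bar>contact_ham AM \<alpha> \<Psi> t y\<bar> \<le> B'" "\<And>m. p (\<Psi> 1 m) = \<psi> (p m)"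
    using assms(2) unfolding liftable_def by blast
  have "smooth_map UNIV AM AM (\<Phi> t)" "smooth_map UNIV AM AM (\<Psi> t)" if "t \<in> {0..1}" for t
    using \<Phi>(1) \<Psi>(1) that by (auto simp: PCont0_def contactomorphism_def diffeo_def)
  then have "conformal AM \<alpha> (\<lambda>x. \<Phi> t (\<Psi> t x)) (\<lambda>_. 1)" if "t \<in> {0..1}" for t
    using conformal_compose[OF AM \<alpha> \<Phi>(2) _ \<Psi>(2)] that by fastforce
  moreover have "\<bar>contact_ham AM \<alpha> (\<lambda>t x. \<Phi> t (\<Psi> t x)) t y\<bar> \<le> B + B'" if t: "t \<in> {0..1}" for t y
    using contact_ham_mult[OF AM \<alpha> compact_M \<Phi>(1) \<Psi>(1) t \<Phi>(2)[OF t], of y] \<Phi>(3)[OF t, of y]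
      \<Psi>(3)[OF t, of "inv_into UNIV (\<Phi> t) y"] by linarith
  ultimately show ?thesis
    by (rule liftableI[OF PCont0_compose[OF AM \<alpha> compact_M \<Phi>(1) \<Psi>(1)]]) (simp_all add: \<Phi>(4) \<Psi>(4))
qed

lemma liftable_inverse:
  assumes "liftable \<phi>" and bij: "bij \<phi>"
  shows "liftable (inv_into UNIV \<phi>)"
proof -
  obtain \<Phi> B where \<Phi>: "\<Phi> \<in> PCont0 AM \<alpha>" "\<And>t. t \<in> {0..1} \<Longrightarrow> conformal AM \<alpha> (\<Phi> t) (\<lambda>_. 1)"
    "\<And>t y. t \<in> {0..1} \<Longrightarrow> \<bar>contact_ham AM \<alpha> \<Phi> t y\<bar> \<le> B" "\<And>m. p (\<Phi> 1 m) = \<phi> (p m)"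
    using assms(1) unfolding liftable_def by blast
  let ?\<Psi> = "\<lambda>t. inv_into UNIV (\<Phi> t)"
  have con: "conformal AM \<alpha> (?\<Psi> t) (\<lambda>_. 1)" if t: "t \<in> {0..1}" for t
    using conformal_inverse[OF AM \<alpha> \<Phi>(2)[OF t]] \<Phi>(1) t by (auto simp: PCont0_def contactomorphism_def)
  have "\<bar>contact_ham AM \<alpha> ?\<Psi> t y\<bar> \<le> B" if t: "t \<in> {0..1}" for t y
    using contact_ham_inverse[OF AM \<alpha> compact_M \<Phi>(1) t con[OF t], of y] \<Phi>(3)[OF t, of "\<Phi> t y"] by simp
  moreover have "p (?\<Psi> 1 m) = inv_into UNIV \<phi> (p m)" for m
  proof -
    have "bij (\<Phi> 1)" by (rule PCont0_bij[OF AM \<alpha> compact_M \<Phi>(1)]) simp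
    then have "\<phi> (p (?\<Psi> 1 m)) = p m" using \<Phi>(4)[of "?\<Psi> 1 m"] by (simp add: bij_inv_cancel)
    then show ?thesis using bij_inv_cancel(1)[OF bij, of "p (?\<Psi> 1 m)"] by simp
  qed
  ultimately show ?thesis
    by (intro liftableI[OF PCont0_inverse[OF AM \<alpha> compact_M \<Phi>(1)] con])
qed

section \<open>Lifting isotopies whose trajectories stay in one trivialization\<close>

context
  fixes \<theta> :: "real \<Rightarrow> 'x \<Rightarrow> 'x" and F :: "real \<Rightarrow> 'x \<Rightarrow> real"
  assumes \<theta>: "smooth_family {0..1} UNIV AX AX \<theta>" and \<theta>_diffeo: "\<And>t. t \<in> {0..1} \<Longrightarrow> diffeo AX (\<theta> t)"
    and \<theta>0: "\<And>x. \<theta> 0 x = x"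
    and F: "smooth_family {0..1} UNIV AX std_atlas F"
    and ham: "\<And>t x \<mu> w. t \<in> {0..1} \<Longrightarrow> \<mu> \<in> AX \<Longrightarrow> \<theta> t x \<in> cdom \<mu> \<Longrightarrow>
      \<omega> \<mu> (\<theta> t x) (velocity \<mu> \<theta> t x) w = frechet_derivative (\<lambda>y. F t (param \<mu> y)) (at (coord \<mu> (\<theta> t x))) w"
    and small: "\<And>x. \<exists>V U \<tau> \<sigma>. open V \<and> x \<in> V \<and> trivialization U \<tau> \<sigma> \<and> (\<forall>t\<in>{0..1}. \<forall>y\<in>V. \<theta> t y \<in> U)"
begin

text \<open>An unspecified choice of a lift through each point. Uniqueness on \<open>{0..1}\<close>
  makes it agree there with the local smooth families, which gives smoothness, and makes it
  equivariant.\<close>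

definition lift :: "real \<Rightarrow> 'm \<Rightarrow> 'm" where
  "lift t m = (SOME c. lift_curve \<theta> F m c) t"

lemma lift_local:
  "\<exists>N L. open N \<and> m \<in> N \<and> smooth_family {0..1} N AM AM L \<and> (\<forall>m\<in>N. lift_curve \<theta> F m (\<lambda>t. L t m))"
proof -
  obtain V U \<tau> \<sigma> where V: "open V" "p m \<in> V" "trivialization U \<tau> \<sigma>" "\<And>t y. t \<in> {0..1} \<Longrightarrow> y \<in> V \<Longrightarrow> \<theta> t y \<in> U"
    using small[of "p m"] by blast
  show ?thesis by (rule lift_curve_local[OF \<theta> \<theta>0 F V(3,1) V(4) V(2)])
qed

lemma lift_curve_lift: "lift_curve \<theta> F m (\<lambda>t. lift t m)"
proof -
  have "\<exists>c. lift_curve \<theta> F m c" using lift_local[of m] by blast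
  from someI_ex[OF this] show ?thesis unfolding lift_def[abs_def] .
qed

lemma lift_unique:
  assumes "lift_curve \<theta> F m c" "t \<in> {0..1}" shows "c t = lift t m"
proof -
  obtain V U \<tau> \<sigma> where V: "p m \<in> V" "trivialization U \<tau> \<sigma>" "\<And>t y. t \<in> {0..1} \<Longrightarrow> y \<in> V \<Longrightarrow> \<theta> t y \<in> U"
    using small[of "p m"] by blast
  show ?thesis by (rule lift_curve_unique[OF V(2) _ assms(1) lift_curve_lift assms(2)]) (use V in auto)
qed

lemma p_lift: "t \<in> {0..1} \<Longrightarrow> p (lift t m) = \<theta> t (p m)"
  and lift_zero: "lift 0 m = m"
  and lift_lform: "t \<in> {0..1} \<Longrightarrow> lform AM \<alpha> {0..1} (\<lambda>t. lift t m) t 1 = - F t (\<theta> t (p m))"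
  and lift_plot: "plot AM {0..1} (\<lambda>t. lift t m)"
  using lift_curve_lift[of m] by (auto simp: lift_curve_def)

lemma lift_family: "smooth_family {0..1} UNIV AM AM lift"
proof (rule smooth_familyI[OF AM AM open_UNIV])
  let ?I = "{0..1::real}"
  note I = thick_unit_interval
  fix \<kappa> assume \<kappa>: "\<kappa> \<in> AM"
  show "plot AM (?I \<times> coord \<kappa> ` (cdom \<kappa> \<inter> UNIV)) (\<lambda>z. lift (fst z) (param \<kappa> (snd z)))"
  proof (rule plot_local[OF AM chart_times_thick[OF AM I \<kappa> open_UNIV]])
    fix z assume z: "z \<in> ?I \<times> coord \<kappa> ` (cdom \<kappa> \<inter> UNIV)"
    define m where "m = param \<kappa> (snd z)"
    have m: "m \<in> cdom \<kappa>" "coord \<kappa> m = snd z" using z \<kappa> AM by (auto simp: m_def)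
    obtain N L where N: "open N" "m \<in> N" "smooth_family ?I N AM AM L" "\<And>m. m \<in> N \<Longrightarrow> lift_curve \<theta> F m (\<lambda>t. L t m)"
      using lift_local[of m] by blast
    define E where "E = ?I \<times> coord \<kappa> ` (cdom \<kappa> \<inter> N)"
    define W where "W = (UNIV :: real set) \<times> coord \<kappa> ` (cdom \<kappa> \<inter> N)"
    have W: "open W" unfolding W_def by (intro open_Times open_UNIV open_chart_image[OF AM \<kappa> N(1)])
    have zW: "z \<in> W" using m N(2) by (auto simp: W_def mem_Times_iff intro: image_eqI[of _ _ m])
    have EW: "(?I \<times> coord \<kappa> ` (cdom \<kappa> \<inter> UNIV)) \<inter> W = E" by (auto simp: E_def W_def)
    have E: "thick E" unfolding E_def by (rule chart_times_thick[OF AM I \<kappa> N(1)])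
    have uN: "param \<kappa> (snd w) \<in> N" "fst w \<in> ?I" if "w \<in> E" for w using that \<kappa> AM by (auto simp: E_def)
    have "plot AM E (\<lambda>z. L (fst z) (param \<kappa> (snd z)))"
      by (rule plot_family[OF AM AM N(3) plot_chart_times[OF AM I \<kappa> N(1), folded E_def] E smooth_on_fst[OF E smooth_on_id[OF E]]])
         (use uN in auto)
    then have "plot AM E (\<lambda>z. lift (fst z) (param \<kappa> (snd z)))"
      by (rule plot_cong[OF AM]) (rule lift_unique[OF N(4)[OF uN(1)] uN(2)])
    then show "\<exists>W. open W \<and> z \<in> W \<and> plot AM ((?I \<times> coord \<kappa> ` (cdom \<kappa> \<inter> UNIV)) \<inter> W) (\<lambda>z. lift (fst z) (param \<kappa> (snd z)))"
      unfolding EW[symmetric] using W zW by blast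
  qed
qed

lemma lift_R:
  assumes t: "t \<in> {0..1}" shows "lift t (R s m) = R s (lift t m)"
proof -
  have "plot AM {0..1} (\<lambda>t. R s (lift t m))"
    by (rule plot_map[OF AM AM R_smooth lift_plot thick_unit_interval open_UNIV]) simp
  moreover have "lform AM \<alpha> {0..1} (\<lambda>t. R s (lift t m)) t 1 = - F t (\<theta> t (p m))" if "t \<in> {0..1}" for t
    using conformal_lform[OF AM \<alpha> R_strict R_smooth lift_plot thick_unit_interval that] lift_lform[OF that] by simp
  ultimately have "lift_curve \<theta> F (R s m) (\<lambda>t. R s (lift t m))"
    unfolding lift_curve_def by (simp add: p_lift lift_zero)
  from lift_unique[OF this t] show ?thesis by simp
qed

text \<open>Since \<open>\<theta> t\<close> is bijective on the base, the question concerns single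
  fibres. There equivariance settles it: the action is transitive, and an s that fixes one point
  fixes all.\<close>

lemma lift_bij:
  assumes t: "t \<in> {0..1}" shows "bij (lift t)"
proof (rule bijI)
  have \<theta>b: "bij (\<theta> t)" using \<theta>_diffeo[OF t] by (simp add: diffeo_def)
  show "inj (lift t)"
  proof (rule injI)
    fix m m' assume eq: "lift t m = lift t m'"
    have "\<theta> t (p m') = \<theta> t (p m)" using p_lift[OF t, of m] p_lift[OF t, of m'] eq by simp
    then have "p m' = p m" using \<theta>b by (meson bij_is_inj injD)
    then obtain s where s: "m' = R s m" by (rule fibre_transitive)
    have "R s (lift t m) = lift t m" using eq lift_R[OF t, of s m] s by simp
    from R_fixed[OF this] show "m = m'" using s by simp
  qed
  show "surj (lift t)"
  proof (rule surjI)
    fix n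
    obtain m where m: "p m = inv_into UNIV (\<theta> t) (p n)" using fibre_nonempty by blast
    have "p n = p (lift t m)" using p_lift[OF t, of m] m bij_inv_cancel(2)[OF \<theta>b] by simp
    then obtain s where "n = R s (lift t m)" by (rule fibre_transitive)
    then have "lift t (R s m) = n" using lift_R[OF t] by simp
    then show "lift t (SOME m. lift t m = n) = n" by (rule someI)
  qed
qed

text \<open>In Cartan's formula the differential of the Hamiltonian cancels the contraction of
  d\<alpha>, the pullback of \<omega>, with the velocity, by the defining equation of the
  Hamiltonian isotopy.\<close>

lemma lift_lform_strict:
  assumes \<kappa>: "\<kappa> \<in> AM" and y: "y \<in> coord \<kappa> ` cdom \<kappa>" and t: "t \<in> {0..1}"
  shows "lform AM \<alpha> (coord \<kappa> ` cdom \<kappa>) (\<lambda>y. lift t (param \<kappa> y)) y v = \<alpha> \<kappa> (param \<kappa> y) v"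
proof -
  let ?I = "{0..1::real}"
  let ?\<epsilon> = "(UNIV, \<lambda>x. x) :: (real, real) chart"
  note I = thick_unit_interval
  define C where "C = coord \<kappa> ` cdom \<kappa>"
  have C: "open C" "thick C" "y \<in> C" using open_chart_image[OF AM \<kappa> open_UNIV] y by (simp_all add: C_def thick_open)
  define D where "D = {0<..<1::real} \<times> C"
  define U where "U = (\<lambda>z. lift (fst z) (param \<kappa> (snd z)))"
  have oD: "open D" unfolding D_def by (intro open_Times) (use C in simp_all)
  have T': "thick {0<..<1::real}" "{0<..<1::real} \<subseteq> ?I" by (auto intro: thick_open)
  have U: "plot AM D U" unfolding D_def U_def C_def
    by (rule plot_family_chart[OF AM \<alpha> lift_family \<kappa> I T'])
  have pU: "plot AX D (\<lambda>z. p (U z))" by (rule plot_map[OF AM AX p_smooth U thick_open[OF oD] open_UNIV]) simp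
  define h where "h z = - F (fst z) (\<theta> (fst z) (p (param \<kappa> (snd z))))" for z
  have h: "lform AM \<alpha> ?I (\<lambda>s. lift s (param \<kappa> y)) s 1 = h (s, y)" if "s \<in> ?I" for s y
    using lift_lform[OF that] by (simp add: h_def)
  have pUeq: "p (U z) = \<theta> (fst z) (p (param \<kappa> (snd z)))" if "z \<in> D" for z
    using p_lift[of "fst z"] that by (auto simp: U_def D_def)
  define f where "f s = lform AM \<alpha> C (\<lambda>y. lift s (param \<kappa> y)) y v" for s
  have deriv: "(f has_real_derivative 0) (at s)" if s: "s \<in> {0<..<1}" for s
  proof -
    have sI: "s \<in> ?I" using s by simp
    define x where "x = p (param \<kappa> y)"
    define n where "n = lift s (param \<kappa> y)"
    define \<mu> where "\<mu> = chart_at AM n"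
    define \<nu> where "\<nu> = chart_at AX (p n)"
    have \<mu>: "\<mu> \<in> AM" "n \<in> cdom \<mu>" and \<nu>: "\<nu> \<in> AX" "p n \<in> cdom \<nu>"
      using chart_at[OF AM] chart_at[OF AX] by (auto simp: \<mu>_def \<nu>_def)
    have pn: "p n = \<theta> s x" using p_lift[OF sI] by (simp add: n_def x_def)
    have z: "(s, y) \<in> D" "U (s, y) = n" using s C by (simp_all add: D_def U_def n_def)
    have T: "tangent_map \<mu> \<nu> p n (dplot \<mu> D U (s, y) w) = dplot \<nu> D (\<lambda>z. p (U z)) (s, y) w" for w
      using dplot_map[OF AM AX p_smooth U thick_open[OF oD] open_UNIV _ z(1) \<mu>(1) _ \<nu>(1), of w] z(2) \<mu>(2) \<nu>(2) by simp
    have N: "dplot \<nu> D (\<lambda>z. p (U z)) (s, y) (1, 0) = velocity \<nu> \<theta> s x"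
    proof -
      have fr: "frechet_derivative (\<lambda>r. (r, y)) (at s within {0<..<1}) = (\<lambda>h. (h, 0))"
        by (rule thick_frechet_unique[OF T'(1) s]) (auto intro!: derivative_eq_intros)
      have "dplot \<nu> {0<..<1} (\<lambda>r. p (U (r, y))) s 1 =
          dplot \<nu> D (\<lambda>z. p (U z)) (s, y) (frechet_derivative (\<lambda>r. (r, y)) (at s within {0<..<1}) 1)"
        by (rule dplot_compose[OF AX pU T'(1) smooth_on_Pair[OF T'(1) smooth_on_id[OF T'(1)] smooth_on_const[OF T'(1)]] _ s \<nu>(1)])
           (use C z \<nu> in \<open>auto simp: D_def\<close>)
      then have "dplot \<nu> D (\<lambda>z. p (U z)) (s, y) (1, 0) = dplot \<nu> {0<..<1} (\<lambda>r. p (U (r, y))) s 1"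
        unfolding fr by simp
      also have "\<dots> = dplot \<nu> {0<..<1} (\<lambda>r. \<theta> r x) s 1"
        by (rule fun_cong[OF dplot_cong[OF s]]) (use pUeq C in \<open>auto simp: D_def x_def\<close>)
      also have "\<dots> = dplot \<nu> (?I \<inter> {0<..<1}) (\<lambda>r. \<theta> r x) s 1" by (simp add: Int_absorb1[OF T'(2)])
      also have "\<dots> = dplot \<nu> ?I (\<lambda>r. \<theta> r x) s 1" by (rule fun_cong[OF dplot_Int_open[OF s]]) simp
      also have "\<dots> = velocity \<nu> \<theta> s x"
        by (rule velocity_eq[OF AX plot_curve[OF AX \<theta> I] sI \<nu>(1), symmetric]) (use \<nu> pn in simp)
      finally show ?thesis .
    qed
    have Fs: "smooth_map UNIV AX std_atlas (F s)" by (rule smooth_map_of_family[OF AX smooth_atlas_std F sI open_UNIV])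
    \<comment> \<open>The Hamiltonian along the lift factors through the projection, so its
      differential is, up to sign, that of \<open>F s\<close> on the projected vector.\<close>
    have dF: "frechet_derivative h (at (s, y)) (0, v) = - frechet_derivative (\<lambda>y. F s (param \<nu> y)) (at (coord \<nu> (p n)))
        (dplot \<nu> D (\<lambda>z. p (U z)) (s, y) (0, v))"
    proof -
      define g where "g z = F (fst z) (p (U z))" for z
      have fst: "smooth_on D fst" using smooth_on_fst[OF _ smooth_on_id] thick_open[OF oD] by blast
      have g: "smooth_on D g"
        using plot_family[OF AX smooth_atlas_std F pU thick_open[OF oD] fst] by (auto simp: plot_std g_def[abs_def] D_def)
      have Dg: "(g has_derivative frechet_derivative g (at (s, y))) (at (s, y))"
        by (rule smooth_on_open_has_derivative[OF g oD z(1)])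
      have "(h has_derivative (\<lambda>w. - frechet_derivative g (at (s, y)) w)) (at (s, y))"
        by (rule has_derivative_transform_within_open[OF has_derivative_minus[OF Dg] oD z(1)]) (simp add: g_def h_def pUeq)
      then have 1: "frechet_derivative h (at (s, y)) (0, v) = - frechet_derivative g (at (s, y)) (0, v)"
        using fun_cong[OF frechet_derivative_at, of h _ "(s, y)" "(0, v)"] by fastforce
      have fr: "frechet_derivative (\<lambda>y. (s, y)) (at y within C) = (\<lambda>h. (0, h))"
        by (rule thick_frechet_unique[OF C(2,3)]) (auto intro!: derivative_eq_intros)
      have pC: "plot AX C (\<lambda>y. p (U (s, y)))"
        by (rule plot_compose[OF AX pU C(2) smooth_on_Pair[OF C(2) smooth_on_const[OF C(2)] smooth_on_id[OF C(2)]]])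
           (use s in \<open>simp add: D_def\<close>)
      have "dplot \<nu> C (\<lambda>y. p (U (s, y))) y v = dplot \<nu> D (\<lambda>z. p (U z)) (s, y) (frechet_derivative (\<lambda>y. (s, y)) (at y within C) v)"
        by (rule dplot_compose[OF AX pU C(2) smooth_on_Pair[OF C(2) smooth_on_const[OF C(2)] smooth_on_id[OF C(2)]] _ C(3) \<nu>(1)])
           (use s z \<nu> in \<open>auto simp: D_def\<close>)
      then have 2: "dplot \<nu> C (\<lambda>y. p (U (s, y))) y v = dplot \<nu> D (\<lambda>z. p (U z)) (s, y) (0, v)" unfolding fr .
      have "dplot ?\<epsilon> C (\<lambda>y. F s (p (U (s, y)))) y v = tangent_map \<nu> ?\<epsilon> (F s) (p (U (s, y))) (dplot \<nu> C (\<lambda>y. p (U (s, y))) y v)"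
        by (rule dplot_map[OF AX smooth_atlas_std Fs pC C(2) open_UNIV _ C(3) \<nu>(1)])
           (use z \<nu> in \<open>auto simp: std_atlas_def\<close>)
      then have 3: "dplot ?\<epsilon> C (\<lambda>y. F s (p (U (s, y)))) y v =
          frechet_derivative (\<lambda>y. F s (param \<nu> y)) (at (coord \<nu> (p n))) (dplot \<nu> D (\<lambda>z. p (U z)) (s, y) (0, v))"
        unfolding 2 by (simp add: tangent_map_def z)
      have "((\<lambda>y. g (s, y)) has_derivative (\<lambda>v. frechet_derivative g (at (s, y)) (0, v))) (at y)"
        by (rule has_derivative_compose[of "\<lambda>y. (s, y)" "\<lambda>v. (0, v)"]) (use Dg in \<open>auto intro!: derivative_eq_intros\<close>)
      then have "((\<lambda>y. coord ?\<epsilon> (g (s, y))) has_derivative (\<lambda>v. frechet_derivative g (at (s, y)) (0, v))) (at y within C)"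
        by (simp add: has_derivative_at_withinI)
      from dplot_eqI[OF C(2,3) this]
      have "dplot ?\<epsilon> C (\<lambda>y. g (s, y)) y v = frechet_derivative g (at (s, y)) (0, v)" by simp
      then show ?thesis using 1 3 by (simp add: g_def)
    qed
    have "ext_deriv1 \<alpha> \<mu> n (dplot \<mu> D U (s, y) (1, 0)) (dplot \<mu> D U (s, y) (0, v)) =
        \<omega> \<nu> (p n) (velocity \<nu> \<theta> s x) (dplot \<nu> D (\<lambda>z. p (U z)) (s, y) (0, v))"
      using dalpha_eq[OF \<mu>] by (simp add: \<nu>_def[symmetric] T N)
    also have "\<dots> = - frechet_derivative h (at (s, y)) (0, v)"
      using ham[OF sI \<nu>(1), of x] \<nu>(2) unfolding dF by (simp add: pn)
    finally show ?thesis
      using cartan_formula[OF AM \<alpha> lift_family \<kappa> y s \<mu>(1), of h v] \<mu>(2) h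
      by (simp add: f_def[abs_def] C_def[symmetric] D_def[symmetric] U_def[symmetric] n_def[symmetric])
  qed
  have contf: "continuous_on ?I f"
    unfolding f_def[abs_def] C_def by (rule continuous_on_pullback_family[OF AM \<alpha> lift_family \<kappa> y])
  have "f t = f 0" by (rule DERIV_isconst2[OF zero_less_one contf]) (use deriv t in auto)
  then show ?thesis using lform_param[OF AM \<alpha> \<kappa> y, of v] by (simp add: f_def lift_zero C_def)
qed

text \<open>A kernel vector is annihilated by \<alpha>, which the lift preserves, and it is
  vertical, because \<open>\<theta> t\<close> has injective differential on the base. By
  \<open>alpha_vertical\<close> such a vector is 0.\<close>

lemma lift_tangent_inj:
  assumes t: "t \<in> {0..1}" and \<kappa>: "\<kappa> \<in> AM" "m \<in> cdom \<kappa>" and \<mu>: "\<mu> \<in> AM" "lift t m \<in> cdom \<mu>"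
    and v: "tangent_map \<kappa> \<mu> (lift t) m v = 0"
  shows "v = 0"
proof (rule ccontr)
  assume "v \<noteq> 0"
  define C where "C = coord \<kappa> ` cdom \<kappa>"
  define y where "y = coord \<kappa> m"
  have y: "y \<in> C" "param \<kappa> y = m" using \<kappa> AM by (auto simp: C_def y_def)
  have C: "thick C" and u: "plot AM C (param \<kappa>)"
    using open_chart_image[OF AM \<kappa>(1) open_UNIV] plot_chart[OF AM \<kappa>(1) open_UNIV] by (auto simp: C_def thick_open)
  have lt: "smooth_map UNIV AM AM (lift t)" by (rule smooth_map_of_family[OF AM AM lift_family t open_UNIV])
  have lu: "plot AM C (\<lambda>y. lift t (param \<kappa> y))" by (rule plot_map[OF AM AM lt u C open_UNIV]) simp
  have pu: "plot AX C (\<lambda>y. p (param \<kappa> y))" by (rule plot_map[OF AM AX p_smooth u C open_UNIV]) simp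
  have plu: "plot AX C (\<lambda>y. p (lift t (param \<kappa> y)))" by (rule plot_map[OF AM AX p_smooth lu C open_UNIV]) simp
  have d0: "dplot \<mu> C (\<lambda>y. lift t (param \<kappa> y)) y v = 0"
    using dplot_map_param[OF AM lt \<kappa>(1) _ \<mu>(1), of y v] y \<mu>(2) v by (simp add: C_def)
  have "\<alpha> \<kappa> m v = lform AM \<alpha> C (\<lambda>y. lift t (param \<kappa> y)) y v"
    using lift_lform_strict[OF \<kappa>(1) _ t, of y v] y by (simp add: C_def)
  also have "\<dots> = 0"
    using lform_eq[OF AM \<alpha> lu C y(1) \<mu>(1), of v] y \<mu>(2) linear_0[OF one_form_linear[OF AM \<alpha> \<mu>]] d0 by simp
  finally have \<alpha>0: "\<alpha> \<kappa> m v = 0" .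
  define \<nu> where "\<nu> = chart_at AX (p m)"
  define \<nu>' where "\<nu>' = chart_at AX (\<theta> t (p m))"
  have \<nu>: "\<nu> \<in> AX" "p m \<in> cdom \<nu>" and \<nu>': "\<nu>' \<in> AX" "\<theta> t (p m) \<in> cdom \<nu>'"
    using chart_at[OF AX] by (auto simp: \<nu>_def \<nu>'_def)
  have T: "dplot \<nu>' C (\<lambda>y. p (lift t (param \<kappa> y))) y w = tangent_map \<mu> \<nu>' p (lift t m) (dplot \<mu> C (\<lambda>y. lift t (param \<kappa> y)) y w)" for w
    using dplot_map[OF AM AX p_smooth lu C open_UNIV _ y(1) \<mu>(1) _ \<nu>'(1), of w] y \<mu>(2) \<nu>'(2) p_lift[OF t] by simp
  have "dplot \<nu>' C (\<lambda>y. p (lift t (param \<kappa> y))) y v = dplot \<nu>' C (\<lambda>y. p (lift t (param \<kappa> y))) y 0"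
    using linear_0[OF dplot_linear[OF AM lu y(1) \<mu>(1)]] y \<mu>(2) d0 by (simp add: T)
  also have "\<dots> = 0"
    by (rule linear_0[OF dplot_linear[OF AX plu y(1) \<nu>'(1)]]) (use y \<nu>' p_lift[OF t] in simp)
  finally have "dplot \<nu>' C (\<lambda>y. \<theta> t (p (param \<kappa> y))) y v = 0" by (simp add: p_lift[OF t])
  moreover have "smooth_map UNIV AX AX (\<theta> t)" using \<theta>_diffeo[OF t] by (simp add: diffeo_def)
  ultimately have "tangent_map \<nu> \<nu>' (\<theta> t) (p m) (dplot \<nu> C (\<lambda>y. p (param \<kappa> y)) y v) = 0"
    using dplot_map[OF AX AX _ pu C open_UNIV _ y(1) \<nu>(1) _ \<nu>'(1), of "\<theta> t" v] y \<nu>(2) \<nu>'(2) by simp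
  then have "dplot \<nu> C (\<lambda>y. p (param \<kappa> y)) y v = 0"
    by (rule diffeo_tangent_inj[OF AX \<theta>_diffeo[OF t] \<nu> \<nu>'])
  then have "tangent_map \<kappa> \<nu> p m v = 0"
    using dplot_map[OF AM AX p_smooth u C open_UNIV _ y(1) \<kappa>(1) _ \<nu>(1), of v] y \<kappa>(2) \<nu>(2)
      dplot_param[OF AM \<kappa>(1), of y v] by (simp add: C_def)
  then show False using alpha_vertical[OF \<kappa> _ \<open>v \<noteq> 0\<close>] \<alpha>0 by (simp add: \<nu>_def)
qed

lemma liftable_small: "liftable (\<theta> 1)"
proof -
  have inv: "smooth_family {0..1} UNIV AM AM (\<lambda>t. inv_into UNIV (lift t))"
    by (rule smooth_family_inverse[OF AM compact_M compact_Icc thick_unit_interval lift_family lift_bij lift_tangent_inj])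
  have diff: "diffeo AM (lift t)" if t: "t \<in> {0..1}" for t
    unfolding diffeo_def
    using lift_bij[OF t] smooth_map_of_family[OF AM AM lift_family t open_UNIV] smooth_map_of_family[OF AM AM inv t open_UNIV]
    by blast
  have strict: "conformal AM \<alpha> (lift t) (\<lambda>_. 1)" if t: "t \<in> {0..1}" for t
    by (rule conformalI[OF AM \<alpha>]) (use diff[OF t] lift_lform_strict[OF _ _ t] in \<open>auto simp: diffeo_def\<close>)
  have P: "lift \<in> PCont0 AM \<alpha>"
    unfolding PCont0_def contactomorphism_iff using lift_family diff strict lift_zero by blast
  have ch: "contact_ham AM \<alpha> lift t y = - F t (p y)" if t: "t \<in> {0..1}" for t y
  proof -
    obtain m where "y = lift t m" using lift_bij[OF t] by (metis bij_pointE)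
    then show ?thesis
      using contact_ham_eq[OF AM \<alpha> lift_family t bij_is_inj[OF lift_bij[OF t]], of m] lift_lform[OF t, of m] p_lift[OF t, of m]
      by simp
  qed
  \<comment> \<open>The Hamiltonian of the lift is bounded, because \<open>F\<close> is continuous
    on a compact set.\<close>
  have "continuous_on ({0..1} \<times> UNIV) (\<lambda>(t, x). F t x)" using F by (simp add: smooth_family_def)
  then have "compact ((\<lambda>(t, x). F t x) ` ({0..1} \<times> UNIV))"
    by (rule compact_continuous_image) (intro compact_Times compact_Icc compact_X)
  then obtain B where "\<forall>r\<in>(\<lambda>(t, x). F t x) ` ({0..1} \<times> UNIV). norm r \<le> B"
    using compact_imp_bounded bounded_iff by metis
  then have "\<bar>contact_ham AM \<alpha> lift t y\<bar> \<le> B" if "t \<in> {0..1}" for t y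
    using ch[OF that] that by auto
  from liftableI[OF P strict this] show ?thesis using p_lift[of 1] by simp
qed

end

text \<open>The piece over \<open>{a..b}\<close> is stretched to the unit interval, which multiplies
  the Hamiltonian by b - a, and preceded by the inverse of \<open>\<phi> a\<close>, which makes it
  start at the identity.\<close>

lemma liftable_segment:
  assumes \<phi>: "smooth_family {0..1} UNIV AX AX \<phi>" and \<phi>_diffeo: "\<And>t. t \<in> {0..1} \<Longrightarrow> diffeo AX (\<phi> t)"
    and F: "smooth_family {0..1} UNIV AX std_atlas F"
    and ham: "\<And>t x \<mu> w. t \<in> {0..1} \<Longrightarrow> \<mu> \<in> AX \<Longrightarrow> \<phi> t x \<in> cdom \<mu> \<Longrightarrow>
      \<omega> \<mu> (\<phi> t x) (velocity \<mu> \<phi> t x) w = frechet_derivative (\<lambda>y. F t (param \<mu> y)) (at (coord \<mu> (\<phi> t x))) w"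
    and ab: "0 \<le> a" "a \<le> b" "b \<le> 1"
    and small: "\<And>x. \<exists>V U \<tau> \<sigma>. open V \<and> x \<in> V \<and> trivialization U \<tau> \<sigma> \<and> (\<forall>r\<in>{a..b}. \<forall>y\<in>V. \<phi> r y \<in> U)"
  shows "liftable (\<lambda>x. \<phi> b (inv_into UNIV (\<phi> a) x))"
proof -
  let ?I = "{0..1::real}"
  note I = thick_unit_interval
  define g where "g = inv_into UNIV (\<phi> a)"
  define \<tau> where "\<tau> s = a + s * (b - a)" for s
  have aI: "a \<in> ?I" using ab by auto
  have \<tau>ab: "\<tau> s \<in> {a..b}" if "s \<in> ?I" for s
  proof -
    have "s * (b - a) \<le> 1 * (b - a)" using that ab by (intro mult_right_mono) auto
    moreover have "0 \<le> s * (b - a)" using that ab by simp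
    ultimately show ?thesis by (simp add: \<tau>_def)
  qed
  then have \<tau>I: "\<tau> s \<in> ?I" if "s \<in> ?I" for s using ab that by fastforce
  have sm\<tau>: "smooth_on ?I \<tau>" unfolding \<tau>_def[abs_def] by (intro smooth_on_intros I)
  have da: "diffeo AX (\<phi> a)" by (rule \<phi>_diffeo[OF aI])
  have dg: "diffeo AX g" unfolding g_def by (rule diffeo_inverse[OF AX da])
  have g\<phi>: "\<phi> a (g x) = x" for x using da by (simp add: g_def diffeo_def bij_inv_cancel)
  have gsm: "smooth_map UNIV AX AX g" using dg by (simp add: diffeo_def)
  define \<theta> where "\<theta> s x = \<phi> (\<tau> s) (g x)" for s x
  define F' where "F' s x = (b - a) * F (\<tau> s) x" for s x
  have \<theta>: "smooth_family ?I UNIV AX AX \<theta>" unfolding \<theta>_def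
    by (rule smooth_family_compose[OF AX AX AX smooth_family_reparam[OF AX AX \<phi> I open_UNIV sm\<tau> \<tau>I]
          smooth_family_of_map[OF AX AX gsm I open_UNIV] I open_UNIV])
  have d\<theta>: "diffeo AX (\<theta> s)" if "s \<in> ?I" for s
    unfolding \<theta>_def by (rule diffeo_compose[OF AX \<phi>_diffeo[OF \<tau>I[OF that]] dg])
  have F': "smooth_family ?I UNIV AX std_atlas F'"
  proof (rule smooth_familyI[OF AX smooth_atlas_std open_UNIV])
    fix \<kappa> assume \<kappa>: "\<kappa> \<in> AX"
    let ?D = "?I \<times> coord \<kappa> ` (cdom \<kappa> \<inter> UNIV)"
    have D: "thick ?D" by (rule chart_times_thick[OF AX I \<kappa> open_UNIV])
    have "plot std_atlas ?D (\<lambda>z. F (\<tau> (fst z)) (param \<kappa> (snd z)))"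
      by (rule plot_family[OF AX smooth_atlas_std smooth_family_reparam[OF AX smooth_atlas_std F I open_UNIV sm\<tau> \<tau>I]
          plot_chart_times[OF AX I \<kappa> open_UNIV] D smooth_on_fst[OF D smooth_on_id[OF D]]]) auto
    then show "plot std_atlas ?D (\<lambda>z. F' (fst z) (param \<kappa> (snd z)))"
      unfolding plot_std F'_def by (rule smooth_on_mult[OF D smooth_on_const[OF D]])
  qed
  have ham': "\<omega> \<mu> (\<theta> s x) (velocity \<mu> \<theta> s x) w = frechet_derivative (\<lambda>y. F' s (param \<mu> y)) (at (coord \<mu> (\<theta> s x))) w"
    if s: "s \<in> ?I" and \<mu>: "\<mu> \<in> AX" "\<theta> s x \<in> cdom \<mu>" for s x \<mu> w
  proof -
    define z where "z = g x"
    define r where "r = \<tau> s"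
    have rI: "r \<in> ?I" using \<tau>I[OF s] by (simp add: r_def)
    have c: "plot AX ?I (\<lambda>r. \<phi> r z)" by (rule plot_curve[OF AX \<phi> I])
    have \<mu>': "\<phi> r z \<in> cdom \<mu>" using \<mu>(2) by (simp add: \<theta>_def z_def r_def)
    have fr: "frechet_derivative \<tau> (at s within ?I) = (\<lambda>h. h * (b - a))"
      unfolding \<tau>_def[abs_def] by (rule thick_frechet_unique[OF I s]) (auto intro!: derivative_eq_intros)
    have "velocity \<mu> \<theta> s x = dplot \<mu> ?I (\<lambda>s. \<theta> s x) s 1"
      by (rule velocity_eq[where \<psi> = \<theta> and x = x, OF AX plot_curve[OF AX \<theta> I] s \<mu>])
    also have "\<dots> = dplot \<mu> ?I (\<lambda>r. \<phi> r z) (\<tau> s) (frechet_derivative \<tau> (at s within ?I) 1)"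
      unfolding \<theta>_def z_def[symmetric] by (rule dplot_compose[OF AX c I sm\<tau> \<tau>I s \<mu>(1) \<mu>'[unfolded r_def]])
    also have "\<dots> = (b - a) *\<^sub>R dplot \<mu> ?I (\<lambda>r. \<phi> r z) r 1"
      using linear_scale[OF dplot_linear[OF AX c rI \<mu>(1) \<mu>'], of "b - a" 1] unfolding fr by (simp add: r_def)
    also have "dplot \<mu> ?I (\<lambda>r. \<phi> r z) r 1 = velocity \<mu> \<phi> r z"
      by (rule velocity_eq[where \<psi> = \<phi> and x = z, OF AX c rI \<mu>(1) \<mu>', symmetric])
    finally have vel: "velocity \<mu> \<theta> s x = (b - a) *\<^sub>R velocity \<mu> \<phi> r z" .
    have "smooth_map UNIV AX std_atlas (F r)" by (rule smooth_map_of_family[OF AX smooth_atlas_std F rI open_UNIV])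
    from plot_map[OF AX smooth_atlas_std this plot_chart[OF AX \<mu>(1) open_UNIV] thick_open[OF open_chart_image[OF AX \<mu>(1) open_UNIV]] open_UNIV]
    have sm: "smooth_on (coord \<mu> ` cdom \<mu>) (\<lambda>y. F r (param \<mu> y))" by (simp add: plot_std)
    have "((\<lambda>y. F r (param \<mu> y)) has_derivative frechet_derivative (\<lambda>y. F r (param \<mu> y)) (at (coord \<mu> (\<phi> r z)))) (at (coord \<mu> (\<phi> r z)))"
      by (rule smooth_on_open_has_derivative[OF sm]) (use open_chart_image[OF AX \<mu>(1) open_UNIV] \<mu>' in auto)
    from has_derivative_mult_right[OF this, of "b - a"]
    have "((\<lambda>y. F' s (param \<mu> y)) has_derivative
        (\<lambda>w. (b - a) * frechet_derivative (\<lambda>y. F r (param \<mu> y)) (at (coord \<mu> (\<phi> r z))) w)) (at (coord \<mu> (\<phi> r z)))"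
      by (simp add: F'_def r_def)
    from fun_cong[OF frechet_derivative_at[OF this], of w]
    have "frechet_derivative (\<lambda>y. F' s (param \<mu> y)) (at (coord \<mu> (\<phi> r z))) w =
        (b - a) * frechet_derivative (\<lambda>y. F r (param \<mu> y)) (at (coord \<mu> (\<phi> r z))) w" by simp
    moreover have "\<omega> \<mu> (\<phi> r z) ((b - a) *\<^sub>R velocity \<mu> \<phi> r z) w = (b - a) * \<omega> \<mu> (\<phi> r z) (velocity \<mu> \<phi> r z) w"
      using bilinear_lmul[OF omega_bilinear[OF \<mu>(1) \<mu>']] by simp
    ultimately show ?thesis
      using ham[OF rI \<mu>(1) \<mu>', of w] by (simp add: vel) (simp add: \<theta>_def r_def z_def)
  qed
  have small': "\<exists>V U \<tau> \<sigma>. open V \<and> x \<in> V \<and> trivialization U \<tau> \<sigma> \<and> (\<forall>s\<in>?I. \<forall>y\<in>V. \<theta> s y \<in> U)" for x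
  proof -
    obtain V U \<tau>' \<sigma> where V: "open V" "g x \<in> V" "trivialization U \<tau>' \<sigma>" "\<forall>r\<in>{a..b}. \<forall>y\<in>V. \<phi> r y \<in> U"
      using small[of "g x"] by blast
    have "continuous_on UNIV g" using gsm by (simp add: smooth_map_def)
    then have "open (g -` V)" using V(1) by (simp add: continuous_on_open_vimage)
    moreover have "\<forall>s\<in>?I. \<forall>y\<in>g -` V. \<theta> s y \<in> U" using V(4) \<tau>ab by (simp add: \<theta>_def)
    ultimately show ?thesis using V by blast
  qed
  have "liftable (\<theta> 1)"
  proof (rule liftable_small[OF \<theta> d\<theta> _ F' ham' small'])
    show "\<theta> 0 x = x" for x by (simp add: \<theta>_def \<tau>_def g\<phi>)
  qed
  then show ?thesis by (simp add: \<theta>_def[abs_def] \<tau>_def g_def)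
qed

section \<open>Subdivision of a Hamiltonian isotopy\<close>

lemma Ham_diffeo:
  assumes "\<phi> \<in> Ham AX \<omega>" shows "diffeo AX \<phi>"
proof -
  from assms obtain \<psi> :: "real \<Rightarrow> 'x \<Rightarrow> 'x" where "\<forall>t\<in>{0..1}. diffeo AX (\<psi> t)" "\<phi> = \<psi> 1"
    unfolding Ham_def by blast
  then show ?thesis by simp
qed

lemma liftable_Ham:
  assumes "\<phi> \<in> Ham AX \<omega>" shows "liftable \<phi>"
proof -
  from assms obtain \<psi> F where \<psi>: "\<phi> = \<psi> 1" "smooth_family {0..1::real} UNIV AX AX \<psi>"
    "\<And>t. t \<in> {0..1} \<Longrightarrow> diffeo AX (\<psi> t)" "\<And>x. \<psi> 0 x = x"
    and F: "smooth_family {0..1::real} UNIV AX std_atlas F"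
    and ham: "\<And>t x \<mu> w. t \<in> {0..1} \<Longrightarrow> \<mu> \<in> AX \<Longrightarrow> \<psi> t x \<in> cdom \<mu> \<Longrightarrow>
      \<omega> \<mu> (\<psi> t x) (velocity \<mu> \<psi> t x) w = frechet_derivative (\<lambda>y. F t (param \<mu> y)) (at (coord \<mu> (\<psi> t x))) w"
    unfolding Ham_def by blast
  \<comment> \<open>\<open>Bolzano\<close> quantifies over all short intervals around a time,
    including ones that leave \<open>{0..1}\<close>; the premises inside \<open>P\<close> make those
    cases trivial.\<close>
  define P where "P a b \<longleftrightarrow> (0 \<le> a \<longrightarrow> a \<le> b \<longrightarrow> b \<le> 1 \<longrightarrow> liftable (\<lambda>x. \<psi> b (inv_into UNIV (\<psi> a) x)))" for a b
  have "(0::real) \<le> 1" by simp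
  then have "P 0 1"
  proof (induction rule: Bolzano)
    case (trans a b c)
    show ?case unfolding P_def
    proof (intro impI)
      assume ac: "0 \<le> a" "a \<le> c" "c \<le> 1"
      have "bij (\<psi> b)" using \<psi>(3)[of b] trans ac by (simp add: diffeo_def)
      then have "\<psi> c (inv_into UNIV (\<psi> b) (\<psi> b (inv_into UNIV (\<psi> a) x))) = \<psi> c (inv_into UNIV (\<psi> a) x)" for x
        by (simp add: bij_inv_cancel)
      then show "liftable (\<lambda>x. \<psi> c (inv_into UNIV (\<psi> a) x))"
        using liftable_compose[of "\<lambda>x. \<psi> c (inv_into UNIV (\<psi> b) x)" "\<lambda>x. \<psi> b (inv_into UNIV (\<psi> a) x)"] trans ac
        by (simp add: P_def)
    qed
  next
    case (local t)
    have cont: "continuous_on ({0..1} \<times> UNIV) (\<lambda>z. \<psi> (fst z) (snd z))"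
      using \<psi>(2) by (simp add: smooth_family_def case_prod_unfold)
    \<comment> \<open>Joint continuity at (t, x) keeps nearby points in one trivializing set for a
      short time; compactness of the base then makes that time uniform.\<close>
    have "\<exists>V d. open V \<and> x \<in> V \<and> d > 0 \<and> (\<exists>U \<tau> \<sigma>. trivialization U \<tau> \<sigma> \<and>
        (\<forall>r\<in>{0..1}. \<bar>r - t\<bar> < d \<longrightarrow> (\<forall>y\<in>V. \<psi> r y \<in> U)))" for x
    proof -
      obtain U \<tau> \<sigma> where U: "\<psi> t x \<in> U" "trivialization U \<tau> \<sigma>" by (rule trivialization_ex)
      obtain W where W: "open W" "W \<inter> {0..1} \<times> UNIV = (\<lambda>z. \<psi> (fst z) (snd z)) -` U \<inter> {0..1} \<times> UNIV"
        using cont[unfolded continuous_on_open_invariant, rule_format, OF trivializationD(1)[OF U(2)]] by blast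
      have mem: "(r, y) \<in> W \<longleftrightarrow> \<psi> r y \<in> U" if "r \<in> {0..1}" for r y 
      proof -
        have "(r, y) \<in> W \<inter> {0..1} \<times> UNIV \<longleftrightarrow> (r, y) \<in> (\<lambda>z. \<psi> (fst z) (snd z)) -` U \<inter> {0..1} \<times> UNIV"
          unfolding W(2) ..
        then show ?thesis using that by simp
      qed
      have "(t, x) \<in> W" using mem U local by simp
      then obtain T V where T: "open T" "open V" "t \<in> T" "x \<in> V" "T \<times> V \<subseteq> W"
        using W(1) by (metis mem_Sigma_iff open_prod_elim)
      obtain d where d: "d > 0" "\<And>r. dist r t < d \<Longrightarrow> r \<in> T" using T(1,3) unfolding open_dist by blast
      have "\<psi> r y \<in> U" if "r \<in> {0..1}" "\<bar>r - t\<bar> < d" "y \<in> V" for r y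
        using mem[OF that(1)] T(5) d(2)[of r] that by (auto simp: dist_real_def)
      then show ?thesis using T d U by blast
    qed
    then obtain V d where Vd: "\<And>x. open (V x)" "\<And>x. x \<in> V x" "\<And>x. d x > 0"
      "\<And>x. \<exists>U \<tau> \<sigma>. trivialization U \<tau> \<sigma> \<and> (\<forall>r\<in>{0..1}. \<bar>r - t\<bar> < d x \<longrightarrow> (\<forall>y\<in>V x. \<psi> r y \<in> U))"
      by metis
    obtain K where K: "finite K" "UNIV \<subseteq> (\<Union>x\<in>K. V x)"
    proof (rule compactE_image[OF compact_X])
      show "open (V x)" for x by (rule Vd(1))
      show "UNIV \<subseteq> (\<Union>x. V x)" using Vd(2) by blast
    qed blast
    have K0: "K \<noteq> {}" using K(2) by auto
    define e where "e = Min (d ` K)"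
    have e: "e > 0" "\<And>x. x \<in> K \<Longrightarrow> e \<le> d x" using K(1) K0 Vd(3) by (auto simp: e_def)
    have "P a b" if ab: "a \<le> t \<and> t \<le> b \<and> b - a < e" for a b
      unfolding P_def
    proof (intro impI)
      assume ab': "0 \<le> a" "a \<le> b" "b \<le> 1"
      show "liftable (\<lambda>x. \<psi> b (inv_into UNIV (\<psi> a) x))"
      proof (rule liftable_segment[OF \<psi>(2,3) F ham ab'])
        fix x
        obtain k where k: "k \<in> K" "x \<in> V k" using K(2) by blast
        obtain U \<tau> \<sigma> where U: "trivialization U \<tau> \<sigma>" "\<And>r y. r \<in> {0..1} \<Longrightarrow> \<bar>r - t\<bar> < d k \<Longrightarrow> y \<in> V k \<Longrightarrow> \<psi> r y \<in> U"
          using Vd(4)[of k] by blast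
        have "\<psi> r y \<in> U" if "r \<in> {a..b}" "y \<in> V k" for r y
          by (rule U(2)) (use that ab ab' e(2)[OF k(1)] in auto)
        then show "\<exists>V U \<tau> \<sigma>. open V \<and> x \<in> V \<and> trivialization U \<tau> \<sigma> \<and> (\<forall>r\<in>{a..b}. \<forall>y\<in>V. \<psi> r y \<in> U)"
          using U(1) k(2) Vd(1) by blast
      qed
    qed
    then show ?case using e(1) by blast
  qed
  moreover have "inv_into UNIV (\<psi> 0) x = x" for x
    using bij_inv_cancel(1)[of "\<psi> 0" x] \<psi>(3)[of 0] \<psi>(4) by (simp add: diffeo_def)
  ultimately show ?thesis by (simp add: P_def \<psi>(1))
qed

text \<open>Needed to see that the set whose infimum is \<open>d_T\<close> is nonempty.\<close>

lemma id_Ham: "(\<lambda>x. x) \<in> Ham AX \<omega>"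
proof -
  have fam: "smooth_family {0..1::real} UNIV AX AX (\<lambda>t x. x)"
    by (rule smooth_family_of_map[OF AX AX smooth_map_id[OF AX] thick_unit_interval open_UNIV])
  have "smooth_family {0..1::real} UNIV AX std_atlas (\<lambda>t x. 0 :: real)"
    by (rule smooth_familyI[OF AX smooth_atlas_std open_UNIV])
       (auto simp: plot_std intro!: smooth_on_const chart_times_thick[OF AX thick_unit_interval _ open_UNIV, simplified])
  moreover have "\<omega> \<mu> x (velocity \<mu> (\<lambda>t x. x) t x) w = frechet_derivative (\<lambda>y. 0) (at (coord \<mu> x)) w"
    if "t \<in> {0..1}" "\<mu> \<in> AX" "x \<in> cdom \<mu>" for t :: real and x \<mu> w
    using velocity_eq[where \<psi> = "\<lambda>t x. x" and x = x, OF AX plot_curve[OF AX fam thick_unit_interval] that] dplot_const[OF thick_unit_interval that(1), of \<mu> x 1]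
      bilinear_lzero[OF omega_bilinear[OF that(2,3)]] by (simp add: frechet_derivative_const)
  ultimately show ?thesis
    unfolding Ham_def using fam diffeo_id[OF AX] by (intro CollectI exI[of _ "\<lambda>t x. x"]) blast
qed

section \<open>Comparison of growth rates through a liftable map\<close>

lemma rho_plus_le:
  assumes wd: "growth_rates_well_defined AM \<alpha>"
    and H: "H \<in> positive_functions AX" and G: "G \<in> positive_functions AX"
    and \<psi>H: "generated_by AM \<alpha> \<psi>H (H \<circ> p)" and \<psi>G: "generated_by AM \<alpha> \<psi>G (G \<circ> p)"
    and \<phi>: "liftable \<phi>" and C: "C > 0" "\<And>x. G (\<phi> x) \<le> C * H x"
  shows "0 \<le> rho_plus AM \<alpha> (isotopy_class AM \<alpha> \<psi>H) (isotopy_class AM \<alpha> \<psi>G)"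
    and "rho_plus AM \<alpha> (isotopy_class AM \<alpha> \<psi>H) (isotopy_class AM \<alpha> \<psi>G) \<le> C"
proof -
  let ?G = "UCont AM \<alpha>"
  let ?cl = "isotopy_class AM \<alpha>"
  interpret group ?G by (rule group_UCont[OF AM \<alpha> compact_M])
  have sm: "smooth_map UNIV AX std_atlas H" "smooth_map UNIV AX std_atlas G" and pos: "\<And>x. H x > 0" "\<And>x. G x > 0"
    using H G by (auto simp: positive_functions_def)
  have PH: "\<psi>H \<in> PCont0 AM \<alpha>" "\<And>t y. t \<in> {0..1} \<Longrightarrow> contact_ham AM \<alpha> \<psi>H t y = H (p y)"
    and PG: "\<psi>G \<in> PCont0 AM \<alpha>" "\<And>t y. t \<in> {0..1} \<Longrightarrow> contact_ham AM \<alpha> \<psi>G t y = G (p y)"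
    using \<psi>H \<psi>G by (auto simp: generated_by_def)
  have hH: "contact_ham AM \<alpha> (\<lambda>t. \<psi>H t ^^ n) t y = real n * H (p y)"
    and hG: "contact_ham AM \<alpha> (\<lambda>t. \<psi>G t ^^ n) t y = real n * G (p y)" if "t \<in> {0..1}" for n t y
    using contact_ham_funpow[OF AM \<alpha> compact_M PH(1), of "\<lambda>y. H (p y)"] autonomous_isotopy[OF PH(1) sm(1) PH(2)]
      contact_ham_funpow[OF AM \<alpha> compact_M PG(1), of "\<lambda>y. G (p y)"] autonomous_isotopy[OF PG(1) sm(2) PG(2)] PH(2) PG(2) that
    by auto
  obtain \<Phi> B where \<Phi>: "\<Phi> \<in> PCont0 AM \<alpha>" "\<And>t. t \<in> {0..1} \<Longrightarrow> conformal AM \<alpha> (\<Phi> t) (\<lambda>_. 1)"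
    "\<And>t y. t \<in> {0..1} \<Longrightarrow> \<bar>contact_ham AM \<alpha> \<Phi> t y\<bar> \<le> B" "\<And>m. p (\<Phi> 1 m) = \<phi> (p m)"
    using \<phi> unfolding liftable_def by blast
  have one: "(1::real) \<in> {0..1}" by simp
  have d\<Phi>: "diffeo AM (\<Phi> t)" if "t \<in> {0..1}" for t
    using \<Phi>(1) that by (auto simp: PCont0_def contactomorphism_def)
  have con: "conformal AM \<alpha> (inv_into UNIV (\<Phi> t)) (\<lambda>_. 1)" if t: "t \<in> {0..1}" for t
    using conformal_inverse[OF AM \<alpha> \<Phi>(2)[OF t] d\<Phi>[OF t]] by simp
  define a b c where "a = ?cl \<psi>H" and "b = ?cl \<psi>G" and "c = ?cl \<Phi>"
  have ac: "a \<in> carrier ?G" "b \<in> carrier ?G" "c \<in> carrier ?G"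
    using PH(1) PG(1) \<Phi>(1) by (auto simp: UCont_carrier[OF AM \<alpha> compact_M] a_def b_def c_def)
  have aP: "a \<in> UCont_plus AM \<alpha>" "b \<in> UCont_plus AM \<alpha>"
    using PH PG pos by (auto simp: UCont_plus_def PCont_plus_def a_def b_def)
  have pw: "a [^]\<^bsub>?G\<^esub> n = ?cl (\<lambda>t. \<psi>H t ^^ n)" "b [^]\<^bsub>?G\<^esub> n = ?cl (\<lambda>t. \<psi>G t ^^ n)" for n :: nat
    unfolding a_def b_def by (rule UCont_pow[OF AM \<alpha> compact_M PH(1)] UCont_pow[OF AM \<alpha> compact_M PG(1)])+
  have "continuous_on UNIV H" using sm(1) by (simp add: smooth_map_def)
  from continuous_attains_inf[OF compact_X UNIV_not_empty this] obtain x0 where x0: "\<And>x. H x0 \<le> H x" by blast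
  \<comment> \<open>By compactness \<open>H\<close> has a positive minimum \<open>H x0\<close>, so
    the N-th power of \<open>\<psi>H\<close> has Hamiltonian at least \<open>B\<close>, the bound
    for the lift and for its inverse.\<close>
  define N where "N = nat \<lceil>B / H x0\<rceil>"
  have N: "B \<le> real N * H x" for x
  proof -
    have "B / H x0 \<le> real N" by (simp add: N_def real_nat_ceiling_ge)
    then have "B \<le> real N * H x0" using pos(1)[of x0] by (simp add: field_simps)
    also have "\<dots> \<le> real N * H x" using x0 by (intro mult_left_mono) auto
    finally show ?thesis .
  qed
  have aN: "dominates AM \<alpha> (a [^]\<^bsub>?G\<^esub> N) c"
    unfolding pw c_def
  proof (rule dominates_ham[OF AM \<alpha> compact_M PCont0_funpow[OF AM \<alpha> compact_M PH(1)] \<Phi>(1)])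
    show "contact_ham AM \<alpha> \<Phi> t y \<le> contact_ham AM \<alpha> (\<lambda>t. \<psi>H t ^^ N) t y" if t: "t \<in> {0..1}" for t y
      using \<Phi>(3)[OF t, of y] N[of "p y"] hH[OF t] by simp
  qed
  have aN': "dominates AM \<alpha> (a [^]\<^bsub>?G\<^esub> N) (inv\<^bsub>?G\<^esub> c)"
    unfolding pw c_def UCont_inv[OF AM \<alpha> compact_M \<Phi>(1)]
  proof (rule dominates_ham[OF AM \<alpha> compact_M PCont0_funpow[OF AM \<alpha> compact_M PH(1)] PCont0_inverse[OF AM \<alpha> compact_M \<Phi>(1)]])
    show "contact_ham AM \<alpha> (\<lambda>t. inv_into UNIV (\<Phi> t)) t y \<le> contact_ham AM \<alpha> (\<lambda>t. \<psi>H t ^^ N) t y" if t: "t \<in> {0..1}" for t y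
      using contact_ham_inverse[OF AM \<alpha> compact_M \<Phi>(1) t con[OF t], of y] \<Phi>(3)[OF t, of "\<Phi> t y"] N[of "p y"] hH[OF t] by simp
  qed
  have main: "\<lceil>C * real l\<rceil> + int (2 * N) \<in> growth_set AM \<alpha> a b l" for l
  proof -
    define k where "k = nat \<lceil>C * real l\<rceil>"
    have "0 \<le> C * real l" using C(1) by simp
    then have k: "int k = \<lceil>C * real l\<rceil>" "C * real l \<le> real k"
      by (simp_all add: k_def real_nat_ceiling_ge le_ceiling_iff)
    let ?\<psi> = "\<lambda>t. \<psi>G t ^^ l"
    have P: "?\<psi> \<in> PCont0 AM \<alpha>" by (rule PCont0_funpow[OF AM \<alpha> compact_M PG(1)])
    have "dominates AM \<alpha> (a [^]\<^bsub>?G\<^esub> k) (inv\<^bsub>?G\<^esub> c \<otimes>\<^bsub>?G\<^esub> (b [^]\<^bsub>?G\<^esub> l \<otimes>\<^bsub>?G\<^esub> c))"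
      unfolding pw c_def UCont_conj(2)[OF AM \<alpha> compact_M \<Phi>(1) P]
    proof (rule dominates_ham[OF AM \<alpha> compact_M PCont0_funpow[OF AM \<alpha> compact_M PH(1)] UCont_conj(1)[OF AM \<alpha> compact_M \<Phi>(1) P]])
      fix t :: real and y assume t: "t \<in> {0..1}"
      have "contact_ham AM \<alpha> (\<lambda>t x. inv_into UNIV (\<Phi> 1) (?\<psi> t (\<Phi> 1 x))) t y = real l * G (\<phi> (p y))"
        using contact_ham_conj[OF AM \<alpha> compact_M d\<Phi>[OF one] \<Phi>(2)[OF one] con[OF one] P t, of y] hG[OF t] \<Phi>(4) by simp
      also have "\<dots> \<le> real l * (C * H (p y))" using C(2) by (intro mult_left_mono) auto
      also have "\<dots> \<le> real k * H (p y)" using k(2) less_imp_le[OF pos(1)] by (metis mult.assoc mult.commute mult_right_mono)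
      also have "\<dots> = contact_ham AM \<alpha> (\<lambda>t. \<psi>H t ^^ k) t y" by (rule hH[OF t, symmetric])
      finally show "contact_ham AM \<alpha> (\<lambda>t x. inv_into UNIV (\<Phi> 1) (?\<psi> t (\<Phi> 1 x))) t y \<le>
          contact_ham AM \<alpha> (\<lambda>t. \<psi>H t ^^ k) t y" .
    qed
    \<comment> \<open>\<open>growth_set_conj\<close> expects the conjugating element on the left and
      its inverse on the right, so it is applied to the inverse of c.\<close>
    then have "int k + int (2 * N) \<in> growth_set AM \<alpha> a b l"
      using growth_set_conj[OF AM \<alpha> compact_M ac(1,2) inv_closed[OF ac(3)], of k l N] aN aN' ac(3) by simp
    then show ?thesis by (simp add: k(1))
  qed
  from rho_plus_bounds[OF AM \<alpha> compact_M wd aP main]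
  show "0 \<le> rho_plus AM \<alpha> (isotopy_class AM \<alpha> \<psi>H) (isotopy_class AM \<alpha> \<psi>G)"
    "rho_plus AM \<alpha> (isotopy_class AM \<alpha> \<psi>H) (isotopy_class AM \<alpha> \<psi>G) \<le> C" by (simp_all add: a_def b_def)
qed

end

theorem theorem3:
  fixes AX :: "('x::{t2_space, second_countable_topology}, 'e::euclidean_space) chart set"
    and \<omega> :: "('x, 'e) form2"
    and AM :: "('m::{t2_space, second_countable_topology}, 'f::euclidean_space) chart set"
    and \<alpha> :: "('m, 'f) form1"
    and R :: "real \<Rightarrow> 'm \<Rightarrow> 'm"
    and p :: "'m \<Rightarrow> 'x"
    and H G :: "'x \<Rightarrow> real"
    and \<psi>H \<psi>G :: "real \<Rightarrow> 'm \<Rightarrow> 'm"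
  assumes "prequantization AX \<omega> AM \<alpha> R p"
    and "growth_rates_well_defined AM \<alpha>"
    and "H \<in> positive_functions AX" and "G \<in> positive_functions AX"
    and "generated_by AM \<alpha> \<psi>H (H \<circ> p)" and "generated_by AM \<alpha> \<psi>G (G \<circ> p)"
  shows "d_gamma AM \<alpha> (isotopy_class AM \<alpha> \<psi>H) (isotopy_class AM \<alpha> \<psi>G) \<le> d_T AX \<omega> H G"
proof -
  interpret prequantization_space AX \<omega> AM \<alpha> R p by unfold_locales (rule assms(1))
  define S where "S = {ln C | C. C > 0 \<and> ln C > 0 \<and> (\<exists>\<phi>\<in>Ham AX \<omega>. \<forall>x. 1 / C * H x \<le> G (\<phi> x) \<and> G (\<phi> x) \<le> C * H x)}"
  have pos: "H x > 0" "G x > 0" for x using assms(3,4) by (auto simp: positive_functions_def)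
  \<comment> \<open>A bound for the infimum can be read off from the members only if there are any.
    As H and G are positive and continuous on a compact space, the identity serves for a large
    constant.\<close>
  have "S \<noteq> {}"
  proof -
    have cont: "continuous_on UNIV H" "continuous_on UNIV G"
      using assms(3,4) by (auto simp: positive_functions_def smooth_map_def)
    obtain h0 where h0: "\<And>x. H h0 \<le> H x" using continuous_attains_inf[OF compact_X UNIV_not_empty cont(1)] by blast
    obtain h1 where h1: "\<And>x. H x \<le> H h1" using continuous_attains_sup[OF compact_X UNIV_not_empty cont(1)] by blast
    obtain g0 where g0: "\<And>x. G g0 \<le> G x" using continuous_attains_inf[OF compact_X UNIV_not_empty cont(2)] by blast
    obtain g1 where g1: "\<And>x. G x \<le> G g1" using continuous_attains_sup[OF compact_X UNIV_not_empty cont(2)] by blast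
    \<comment> \<open>The maximum with 2 ensures \<open>ln C > 0\<close>, as membership in the set
      demands.\<close>
    define C where "C = max 2 (max (H h1 / G g0) (G g1 / H h0))"
    have "H h1 / G g0 \<le> C" "G g1 / H h0 \<le> C" by (simp_all add: C_def)
    then have C: "C \<ge> 2" "H h1 \<le> C * G g0" "G g1 \<le> C * H h0"
      using pos by (simp_all add: divide_le_eq) (simp add: C_def)
    have "1 / C * H x \<le> G x \<and> G x \<le> C * H x" for x
    proof -
      have "H x \<le> C * G g0" using h1[of x] C(2) by linarith
      also have "\<dots> \<le> C * G x" using g0 C(1) by (intro mult_left_mono) auto
      finally have "1 / C * H x \<le> G x" using C(1) by (simp add: field_simps)
      moreover have "G x \<le> C * H h0" using g1[of x] C(3) by linarith
      then have "G x \<le> C * H x" using h0[of x] C(1) mult_left_mono[of "H h0" "H x" C] by linarith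
      ultimately show ?thesis by blast
    qed
    then have "ln C \<in> S" unfolding S_def using C(1) by (intro CollectI exI[of _ C] conjI bexI[OF _ id_Ham]) auto
    then show ?thesis by blast
  qed
  moreover have "d_gamma AM \<alpha> (isotopy_class AM \<alpha> \<psi>H) (isotopy_class AM \<alpha> \<psi>G) \<le> s" if s: "s \<in> S" for s
  proof -
    let ?g = "gamma_dist AM \<alpha> (isotopy_class AM \<alpha> \<psi>H) (isotopy_class AM \<alpha> \<psi>G)"
    obtain C \<phi> where C: "s = ln C" "C > 0" "ln C > 0" and \<phi>: "\<phi> \<in> Ham AX \<omega>"
      "\<And>x. 1 / C * H x \<le> G (\<phi> x)" "\<And>x. G (\<phi> x) \<le> C * H x" using s unfolding S_def by blast
    have bij: "bij \<phi>" using Ham_diffeo[OF \<phi>(1)] by (simp add: diffeo_def)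
    \<comment> \<open>The lower estimate, read at the preimage of x under \<phi>, is an upper
      estimate with H and G exchanged and the same constant.\<close>
    have 1: "H (inv_into UNIV \<phi> x) \<le> C * G x" for x
      using \<phi>(2)[of "inv_into UNIV \<phi> x"] C(2) bij_inv_cancel(2)[OF bij, of x] by (simp add: field_simps)
    note lift = liftable_Ham[OF \<phi>(1)]
    have "0 \<le> ?g" "?g \<le> C"
      using rho_plus_le[OF assms(2-6) lift C(2) \<phi>(3)]
        rho_plus_le[OF assms(2,4,3,6,5) liftable_inverse[OF lift bij] C(2) 1]
      by (auto simp: gamma_dist_def rho_minus_def)
    \<comment> \<open>If the maximum is 0, then \<open>ln 0 = 0\<close> by convention and the bound
      is \<open>ln C > 0\<close>; otherwise \<open>ln\<close> is monotone.\<close>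
    then show ?thesis
      unfolding d_gamma_def C(1) using C(2,3) by (cases "?g = 0") auto
  qed
  ultimately show ?thesis unfolding d_T_def S_def[symmetric] by (rule cInf_greatest)
qed

end
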